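(* Fix $n\in\mathbb N$, a recursive theory $T_0\supseteq\mathrm{PA}$, and a cardinal $\kappa$ of countable cofinality. Let $\mathfrak M\models T_0$ have cardinality strictly less than $\kappa$. For every countable $A\subseteq M$, there is a $\kappa$-like $\Sigma_n$-elementary end extension $\mathfrak K$ of $\mathfrak M$ satisfying $\Sigma_{n+3}\text{-}\mathrm{Th}(T_0)$ in which $A\in\Sigma_{n+1}\text{-}\mathrm{Def}(\mathfrak K)$.
   Context: $T_0$ is a theory in the language of first-order arithmetic; $\Sigma_{n+3}\text{-}\mathrm{Th}(T_0)$ is the set of $\Sigma_{n+3}$ sentences provable in $T_0$. A linearly ordered structure $\mathfrak K$ is $\kappa$-like if it has cardinality $\kappa$ but every proper initial segment has cardinality $<\kappa$. $\mathfrak K$ is an end extension of $\mathfrak M$ if $\mathfrak M\subseteq\mathfrak K$ and every element of $K-M$ is above every element of $M$; $\Sigma_n$-elementary means $\Sigma_n$ formulas with parameters from $M$ have the same truth values in both. $\Sigma_{n+1}\text{-}\mathrm{Def}(\mathfrak K)$ is the collection of subsets of $K$ definable in $\mathfrak K$ by $\Sigma_{n+1}$ formulas with parameters. *)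

theory Defs
  imports Main "HOL-Library.Countable_Set" "HOL-Library.Nat_Bijection"
begin

datatype trm = Var nat | Zero | S trm | Plus trm trm | Times trm trm

datatype fm = Eq trm trm | Lt trm trm | Neg fm | Conj fm fm | Disj fm fm
  | Ex nat fm | All nat fm

fun vars_t :: "trm \<Rightarrow> nat set" where
  "vars_t (Var x) = {x}"
| "vars_t Zero = {}"
| "vars_t (S t) = vars_t t"
| "vars_t (Plus t u) = vars_t t \<union> vars_t u"
| "vars_t (Times t u) = vars_t t \<union> vars_t u"

fun vars :: "fm \<Rightarrow> nat set" where
  "vars (Eq t u) = vars_t t \<union> vars_t u"
| "vars (Lt t u) = vars_t t \<union> vars_t u"
| "vars (Neg p) = vars p"
| "vars (Conj p q) = vars p \<union> vars q"
| "vars (Disj p q) = vars p \<union> vars q"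
| "vars (Ex x p) = insert x (vars p)"
| "vars (All x p) = insert x (vars p)"

fun fv :: "fm \<Rightarrow> nat set" where
  "fv (Eq t u) = vars_t t \<union> vars_t u"
| "fv (Lt t u) = vars_t t \<union> vars_t u"
| "fv (Neg p) = fv p"
| "fv (Conj p q) = fv p \<union> fv q"
| "fv (Disj p q) = fv p \<union> fv q"
| "fv (Ex x p) = fv p - {x}"
| "fv (All x p) = fv p - {x}"

definition sentence :: "fm \<Rightarrow> bool" where
  "sentence p \<longleftrightarrow> fv p = {}"

definition Imp :: "fm \<Rightarrow> fm \<Rightarrow> fm" where
  "Imp p q = Disj (Neg p) q"

definition Iff :: "fm \<Rightarrow> fm \<Rightarrow> fm" where
  "Iff p q = Conj (Imp p q) (Imp q p)"

inductive delta0 :: "fm \<Rightarrow> bool" where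
  "delta0 (Eq t u)"
| "delta0 (Lt t u)"
| "delta0 p \<Longrightarrow> delta0 (Neg p)"
| "delta0 p \<Longrightarrow> delta0 q \<Longrightarrow> delta0 (Conj p q)"
| "delta0 p \<Longrightarrow> delta0 q \<Longrightarrow> delta0 (Disj p q)"
| "delta0 p \<Longrightarrow> x \<notin> vars_t t \<Longrightarrow> delta0 (Ex x (Conj (Lt (Var x) t) p))"
| "delta0 p \<Longrightarrow> x \<notin> vars_t t \<Longrightarrow> delta0 (All x (Disj (Neg (Lt (Var x) t)) p))"

inductive Sigma :: "nat \<Rightarrow> fm \<Rightarrow> bool" and Pi :: "nat \<Rightarrow> fm \<Rightarrow> bool" where
  "delta0 p \<Longrightarrow> Sigma 0 p"
| "delta0 p \<Longrightarrow> Pi 0 p"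
| "Pi n p \<Longrightarrow> Sigma (Suc n) p"
| "Sigma (Suc n) p \<Longrightarrow> Sigma (Suc n) (Ex x p)"
| "Sigma n p \<Longrightarrow> Pi (Suc n) p"
| "Pi (Suc n) p \<Longrightarrow> Pi (Suc n) (All x p)"

record 'a struc =
  dom :: "'a set"
  zer :: 'a
  sc :: "'a \<Rightarrow> 'a"
  pl :: "'a \<Rightarrow> 'a \<Rightarrow> 'a"
  tm :: "'a \<Rightarrow> 'a \<Rightarrow> 'a"
  lt :: "'a \<Rightarrow> 'a \<Rightarrow> bool"

definition wf_struc :: "'a struc \<Rightarrow> bool" where
  "wf_struc K \<longleftrightarrow> zer K \<in> dom K \<and> (\<forall>a\<in>dom K. sc K a \<in> dom K)
     \<and> (\<forall>a\<in>dom K. \<forall>b\<in>dom K. pl K a b \<in> dom K \<and> tm K a b \<in> dom K)"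

fun eval_t :: "'a struc \<Rightarrow> (nat \<Rightarrow> 'a) \<Rightarrow> trm \<Rightarrow> 'a" where
  "eval_t K s (Var x) = s x"
| "eval_t K s Zero = zer K"
| "eval_t K s (S t) = sc K (eval_t K s t)"
| "eval_t K s (Plus t u) = pl K (eval_t K s t) (eval_t K s u)"
| "eval_t K s (Times t u) = tm K (eval_t K s t) (eval_t K s u)"

fun sat :: "'a struc \<Rightarrow> (nat \<Rightarrow> 'a) \<Rightarrow> fm \<Rightarrow> bool" where
  "sat K s (Eq t u) \<longleftrightarrow> eval_t K s t = eval_t K s u"
| "sat K s (Lt t u) \<longleftrightarrow> lt K (eval_t K s t) (eval_t K s u)"
| "sat K s (Neg p) \<longleftrightarrow> \<not> sat K s p"
| "sat K s (Conj p q) \<longleftrightarrow> sat K s p \<and> sat K s q"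
| "sat K s (Disj p q) \<longleftrightarrow> sat K s p \<or> sat K s q"
| "sat K s (Ex x p) \<longleftrightarrow> (\<exists>a\<in>dom K. sat K (s(x := a)) p)"
| "sat K s (All x p) \<longleftrightarrow> (\<forall>a\<in>dom K. sat K (s(x := a)) p)"

definition models :: "'a struc \<Rightarrow> fm set \<Rightarrow> bool" where
  "models K T \<longleftrightarrow> wf_struc K \<and>
     (\<forall>p\<in>T. \<forall>s. (\<forall>v. s v \<in> dom K) \<longrightarrow> sat K s p)"

text \<open>Consequence (= provability, by the completeness and downward
  Loewenheim-Skolem theorems): truth in every model whose universe is a set of
  natural numbers, i.e. in every countable model.\<close>
definition proves :: "fm set \<Rightarrow> fm \<Rightarrow> bool" where
  "proves T p \<longleftrightarrow> (\<forall>K :: nat struc. models K T \<longrightarrow>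
     (\<forall>s. (\<forall>v. s v \<in> dom K) \<longrightarrow> sat K s p))"

definition Sigma_Th :: "nat \<Rightarrow> fm set \<Rightarrow> fm set" where
  "Sigma_Th k T = {p. sentence p \<and> Sigma k p \<and> proves T p}"

definition univ_closure :: "fm \<Rightarrow> fm" where
  "univ_closure p = foldr All (sorted_list_of_set (fv p)) p"

text \<open>Induction axiom for p in the variable x, written without substitution:
  p(0) is (exists x. x = 0 and p), p(z) is (exists x. x = z and p),
  p(S z) is (exists x. x = S z and p), for a variable z not occurring in p.\<close>
definition ind_ax :: "nat \<Rightarrow> fm \<Rightarrow> fm" where
  "ind_ax x p = (let z = Suc (Max (insert x (vars p))) in
     univ_closure
       (Imp (Conj (Ex x (Conj (Eq (Var x) Zero) p))
                  (All z (Imp (Ex x (Conj (Eq (Var x) (Var z)) p))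
                              (Ex x (Conj (Eq (Var x) (S (Var z))) p)))))
            (All x p)))"

definition PA_basic :: "fm set" where
  "PA_basic = {
     All 0 (Neg (Eq (S (Var 0)) Zero)),
     All 0 (All 1 (Imp (Eq (S (Var 0)) (S (Var 1))) (Eq (Var 0) (Var 1)))),
     All 0 (Eq (Plus (Var 0) Zero) (Var 0)),
     All 0 (All 1 (Eq (Plus (Var 0) (S (Var 1))) (S (Plus (Var 0) (Var 1))))),
     All 0 (Eq (Times (Var 0) Zero) Zero),
     All 0 (All 1 (Eq (Times (Var 0) (S (Var 1))) (Plus (Times (Var 0) (Var 1)) (Var 0)))),
     All 0 (All 1 (Iff (Lt (Var 0) (Var 1))
                       (Ex 2 (Eq (Plus (Var 0) (S (Var 2))) (Var 1)))))}"

definition PA :: "fm set" where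
  "PA = PA_basic \<union> {ind_ax x p | x p. True}"

fun code_t :: "trm \<Rightarrow> nat" where
  "code_t (Var x) = prod_encode (0, x)"
| "code_t Zero = prod_encode (1, 0)"
| "code_t (S t) = prod_encode (2, code_t t)"
| "code_t (Plus t u) = prod_encode (3, prod_encode (code_t t, code_t u))"
| "code_t (Times t u) = prod_encode (4, prod_encode (code_t t, code_t u))"

fun code_fm :: "fm \<Rightarrow> nat" where
  "code_fm (Eq t u) = prod_encode (0, prod_encode (code_t t, code_t u))"
| "code_fm (Lt t u) = prod_encode (1, prod_encode (code_t t, code_t u))"
| "code_fm (Neg p) = prod_encode (2, code_fm p)"
| "code_fm (Conj p q) = prod_encode (3, prod_encode (code_fm p, code_fm q))"
| "code_fm (Disj p q) = prod_encode (4, prod_encode (code_fm p, code_fm q))"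
| "code_fm (Ex x p) = prod_encode (5, prod_encode (x, code_fm p))"
| "code_fm (All x p) = prod_encode (6, prod_encode (x, code_fm p))"

datatype rf = RZ | RSuc | Proj nat | Comp rf "rf list" | Prim rf rf | Mn rf

inductive rf_eval :: "rf \<Rightarrow> nat list \<Rightarrow> nat \<Rightarrow> bool" where
  "rf_eval RZ xs 0"
| "rf_eval RSuc (x # xs) (Suc x)"
| "i < length xs \<Longrightarrow> rf_eval (Proj i) xs (xs ! i)"
| "list_all2 (\<lambda>g y. rf_eval g xs y) gs ys \<Longrightarrow> rf_eval f ys z \<Longrightarrow> rf_eval (Comp f gs) xs z"
| "rf_eval f xs y \<Longrightarrow> rf_eval (Prim f g) (0 # xs) y"
| "rf_eval (Prim f g) (n # xs) y \<Longrightarrow> rf_eval g (y # n # xs) z \<Longrightarrow> rf_eval (Prim f g) (Suc n # xs) z"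
| "rf_eval f (m # xs) 0 \<Longrightarrow> (\<forall>k<m. \<exists>y. 0 < y \<and> rf_eval f (k # xs) y) \<Longrightarrow> rf_eval (Mn f) xs m"

definition recursive_set :: "nat set \<Rightarrow> bool" where
  "recursive_set A \<longleftrightarrow> (\<exists>f. \<forall>x. rf_eval f [x] (if x \<in> A then 1 else 0))"

definition recursive_theory :: "fm set \<Rightarrow> bool" where
  "recursive_theory T \<longleftrightarrow> (\<forall>p\<in>T. sentence p) \<and> recursive_set (code_fm ` T)"

definition sigma_elem_end_ext :: "nat \<Rightarrow> ('a \<Rightarrow> 'b) \<Rightarrow> 'a struc \<Rightarrow> 'b struc \<Rightarrow> bool" where
  "sigma_elem_end_ext n h M K \<longleftrightarrow>
     inj_on h (dom M) \<and> h ` dom M \<subseteq> dom K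
     \<and> h (zer M) = zer K
     \<and> (\<forall>a\<in>dom M. h (sc M a) = sc K (h a))
     \<and> (\<forall>a\<in>dom M. \<forall>b\<in>dom M. h (pl M a b) = pl K (h a) (h b)
          \<and> h (tm M a b) = tm K (h a) (h b) \<and> (lt M a b \<longleftrightarrow> lt K (h a) (h b)))
     \<and> (\<forall>c\<in>dom K - h ` dom M. \<forall>a\<in>dom M. lt K (h a) c)
     \<and> (\<forall>p s. Sigma n p \<longrightarrow> (\<forall>v. s v \<in> dom M) \<longrightarrow> (sat M s p \<longleftrightarrow> sat K (h \<circ> s) p))"

text \<open>kappa is given by a cardinal order relation r (an initial ordinal).\<close>
definition kappa_like :: "'k rel \<Rightarrow> 'b struc \<Rightarrow> bool" where
  "kappa_like r K \<longleftrightarrow> (card_of (dom K), r) \<in> ordIso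
     \<and> (\<forall>I. I \<subseteq> dom K \<longrightarrow> I \<noteq> dom K \<longrightarrow>
            (\<forall>a\<in>I. \<forall>b\<in>dom K. lt K b a \<longrightarrow> b \<in> I) \<longrightarrow> (card_of I, r) \<in> ordLess)"

definition countable_cofinality :: "'k rel \<Rightarrow> bool" where
  "countable_cofinality r \<longleftrightarrow>
     (\<exists>C\<subseteq>Field r. countable C \<and> (\<forall>a\<in>Field r. \<exists>c\<in>C. (a, c) \<in> r))"

definition Sigma_Def :: "nat \<Rightarrow> 'b struc \<Rightarrow> 'b set set" where
  "Sigma_Def k K = {X. \<exists>p x s. Sigma k p \<and> (\<forall>v. s v \<in> dom K) \<and>
       X = {b\<in>dom K. sat K (s(x := b)) p}}"

end

theory Submission
  imports Defs
begin

text \<open>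
  \<open>K\<close> is a restricted ultrapower of \<open>M\<close>: its elements are classes of functions \<open>G\<close> with \<open>\<Delta>\<close>
  graphs of level \<open>n + 1\<close> and parameters in a countable set \<open>Q\<close>, applied to a nonstandard
  argument \<open>x\<close> above \<open>M\<close>, finitely many generators \<open>u e\<close> with \<open>e\<close> below \<open>\<kappa>\<close>, and an element of
  \<open>M\<close>. There are fast growing functions \<open>y 0 x, y 1 x, \<dots>\<close> such that the generators of level
  \<open>i\<close> lie in a gap between \<open>y i x\<close> and \<open>y (i + 1) x\<close>. The gap contains long intervals that
  are homogeneous for the countably many functions \<open>G\<close>, by a finite Ramsey theorem with provably
  total bounds. So a value below \<open>y i x\<close> depends only on the generators of level less than
  \<open>i\<close>. As \<open>\<kappa>\<close> has countable cofinality, there are fewer than \<open>\<kappa>\<close> of these for each \<open>i\<close>, and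
  \<open>K\<close>, in which the \<open>y i x\<close> are cofinal, is \<open>\<kappa>\<close>-like.

  The first component of \<open>y i x\<close> is given by a flexible function, whose value can be chosen after
  everything else is defined. It is set to code the \<open>i\<close>-th element of \<open>A\<close> together with a
  program for \<open>y (i + 1)\<close>. From these codes a \<open>\<Sigma>\<close> formula of level \<open>n + 1\<close> recovers \<open>A\<close>.

  The class of functions has Skolem functions for \<open>\<Sigma>\<close> formulas of level \<open>n + 1\<close>. Hence
  \<open>\<Pi>\<close> formulas of level \<open>n + 2\<close> with parameters in \<open>Q\<close> pass from \<open>M\<close> to \<open>K\<close>. If \<open>Q\<close>
  contains witnesses for the outer existential quantifiers of the \<open>\<Sigma>\<close> sentences of level
  \<open>n + 3\<close>, these sentences hold in \<open>K\<close>.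
\<close>

subsection \<open>Renaming of variables\<close>

text \<open>The obstacle is that \<open>M\<close> may be uncountable, while the construction has
  only countably many stages. Hence only the functions \<open>G\<close> are treated one by one.
  Elements of \<open>M\<close> enter as arguments, and a stage decides the truncated values of one
  \<open>G\<close> at all arguments simultaneously, by a definable limit. This makes every function
  bounded by an element of \<open>M\<close> constant modulo the ultrafilter, so that an end
  extension results. For the same reason the parameters \<open>Q\<close> of the functions form a
  countable set.

  A second obstacle is a circularity: the head of \<open>y i x\<close> has to contain a program for
  \<open>y (i + 1)\<close>, which is built after \<open>y i\<close>. A flexible function breaks it,
  because the programs do not depend on the value imposed on it later.

  The gaps have to survive infinitely many thinnings. Their length at \<open>x\<close> is a fast
  function iterated about \<open>x\<close> times, and a thinning costs one iteration; as
  \<open>x\<close> lies above all numerals, every standard number of thinnings leaves a long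
  interval. The growth function must lie in the class of functions already for \<open>n = 0\<close>,
  hence the bounded form given to the Ramsey statement.\<close>

lemma eval_t_cong: "(\<And>v. v \<in> vars_t t \<Longrightarrow> s v = s' v) \<Longrightarrow> eval_t K s t = eval_t K s' t"
  by (induction t) auto

lemma finite_vars_t: "finite (vars_t t)" by (induction t) auto
lemma finite_vars: "finite (vars p)" by (induction p) (auto simp: finite_vars_t)
lemma fv_subset_vars: "fv p \<subseteq> vars p" by (induction p) auto

lemma sat_cong: "(\<And>v. v \<in> fv p \<Longrightarrow> s v = s' v) \<Longrightarrow> sat K s p = sat K s' p"
proof (induction p arbitrary: s s')
  case (Eq t u) then show ?case using eval_t_cong[of t s s' K] eval_t_cong[of u s s' K] by auto
next
  case (Lt t u) then show ?case using eval_t_cong[of t s s' K] eval_t_cong[of u s s' K] by auto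
next
  case (Conj p q) show ?case
    using Conj.IH(1)[of s s'] Conj.IH(2)[of s s'] Conj.prems by auto
next
  case (Disj p q) show ?case
    using Disj.IH(1)[of s s'] Disj.IH(2)[of s s'] Disj.prems by auto
next
  case (Neg p) show ?case using Neg.IH[of s s'] Neg.prems by auto
next
  case (Ex x p)
  have "sat K (s(x := a)) p = sat K (s'(x := a)) p" for a by (rule Ex.IH) (use Ex.prems in auto)
  then show ?case by simp
next
  case (All x p)
  have "sat K (s(x := a)) p = sat K (s'(x := a)) p" for a by (rule All.IH) (use All.prems in auto)
  then show ?case by simp
qed

primrec ren_t :: "(nat \<Rightarrow> nat) \<Rightarrow> trm \<Rightarrow> trm" where
  "ren_t f (Var x) = Var (f x)"
| "ren_t f Zero = Zero"
| "ren_t f (S t) = S (ren_t f t)"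
| "ren_t f (Plus t u) = Plus (ren_t f t) (ren_t f u)"
| "ren_t f (Times t u) = Times (ren_t f t) (ren_t f u)"

primrec ren :: "(nat \<Rightarrow> nat) \<Rightarrow> fm \<Rightarrow> fm" where
  "ren f (Eq t u) = Eq (ren_t f t) (ren_t f u)"
| "ren f (Lt t u) = Lt (ren_t f t) (ren_t f u)"
| "ren f (Neg p) = Neg (ren f p)"
| "ren f (Conj p q) = Conj (ren f p) (ren f q)"
| "ren f (Disj p q) = Disj (ren f p) (ren f q)"
| "ren f (Ex x p) = Ex (f x) (ren f p)"
| "ren f (All x p) = All (f x) (ren f p)"

lemma vars_ren_t: "vars_t (ren_t f t) = f ` vars_t t" by (induction t) auto

lemma eval_ren_t: "eval_t K s (ren_t f t) = eval_t K (s \<circ> f) t" by (induction t) auto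

text \<open>Bound variables are renamed too; injectivity on all variables of \<open>p\<close>, not
  only on the free ones, excludes capture.\<close>

lemma sat_ren: "inj_on f (vars p) \<Longrightarrow> sat K s (ren f p) = sat K (s \<circ> f) p"
proof (induction p arbitrary: s)
  case (Ex x p)
  have "inj_on f (vars p)" using Ex.prems by (auto intro: inj_on_subset)
  moreover have "sat K (s(f x := a) \<circ> f) p = sat K ((s \<circ> f)(x := a)) p" for a
    by (rule sat_cong) (use Ex.prems fv_subset_vars[of p] in \<open>auto simp: inj_on_def\<close>)
  ultimately show ?case by (simp only: ren.simps sat.simps Ex.IH)
next
  case (All x p)
  have "inj_on f (vars p)" using All.prems by (auto intro: inj_on_subset)
  moreover have "sat K (s(f x := a) \<circ> f) p = sat K ((s \<circ> f)(x := a)) p" for a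
    by (rule sat_cong) (use All.prems fv_subset_vars[of p] in \<open>auto simp: inj_on_def\<close>)
  ultimately show ?case by (simp only: ren.simps sat.simps All.IH)
qed (auto simp: eval_ren_t inj_on_Un)

lemma delta0_ren: "delta0 p \<Longrightarrow> inj_on f (vars p) \<Longrightarrow> delta0 (ren f p)"
proof (induction rule: delta0.induct)
  case (6 p x t)
  have "f x \<notin> vars_t (ren_t f t)" using 6 by (auto simp: vars_ren_t inj_on_def)
  then show ?case using 6 by (auto intro!: delta0.intros simp: inj_on_Un)
next
  case (7 p x t)
  have "f x \<notin> vars_t (ren_t f t)" using 7 by (auto simp: vars_ren_t inj_on_def)
  then show ?case using 7 by (auto intro!: delta0.intros simp: inj_on_Un)
qed (auto intro: delta0.intros simp: inj_on_Un)

subsection \<open>Predicates on assignments represented by formulas\<close>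

text \<open>Even variables carry the arguments of a predicate, odd variables carry parameters.\<close>

definition pe :: "(nat \<Rightarrow> 'a) \<Rightarrow> (nat \<Rightarrow> 'a) \<Rightarrow> nat \<Rightarrow> 'a" where
  "pe \<rho> e v = (if even v then e (v div 2) else \<rho> (v div 2))"

section \<open>The axioms of PA in the model\<close>

locale pa =
  fixes M :: "'a struc"
  assumes modPA: "models M PA"
begin

abbreviation D where "D \<equiv> dom M"
abbreviation zr ("\<zero>") where "\<zero> \<equiv> zer M"
abbreviation sc' ("\<S>") where "\<S> \<equiv> sc M"
abbreviation pl' (infixl "\<oplus>" 65) where "a \<oplus> b \<equiv> pl M a b"
abbreviation tm' (infixl "\<otimes>" 70) where "a \<otimes> b \<equiv> tm M a b"
abbreviation lt' (infix "\<prec>" 50) where "a \<prec> b \<equiv> lt M a b"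

definition asg :: "(nat \<Rightarrow> 'a) set" where "asg = {e. \<forall>i. e i \<in> D}"

lemma asgD: "e \<in> asg \<Longrightarrow> e i \<in> D" by (simp add: asg_def)
lemma asg_upd [simp]: "e \<in> asg \<Longrightarrow> a \<in> D \<Longrightarrow> e(i := a) \<in> asg" by (simp add: asg_def)
lemma asg_shift [simp]: "e \<in> asg \<Longrightarrow> (\<lambda>i. e (f i)) \<in> asg" by (simp add: asg_def)

lemma D0 [simp]: "\<zero> \<in> D" and DS [simp]: "a \<in> D \<Longrightarrow> \<S> a \<in> D"
  and Dpl [simp]: "a \<in> D \<Longrightarrow> b \<in> D \<Longrightarrow> a \<oplus> b \<in> D"
  and Dtm [simp]: "a \<in> D \<Longrightarrow> b \<in> D \<Longrightarrow> a \<otimes> b \<in> D"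
  using modPA by (auto simp: models_def wf_struc_def)

lemma sat_PA: "p \<in> PA \<Longrightarrow> e \<in> asg \<Longrightarrow> sat M e p"
  using modPA by (auto simp: models_def asg_def)

lemma S_nz: "a \<in> D \<Longrightarrow> \<S> a \<noteq> \<zero>"
  using sat_PA[of "All 0 (Neg (Eq (S (Var 0)) Zero))" "\<lambda>_. \<zero>"]
  by (auto simp: PA_def PA_basic_def asg_def)

lemma S_inj: "a \<in> D \<Longrightarrow> b \<in> D \<Longrightarrow> \<S> a = \<S> b \<Longrightarrow> a = b"
  using sat_PA[of "All 0 (All 1 (Imp (Eq (S (Var 0)) (S (Var 1))) (Eq (Var 0) (Var 1))))" "\<lambda>_. \<zero>"]
  by (auto simp: PA_def PA_basic_def asg_def Imp_def)

lemma S_inj' [simp]: "a \<in> D \<Longrightarrow> b \<in> D \<Longrightarrow> \<S> a = \<S> b \<longleftrightarrow> a = b" using S_inj by auto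

lemma pl_0 [simp]: "a \<in> D \<Longrightarrow> a \<oplus> \<zero> = a"
  using sat_PA[of "All 0 (Eq (Plus (Var 0) Zero) (Var 0))" "\<lambda>_. \<zero>"]
  by (auto simp: PA_def PA_basic_def asg_def)

lemma pl_S: "a \<in> D \<Longrightarrow> b \<in> D \<Longrightarrow> a \<oplus> \<S> b = \<S> (a \<oplus> b)"
  using sat_PA[of "All 0 (All 1 (Eq (Plus (Var 0) (S (Var 1))) (S (Plus (Var 0) (Var 1)))))" "\<lambda>_. \<zero>"]
  by (auto simp: PA_def PA_basic_def asg_def)

lemma tm_0 [simp]: "a \<in> D \<Longrightarrow> a \<otimes> \<zero> = \<zero>"
  using sat_PA[of "All 0 (Eq (Times (Var 0) Zero) Zero)" "\<lambda>_. \<zero>"]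
  by (auto simp: PA_def PA_basic_def asg_def)

lemma tm_S: "a \<in> D \<Longrightarrow> b \<in> D \<Longrightarrow> a \<otimes> \<S> b = a \<otimes> b \<oplus> a"
  using sat_PA[of "All 0 (All 1 (Eq (Times (Var 0) (S (Var 1))) (Plus (Times (Var 0) (Var 1)) (Var 0))))" "\<lambda>_. \<zero>"]
  by (auto simp: PA_def PA_basic_def asg_def)

lemma lt_iff: "a \<in> D \<Longrightarrow> b \<in> D \<Longrightarrow> a \<prec> b \<longleftrightarrow> (\<exists>c\<in>D. a \<oplus> \<S> c = b)"
  using sat_PA[of "All 0 (All 1 (Iff (Lt (Var 0) (Var 1)) (Ex 2 (Eq (Plus (Var 0) (S (Var 2))) (Var 1)))))" "\<lambda>_. \<zero>"]
  by (simp add: PA_def PA_basic_def asg_def Iff_def Imp_def) blast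

lemma lt_S [simp]: "a \<in> D \<Longrightarrow> a \<prec> \<S> a"
  by (subst lt_iff) (auto intro!: bexI[of _ "\<zero>"] simp: pl_S)

lemma sat_univ: "e \<in> asg \<Longrightarrow> sat M e (foldr All xs p) \<Longrightarrow> sat M e p"
proof (induction xs)
  case (Cons x xs)
  have "sat M (e(x := e x)) (foldr All xs p)" using Cons.prems asgD[of e x] by (simp del: fun_upd_triv)
  then show ?case using Cons by simp
qed simp

text \<open>\<open>ind_ax\<close> avoids substitution by clauses such as
  \<open>Ex x (Conj (Eq (Var x) (Var z)) p)\<close>. As \<open>z\<close> does not occur in
  \<open>p\<close>, they express \<open>p\<close> at the value of \<open>z\<close> and at its
  successor.\<close>

lemma ind_sat:
  assumes e: "e \<in> asg" and 0: "sat M (e(x := \<zero>)) p"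
    and s: "\<And>b. b \<in> D \<Longrightarrow> sat M (e(x := b)) p \<Longrightarrow> sat M (e(x := \<S> b)) p" and b: "b \<in> D"
  shows "sat M (e(x := b)) p"
proof -
  define z where "z = Suc (Max (insert x (vars p)))"
  have zz: "v < z" if "v \<in> insert x (vars p)" for v
    using Max_ge[of "insert x (vars p)" v] that finite_vars[of p] by (simp add: z_def del: Max_insert Max_ge)
  then have zx: "z \<noteq> x" and zp: "z \<notin> vars p" by auto
  have "sat M e (ind_ax x p)" using e by (intro sat_PA) (auto simp: PA_def)
  then have *: "sat M e (Imp (Conj (Ex x (Conj (Eq (Var x) Zero) p))
                  (All z (Imp (Ex x (Conj (Eq (Var x) (Var z)) p))
                              (Ex x (Conj (Eq (Var x) (S (Var z))) p)))))
            (All x p))"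
    unfolding ind_ax_def Let_def univ_closure_def z_def[symmetric] by (rule sat_univ[OF e])
  have c: "sat M (e(z := b, x := c)) p = sat M (e(x := c)) p" for b c
    by (rule sat_cong) (use zp fv_subset_vars[of p] in auto)
  from * 0 s b show ?thesis using zx
    by (auto simp: Imp_def c)
qed

text \<open>The language has no names for elements, so the parameters from \<open>Q\<close> are
  supplied through the assignment \<open>\<rho>\<close> of the odd variables. The formula has to
  match \<open>P\<close> only on assignments into \<open>D\<close>.\<close>

definition rep :: "(fm \<Rightarrow> bool) \<Rightarrow> 'a set \<Rightarrow> ((nat \<Rightarrow> 'a) \<Rightarrow> bool) \<Rightarrow> bool" where
  "rep \<Phi> Q P \<longleftrightarrow> (\<exists>p \<rho>. \<Phi> p \<and> (\<forall>i. \<rho> i \<in> Q) \<and> (\<forall>e\<in>asg. P e = sat M (pe \<rho> e) p))"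

definition good :: "(fm \<Rightarrow> bool) \<Rightarrow> bool" where
  "good \<Phi> \<longleftrightarrow> (\<forall>t u. \<Phi> (Eq t u)) \<and> (\<forall>t u. \<Phi> (Lt t u)) \<and> (\<forall>p. \<Phi> p \<longrightarrow> \<Phi> (Neg p))
     \<and> (\<forall>p q. \<Phi> p \<longrightarrow> \<Phi> q \<longrightarrow> \<Phi> (Conj p q))
     \<and> (\<forall>p x t. \<Phi> p \<longrightarrow> x \<notin> vars_t t \<longrightarrow> \<Phi> (Ex x (Conj (Lt (Var x) t) p)))
     \<and> (\<forall>p f. \<Phi> p \<longrightarrow> inj_on f (vars p) \<longrightarrow> \<Phi> (ren f p))"

lemma good_delta0: "good delta0" by (auto simp: good_def intro: delta0.intros delta0_ren)
lemma good_True: "good (\<lambda>_. True)" by (auto simp: good_def)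

lemma rep_cong: "rep \<Phi> Q P \<Longrightarrow> (\<And>e. e \<in> asg \<Longrightarrow> P e = P' e) \<Longrightarrow> rep \<Phi> Q P'"
  unfolding rep_def by metis

lemma rep_mono: "rep \<Phi> Q P \<Longrightarrow> Q \<subseteq> Q' \<Longrightarrow> (\<And>p. \<Phi> p \<Longrightarrow> \<Phi>' p) \<Longrightarrow> rep \<Phi>' Q' P"
  unfolding rep_def by blast

text \<open>Quantifier rules treat the bound variable as argument 0 and shift the others, while
  formulas have named variables. The renaming \<open>h\<close> sends variable 0 to the fresh
  variable \<open>2 * N\<close> and moves every other argument down by one, so that \<open>p\<close>
  can be quantified over \<open>2 * N\<close>.\<close>

lemma rep_push:
  assumes g: "\<And>p f. \<Phi> p \<Longrightarrow> inj_on f (vars p) \<Longrightarrow> \<Phi> (ren f p)"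
    and P: "rep \<Phi> Q (\<lambda>e. P (e 0) (\<lambda>i. e (Suc i)))"
  obtains p N \<rho> where "\<Phi> p" "\<forall>i. \<rho> i \<in> Q" "N > k"
    "\<And>e a. e \<in> asg \<Longrightarrow> a \<in> D \<Longrightarrow> sat M (pe \<rho> (e(N := a))) p = P a e"
proof -
  obtain p \<rho> where *: "\<Phi> p" "\<forall>i. \<rho> i \<in> Q" "\<And>e. e\<in>asg \<Longrightarrow> P (e 0) (\<lambda>i. e (Suc i)) = sat M (pe \<rho> e) p"
    using P by (auto simp: rep_def)
  define N where "N = Suc (k + Max (insert 0 (vars p)))"
  have Ng: "v < N" if "v \<in> vars p" for v
    using Max_ge[of "insert 0 (vars p)" v] that finite_vars[of p] by (simp add: N_def del: Max_insert Max_ge)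
  define h where "h v = (if v = 0 then 2 * N else if even v then v - 2 else v)" for v
  have h: "inj_on h (vars p)"
  proof (rule inj_onI)
    fix u v assume a: "u \<in> vars p" "v \<in> vars p" "h u = h v"
    then have "u < N" "v < N" using Ng by auto
    moreover have "even (h u) = even u" "even (h v) = even v" by (auto simp: h_def)
    with a(3) have "even u = even v" by simp
    moreover have "u \<ge> 2" if "even u" "u \<noteq> 0" for u :: nat using that by (auto elim!: evenE)
    ultimately show "u = v" using a(3) by (fastforce simp: h_def split: if_splits)
  qed
  have 1: "pe \<rho> (e(N := a)) (h v) = pe \<rho> (\<lambda>i. if i = 0 then a else e (i - 1)) v" if "v < N" for e a v
  proof (cases "even v \<and> v \<noteq> 0")
    case True
    then have "(v - 2) div 2 = v div 2 - 1" by (auto elim!: evenE)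
    then show ?thesis using True that by (auto simp: pe_def h_def)
  next
    case False then show ?thesis by (auto simp: pe_def h_def)
  qed
  show ?thesis
  proof (rule that[of "ren h p" \<rho> N])
    show "\<Phi> (ren h p)" using g * h by auto
    show "\<forall>i. \<rho> i \<in> Q" "N > k" using * by (auto simp: N_def)
    fix e a assume e: "e \<in> asg" and a: "a \<in> D"
    have "sat M (pe \<rho> (e(N := a))) (ren h p) = sat M (pe \<rho> (\<lambda>i. if i = 0 then a else e (i - 1))) p"
      unfolding sat_ren[OF h] by (rule sat_cong) (use 1 Ng fv_subset_vars[of p] in auto)
    also have "\<dots> = P a e" using *(3)[of "\<lambda>i. if i = 0 then a else e (i - 1)"] e a by (auto simp: asg_def)
    finally show "sat M (pe \<rho> (e(N := a))) (ren h p) = P a e" .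
  qed
qed

lemma pe_upd_even: "(pe \<rho> e)(2*N := a) = pe \<rho> (e(N := a))"
  by (auto simp: fun_eq_iff pe_def)

lemma rep_ex:
  assumes g: "\<And>p f. \<Phi> p \<Longrightarrow> inj_on f (vars p) \<Longrightarrow> \<Phi> (ren f p)"
    and P: "rep \<Phi> Q (\<lambda>e. P (e 0) (\<lambda>i. e (Suc i)))" and c: "\<And>x p. \<Phi> p \<Longrightarrow> \<Phi>' (Ex x p)"
  shows "rep \<Phi>' Q (\<lambda>e. \<exists>a\<in>D. P a e)"
proof -
  obtain p N \<rho> where *: "\<Phi> p" "\<forall>i. \<rho> i \<in> Q" "N > 0"
    "\<And>e a. e \<in> asg \<Longrightarrow> a \<in> D \<Longrightarrow> sat M (pe \<rho> (e(N := a))) p = P a e"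
    using rep_push[OF g P, of 0] by metis
  have 1: "sat M (pe \<rho> e) (Ex (2*N) p) \<longleftrightarrow> (\<exists>a\<in>D. P a e)"
    if "e \<in> asg" for e using that *(3,4) by (auto simp: pe_upd_even)
  show ?thesis unfolding rep_def
    by (rule exI, rule exI[of _ \<rho>], intro conjI ballI)
      (use * c in \<open>auto simp: 1[symmetric] simp del: sat.simps\<close>)
qed

context
  fixes \<Phi> Q assumes g: "good \<Phi>" and QD: "Q \<subseteq> D"
begin

text \<open>The parameter lists of the two formulas are interleaved, the first on the even and the
  second on the odd positions of \<open>\<rho>\<close>.\<close>

lemma rep_merge:
  assumes "rep \<Phi> Q P" "rep \<Phi> Q P'"
  obtains p p' \<rho> where "\<Phi> p" "\<Phi> p'" "\<forall>i. \<rho> i \<in> Q" "\<And>e. e \<in> asg \<Longrightarrow> P e = sat M (pe \<rho> e) p"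
    "\<And>e. e \<in> asg \<Longrightarrow> P' e = sat M (pe \<rho> e) p'"
proof -
  obtain p r p' r' where *: "\<Phi> p" "\<forall>i. r i \<in> Q" "\<forall>e\<in>asg. P e = sat M (pe r e) p"
    "\<Phi> p'" "\<forall>i. r' i \<in> Q" "\<forall>e\<in>asg. P' e = sat M (pe r' e) p'"
    using assms by (auto simp: rep_def)
  define f where "f b v = (if even v then v else 2 * (2 * (v div 2) + b) + 1)" for b v :: nat
  have inj: "inj (f b)" for b
  proof (rule injI)
    fix u v assume eq: "f b u = f b v"
    have "even (f b u) = even u" "even (f b v) = even v" by (simp_all add: f_def)
    with eq have p: "even u = even v" by simp
    show "u = v"
    proof (cases "even u")
      case True then show ?thesis using eq p by (simp add: f_def)
    next
      case False
      then have "u div 2 = v div 2" using eq p by (simp add: f_def)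
      then show ?thesis using False p by (metis odd_two_times_div_two_succ)
    qed
  qed
  define \<rho> where "\<rho> = (\<lambda>i. if even i then r (i div 2) else r' (i div 2))"
  have 1: "pe \<rho> e \<circ> f 0 = pe r e" "pe \<rho> e \<circ> f 1 = pe r' e" for e
    by (rule ext, auto simp: pe_def f_def \<rho>_def elim!: oddE)+
  have i: "inj_on (f b) (vars q)" for b q using inj by (rule inj_on_subset) simp
  have g': "\<Phi> q \<Longrightarrow> \<Phi> (ren (f b) q)" for b q using g i by (simp add: good_def)
  show ?thesis
  proof (rule that[of "ren (f 0) p" "ren (f 1) p'" \<rho>])
    show "\<forall>i. \<rho> i \<in> Q" using * by (simp add: \<rho>_def)
  qed (use * g' in \<open>simp_all only: sat_ren[OF i] 1\<close>)
qed

lemma rep_not: "rep \<Phi> Q P \<Longrightarrow> rep \<Phi> Q (\<lambda>e. \<not> P e)"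
proof -
  assume "rep \<Phi> Q P"
  then obtain p r where "\<Phi> p" "\<forall>i. r i \<in> Q" "\<forall>e\<in>asg. P e = sat M (pe r e) p" by (auto simp: rep_def)
  then show ?thesis unfolding rep_def using g by (intro exI[of _ "Neg p"] exI[of _ r]) (auto simp: good_def)
qed

lemma rep_and: "rep \<Phi> Q P \<Longrightarrow> rep \<Phi> Q P' \<Longrightarrow> rep \<Phi> Q (\<lambda>e. P e \<and> P' e)"
proof -
  assume "rep \<Phi> Q P" "rep \<Phi> Q P'"
  then obtain p p' r where "\<Phi> p" "\<Phi> p'" "\<forall>i. r i \<in> Q" "\<And>e. e\<in>asg \<Longrightarrow> P e = sat M (pe r e) p"
     "\<And>e. e\<in>asg \<Longrightarrow> P' e = sat M (pe r e) p'" by (rule rep_merge) blast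
  then show ?thesis unfolding rep_def using g
    by (intro exI[of _ "Conj p p'"] exI[of _ r]) (auto simp: good_def)
qed

lemma rep_support:
  assumes "rep \<Phi> Q P"
  obtains r where "\<And>e e'. e \<in> asg \<Longrightarrow> e' \<in> asg \<Longrightarrow> (\<And>i. i < r \<Longrightarrow> e i = e' i) \<Longrightarrow> P e = P e'"
proof -
  obtain p s where *: "\<Phi> p" "\<forall>i. s i \<in> Q" "\<forall>e\<in>asg. P e = sat M (pe s e) p"
    using assms by (auto simp: rep_def)
  define r where "r = Suc (Max (insert 0 (vars p)))"
  have r: "v < r" if "v \<in> vars p" for v using that finite_vars[of p] by (simp add: r_def less_Suc_eq_le)
  show ?thesis
  proof (rule that[of r])
    fix e e' assume "e \<in> asg" "e' \<in> asg" and eq: "\<And>i. i < r \<Longrightarrow> e i = e' i"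
    moreover have "sat M (pe s e) p = sat M (pe s e') p"
    proof (rule sat_cong)
      fix v assume "v \<in> fv p"
      then have "v div 2 < r" using r fv_subset_vars[of p] by (meson div_le_dividend le_less_trans subsetD)
      then show "pe s e v = pe s e' v" using eq by (simp add: pe_def)
    qed
    ultimately show "P e = P e'" using * by simp
  qed
qed

lemma rep_inj:
  assumes "rep \<Phi> Q P" "inj f"
  shows "rep \<Phi> Q (\<lambda>e. P (\<lambda>i. e (f i)))"
proof -
  obtain p s where *: "\<Phi> p" "\<forall>i. s i \<in> Q" "\<forall>e\<in>asg. P e = sat M (pe s e) p"
    using assms by (auto simp: rep_def)
  define h where "h v = (if even v then 2 * f (v div 2) else v)" for v
  have h: "inj h"
  proof (rule injI)
    fix u v assume eq: "h u = h v"
    have "even (h u) = even u" "even (h v) = even v" by (simp_all add: h_def)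
    with eq have p: "even u = even v" by simp
    show "u = v"
    proof (cases "even u")
      case True
      then have "f (u div 2) = f (v div 2)" using eq p by (simp add: h_def)
      then have "u div 2 = v div 2" by (rule injD[OF assms(2)])
      then show ?thesis using True p by (metis dvd_mult_div_cancel)
    next
      case False then show ?thesis using eq p by (simp add: h_def)
    qed
  qed
  have 1: "pe s e \<circ> h = pe s (\<lambda>i. e (f i))" for e by (auto simp: fun_eq_iff pe_def h_def)
  have i: "inj_on h (vars p)" using h by (rule inj_on_subset) simp
  show ?thesis unfolding rep_def
    by (rule exI[of _ "ren h p"], rule exI[of _ s])
      (use * g i in \<open>simp add: good_def sat_ren[OF i] 1\<close>)
qed

text \<open>A variable replaces a variable by means of a bounded quantifier: among the numbers below
  the successor of argument \<open>k\<close>, take the one equal to argument \<open>k\<close>. This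
  keeps bounded formulas bounded.\<close>

lemma rep_upd:
  assumes "rep \<Phi> Q P" "j \<noteq> k"
  shows "rep \<Phi> Q (\<lambda>e. P (e(j := e k)))"
proof -
  obtain p s where *: "\<Phi> p" "\<forall>i. s i \<in> Q" "\<forall>e\<in>asg. P e = sat M (pe s e) p"
    using assms by (auto simp: rep_def)
  have pe: "(pe s e)(2*j := a) = pe s (e(j := a))" for e a
    by (auto simp: fun_eq_iff pe_def)
  have pe1: "pe s e (2 * k) = e k" "pe s e (2*j) = e j" for e  by (auto simp: pe_def)
  have 1: "sat M (pe s e) (Ex (2*j) (Conj (Lt (Var (2*j)) (S (Var (2*k)))) (Conj (Eq (Var (2*j)) (Var (2*k))) p)))
     \<longleftrightarrow> P (e(j := e k))" if "e \<in> asg" for e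
  proof -
    have "\<And>a. a \<in> D \<Longrightarrow> e(j := a) \<in> asg" using that by simp
    then show ?thesis using that * assms(2) asgD[OF that, of k] by (auto simp: pe pe1)
  qed
  show ?thesis unfolding rep_def
    by (rule exI, rule exI[of _ s], intro conjI ballI)
      (use * g assms(2) in \<open>auto simp: 1[symmetric] good_def simp del: sat.simps\<close>)
qed

text \<open>\<open>\<sigma>\<close> may identify arguments, so a renaming alone does not suffice.
  All arguments are first moved up by \<open>N\<close>, beyond every \<open>\<sigma> i\<close> that
  matters; then the finitely many relevant ones are overwritten one at a time by
  \<open>rep_upd\<close>, without disturbing the places they are copied from.\<close>

lemma rep_re:
  assumes P: "rep \<Phi> Q P"
  shows "rep \<Phi> Q (\<lambda>e. P (\<lambda>i. e (\<sigma> i)))"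
proof -
  obtain r where r: "\<And>e e'. e \<in> asg \<Longrightarrow> e' \<in> asg \<Longrightarrow> (\<And>i. i < r \<Longrightarrow> e i = e' i) \<Longrightarrow> P e = P e'"
    using rep_support[OF P] by blast
  define N where "N = Suc (Max (insert 0 (\<sigma> ` {..<r})))"
  have N: "\<sigma> i < N" if "i < r" for i using that by (simp add: N_def less_Suc_eq_le)
  define P1 where "P1 e = P (\<lambda>i. e (i + N))" for e
  have P1: "rep \<Phi> Q P1" unfolding P1_def by (rule rep_inj[OF P]) (auto simp: inj_def)
  have "rep \<Phi> Q (\<lambda>e. P1 (\<lambda>v. if N \<le> v \<and> v < N + m then e (\<sigma> (v - N)) else e v))" if "m \<le> r" for m
    using that
  proof (induction m)
    case 0
    have "(\<lambda>v. if N \<le> v \<and> v < N + 0 then e (\<sigma> (v - N)) else e v) = e" for e :: "nat \<Rightarrow> 'a"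
      by (simp add: fun_eq_iff not_less[symmetric])
    then show ?case using P1 by simp
  next
    case (Suc m)
    have a: "N + m \<noteq> \<sigma> m" using N[of m] Suc by auto
    have "rep \<Phi> Q (\<lambda>e. P1 (\<lambda>v. if N \<le> v \<and> v < N + m then e (\<sigma> (v - N)) else e v))"
      using Suc by auto
    from rep_upd[OF this a] show ?case
    proof (rule rep_cong)
      fix e :: "nat \<Rightarrow> 'a"
      have "(\<lambda>v. if N \<le> v \<and> v < N + m then (e(N + m := e (\<sigma> m))) (\<sigma> (v - N)) else (e(N + m := e (\<sigma> m))) v)
        = (\<lambda>v. if N \<le> v \<and> v < N + Suc m then e (\<sigma> (v - N)) else e v)"
      proof
        fix v
        have "\<sigma> (v - N) \<noteq> N + m" if "N \<le> v" "v < N + m" using N[of "v - N"] that Suc.prems by linarith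
        moreover have "v - N = m" if "v = N + m" using that by simp
        ultimately show "(if N \<le> v \<and> v < N + m then (e(N + m := e (\<sigma> m))) (\<sigma> (v - N)) else (e(N + m := e (\<sigma> m))) v)
           = (if N \<le> v \<and> v < N + Suc m then e (\<sigma> (v - N)) else e v)" by (auto simp: less_Suc_eq)
      qed
      then show "P1 (\<lambda>v. if N \<le> v \<and> v < N + m then (e(N + m := e (\<sigma> m))) (\<sigma> (v - N)) else (e(N + m := e (\<sigma> m))) v)
        = P1 (\<lambda>v. if N \<le> v \<and> v < N + Suc m then e (\<sigma> (v - N)) else e v)" by simp
    qed
  qed
  from this[of r] show ?thesis
  proof (rule rep_cong[OF _ ])
    fix e assume e: "e \<in> asg"
    show "P1 (\<lambda>v. if N \<le> v \<and> v < N + r then e (\<sigma> (v - N)) else e v) = P (\<lambda>i. e (\<sigma> i))"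
      unfolding P1_def by (rule r) (use e in \<open>auto simp: asg_def\<close>)
  qed simp
qed

lemma rep_bex:
  assumes P: "rep \<Phi> Q (\<lambda>e. P (e 0) (\<lambda>i. e (Suc i)))"
  shows "rep \<Phi> Q (\<lambda>e. \<exists>a\<in>D. a \<prec> e k \<and> P a e)"
proof -
  obtain p N \<rho> where *: "\<Phi> p" "\<forall>i. \<rho> i \<in> Q" "N > k"
    "\<And>e a. e \<in> asg \<Longrightarrow> a \<in> D \<Longrightarrow> sat M (pe \<rho> (e(N := a))) p = P a e"
    using rep_push[OF _ P, of k] g unfolding good_def by metis
  have 1: "sat M (pe \<rho> e) (Ex (2*N) (Conj (Lt (Var (2*N)) (Var (2*k))) p)) \<longleftrightarrow> (\<exists>a\<in>D. a \<prec> e k \<and> P a e)"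
    if "e \<in> asg" for e using that *(3,4) by (auto simp: pe_upd_even) (auto simp: pe_def)
  show ?thesis unfolding rep_def
    by (rule exI, rule exI[of _ \<rho>], intro conjI ballI)
      (use * g in \<open>auto simp: 1[symmetric] good_def simp del: sat.simps\<close>)
qed

lemma rep_atoms:
  assumes "c \<in> Q"
  shows "rep \<Phi> Q (\<lambda>e. e 0 = e 1)" "rep \<Phi> Q (\<lambda>e. e 0 \<prec> e 1)" "rep \<Phi> Q (\<lambda>e. e 0 = e 1 \<oplus> e 2)"
    "rep \<Phi> Q (\<lambda>e. e 0 = e 1 \<otimes> e 2)" "rep \<Phi> Q (\<lambda>e. e 0 = \<S> (e 1))" "rep \<Phi> Q (\<lambda>e. e 0 = \<zero>)"
    "rep \<Phi> Q (\<lambda>e. e 0 = c)"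
proof -
  have *: "rep \<Phi> Q P" if "\<Phi> p" "\<And>e. e \<in> asg \<Longrightarrow> P e = sat M (pe (\<lambda>_. c) e) p" for p P
    unfolding rep_def by (rule exI[of _ p], rule exI[of _ "\<lambda>_. c"]) (use that assms in simp)
  have e: "\<Phi> (Eq t u)" "\<Phi> (Lt t u)" for t u using g by (auto simp: good_def)
  show "rep \<Phi> Q (\<lambda>e. e 0 = e 1)" by (rule *[OF e(1)[of "Var 0" "Var 2"]]) (auto simp: pe_def)
  show "rep \<Phi> Q (\<lambda>e. e 0 \<prec> e 1)" by (rule *[OF e(2)[of "Var 0" "Var 2"]]) (auto simp: pe_def)
  show "rep \<Phi> Q (\<lambda>e. e 0 = e 1 \<oplus> e 2)" by (rule *[OF e(1)[of "Var 0" "Plus (Var 2) (Var 4)"]]) (auto simp: pe_def)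
  show "rep \<Phi> Q (\<lambda>e. e 0 = e 1 \<otimes> e 2)" by (rule *[OF e(1)[of "Var 0" "Times (Var 2) (Var 4)"]]) (auto simp: pe_def)
  show "rep \<Phi> Q (\<lambda>e. e 0 = \<S> (e 1))" by (rule *[OF e(1)[of "Var 0" "S (Var 2)"]]) (auto simp: pe_def)
  show "rep \<Phi> Q (\<lambda>e. e 0 = \<zero>)" by (rule *[OF e(1)[of "Var 0" "Zero"]]) (auto simp: pe_def)
  show "rep \<Phi> Q (\<lambda>e. e 0 = c)" by (rule *[OF e(1)[of "Var 0" "Var 1"]]) (auto simp: pe_def)
qed

end

end

text \<open>Predicate classes closed under Boolean operations, bounded quantification and substitution
  of the functions whose graph is in the class. Quantifier rules use de Bruijn style: the bound
  variable becomes argument 0 and the other arguments are shifted.\<close>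

locale calc = pa M for M :: "'a struc" +
  fixes C :: "((nat \<Rightarrow> 'a) \<Rightarrow> bool) \<Rightarrow> bool" and Q :: "'a set"
  assumes c_cong: "C P \<Longrightarrow> (\<And>e. e \<in> asg \<Longrightarrow> P e = P' e) \<Longrightarrow> C P'"
    and c_not: "C P \<Longrightarrow> C (\<lambda>e. \<not> P e)"
    and c_and: "C P \<Longrightarrow> C P' \<Longrightarrow> C (\<lambda>e. P e \<and> P' e)"
    and c_bex0: "C (\<lambda>e. R (e 0) (\<lambda>i. e (Suc i))) \<Longrightarrow> C (\<lambda>e. \<exists>a\<in>D. a \<prec> e k \<and> R a e)"
    and c_re: "C P \<Longrightarrow> C (\<lambda>e. P (\<lambda>i. e (\<sigma> i)))"
    and c_sub0: "C (\<lambda>e. R (e 0) (\<lambda>i. e (Suc i))) \<Longrightarrow> (\<And>e. e \<in> asg \<Longrightarrow> f e \<in> D) \<Longrightarrow>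
        C (\<lambda>e. e 0 = f (\<lambda>i. e (Suc i))) \<Longrightarrow> C (\<lambda>e. R (f e) e)"
    and c_eq0: "C (\<lambda>e. e 0 = e 1)" and c_lt0: "C (\<lambda>e. e 0 \<prec> e 1)"
    and c_pl0: "C (\<lambda>e. e 0 = e 1 \<oplus> e 2)" and c_tm0: "C (\<lambda>e. e 0 = e 1 \<otimes> e 2)"
    and c_S0: "C (\<lambda>e. e 0 = \<S> (e 1))" and c_00: "C (\<lambda>e. e 0 = \<zero>)"
    and c_con0: "c \<in> Q \<Longrightarrow> C (\<lambda>e. e 0 = c)"
    and QD: "Q \<subseteq> D"
begin

definition Fn :: "((nat \<Rightarrow> 'a) \<Rightarrow> 'a) \<Rightarrow> bool" where
  "Fn f \<longleftrightarrow> (\<forall>e\<in>asg. f e \<in> D) \<and> C (\<lambda>e. e 0 = f (\<lambda>i. e (Suc i)))"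

lemma FnD: "Fn f \<Longrightarrow> e \<in> asg \<Longrightarrow> f e \<in> D" by (simp add: Fn_def)

lemma c_sub: "C (\<lambda>e. R (e 0) (\<lambda>i. e (Suc i))) \<Longrightarrow> Fn f \<Longrightarrow> C (\<lambda>e. R (f e) e)"
  by (rule c_sub0) (auto simp: Fn_def)

lemma Fn_var: "Fn (\<lambda>e. e i)"
  unfolding Fn_def using c_re[OF c_eq0, of "\<lambda>j. if j = 0 then 0 else Suc i"] by (simp add: asgD)

lemma Fn_cong: "Fn f \<Longrightarrow> (\<And>e. e \<in> asg \<Longrightarrow> f e = f' e) \<Longrightarrow> Fn f'"
  unfolding Fn_def by (auto elim!: c_cong)

lemma Fn_re: "Fn f \<Longrightarrow> Fn (\<lambda>e. f (\<lambda>i. e (\<sigma> i)))"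
  unfolding Fn_def using c_re[of "\<lambda>e. e 0 = f (\<lambda>i. e (Suc i))" "\<lambda>j. case j of 0 \<Rightarrow> 0 | Suc i \<Rightarrow> Suc (\<sigma> i)"]
  by simp

lemma c_r1: assumes "C (\<lambda>e. R (e 0))" "Fn f" shows "C (\<lambda>e. R (f e))"
  using c_sub[of "\<lambda>a e. R a" f] assms by simp

text \<open>Substitution acts on argument 0. Hence the arguments are put in reverse order and filled
  from the last to the first, each step shifting those still to come.\<close>

lemma c_r2:
  assumes "C (\<lambda>e. R (e 0) (e 1))" "Fn f" "Fn g" shows "C (\<lambda>e. R (f e) (g e))"
proof -
  have "C (\<lambda>e. R (e (Suc 0)) (e 0))" using c_re[OF assms(1), of "\<lambda>i. if i = 0 then 1 else 0"] by simp
  from c_sub[of "\<lambda>b e. R (e 0) b", OF this Fn_re[OF assms(3), of Suc]]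
  have "C (\<lambda>e. R (e 0) (g (\<lambda>i. e (Suc i))))" .
  from c_sub[of "\<lambda>a e. R a (g e)", OF this assms(2)] show ?thesis .
qed

lemma c_r3:
  assumes "C (\<lambda>e. R (e 0) (e 1) (e 2))" "Fn f" "Fn g" "Fn h" shows "C (\<lambda>e. R (f e) (g e) (h e))"
proof -
  have "C (\<lambda>e. R (e (Suc (Suc 0))) (e (Suc 0)) (e 0))"
    using c_re[OF assms(1), of "\<lambda>i. if i = 0 then 2 else if i = 1 then 1 else 0"] by (simp add: numeral_2_eq_2)
  from c_sub[of "\<lambda>b e. R (e 1) (e 0) b", OF _ Fn_re[OF assms(4), of "\<lambda>i. Suc (Suc i)"]] this
  have "C (\<lambda>e. R (e 1) (e 0) (h (\<lambda>i. e (Suc (Suc i)))))" by simp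
  from c_sub[of "\<lambda>a e. R (e 0) a (h (\<lambda>i. e (Suc i)))", OF _ Fn_re[OF assms(3), of Suc]] this
  have "C (\<lambda>e. R (e 0) (g (\<lambda>i. e (Suc i))) (h (\<lambda>i. e (Suc i))))" by simp
  from c_sub[of "\<lambda>a e. R a (g e) (h e)", OF this assms(2)] show ?thesis .
qed

lemma c_eq: "Fn f \<Longrightarrow> Fn g \<Longrightarrow> C (\<lambda>e. f e = g e)" by (rule c_r2[OF c_eq0])
lemma c_lt: "Fn f \<Longrightarrow> Fn g \<Longrightarrow> C (\<lambda>e. f e \<prec> g e)" by (rule c_r2[OF c_lt0])
lemma Fn_con: "c \<in> Q \<Longrightarrow> Fn (\<lambda>e. c)" unfolding Fn_def using c_con0 QD by auto
lemma Fn_0: "Fn (\<lambda>e. \<zero>)" unfolding Fn_def using c_00 by simp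

lemma Fn_f1: assumes "Fn (\<lambda>e. F (e 0))" "Fn f" shows "Fn (\<lambda>e. F (f e))"
proof -
  have "C (\<lambda>e. e 0 = F (e 1))" using assms(1) by (simp add: Fn_def)
  from c_r2[OF this Fn_var[of 0] Fn_re[OF assms(2), of Suc]]
  have "C (\<lambda>e. e 0 = F (f (\<lambda>i. e (Suc i))))" .
  moreover have "F (f e) \<in> D" if "e \<in> asg" for e
    using FnD[OF assms(1), of "\<lambda>_. f e"] FnD[OF assms(2), of e] that by (auto simp: asg_def)
  ultimately show ?thesis by (simp add: Fn_def)
qed

lemma Fn_f2: assumes "Fn (\<lambda>e. F (e 0) (e 1))" "Fn f" "Fn g" shows "Fn (\<lambda>e. F (f e) (g e))"
proof -
  have "C (\<lambda>e. e 0 = F (e 1) (e 2))" using assms(1) by (simp add: Fn_def numeral_2_eq_2)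
  from c_r3[OF this Fn_var[of 0] Fn_re[OF assms(2), of Suc] Fn_re[OF assms(3), of Suc]]
  have "C (\<lambda>e. e 0 = F (f (\<lambda>i. e (Suc i))) (g (\<lambda>i. e (Suc i))))" .
  moreover have "F (f e) (g e) \<in> D" if "e \<in> asg" for e
    using FnD[OF assms(1), of "\<lambda>i. if i = 0 then f e else g e"] FnD[OF assms(2), of e]
      FnD[OF assms(3), of e] that by (auto simp: asg_def)
  ultimately show ?thesis by (simp add: Fn_def)
qed

lemma Fn_S: "Fn f \<Longrightarrow> Fn (\<lambda>e. \<S> (f e))"
  by (rule Fn_f1[of "\<lambda>x. \<S> x"]) (auto simp: Fn_def c_S0[simplified] asgD)
lemma Fn_pl: "Fn f \<Longrightarrow> Fn g \<Longrightarrow> Fn (\<lambda>e. f e \<oplus> g e)"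
  by (rule Fn_f2[of "\<lambda>x y. x \<oplus> y"]) (auto simp: Fn_def c_pl0[simplified numeral_2_eq_2, simplified] asgD)
lemma Fn_tm: "Fn f \<Longrightarrow> Fn g \<Longrightarrow> Fn (\<lambda>e. f e \<otimes> g e)"
  by (rule Fn_f2[of "\<lambda>x y. x \<otimes> y"]) (auto simp: Fn_def c_tm0[simplified numeral_2_eq_2, simplified] asgD)

lemma c_or: "C P \<Longrightarrow> C P' \<Longrightarrow> C (\<lambda>e. P e \<or> P' e)"
  using c_not[OF c_and[OF c_not c_not, of P P']] by simp
lemma c_imp: "C P \<Longrightarrow> C P' \<Longrightarrow> C (\<lambda>e. P e \<longrightarrow> P' e)"
  unfolding imp_conv_disj by (rule c_or[OF c_not])
lemma c_iff: "C P \<Longrightarrow> C P' \<Longrightarrow> C (\<lambda>e. P e \<longleftrightarrow> P' e)"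
    by (rule c_cong[OF c_and[OF c_imp[of P P'] c_imp[of P' P]]]) auto

lemma c_True: "C (\<lambda>e. True)" using c_eq0 c_eq[OF Fn_var Fn_var, of 0 0] by simp

lemma c_bex:
  assumes "Fn f" "C (\<lambda>e. R (e 0) (\<lambda>i. e (Suc i)))" shows "C (\<lambda>e. \<exists>a\<in>D. a \<prec> f e \<and> R a e)"
proof -
  have "C (\<lambda>e. (\<lambda>a e'. R a (\<lambda>i. e' (Suc i))) (e 0) (\<lambda>i. e (Suc i)))"
    using c_re[OF assms(2), of "\<lambda>j. case j of 0 \<Rightarrow> 0 | Suc i \<Rightarrow> Suc (Suc i)"] by simp
  from c_bex0[OF this, of 0]
  have "C (\<lambda>e. \<exists>a\<in>D. a \<prec> e 0 \<and> R a (\<lambda>i. e (Suc i)))" .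
  from c_sub[of "\<lambda>b e. \<exists>a\<in>D. a \<prec> b \<and> R a e", OF this assms(1)] show ?thesis .
qed

lemma c_ball:
  assumes "Fn f" "C (\<lambda>e. R (e 0) (\<lambda>i. e (Suc i)))" shows "C (\<lambda>e. \<forall>a\<in>D. a \<prec> f e \<longrightarrow> R a e)"
  using c_not[OF c_bex[OF assms(1), of "\<lambda>a e. \<not> R a e", OF c_not[OF assms(2)]]] by simp

end

text \<open>Membership of a predicate in a class is proved from its shape alone, by
  \<open>intro cintro\<close>; later coding notions add their own rules.\<close>

named_theorems cintro

context calc begin
lemmas [cintro] = c_not c_and c_or c_imp c_iff c_eq c_lt c_bex c_ball c_True
  Fn_var Fn_con Fn_0 Fn_S Fn_pl Fn_tm
end

context pa begin

section \<open>Predicates definable with arbitrary parameters\<close>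

definition Df :: "((nat \<Rightarrow> 'a) \<Rightarrow> bool) \<Rightarrow> bool" where "Df = rep (\<lambda>_. True) D"

lemma Df_ex: "Df (\<lambda>e. P (e 0) (\<lambda>i. e (Suc i))) \<Longrightarrow> Df (\<lambda>e. \<exists>a\<in>D. P a e)"
  unfolding Df_def by (rule rep_ex[where \<Phi> = "\<lambda>_. True"]) auto

text \<open>No term for \<open>f\<close> is needed: some \<open>a\<close> equals \<open>f e\<close>
  and satisfies \<open>R a e\<close>.\<close>

lemma Df_sub:
  assumes "Df (\<lambda>e. R (e 0) (\<lambda>i. e (Suc i)))" "\<And>e. e \<in> asg \<Longrightarrow> f e \<in> D"
    "Df (\<lambda>e. e 0 = f (\<lambda>i. e (Suc i)))"
  shows "Df (\<lambda>e. R (f e) e)"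
proof -
  have "Df (\<lambda>e. e 0 = f (\<lambda>i. e (Suc i)) \<and> R (e 0) (\<lambda>i. e (Suc i)))"
    using assms(1,3) unfolding Df_def by (intro rep_and[OF good_True]) auto
  from Df_ex[of "\<lambda>a e. a = f e \<and> R a e", OF this]
  have *: "Df (\<lambda>e. \<exists>a\<in>D. a = f e \<and> R a e)" .
  show ?thesis
    using * unfolding Df_def by (rule rep_cong) (use assms(2) in auto)
qed

end

sublocale pa \<subseteq> Df: calc M Df D
proof
  show "Df P \<Longrightarrow> (\<And>e. e \<in> asg \<Longrightarrow> P e = P' e) \<Longrightarrow> Df P'" for P P'
    unfolding Df_def by (rule rep_cong)
  show "Df P \<Longrightarrow> Df (\<lambda>e. \<not> P e)" for P unfolding Df_def by (rule rep_not[OF good_True]) auto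
  show "Df P \<Longrightarrow> Df P' \<Longrightarrow> Df (\<lambda>e. P e \<and> P' e)" for P P'
    unfolding Df_def by (rule rep_and[OF good_True]) auto
  show "Df (\<lambda>e. R (e 0) (\<lambda>i. e (Suc i))) \<Longrightarrow> Df (\<lambda>e. \<exists>a\<in>D. a \<prec> e k \<and> R a e)" for R k
    unfolding Df_def by (rule rep_bex[OF good_True]) auto
  show "Df P \<Longrightarrow> Df (\<lambda>e. P (\<lambda>i. e (\<sigma> i)))" for P \<sigma>
    unfolding Df_def by (rule rep_re[OF good_True]) auto
  show "Df (\<lambda>e. R (f e) e)" if "Df (\<lambda>e. R (e 0) (\<lambda>i. e (Suc i)))" "\<And>e. e \<in> asg \<Longrightarrow> f e \<in> D"
    "Df (\<lambda>e. e 0 = f (\<lambda>i. e (Suc i)))" for R f using that by (rule Df_sub)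
  show "Df (\<lambda>e. e 0 = c)" if "c \<in> D" for c
    unfolding Df_def by (rule rep_atoms(7)[OF good_True subset_refl that])
qed (unfold Df_def, (rule rep_atoms[OF good_True subset_refl D0])+, simp)

context pa begin

lemmas [cintro] = Df_ex

lemma Df_all [cintro]: "Df (\<lambda>e. P (e 0) (\<lambda>i. e (Suc i))) \<Longrightarrow> Df (\<lambda>e. \<forall>a\<in>D. P a e)"
  using Df.c_not[OF Df_ex[of "\<lambda>a e. \<not> P a e", OF Df.c_not]] by simp

subsection \<open>Arithmetic in a model of Peano arithmetic\<close>

text \<open>The defining formula of \<open>P\<close> may use any elements of \<open>M\<close> as
  parameters. Argument 0 of \<open>P\<close> is variable 0 of that formula, over which the induction
  axiom is taken.\<close>

lemma ind:
  assumes P: "Df (\<lambda>e. P (e 0))" and 0: "P \<zero>" and s: "\<And>b. b \<in> D \<Longrightarrow> P b \<Longrightarrow> P (\<S> b)" and a: "a \<in> D"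
  shows "P a"
proof -
  obtain p \<rho> where *: "\<forall>i. \<rho> i \<in> D" "\<And>e. e \<in> asg \<Longrightarrow> P (e 0) = sat M (pe \<rho> e) p"
    using P by (auto simp: Df_def rep_def)
  define e where "e = (\<lambda>_::nat. \<zero>)"
  have e: "e \<in> asg" "pe \<rho> e \<in> asg" using * by (auto simp: e_def asg_def pe_def)
  have 1: "P b = sat M ((pe \<rho> e)(0 := b)) p" if "b \<in> D" for b
  proof -
    have "(pe \<rho> e)(0 := b) = pe \<rho> (e(0 := b))" by (auto simp: fun_eq_iff pe_def)
    then show ?thesis using *(2)[of "e(0 := b)"] e that by simp
  qed
  show ?thesis using ind_sat[OF e(2), of 0 p a] 0 s a 1 by simp
qed

lemma pl_0l [simp]: "a \<in> D \<Longrightarrow> \<zero> \<oplus> a = a"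
  by (rule ind[of "\<lambda>a. \<zero> \<oplus> a = a"]) (intro cintro, simp_all add: pl_S)

lemma pl_Sl: assumes "a \<in> D" "b \<in> D" shows "\<S> a \<oplus> b = \<S> (a \<oplus> b)"
  by (rule ind[of "\<lambda>b. \<S> a \<oplus> b = \<S> (a \<oplus> b)"]) (intro cintro, simp_all add: pl_S assms)

lemma pl_comm: assumes "a \<in> D" "b \<in> D" shows "a \<oplus> b = b \<oplus> a"
  by (rule ind[of "\<lambda>b. a \<oplus> b = b \<oplus> a"]) (intro cintro, simp_all add: pl_S pl_Sl assms)

lemma pl_assoc: assumes "a \<in> D" "b \<in> D" "c \<in> D" shows "a \<oplus> b \<oplus> c = a \<oplus> (b \<oplus> c)"
  by (rule ind[of "\<lambda>c. a \<oplus> b \<oplus> c = a \<oplus> (b \<oplus> c)"]) (intro cintro, simp_all add: pl_S assms)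

lemma pl_lc: "a \<in> D \<Longrightarrow> b \<in> D \<Longrightarrow> c \<in> D \<Longrightarrow> a \<oplus> (b \<oplus> c) = b \<oplus> (a \<oplus> c)"
  by (metis pl_assoc pl_comm)

lemma tm_0l [simp]: "a \<in> D \<Longrightarrow> \<zero> \<otimes> a = \<zero>"
  by (rule ind[of "\<lambda>a. \<zero> \<otimes> a = \<zero>"]) (intro cintro, simp_all add: tm_S)

lemma tm_Sl: assumes "a \<in> D" "b \<in> D" shows "\<S> a \<otimes> b = a \<otimes> b \<oplus> b"
  by (rule ind[of "\<lambda>b. \<S> a \<otimes> b = a \<otimes> b \<oplus> b"])
    (intro cintro, simp_all add: pl_S pl_Sl tm_S assms pl_assoc pl_comm[of a])

lemma tm_comm: assumes "a \<in> D" "b \<in> D" shows "a \<otimes> b = b \<otimes> a"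
  by (rule ind[of "\<lambda>b. a \<otimes> b = b \<otimes> a"]) (intro cintro, simp_all add: tm_S tm_Sl assms)

lemma tm_dl: assumes "a \<in> D" "b \<in> D" "c \<in> D" shows "a \<otimes> (b \<oplus> c) = a \<otimes> b \<oplus> a \<otimes> c"
  by (rule ind[of "\<lambda>c. a \<otimes> (b \<oplus> c) = a \<otimes> b \<oplus> a \<otimes> c"])
    (intro cintro, simp_all add: pl_S tm_S assms pl_assoc)

lemma tm_dr: "a \<in> D \<Longrightarrow> b \<in> D \<Longrightarrow> c \<in> D \<Longrightarrow> (b \<oplus> c) \<otimes> a = b \<otimes> a \<oplus> c \<otimes> a"
  using tm_dl[of a b c] by (simp add: tm_comm[of a])

lemma tm_assoc: assumes "a \<in> D" "b \<in> D" "c \<in> D" shows "a \<otimes> b \<otimes> c = a \<otimes> (b \<otimes> c)"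
  by (rule ind[of "\<lambda>c. a \<otimes> b \<otimes> c = a \<otimes> (b \<otimes> c)"]) (intro cintro, simp_all add: tm_dl tm_S assms)

lemma tm_lc: "a \<in> D \<Longrightarrow> b \<in> D \<Longrightarrow> c \<in> D \<Longrightarrow> a \<otimes> (b \<otimes> c) = b \<otimes> (a \<otimes> c)"
  by (metis tm_assoc tm_comm)

lemmas ring = pl_assoc pl_comm pl_lc tm_assoc tm_comm tm_lc tm_dl tm_dr pl_S pl_Sl tm_S tm_Sl

lemma pl_cancel: assumes "a \<in> D" "b \<in> D" "c \<in> D" shows "a \<oplus> c = b \<oplus> c \<longleftrightarrow> a = b"
  by (rule ind[of "\<lambda>c. a \<oplus> c = b \<oplus> c \<longleftrightarrow> a = b"]) (intro cintro, simp_all add: pl_S assms)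

lemma pl_cancel_l: "a \<in> D \<Longrightarrow> b \<in> D \<Longrightarrow> c \<in> D \<Longrightarrow> c \<oplus> a = c \<oplus> b \<longleftrightarrow> a = b"
  by (metis pl_cancel pl_comm)

lemma cases0: assumes "a \<in> D" obtains "a = \<zero>" | b where "b \<in> D" "a = \<S> b"
proof -
  have "a = \<zero> \<or> (\<exists>b\<in>D. a = \<S> b)"
    by (rule ind[of "\<lambda>a. a = \<zero> \<or> (\<exists>b\<in>D. a = \<S> b)"]) (intro cintro, auto simp: assms)
  then show ?thesis using that by auto
qed

lemma pl_eq0: "a \<in> D \<Longrightarrow> b \<in> D \<Longrightarrow> a \<oplus> b = \<zero> \<longleftrightarrow> a = \<zero> \<and> b = \<zero>"
  by (cases rule: cases0[of b]) (auto simp: pl_S S_nz)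

definition le (infix "\<preceq>" 50) where "a \<preceq> b \<longleftrightarrow> a \<prec> b \<or> a = b"

lemma le_iff: assumes "a \<in> D" "b \<in> D" shows "a \<preceq> b \<longleftrightarrow> (\<exists>c\<in>D. a \<oplus> c = b)"
proof
  assume "a \<preceq> b" then show "\<exists>c\<in>D. a \<oplus> c = b" using assms unfolding le_def lt_iff[OF assms]
    by (metis DS D0 pl_0)
next
  assume "\<exists>c\<in>D. a \<oplus> c = b"
  then obtain c where "c \<in> D" "a \<oplus> c = b" by auto
  then show "a \<preceq> b" using assms unfolding le_def lt_iff[OF assms] by (cases rule: cases0[of c]) auto
qed

lemma leE: assumes "a \<preceq> b" "a \<in> D" "b \<in> D" obtains c where "c \<in> D" "b = a \<oplus> c"
  using assms le_iff by metis

lemma lt_le: "a \<in> D \<Longrightarrow> b \<in> D \<Longrightarrow> a \<prec> b \<longleftrightarrow> \<S> a \<preceq> b"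
  by (simp add: lt_iff le_iff pl_S pl_Sl)

lemma lt_S_le [simp]: "a \<in> D \<Longrightarrow> b \<in> D \<Longrightarrow> a \<prec> \<S> b \<longleftrightarrow> a \<preceq> b"
  by (simp add: lt_iff le_iff pl_S)

lemma le_refl [simp]: "a \<preceq> a" by (simp add: le_def)

lemma le_trans: "a \<preceq> b \<Longrightarrow> b \<preceq> c \<Longrightarrow> a \<in> D \<Longrightarrow> b \<in> D \<Longrightarrow> c \<in> D \<Longrightarrow> a \<preceq> c"
  unfolding le_iff by (metis pl_assoc Dpl)

lemma le_antisym: assumes "a \<preceq> b" "b \<preceq> a" "a \<in> D" "b \<in> D" shows "a = b"
proof -
  obtain c d where "c \<in> D" "b = a \<oplus> c" "d \<in> D" "a = b \<oplus> d" using assms by (meson leE)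
  then have "a \<oplus> (c \<oplus> d) = a \<oplus> \<zero>" using assms(3,4) by (metis pl_assoc pl_0)
  then have "c \<oplus> d = \<zero>"
    using \<open>c \<in> D\<close> \<open>d \<in> D\<close> assms(3) pl_cancel_l[of "c \<oplus> d" "\<zero>" a] by simp
  then show ?thesis using \<open>c \<in> D\<close> \<open>d \<in> D\<close> \<open>b = a \<oplus> c\<close> assms(3) by (simp add: pl_eq0)
qed

lemma lt_irrefl [simp]: "a \<in> D \<Longrightarrow> \<not> a \<prec> a"
proof
  assume a: "a \<in> D" and "a \<prec> a"
  then obtain c where "c \<in> D" "a \<oplus> \<S> c = a \<oplus> \<zero>" by (auto simp: lt_iff)
  then have "\<S> c = \<zero>" using a pl_cancel_l[of "\<S> c" "\<zero>" a] by simp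
  then show False using \<open>c \<in> D\<close> S_nz by auto
qed

lemma lt_le_trans: "a \<prec> b \<Longrightarrow> b \<preceq> c \<Longrightarrow> a \<in> D \<Longrightarrow> b \<in> D \<Longrightarrow> c \<in> D \<Longrightarrow> a \<prec> c"
  using le_trans[of "\<S> a" b c] by (simp add: lt_le)

lemma le_lt_trans: "a \<preceq> b \<Longrightarrow> b \<prec> c \<Longrightarrow> a \<in> D \<Longrightarrow> b \<in> D \<Longrightarrow> c \<in> D \<Longrightarrow> a \<prec> c"
  unfolding le_def using lt_le_trans[of a b c] le_def by auto

lemma lt_trans: "a \<prec> b \<Longrightarrow> b \<prec> c \<Longrightarrow> a \<in> D \<Longrightarrow> b \<in> D \<Longrightarrow> c \<in> D \<Longrightarrow> a \<prec> c"
  using lt_le_trans[of a b c] le_def by auto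

lemma lt_imp_le: "a \<prec> b \<Longrightarrow> a \<preceq> b" by (simp add: le_def)

lemma not_lt0 [simp]: "a \<in> D \<Longrightarrow> \<not> a \<prec> \<zero>"
  using lt_iff[of a "\<zero>"] by (auto simp: pl_S S_nz)

lemma le0 [simp]: "a \<in> D \<Longrightarrow> \<zero> \<preceq> a" by (auto simp: le_iff)
lemma le_0 [simp]: "a \<in> D \<Longrightarrow> a \<preceq> \<zero> \<longleftrightarrow> a = \<zero>" by (auto simp: le_def)
lemma S_le_S [simp]: "a \<in> D \<Longrightarrow> b \<in> D \<Longrightarrow> \<S> a \<preceq> \<S> b \<longleftrightarrow> a \<preceq> b"
  using lt_le[of a "\<S> b"] by simp

lemma linear: assumes "a \<in> D" "b \<in> D" shows "a \<prec> b \<or> a = b \<or> b \<prec> a"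
proof (rule ind[of "\<lambda>b. a \<prec> b \<or> a = b \<or> b \<prec> a"])
  show "a \<prec> \<zero> \<or> a = \<zero> \<or> \<zero> \<prec> a" using le0[OF assms(1)] by (auto simp: le_def)
  fix b assume b: "b \<in> D" "a \<prec> b \<or> a = b \<or> b \<prec> a"
  then show "a \<prec> \<S> b \<or> a = \<S> b \<or> \<S> b \<prec> a"
    using assms lt_le[of b a] by (auto simp: le_def)
qed (intro cintro, use assms in auto)

lemma not_lt [simp]: "a \<in> D \<Longrightarrow> b \<in> D \<Longrightarrow> \<not> a \<prec> b \<longleftrightarrow> b \<preceq> a"
  using linear[of a b] lt_le_trans[of a b a] by (auto simp: le_def dest: lt_trans)

lemma not_le [simp]: "a \<in> D \<Longrightarrow> b \<in> D \<Longrightarrow> \<not> a \<preceq> b \<longleftrightarrow> b \<prec> a"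
  using not_lt[of b a] by blast

lemma le_pl1 [simp]: "a \<in> D \<Longrightarrow> b \<in> D \<Longrightarrow> a \<preceq> a \<oplus> b" by (auto simp: le_iff)
lemma le_pl2 [simp]: "a \<in> D \<Longrightarrow> b \<in> D \<Longrightarrow> b \<preceq> a \<oplus> b" using le_pl1[of b a] by (simp add: pl_comm)

lemma pl_mono: assumes "a \<preceq> b" "c \<preceq> d" "a \<in> D" "b \<in> D" "c \<in> D" "d \<in> D" shows "a \<oplus> c \<preceq> b \<oplus> d"
proof -
  obtain x y where "x \<in> D" "y \<in> D" "b = a \<oplus> x" "d = c \<oplus> y" using assms by (meson leE)
  then have "b \<oplus> d = (a \<oplus> c) \<oplus> (x \<oplus> y)" using assms by (simp add: ring)
  then show ?thesis using \<open>x \<in> D\<close> \<open>y \<in> D\<close> assms by simp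
qed

lemma tm_mono: assumes "a \<preceq> b" "c \<preceq> d" "a \<in> D" "b \<in> D" "c \<in> D" "d \<in> D" shows "a \<otimes> c \<preceq> b \<otimes> d"
proof -
  obtain x y where "x \<in> D" "y \<in> D" "b = a \<oplus> x" "d = c \<oplus> y" using assms by (meson leE)
  then have "b \<otimes> d = (a \<otimes> c) \<oplus> (a \<otimes> y \<oplus> x \<otimes> c \<oplus> x \<otimes> y)" using assms by (simp add: ring)
  then show ?thesis using \<open>x \<in> D\<close> \<open>y \<in> D\<close> assms by simp
qed

lemma pl_lt_mono: "a \<prec> b \<Longrightarrow> c \<preceq> d \<Longrightarrow> a \<in> D \<Longrightarrow> b \<in> D \<Longrightarrow> c \<in> D \<Longrightarrow> d \<in> D \<Longrightarrow> a \<oplus> c \<prec> b \<oplus> d"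
  using pl_mono[of "\<S> a" b c d] by (simp add: lt_le pl_Sl)

lemma tm_le: "a \<in> D \<Longrightarrow> b \<in> D \<Longrightarrow> b \<noteq> \<zero> \<Longrightarrow> a \<preceq> a \<otimes> b"
  by (cases rule: cases0[of b]) (auto simp: tm_S)

section \<open>Least number principle and collection\<close>

lemma sind:
  assumes P: "Df (\<lambda>e. P (e 0))" and s: "\<And>a. a \<in> D \<Longrightarrow> (\<And>b. b \<in> D \<Longrightarrow> b \<prec> a \<Longrightarrow> P b) \<Longrightarrow> P a" and a: "a \<in> D"
  shows "P a"
proof -
  have P': "Df (\<lambda>e. P (e 0))" by (rule P)
  have "\<forall>b\<in>D. b \<prec> a \<longrightarrow> P b"
  proof (rule ind[of "\<lambda>a. \<forall>b\<in>D. b \<prec> a \<longrightarrow> P b"])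
    show "Df (\<lambda>e. \<forall>b\<in>D. b \<prec> e 0 \<longrightarrow> P b)"
      by (intro Df_all Df.c_imp cintro Df.c_r1[OF P'])
    fix b assume b: "b \<in> D" "\<forall>c\<in>D. c \<prec> b \<longrightarrow> P c"
    then have "P b" using s by blast
    then show "\<forall>c\<in>D. c \<prec> \<S> b \<longrightarrow> P c" using b by (auto simp: le_def)
  qed (use a in auto)
  then show ?thesis using s a by blast
qed

lemma LNP:
  assumes P: "Df (\<lambda>e. P (e 0))" and a: "a \<in> D" "P a"
  shows "\<exists>b\<in>D. P b \<and> (\<forall>c\<in>D. c \<prec> b \<longrightarrow> \<not> P c)"
proof (rule ccontr)
  assume n: "\<not> ?thesis"
  have "\<not> P a"
    by (rule sind[of "\<lambda>a. \<not> P a", OF Df.c_not[OF P]]) (use n a in auto)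
  then show False using a by simp
qed

text \<open>Induction on the initial segment \<open>b'\<close> of \<open>b\<close> that is already
  bounded. The old bound plus the successor of the new witness serves for the next step.\<close>

lemma collection:
  assumes R: "Df (\<lambda>e. R (e 0) (e 1))" and b: "b \<in> D" and ex: "\<And>i. i \<in> D \<Longrightarrow> i \<prec> b \<Longrightarrow> \<exists>z\<in>D. R i z"
  shows "\<exists>B\<in>D. \<forall>i\<in>D. i \<prec> b \<longrightarrow> (\<exists>z\<in>D. z \<prec> B \<and> R i z)"
proof -
  have "b' \<preceq> b \<longrightarrow> (\<exists>B\<in>D. \<forall>i\<in>D. i \<prec> b' \<longrightarrow> (\<exists>z\<in>D. z \<prec> B \<and> R i z))" if "b' \<in> D" for b'
  proof (rule ind[of "\<lambda>b'. b' \<preceq> b \<longrightarrow> (\<exists>B\<in>D. \<forall>i\<in>D. i \<prec> b' \<longrightarrow> (\<exists>z\<in>D. z \<prec> B \<and> R i z))"])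
    show "Df (\<lambda>e. e 0 \<preceq> b \<longrightarrow> (\<exists>B\<in>D. \<forall>i\<in>D. i \<prec> e 0 \<longrightarrow> (\<exists>z\<in>D. z \<prec> B \<and> R i z)))"
      unfolding le_def using b by (intro cintro Df.c_r2[OF R])
    fix c assume c: "c \<in> D" "c \<preceq> b \<longrightarrow> (\<exists>B\<in>D. \<forall>i\<in>D. i \<prec> c \<longrightarrow> (\<exists>z\<in>D. z \<prec> B \<and> R i z))"
    show "\<S> c \<preceq> b \<longrightarrow> (\<exists>B\<in>D. \<forall>i\<in>D. i \<prec> \<S> c \<longrightarrow> (\<exists>z\<in>D. z \<prec> B \<and> R i z))"
    proof
      assume "\<S> c \<preceq> b"
      then have cb: "c \<prec> b" using c b by (simp add: lt_le)
      then obtain B where B: "B \<in> D" "\<forall>i\<in>D. i \<prec> c \<longrightarrow> (\<exists>z\<in>D. z \<prec> B \<and> R i z)"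
        using c lt_imp_le by blast
      obtain z where z: "z \<in> D" "R c z" using ex c(1) cb by blast
      have "\<exists>z'\<in>D. z' \<prec> B \<oplus> \<S> z \<and> R i z'" if "i \<in> D" "i \<prec> \<S> c" for i
      proof (cases "i = c")
        case True
        have "z \<prec> B \<oplus> \<S> z" using B z by (simp add: pl_S)
        then show ?thesis using z True by blast
      next
        case False
        moreover have "i \<preceq> c" using that c(1) by simp
        ultimately have "i \<prec> c" by (simp add: le_def)
        then obtain z' where "z' \<in> D" "z' \<prec> B" "R i z'" using \<open>i \<in> D\<close> B(2) by blast
        moreover have "z' \<prec> B \<oplus> \<S> z" using lt_le_trans[of z' B "B \<oplus> \<S> z"] calculation B z by simp
        ultimately show ?thesis by blast
      qed
      then show "\<exists>B\<in>D. \<forall>i\<in>D. i \<prec> \<S> c \<longrightarrow> (\<exists>z\<in>D. z \<prec> B \<and> R i z)"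
        using B z by (intro bexI[of _ "B \<oplus> \<S> z"]) auto
    qed
  qed (use that in auto)
  from this[OF b] show ?thesis by simp
qed

end

context calc begin
lemma c_le [cintro]: "Fn f \<Longrightarrow> Fn g \<Longrightarrow> C (\<lambda>e. f e \<preceq> g e)"
  unfolding le_def by (intro cintro)

lemma c_bex_le [cintro]:
  assumes "Fn f" "C (\<lambda>e. R (e 0) (\<lambda>i. e (Suc i)))" shows "C (\<lambda>e. \<exists>a\<in>D. a \<preceq> f e \<and> R a e)"
  by (rule c_cong[OF c_bex[OF Fn_S[OF assms(1)] assms(2)]]) (auto simp: FnD[OF assms(1)])

lemma c_ball_le [cintro]:
  assumes "Fn f" "C (\<lambda>e. R (e 0) (\<lambda>i. e (Suc i)))" shows "C (\<lambda>e. \<forall>a\<in>D. a \<preceq> f e \<longrightarrow> R a e)"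
  by (rule c_cong[OF c_ball[OF Fn_S[OF assms(1)] assms(2)]]) (auto simp: FnD[OF assms(1)])
end

subsection \<open>Coding of pairs, finite sets and finite sequences\<close>

context pa begin

section \<open>Least elements and pairing\<close>

definition lst :: "('a \<Rightarrow> bool) \<Rightarrow> 'a" where
  "lst P = (THE a. a \<in> D \<and> P a \<and> (\<forall>b\<in>D. b \<prec> a \<longrightarrow> \<not> P b))"

lemma lst_eq: assumes "a \<in> D" "P a" "\<And>b. b \<in> D \<Longrightarrow> b \<prec> a \<Longrightarrow> \<not> P b" shows "lst P = a"
  unfolding lst_def by (rule the_equality) (use assms linear in blast)+

lemma lst:
  assumes "Df (\<lambda>e. P (e 0))" "a \<in> D" "P a"
  shows "lst P \<in> D" "P (lst P)" "b \<in> D \<Longrightarrow> b \<prec> lst P \<Longrightarrow> \<not> P b" "b \<in> D \<Longrightarrow> P b \<Longrightarrow> lst P \<preceq> b"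
proof -
  obtain c where c: "c \<in> D" "P c" "\<And>b. b \<in> D \<Longrightarrow> b \<prec> c \<Longrightarrow> \<not> P b" using LNP[OF assms] by blast
  have "lst P = c" using c by (rule lst_eq)
  with c show "lst P \<in> D" "P (lst P)" "b \<in> D \<Longrightarrow> b \<prec> lst P \<Longrightarrow> \<not> P b" "b \<in> D \<Longrightarrow> P b \<Longrightarrow> lst P \<preceq> b"
    by auto (metis not_lt)
qed

text \<open>The square of a sum plus its first summand lies below the next square, which gives
  injectivity. The outer successor puts a pair strictly above both components, so quantifiers over
  components can be bounded by the pair.\<close>

definition pr :: "'a \<Rightarrow> 'a \<Rightarrow> 'a" where "pr a b = \<S> ((a \<oplus> b) \<otimes> (a \<oplus> b) \<oplus> a)"

lemma pr_D [simp]: "a \<in> D \<Longrightarrow> b \<in> D \<Longrightarrow> pr a b \<in> D" by (simp add: pr_def)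

lemma sq_lt:
  assumes "s \<prec> s'" "a \<preceq> s" "s \<in> D" "s' \<in> D" "a \<in> D" "c \<in> D"
  shows "s \<otimes> s \<oplus> a \<prec> s' \<otimes> s' \<oplus> c"
proof -
  obtain d where d: "d \<in> D" "s = a \<oplus> d" using assms by (meson leE)
  have "\<S> s \<otimes> \<S> s = \<S> (s \<otimes> s \<oplus> a) \<oplus> (d \<oplus> s)" using assms d by (simp add: ring)
  then have "\<S> (s \<otimes> s \<oplus> a) \<preceq> \<S> s \<otimes> \<S> s" using assms d by simp
  moreover have "\<S> s \<otimes> \<S> s \<preceq> s' \<otimes> s'" using assms by (intro tm_mono) (auto simp: lt_le)
  moreover have "s' \<otimes> s' \<preceq> s' \<otimes> s' \<oplus> c" using assms by simp
  ultimately have "\<S> (s \<otimes> s \<oplus> a) \<preceq> s' \<otimes> s' \<oplus> c" using assms by (meson le_trans Dtm Dpl DS)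
  then show ?thesis using assms by (simp add: lt_le)
qed

lemma pr_inj: 
  assumes "pr a b = pr c d" "a \<in> D" "b \<in> D" "c \<in> D" "d \<in> D" shows "a = c \<and> b = d"
proof -
  have eq: "(a \<oplus> b) \<otimes> (a \<oplus> b) \<oplus> a = (c \<oplus> d) \<otimes> (c \<oplus> d) \<oplus> c" using assms by (simp add: pr_def)
  have "\<not> a \<oplus> b \<prec> c \<oplus> d"
    using sq_lt[of "a \<oplus> b" "c \<oplus> d" a c] assms(2-) eq lt_irrefl[of "(c \<oplus> d) \<otimes> (c \<oplus> d) \<oplus> c"]
    by (metis Dpl Dtm le_pl1)
  moreover have "\<not> c \<oplus> d \<prec> a \<oplus> b"
    using sq_lt[of "c \<oplus> d" "a \<oplus> b" c a] assms(2-) eq lt_irrefl[of "(c \<oplus> d) \<otimes> (c \<oplus> d) \<oplus> c"]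
    by (metis Dpl Dtm le_pl1)
  ultimately have s: "a \<oplus> b = c \<oplus> d" using assms le_antisym[of "a \<oplus> b" "c \<oplus> d"] by auto
  then have "a = c" using eq assms pl_cancel_l[of a c "(c \<oplus> d) \<otimes> (c \<oplus> d)"] by simp
  with s show ?thesis using assms pl_cancel_l by auto
qed

lemma pr_inj' [simp]:
  "a \<in> D \<Longrightarrow> b \<in> D \<Longrightarrow> c \<in> D \<Longrightarrow> d \<in> D \<Longrightarrow> pr a b = pr c d \<longleftrightarrow> a = c \<and> b = d"
  using pr_inj by blast

lemma pr_gt1 [simp]: assumes "a \<in> D" "b \<in> D" shows "a \<prec> pr a b"
  using assms by (simp add: pr_def)

lemma sq_ge: "a \<in> D \<Longrightarrow> a \<preceq> a \<otimes> a"
  by (cases "a = \<zero>") (auto intro: tm_le)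

lemma pr_gt2 [simp]: assumes "a \<in> D" "b \<in> D" shows "b \<prec> pr a b"
proof -
  have "b \<preceq> a \<oplus> b" "a \<oplus> b \<preceq> (a \<oplus> b) \<otimes> (a \<oplus> b)" 
    "(a \<oplus> b) \<otimes> (a \<oplus> b) \<preceq> (a \<oplus> b) \<otimes> (a \<oplus> b) \<oplus> a" using assms sq_ge by auto
  then have "b \<preceq> (a \<oplus> b) \<otimes> (a \<oplus> b) \<oplus> a" using assms by (meson le_trans Dpl Dtm)
  then show ?thesis using assms by (simp add: pr_def)
qed

lemma pr_mono: assumes "a \<preceq> c" "b \<preceq> d" "a \<in> D" "b \<in> D" "c \<in> D" "d \<in> D" shows "pr a b \<preceq> pr c d"
  unfolding pr_def using assms by (simp add: pl_mono tm_mono)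

definition fs :: "'a \<Rightarrow> 'a" where "fs z = (if \<exists>a\<in>D. \<exists>b\<in>D. z = pr a b then THE a. a \<in> D \<and> (\<exists>b\<in>D. z = pr a b) else \<zero>)"
definition sn :: "'a \<Rightarrow> 'a" where "sn z = (if \<exists>a\<in>D. \<exists>b\<in>D. z = pr a b then THE b. b \<in> D \<and> (\<exists>a\<in>D. z = pr a b) else \<zero>)"

lemma fs_pr [simp]: "a \<in> D \<Longrightarrow> b \<in> D \<Longrightarrow> fs (pr a b) = a"
  unfolding fs_def by (auto intro!: the_equality)
lemma sn_pr [simp]: "a \<in> D \<Longrightarrow> b \<in> D \<Longrightarrow> sn (pr a b) = b"
  unfolding sn_def by (auto intro!: the_equality)

lemma pr_cases: assumes "z \<in> D" obtains (pr) a b where "a \<in> D" "b \<in> D" "z = pr a b" 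
  | (n) "\<not> (\<exists>a\<in>D. \<exists>b\<in>D. z = pr a b)" "fs z = \<zero>" "sn z = \<zero>"
  using that by (auto simp: fs_def sn_def)

lemma fs_D [simp]: "z \<in> D \<Longrightarrow> fs z \<in> D" by (cases z rule: pr_cases) auto
lemma sn_D [simp]: "z \<in> D \<Longrightarrow> sn z \<in> D" by (cases z rule: pr_cases) auto
lemma fs_le: "z \<in> D \<Longrightarrow> fs z \<preceq> z" by (cases z rule: pr_cases) (auto simp: lt_imp_le)
lemma sn_le: "z \<in> D \<Longrightarrow> sn z \<preceq> z" by (cases z rule: pr_cases) (auto simp: lt_imp_le)

section \<open>Divisibility and coded sets\<close>

definition dv :: "'a \<Rightarrow> 'a \<Rightarrow> bool" where "dv a b \<longleftrightarrow> (\<exists>c\<in>D. c \<preceq> b \<and> a \<otimes> c = b)"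

text \<open>The bound on the quotient, which keeps \<open>dv\<close> a bounded predicate, costs
  nothing: if \<open>a\<close> is nonzero the quotient is at most \<open>b\<close>, and for
  \<open>a = \<zero>\<close> the quotient zero serves.\<close>

lemma dvI: assumes "a \<in> D" "c \<in> D" "a \<otimes> c = b" shows "dv a b"
proof (cases "a = \<zero>")
  case True then show ?thesis using assms unfolding dv_def by (intro bexI[of _ "\<zero>"]) auto
next
  case False
  then have "c \<preceq> b" using tm_le[of c a] assms tm_comm by auto
  then show ?thesis using assms unfolding dv_def by auto
qed

lemma dvE: assumes "dv a b" obtains c where "c \<in> D" "a \<otimes> c = b" using assms by (auto simp: dv_def)

text \<open>There is no subtraction, so the proof compares the two quotients. If the quotient of
  \<open>x\<close> is the larger one, then \<open>y\<close> is zero.\<close>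

lemma dv_diff: assumes "dv p (x \<oplus> y)" "dv p x" "p \<in> D" "x \<in> D" "y \<in> D" shows "dv p y"
proof -
  obtain c d where c: "c \<in> D" "p \<otimes> c = x \<oplus> y" and d: "d \<in> D" "p \<otimes> d = x" using assms by (meson dvE)
  show ?thesis
  proof (cases "d \<preceq> c")
    case True
    then obtain f where f: "f \<in> D" "c = d \<oplus> f" using c d by (meson leE)
    then have "x \<oplus> p \<otimes> f = x \<oplus> y" using c d assms by (simp add: tm_dl)
    then show ?thesis using assms f pl_cancel_l[of "p \<otimes> f" y x] by (auto intro: dvI)
  next
    case False
    then have "c \<preceq> d" using c d by (simp add: lt_imp_le)
    then obtain f where f: "f \<in> D" "d = c \<oplus> f" using c d by (meson leE)
    then have "x = p \<otimes> c \<oplus> p \<otimes> f" using d c(1) assms by (simp add: tm_dl[symmetric])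
    then have "x = x \<oplus> y \<oplus> p \<otimes> f" using c by simp
    then have "x \<oplus> \<zero> = x \<oplus> (y \<oplus> p \<otimes> f)" using assms f by (simp add: pl_assoc)
    then have "y \<oplus> p \<otimes> f = \<zero>" using assms f pl_cancel_l[of "\<zero>" "y \<oplus> p \<otimes> f" x] by simp
    then have "y = \<zero>" using assms f by (simp add: pl_eq0)
    then show ?thesis using assms by (auto intro: dvI[of _ "\<zero>"])
  qed
qed

lemma dv_mult: assumes "dv p x" "p \<in> D" "x \<in> D" "y \<in> D" shows "dv p (x \<otimes> y)"
proof -
  obtain c where "c \<in> D" "p \<otimes> c = x" using assms by (meson dvE)
  then show ?thesis using assms by (intro dvI[of _ "c \<otimes> y"]) (auto simp: tm_assoc[symmetric])
qed

text \<open>The moduli of Goedel's beta function.\<close>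

definition qq :: "'a \<Rightarrow> 'a \<Rightarrow> 'a" where "qq v z = \<S> (\<S> z \<otimes> v)"
lemma qq_D [simp]: "v \<in> D \<Longrightarrow> z \<in> D \<Longrightarrow> qq v z \<in> D" by (simp add: qq_def)

text \<open>Coprimality of two moduli, put as cancellation so that no primes are needed. With
  \<open>d\<close> the difference of \<open>z'\<close> and \<open>z\<close>, the identity
  \<open>id\<close> shows that the modulus divides \<open>u \<otimes> d\<close>. As \<open>d\<close>
  divides \<open>v\<close>, it divides \<open>u \<otimes> v\<close>; being one more than a multiple
  of \<open>v\<close>, it then divides \<open>u\<close>.\<close>

lemma qq_coprime:
  assumes D: "z \<in> D" "z' \<in> D" "v \<in> D" "u \<in> D" and "z \<prec> z'"
    and dv: "\<And>d. d \<in> D \<Longrightarrow> d \<noteq> \<zero> \<Longrightarrow> d \<preceq> z' \<Longrightarrow> dv d v"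
  shows "dv (qq v z) (u \<otimes> qq v z') \<Longrightarrow> dv (qq v z) u"
    and "dv (qq v z') (u \<otimes> qq v z) \<Longrightarrow> dv (qq v z') u"
proof -
  let ?p = "qq v z" and ?p' = "qq v z'"
  obtain d0 where d0: "d0 \<in> D" "z' = z \<oplus> \<S> d0" using assms by (metis lt_iff)
  define d where "d = \<S> d0"
  have d: "d \<in> D" "z' = z \<oplus> d" "d \<noteq> \<zero>" using d0 S_nz by (auto simp: d_def)
  then have "d \<preceq> z'" using D by simp
  then have "dv d v" using dv d by auto
  then obtain w where w: "w \<in> D" "d \<otimes> w = v" by (meson dvE)
  have id: "\<S> z' \<otimes> ?p = \<S> z \<otimes> ?p' \<oplus> d" using D d by (simp add: qq_def ring)
  have last: "dv q u" if q: "q = \<S> (\<S> y \<otimes> v)" "dv q (u \<otimes> d)" "y \<in> D" for q y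
  proof -
    have qD: "q \<in> D" using q D by simp
    have "dv q (u \<otimes> d \<otimes> w)" using dv_mult[of q "u \<otimes> d" w] q(2) qD D d(1) w(1) by simp
    then have "dv q (u \<otimes> v)" using D d w by (simp add: tm_assoc)
    then have "dv q (u \<otimes> v \<otimes> \<S> y)" using dv_mult[of q "u \<otimes> v" "\<S> y"] q(3) D qD by simp
    moreover have "u \<otimes> v \<otimes> \<S> y \<oplus> u = q \<otimes> u" unfolding q(1) using D q(3) by (simp add: ring)
    then have "dv q (u \<otimes> v \<otimes> \<S> y \<oplus> u)" using qD D by (auto intro: dvI)
    ultimately show ?thesis using dv_diff[of q "u \<otimes> v \<otimes> \<S> y" u] qD D q(3) by simp
  qed
  have eq: "(u \<otimes> ?p) \<otimes> \<S> z' = (u \<otimes> ?p') \<otimes> \<S> z \<oplus> u \<otimes> d"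
  proof -
    have "(u \<otimes> ?p) \<otimes> \<S> z' = u \<otimes> (\<S> z' \<otimes> ?p)" using D by (simp only: tm_assoc tm_comm[of ?p] qq_D DS)
    also have "\<dots> = u \<otimes> (\<S> z \<otimes> ?p') \<oplus> u \<otimes> d" unfolding id using D d by (simp only: tm_dl qq_D DS Dtm)
    also have "u \<otimes> (\<S> z \<otimes> ?p') = (u \<otimes> ?p') \<otimes> \<S> z" using D by (simp only: tm_assoc tm_comm[of ?p'] qq_D DS)
    finally show ?thesis .
  qed
  show "dv ?p u" if "dv ?p (u \<otimes> ?p')"
  proof (rule last[OF qq_def _ D(1)])
    have "dv ?p (u \<otimes> ?p' \<otimes> \<S> z)" using that D dv_mult[of ?p "u \<otimes> ?p'" "\<S> z"] by simp
    moreover have "(u \<otimes> ?p) \<otimes> \<S> z' = ?p \<otimes> (u \<otimes> \<S> z')"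
      using D by (simp only: tm_assoc tm_comm[of u ?p] qq_D DS)
    then have "dv ?p ((u \<otimes> ?p') \<otimes> \<S> z \<oplus> u \<otimes> d)" unfolding eq[symmetric] using D by (metis dvI qq_D DS Dtm)
    ultimately show "dv ?p (u \<otimes> d)" using dv_diff[of ?p "u \<otimes> ?p' \<otimes> \<S> z" "u \<otimes> d"] D d by simp
  qed
  show "dv ?p' u" if "dv ?p' (u \<otimes> ?p)"
  proof (rule last[OF qq_def _ D(2)])
    have "dv ?p' (u \<otimes> ?p \<otimes> \<S> z')" using that D dv_mult[of ?p' "u \<otimes> ?p" "\<S> z'"] by simp
    then have 1: "dv ?p' ((u \<otimes> ?p') \<otimes> \<S> z \<oplus> u \<otimes> d)" unfolding eq .
    have "(u \<otimes> ?p') \<otimes> \<S> z = ?p' \<otimes> (u \<otimes> \<S> z)"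
      using D by (simp only: tm_assoc tm_comm[of u ?p'] qq_D DS)
    then have "dv ?p' ((u \<otimes> ?p') \<otimes> \<S> z)" using D by (metis dvI qq_D DS Dtm)
    with 1 show "dv ?p' (u \<otimes> d)" using dv_diff[of ?p' "u \<otimes> ?p' \<otimes> \<S> z" "u \<otimes> d"] D d by simp
  qed
qed

end

context calc begin
lemma c_dv [cintro]: "Fn f \<Longrightarrow> Fn g \<Longrightarrow> C (\<lambda>e. dv (f e) (g e))"
proof (rule c_r2[of dv])
  show "C (\<lambda>e. dv (e 0) (e 1))" unfolding dv_def by (intro cintro)
qed
lemma Fn_pr [cintro]: "Fn f \<Longrightarrow> Fn g \<Longrightarrow> Fn (\<lambda>e. pr (f e) (g e))"
  unfolding pr_def by (intro cintro)
lemma Fn_fs [cintro]: "Fn f \<Longrightarrow> Fn (\<lambda>e. fs (f e))"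
proof (rule Fn_f1[of fs])
  have "C (\<lambda>e. (\<exists>b\<in>D. b \<prec> e 1 \<and> e 1 = pr (e 0) b) \<or> e 0 = \<zero> \<and> \<not> (\<exists>a\<in>D. a \<prec> e 1 \<and> (\<exists>b\<in>D. b \<prec> e 1 \<and> e 1 = pr a b)))"
    by (intro cintro)
  then have "C (\<lambda>e. e 0 = fs (e 1))"
  proof (rule c_cong)
    fix e assume e: "e \<in> asg"
    then have "e 0 \<in> D" "e 1 \<in> D" by (auto simp: asgD)
    then show "((\<exists>b\<in>D. b \<prec> e 1 \<and> e 1 = pr (e 0) b) \<or> e 0 = \<zero> \<and> \<not> (\<exists>a\<in>D. a \<prec> e 1 \<and> (\<exists>b\<in>D. b \<prec> e 1 \<and> e 1 = pr a b)))
      \<longleftrightarrow> e 0 = fs (e 1)" by (cases rule: pr_cases[OF \<open>e 1 \<in> D\<close>]) auto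
  qed
  then show "Fn (\<lambda>e. fs (e 0))" unfolding Fn_def by (simp add: asgD)
qed
lemma Fn_sn [cintro]: "Fn f \<Longrightarrow> Fn (\<lambda>e. sn (f e))"
proof (rule Fn_f1[of sn])
  have "C (\<lambda>e. (\<exists>b\<in>D. b \<prec> e 1 \<and> e 1 = pr b (e 0)) \<or> e 0 = \<zero> \<and> \<not> (\<exists>a\<in>D. a \<prec> e 1 \<and> (\<exists>b\<in>D. b \<prec> e 1 \<and> e 1 = pr a b)))"
    by (intro cintro)
  then have "C (\<lambda>e. e 0 = sn (e 1))"
  proof (rule c_cong)
    fix e assume e: "e \<in> asg"
    then have "e 0 \<in> D" "e 1 \<in> D" by (auto simp: asgD)
    then show "((\<exists>b\<in>D. b \<prec> e 1 \<and> e 1 = pr b (e 0)) \<or> e 0 = \<zero> \<and> \<not> (\<exists>a\<in>D. a \<prec> e 1 \<and> (\<exists>b\<in>D. b \<prec> e 1 \<and> e 1 = pr a b)))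
      \<longleftrightarrow> e 0 = sn (e 1)" by (cases rule: pr_cases[OF \<open>e 1 \<in> D\<close>]) auto
  qed
  then show "Fn (\<lambda>e. sn (e 0))" unfolding Fn_def by (simp add: asgD)
qed
lemma Fn_qq [cintro]: "Fn f \<Longrightarrow> Fn g \<Longrightarrow> Fn (\<lambda>e. qq (f e) (g e))"
  unfolding qq_def by (intro cintro)
end

context pa begin

text \<open>A stand-in for the factorial of \<open>b\<close>. As the base \<open>v\<close> of the
  moduli it makes all moduli \<open>qq v z\<close> with \<open>z \<prec> b\<close> coprime to each
  other.\<close>

lemma common_multiple:
  assumes b: "b \<in> D"
  shows "\<exists>v\<in>D. v \<noteq> \<zero> \<and> (\<forall>d\<in>D. d \<noteq> \<zero> \<longrightarrow> d \<preceq> b \<longrightarrow> dv d v)"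
proof (rule ind[of "\<lambda>b. \<exists>v\<in>D. v \<noteq> \<zero> \<and> (\<forall>d\<in>D. d \<noteq> \<zero> \<longrightarrow> d \<preceq> b \<longrightarrow> dv d v)"])
  show "\<exists>v\<in>D. v \<noteq> \<zero> \<and> (\<forall>d\<in>D. d \<noteq> \<zero> \<longrightarrow> d \<preceq> \<zero> \<longrightarrow> dv d v)"
    by (intro bexI[of _ "\<S> \<zero>"]) (auto simp: S_nz)
  fix b assume b: "b \<in> D" "\<exists>v\<in>D. v \<noteq> \<zero> \<and> (\<forall>d\<in>D. d \<noteq> \<zero> \<longrightarrow> d \<preceq> b \<longrightarrow> dv d v)"
  then obtain v where v: "v \<in> D" "v \<noteq> \<zero>" "\<And>d. d \<in> D \<Longrightarrow> d \<noteq> \<zero> \<Longrightarrow> d \<preceq> b \<Longrightarrow> dv d v" by auto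
  have "dv d (v \<otimes> \<S> b)" if d: "d \<in> D" "d \<noteq> \<zero>" "d \<preceq> \<S> b" for d
  proof (cases "d = \<S> b")
    case True then show ?thesis using v b by (intro dvI[of _ v]) (auto simp: tm_comm)
  next
    case False
    then have "d \<preceq> b" using d b by (simp add: le_def[of d "\<S> b"])
    then show ?thesis using v d b by (intro dv_mult) auto
  qed
  moreover have "v \<otimes> \<S> b \<noteq> \<zero>" using v b by (simp add: tm_S pl_eq0)
  ultimately show "\<exists>v\<in>D. v \<noteq> \<zero> \<and> (\<forall>d\<in>D. d \<noteq> \<zero> \<longrightarrow> d \<preceq> \<S> b \<longrightarrow> dv d v)"
    using v b by (intro bexI[of _ "v \<otimes> \<S> b"]) auto
qed (intro cintro, use b in auto)

text \<open>\<open>s\<close> codes a bound, a number \<open>u\<close> and a base \<open>v\<close>;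
  the elements are the numbers below the bound whose modulus divides \<open>u\<close>. Every number
  codes some set in this way.\<close>

definition Mem :: "'a \<Rightarrow> 'a \<Rightarrow> bool" where
  "Mem z s \<longleftrightarrow> z \<prec> fs s \<and> dv (qq (sn (sn s)) z) (fs (sn s))"

lemma Mem_lt: "Mem z s \<Longrightarrow> z \<in> D \<Longrightarrow> s \<in> D \<Longrightarrow> z \<prec> s"
  unfolding Mem_def using lt_le_trans[of z "fs s" s] fs_le by auto

text \<open>\<open>u\<close> is the product of the moduli of the wanted elements, built by induction
  on \<open>k\<close>. By \<open>qq_coprime\<close>, multiplying by one modulus does not change
  divisibility by the others.\<close>

lemma comprehension:
  assumes P: "Df (\<lambda>e. P (e 0))" and b: "b \<in> D"
  shows "\<exists>s\<in>D. \<forall>z\<in>D. Mem z s \<longleftrightarrow> z \<prec> b \<and> P z"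
proof -
  obtain v where v: "v \<in> D" "v \<noteq> \<zero>" "\<And>d. d \<in> D \<Longrightarrow> d \<noteq> \<zero> \<Longrightarrow> d \<preceq> b \<Longrightarrow> dv d v"
    using common_multiple[OF b] by auto
  have "k \<preceq> b \<longrightarrow> (\<exists>u\<in>D. \<forall>z\<in>D. z \<prec> b \<longrightarrow> (dv (qq v z) u \<longleftrightarrow> z \<prec> k \<and> P z))" if "k \<in> D" for k
  proof (rule ind[of "\<lambda>k. k \<preceq> b \<longrightarrow> (\<exists>u\<in>D. \<forall>z\<in>D. z \<prec> b \<longrightarrow> (dv (qq v z) u \<longleftrightarrow> z \<prec> k \<and> P z))"])
    show "Df (\<lambda>e. e 0 \<preceq> b \<longrightarrow> (\<exists>u\<in>D. \<forall>z\<in>D. z \<prec> b \<longrightarrow> (dv (qq v z) u \<longleftrightarrow> z \<prec> e 0 \<and> P z)))"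
      using b v by (intro cintro Df.c_r1[OF P])
    \<comment> \<open>Each modulus exceeds one, so the empty product codes the empty set.\<close>
    have "\<not> dv (qq v z) (\<S> \<zero>)" if z: "z \<in> D" for z
    proof
      assume "dv (qq v z) (\<S> \<zero>)"
      then obtain c where c: "c \<in> D" "qq v z \<otimes> c = \<S> \<zero>" by (meson dvE)
      then have "c \<noteq> \<zero>" using z v S_nz[of "\<zero>"] by auto
      then have "qq v z \<preceq> \<S> \<zero>" using tm_le[of "qq v z" c] c z v by simp
      then have "\<S> z \<otimes> v = \<zero>" using z v by (simp add: qq_def)
      then show False using z v by (simp add: tm_Sl pl_eq0)
    qed
    then show "\<zero> \<preceq> b \<longrightarrow> (\<exists>u\<in>D. \<forall>z\<in>D. z \<prec> b \<longrightarrow> (dv (qq v z) u \<longleftrightarrow> z \<prec> \<zero> \<and> P z))"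
      by (intro impI bexI[of _ "\<S> \<zero>"]) auto
    fix k assume k: "k \<in> D" and IH: "k \<preceq> b \<longrightarrow> (\<exists>u\<in>D. \<forall>z\<in>D. z \<prec> b \<longrightarrow> (dv (qq v z) u \<longleftrightarrow> z \<prec> k \<and> P z))"
    show "\<S> k \<preceq> b \<longrightarrow> (\<exists>u\<in>D. \<forall>z\<in>D. z \<prec> b \<longrightarrow> (dv (qq v z) u \<longleftrightarrow> z \<prec> \<S> k \<and> P z))"
    proof
      assume Sk: "\<S> k \<preceq> b"
      then have kb: "k \<prec> b" using k b by (simp add: lt_le)
      then obtain u where u: "u \<in> D" "\<And>z. z \<in> D \<Longrightarrow> z \<prec> b \<Longrightarrow> dv (qq v z) u \<longleftrightarrow> z \<prec> k \<and> P z"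
        using IH lt_imp_le by blast
      have dv: "dv d v" if "d \<in> D" "d \<noteq> \<zero>" "d \<preceq> x" "x \<prec> b" "x \<in> D" for d x
        using v(3)[OF that(1,2)] le_lt_trans[of d x b] that b lt_imp_le by auto
      have 1: "dv (qq v z) (u \<otimes> qq v k) \<longleftrightarrow> dv (qq v z) u" if z: "z \<in> D" "z \<prec> b" "z \<noteq> k" for z
      proof
        assume a: "dv (qq v z) (u \<otimes> qq v k)"
        consider "z \<prec> k" | "k \<prec> z" using linear[of z k] z k by auto
        then show "dv (qq v z) u"
          using qq_coprime(1)[of z k v u, OF z(1) k v(1) u(1)] qq_coprime(2)[of k z v u, OF k z(1) v(1) u(1)]
            a dv z k kb by cases blast+
      next
        assume "dv (qq v z) u" then show "dv (qq v z) (u \<otimes> qq v k)" using z u v k by (intro dv_mult) auto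
      qed
      have 2: "dv (qq v k) (u \<otimes> qq v k)" using u v k by (intro dvI[of _ u]) (auto simp: tm_comm)
      have 3: "z \<prec> \<S> k \<longleftrightarrow> z \<prec> k \<or> z = k" if "z \<in> D" for z using that k by (auto simp: le_def)
      show "\<exists>u\<in>D. \<forall>z\<in>D. z \<prec> b \<longrightarrow> (dv (qq v z) u \<longleftrightarrow> z \<prec> \<S> k \<and> P z)"
      proof (cases "P k")
        case True
        have "dv (qq v z) (u \<otimes> qq v k) \<longleftrightarrow> z \<prec> \<S> k \<and> P z" if "z \<in> D" "z \<prec> b" for z
          using 1[OF that] 2 3 that u(2)[OF that] True by (cases "z = k") auto
        then show ?thesis using u v k by (intro bexI[of _ "u \<otimes> qq v k"]) auto
      next
        case False then show ?thesis using u 3 by (intro bexI[of _ u]) auto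
      qed
    qed
  qed (use that in auto)
  from this[OF b] obtain u where u: "u \<in> D" "\<And>z. z \<in> D \<Longrightarrow> z \<prec> b \<Longrightarrow> dv (qq v z) u \<longleftrightarrow> z \<prec> b \<and> P z" by auto
  have "Mem z (pr b (pr u v)) \<longleftrightarrow> z \<prec> b \<and> P z" if "z \<in> D" for z
    unfolding Mem_def using u(1,2) that b v(1) by auto
  then show ?thesis using b u(1) v(1) by (intro bexI[of _ "pr b (pr u v)"]) auto
qed

text \<open>Taking the least entry makes \<open>nth\<close> total even if \<open>s\<close> is not
  the graph of a function; missing entries read as zero.\<close>

definition nth :: "'a \<Rightarrow> 'a \<Rightarrow> 'a" where
  "nth s i = (if \<exists>v\<in>D. Mem (pr i v) s then lst (\<lambda>v. Mem (pr i v) s) else \<zero>)"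

end

context calc begin
lemma c_Mem [cintro]: "Fn f \<Longrightarrow> Fn g \<Longrightarrow> C (\<lambda>e. Mem (f e) (g e))"
  unfolding Mem_def by (intro cintro)
end

context pa begin

lemma nth_cases:
  assumes "s \<in> D" "i \<in> D"
  obtains (1) "nth s i \<in> D" "Mem (pr i (nth s i)) s" "\<And>w. w \<in> D \<Longrightarrow> w \<prec> nth s i \<Longrightarrow> \<not> Mem (pr i w) s"
  | (2) "nth s i = \<zero>" "\<And>v. v \<in> D \<Longrightarrow> \<not> Mem (pr i v) s"
proof (cases "\<exists>v\<in>D. Mem (pr i v) s")
  case True
  then obtain v where v: "v \<in> D" "Mem (pr i v) s" by auto
  have d: "Df (\<lambda>e. Mem (pr i (e 0)) s)" using assms by (intro cintro)
  show ?thesis using lst[OF d v] True by (intro that(1)) (auto simp: nth_def)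
next
  case False then show ?thesis by (intro that(2)) (auto simp: nth_def)
qed

lemma nth_D [simp]: "s \<in> D \<Longrightarrow> i \<in> D \<Longrightarrow> nth s i \<in> D"
  by (cases rule: nth_cases[of s i]) auto

lemma nth_le: "s \<in> D \<Longrightarrow> i \<in> D \<Longrightarrow> nth s i \<preceq> s"
proof (cases rule: nth_cases[of s i], simp_all only:)
  assume 1: "nth s i \<in> D" "Mem (pr i (nth s i)) s"
  assume "s \<in> D" "i \<in> D"
  then show ?thesis using 1 Mem_lt[of "pr i (nth s i)" s] lt_trans[of "nth s i" "pr i (nth s i)" s]
    by (simp add: lt_imp_le)
qed auto

lemma nth_eqI: assumes "s \<in> D" "i \<in> D" "v \<in> D" "\<And>w. w \<in> D \<Longrightarrow> Mem (pr i w) s \<longleftrightarrow> w = v" shows "nth s i = v"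
  by (cases rule: nth_cases[OF assms(1,2)]) (use assms in auto)
end

context calc begin
lemma Fn_nth [cintro]: "Fn f \<Longrightarrow> Fn g \<Longrightarrow> Fn (\<lambda>e. nth (f e) (g e))"
proof (rule Fn_f2[of nth])
  have "C (\<lambda>e. (Mem (pr (e 2) (e 0)) (e 1) \<and> (\<forall>w\<in>D. w \<prec> e 0 \<longrightarrow> \<not> Mem (pr (e 2) w) (e 1)))
     \<or> (e 0 = \<zero> \<and> \<not> (\<exists>v\<in>D. v \<prec> e 1 \<and> Mem (pr (e 2) v) (e 1))))"
    by (intro cintro)
  then have "C (\<lambda>e. e 0 = nth (e 1) (e 2))"
  proof (rule c_cong)
    fix e assume "e \<in> asg"
    then have e: "e 0 \<in> D" "e 1 \<in> D" "e 2 \<in> D" by (auto simp: asgD)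
    have b: "v \<prec> e 1" if "v \<in> D" "Mem (pr (e 2) v) (e 1)" for v
      using Mem_lt[OF that(2)] lt_trans[of v "pr (e 2) v" "e 1"] that e by auto
    have l: "nth (e 1) (e 2) \<prec> e 0 \<or> nth (e 1) (e 2) = e 0 \<or> e 0 \<prec> nth (e 1) (e 2)"
      using linear e by auto
    show "((Mem (pr (e 2) (e 0)) (e 1) \<and> (\<forall>w\<in>D. w \<prec> e 0 \<longrightarrow> \<not> Mem (pr (e 2) w) (e 1)))
     \<or> (e 0 = \<zero> \<and> \<not> (\<exists>v\<in>D. v \<prec> e 1 \<and> Mem (pr (e 2) v) (e 1)))) \<longleftrightarrow> e 0 = nth (e 1) (e 2)"
    proof (cases rule: nth_cases[OF e(2,3)])
      case 1
      let ?n = "nth (e 1) (e 2)"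
      have "e 0 = ?n" if "Mem (pr (e 2) (e 0)) (e 1)" "\<forall>w\<in>D. w \<prec> e 0 \<longrightarrow> \<not> Mem (pr (e 2) w) (e 1)"
        using l that 1(1,2) 1(3)[OF e(1)] by metis
      moreover have "\<not> (e 0 = \<zero> \<and> \<not> (\<exists>v\<in>D. v \<prec> e 1 \<and> Mem (pr (e 2) v) (e 1)))"
        using b[OF 1(1,2)] 1(1,2) by metis
      ultimately show ?thesis using 1(2,3) by metis
    next
      case 2 then show ?thesis using e by auto
    qed
  qed
  then show "Fn (\<lambda>e. nth (e 0) (e 1))" unfolding Fn_def by (simp add: asgD numeral_2_eq_2)
qed
end

context pa begin

lemma bounding:
  assumes f: "Df.Fn (\<lambda>e. f (e 0))" and b: "b \<in> D"
  shows "\<exists>B\<in>D. \<forall>i\<in>D. i \<prec> b \<longrightarrow> f i \<prec> B"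
proof -
  have fD: "f i \<in> D" if "i \<in> D" for i using Df.FnD[OF f, of "\<lambda>_. i"] that by (simp add: asg_def)
  have "Df (\<lambda>e. e 1 = f (e 0))" by (intro cintro Df.Fn_f1[OF f])
  from collection[of "\<lambda>i z. z = f i", OF this b] fD show ?thesis by blast
qed

text \<open>The graph of \<open>f\<close> below \<open>b\<close> is bounded by collection and then
  coded by comprehension. This turns any definable function on an initial segment, even a
  nonstandard one, into an element of \<open>M\<close>.\<close>

lemma seq_comp:
  assumes f: "Df.Fn (\<lambda>e. f (e 0))" and b: "b \<in> D"
  shows "\<exists>s\<in>D. \<forall>i\<in>D. (i \<prec> b \<longrightarrow> nth s i = f i) \<and> (b \<preceq> i \<longrightarrow> nth s i = \<zero>)"
proof -
  have fD: "f i \<in> D" if "i \<in> D" for i using Df.FnD[OF f, of "\<lambda>_. i"] that by (simp add: asg_def)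
  have g: "Df.Fn (\<lambda>e. pr (e 0) (f (e 0)))" by (intro cintro Df.Fn_f1[OF f])
  obtain B where B: "B \<in> D" "\<And>i. i \<in> D \<Longrightarrow> i \<prec> b \<Longrightarrow> pr i (f i) \<prec> B"
    using bounding[OF g b] by auto
  have "Df (\<lambda>e. \<exists>i\<in>D. i \<prec> b \<and> e 0 = pr i (f i))" using b by (intro cintro Df.Fn_f1[OF f])
  from comprehension[of "\<lambda>t. \<exists>i\<in>D. i \<prec> b \<and> t = pr i (f i)", OF this B(1)]
  obtain s where s: "s \<in> D" "\<And>z. z \<in> D \<Longrightarrow> Mem z s \<longleftrightarrow> z \<prec> B \<and> (\<exists>i\<in>D. i \<prec> b \<and> z = pr i (f i))" by auto
  have m: "Mem (pr i v) s \<longleftrightarrow> i \<prec> b \<and> v = f i" if "i \<in> D" "v \<in> D" for i v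
    using s(2)[of "pr i v"] that B fD by auto
  have "nth s i = f i" if "i \<in> D" "i \<prec> b" for i
    by (rule nth_eqI) (use that m s fD in auto)
  moreover have "nth s i = \<zero>" if "i \<in> D" "b \<preceq> i" for i
    by (cases rule: nth_cases[OF s(1) that(1)]) (use m that b not_lt[of i b] in auto)
  ultimately show ?thesis using s(1) by blast
qed

end

subsection \<open>The arithmetical hierarchy\<close>

context pa begin

text \<open>As \<open>Df\<close> admits all of \<open>D\<close> as parameters, the arguments from
  \<open>r\<close> on can be frozen at the values \<open>E\<close>, by renaming their variables to
  new odd ones. So induction, collection and least elements, stated without side arguments, apply
  also in their presence.\<close>

lemma Df_fix:
  assumes P: "Df P" and E: "E \<in> asg"
  shows "Df (\<lambda>e. P (\<lambda>i. if i < r then e i else E i))"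
proof -
  obtain p \<rho> where *: "\<forall>i. \<rho> i \<in> D" "\<And>e. e \<in> asg \<Longrightarrow> P e = sat M (pe \<rho> e) p"
    using P by (auto simp: Df_def rep_def)
  define \<rho>' where "\<rho>' i = (if even i then \<rho> (i div 2) else E (i div 2))" for i
  define h where "h v = (if even v then (if v < 2 * r then v else 2 * (2 * (v div 2) + 1) + 1) else 2 * (2 * (v div 2)) + 1)" for v :: nat
  have h: "inj_on h (vars p)"
  proof (rule inj_on_inverseI[of _ "\<lambda>w. if even w then w else if even (w div 2) then 2 * (w div 2 div 2) + 1 else 2 * (w div 2 div 2)"])
    fix v :: nat
    have "v = 2 * (v div 2) \<or> v = 2 * (v div 2) + 1" by presburger
    then show "(if even (h v) then h v else if even (h v div 2) then 2 * (h v div 2 div 2) + 1 else 2 * (h v div 2 div 2)) = v"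
      unfolding h_def by (cases "even v") auto
  qed
  have \<rho>': "\<forall>i. \<rho>' i \<in> D" using *(1) E by (auto simp: \<rho>'_def asgD)
  have "P (\<lambda>i. if i < r then e i else E i) = sat M (pe \<rho>' e) (ren h p)" if e: "e \<in> asg" for e
  proof -
    have "(\<lambda>i. if i < r then e i else E i) \<in> asg" using e E by (auto simp: asg_def)
    from *(2)[OF this] have 1: "P (\<lambda>i. if i < r then e i else E i) = sat M (pe \<rho> (\<lambda>i. if i < r then e i else E i)) p" .
    have "(pe \<rho>' e \<circ> h) v = pe \<rho> (\<lambda>i. if i < r then e i else E i) v" for v
      by (auto simp: pe_def h_def \<rho>'_def elim!: evenE oddE)
    then show ?thesis unfolding 1 sat_ren[OF h] by (intro sat_cong) auto
  qed
  then show ?thesis using \<rho>' unfolding Df_def rep_def by blast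
qed

lemma Df_fix1:
  assumes "Df (\<lambda>e. R (e 0) (\<lambda>i. e (Suc i)))" "E \<in> asg" shows "Df (\<lambda>e. R (e 0) E)"
  using Df_fix[OF assms(1), of "case_nat \<zero> E" 1] assms(2) by (auto simp: asg_def split: nat.split)

lemma Df_fix2:
  assumes "Df (\<lambda>e. R (e 0) (e 1) (\<lambda>i. e (Suc (Suc i))))" "E \<in> asg" shows "Df (\<lambda>e. R (e 0) (e 1) E)"
  using Df_fix[OF assms(1), of "case_nat \<zero> (case_nat \<zero> E)" 2] assms(2)
  by (auto simp: asg_def split: nat.split)

end

locale calcD = calc +
  assumes C_Df: "C P \<Longrightarrow> Df P"
begin

lemma Fn_Df: "Fn f \<Longrightarrow> Df.Fn f" unfolding Fn_def Df.Fn_def by (auto intro: C_Df)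

text \<open>Minimality is a bounded statement, so the least solution has its graph in the class.
  That a least solution exists is seen in the wider class \<open>Df\<close>.\<close>

lemma Fn_lst:
  assumes R: "C (\<lambda>e. R (e 0) (\<lambda>i. e (Suc i)))" and ex: "\<And>e. e \<in> asg \<Longrightarrow> \<exists>a\<in>D. R a e"
  shows "Fn (\<lambda>e. lst (\<lambda>a. R a e))"
proof -
  have d: "Df (\<lambda>e'. R (e' 0) e)" if "e \<in> asg" for e
    by (rule Df_fix1[OF C_Df[OF R] that])
  have L: "lst (\<lambda>a. R a e) \<in> D" "R (lst (\<lambda>a. R a e)) e" "\<And>b. b \<in> D \<Longrightarrow> b \<prec> lst (\<lambda>a. R a e) \<Longrightarrow> \<not> R b e"
    if "e \<in> asg" for e
    using ex[OF that] lst[OF d[OF that]] by blast+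
  have R1: "C (\<lambda>e. R (e 0) (\<lambda>i. e (Suc (Suc i))))"
    using c_re[OF R, of "\<lambda>j. case j of 0 \<Rightarrow> 0 | Suc i \<Rightarrow> Suc (Suc i)"] by simp
  have "C (\<lambda>e. R (e 0) (\<lambda>i. e (Suc i)) \<and> (\<forall>b\<in>D. b \<prec> e 0 \<longrightarrow> \<not> R b (\<lambda>i. e (Suc i))))"
    by (intro cintro R R1)
  then have "C (\<lambda>e. e 0 = lst (\<lambda>a. R a (\<lambda>i. e (Suc i))))"
  proof (rule c_cong)
    fix e assume e: "e \<in> asg"
    then have 1: "(\<lambda>i. e (Suc i)) \<in> asg" "e 0 \<in> D" by (auto simp: asgD)
    show "(R (e 0) (\<lambda>i. e (Suc i)) \<and> (\<forall>b\<in>D. b \<prec> e 0 \<longrightarrow> \<not> R b (\<lambda>i. e (Suc i))))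
      \<longleftrightarrow> e 0 = lst (\<lambda>a. R a (\<lambda>i. e (Suc i)))"
      using L[OF 1(1)] lst_eq[OF 1(2), of "\<lambda>a. R a (\<lambda>i. e (Suc i))"] by metis
  qed
  then show ?thesis using L by (simp add: Fn_def)
qed

end

sublocale pa \<subseteq> Df: calcD M Df D by unfold_locales

context pa begin

text \<open>The predicates that are \<open>\<Sigma>\<close> of level \<open>k\<close> in
  \<open>M\<close>, with parameters in \<open>Q\<close>. Only this side of the hierarchy is defined:
  \<open>\<Pi>\<close> predicates occur as negations, and a block of equal quantifiers is a single
  quantifier.\<close>

fun Sg :: "'a set \<Rightarrow> nat \<Rightarrow> ((nat \<Rightarrow> 'a) \<Rightarrow> bool) \<Rightarrow> bool" where
  "Sg Q 0 P = rep delta0 Q P"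
| "Sg Q (Suc k) P = (\<exists>R. Sg Q k (\<lambda>e. R (e 0) (\<lambda>i. e (Suc i))) \<and> (\<forall>e\<in>asg. P e = (\<exists>a\<in>D. \<not> R a e)))"

lemma Sg_SucI: "Sg Q k (\<lambda>e. R (e 0) (\<lambda>i. e (Suc i))) \<Longrightarrow> (\<And>e. e \<in> asg \<Longrightarrow> P e = (\<exists>a\<in>D. \<not> R a e)) \<Longrightarrow> Sg Q (Suc k) P"
  by auto

lemma Sg_cong: "Sg Q k P \<Longrightarrow> (\<And>e. e \<in> asg \<Longrightarrow> P e = P' e) \<Longrightarrow> Sg Q k P'"
proof (cases k)
  case 0 assume "Sg Q k P" "\<And>e. e \<in> asg \<Longrightarrow> P e = P' e" then show ?thesis using 0 rep_cong by auto
qed auto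

lemma Sg_re: "Q \<subseteq> D \<Longrightarrow> Sg Q k P \<Longrightarrow> Sg Q k (\<lambda>e. P (\<lambda>i. e (\<sigma> i)))"
proof (induction k arbitrary: P \<sigma>)
  case 0 then show ?case using rep_re[OF good_delta0] by auto
next
  case (Suc k)
  then obtain R where R: "Sg Q k (\<lambda>e. R (e 0) (\<lambda>i. e (Suc i)))" "\<And>e. e \<in> asg \<Longrightarrow> P e = (\<exists>a\<in>D. \<not> R a e)" by auto
  have "Sg Q k (\<lambda>e. R (e 0) (\<lambda>i. e (Suc (\<sigma> i))))"
    using Suc.IH[OF Suc.prems(1) R(1), of "\<lambda>j. case j of 0 \<Rightarrow> 0 | Suc i \<Rightarrow> Suc (\<sigma> i)"] by simp
  then show ?case by (rule Sg_SucI[of _ _ "\<lambda>a e. R a (\<lambda>i. e (\<sigma> i))"]) (simp add: R(2))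
qed

lemma Sg_Df: "Sg Q k P \<Longrightarrow> Q \<subseteq> D \<Longrightarrow> Df P"
proof (induction k arbitrary: P)
  case 0 then show ?case unfolding Df_def using rep_mono by auto
next
  case (Suc k)
  then obtain R where R: "Sg Q k (\<lambda>e. R (e 0) (\<lambda>i. e (Suc i)))" "\<And>e. e \<in> asg \<Longrightarrow> P e = (\<exists>a\<in>D. \<not> R a e)" by auto
  have "Df (\<lambda>e. \<exists>a\<in>D. \<not> R a e)" by (intro Df_ex Df.c_not Suc.IH R Suc)
  then show ?case by (rule Df.c_cong) (simp add: R(2))
qed

lemma collection_env:
  assumes R: "Df (\<lambda>e. R (e 0) (e 1) (\<lambda>i. e (Suc (Suc i))))" and e: "e \<in> asg" and b: "b \<in> D"
    and ex: "\<And>i. i \<in> D \<Longrightarrow> i \<prec> b \<Longrightarrow> \<exists>z\<in>D. R i z e"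
  shows "\<exists>B\<in>D. \<forall>i\<in>D. i \<prec> b \<longrightarrow> (\<exists>z\<in>D. z \<prec> B \<and> R i z e)"
  by (rule collection[OF Df_fix2[OF R e] b ex])

text \<open>The closure properties that hold at every level. Negation is not among them, since it
  leads from \<open>\<Sigma>\<close> to \<open>\<Pi>\<close>.\<close>

definition cl :: "(((nat \<Rightarrow> 'a) \<Rightarrow> bool) \<Rightarrow> bool) \<Rightarrow> bool" where
  "cl C \<longleftrightarrow> (\<forall>P P'. C P \<longrightarrow> C P' \<longrightarrow> C (\<lambda>e. P e \<and> P' e)) \<and> (\<forall>P P'. C P \<longrightarrow> C P' \<longrightarrow> C (\<lambda>e. P e \<or> P' e))
    \<and> (\<forall>R k. C (\<lambda>e. R (e 0) (\<lambda>i. e (Suc i))) \<longrightarrow> C (\<lambda>e. \<exists>a\<in>D. a \<prec> e k \<and> R a e))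
    \<and> (\<forall>R k. C (\<lambda>e. R (e 0) (\<lambda>i. e (Suc i))) \<longrightarrow> C (\<lambda>e. \<forall>a\<in>D. a \<prec> e k \<longrightarrow> R a e))"

lemma clD:
  assumes "cl C"
  shows "C P \<Longrightarrow> C P' \<Longrightarrow> C (\<lambda>e. P e \<and> P' e)" "C P \<Longrightarrow> C P' \<Longrightarrow> C (\<lambda>e. P e \<or> P' e)"
    "C (\<lambda>e. R (e 0) (\<lambda>i. e (Suc i))) \<Longrightarrow> C (\<lambda>e. \<exists>a\<in>D. a \<prec> e k \<and> R a e)"
    "C (\<lambda>e. R (e 0) (\<lambda>i. e (Suc i))) \<Longrightarrow> C (\<lambda>e. \<forall>a\<in>D. a \<prec> e k \<longrightarrow> R a e)"
  using assms unfolding cl_def by blast+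

context
  fixes Q assumes Q: "Q \<subseteq> D"
begin

lemma Sg0_not: "Sg Q 0 P \<Longrightarrow> Sg Q 0 (\<lambda>e. \<not> P e)"
  using rep_not[OF good_delta0 Q] by auto

lemma cl_0: "cl (Sg Q 0)"
proof -
  have n: "rep delta0 Q P \<Longrightarrow> rep delta0 Q (\<lambda>e. \<not> P e)" for P by (rule rep_not[OF good_delta0 Q])
  have a: "rep delta0 Q P \<Longrightarrow> rep delta0 Q P' \<Longrightarrow> rep delta0 Q (\<lambda>e. P e \<and> P' e)" for P P'
    by (rule rep_and[OF good_delta0 Q])
  have b: "rep delta0 Q (\<lambda>e. R (e 0) (\<lambda>i. e (Suc i))) \<Longrightarrow> rep delta0 Q (\<lambda>e. \<exists>a\<in>D. a \<prec> e k \<and> R a e)" for R k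
    by (rule rep_bex[OF good_delta0 Q])
  show ?thesis unfolding cl_def Sg.simps
  proof (intro conjI allI impI)
    show "rep delta0 Q (\<lambda>e. P e \<or> P' e)" if "rep delta0 Q P" "rep delta0 Q P'" for P P'
      using n[OF a[OF n[OF that(1)] n[OF that(2)]]] by simp
    show "rep delta0 Q (\<lambda>e. \<forall>a\<in>D. a \<prec> e k \<longrightarrow> R a e)" if "rep delta0 Q (\<lambda>e. R (e 0) (\<lambda>i. e (Suc i)))" for R k
      using n[OF b[of "\<lambda>a e. \<not> R a e", OF n[OF that]], of k] by simp
  qed (use a b in auto)
qed

text \<open>In a conjunction the two witnesses are replaced by one common bound, so that a single
  unbounded quantifier remains. A bounded universal quantifier moves past the existential one by
  collection; a bounded existential one simply changes places with it.\<close>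

lemma cl_Suc: assumes k: "cl (Sg Q k)" shows "cl (Sg Q (Suc k))"
proof -
  note kd = clD[OF k]
  have ub: "\<exists>c\<in>D. a \<prec> c \<and> b \<prec> c" if "a \<in> D" "b \<in> D" for a b
    using that by (intro bexI[of _ "\<S> (a \<oplus> b)"]) auto
  have re: "Sg Q k P \<Longrightarrow> Sg Q k (\<lambda>e. P (\<lambda>i. e (\<sigma> i)))" for P \<sigma> by (rule Sg_re[OF Q])
  show ?thesis unfolding cl_def
  proof (intro conjI allI impI)
    fix P P' assume "Sg Q (Suc k) P" "Sg Q (Suc k) P'"
    then obtain R R' where R: "Sg Q k (\<lambda>e. R (e 0) (\<lambda>i. e (Suc i)))" "\<And>e. e \<in> asg \<Longrightarrow> P e = (\<exists>a\<in>D. \<not> R a e)"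
      and R': "Sg Q k (\<lambda>e. R' (e 0) (\<lambda>i. e (Suc i)))" "\<And>e. e \<in> asg \<Longrightarrow> P' e = (\<exists>a\<in>D. \<not> R' a e)" by auto
    show "Sg Q (Suc k) (\<lambda>e. P e \<or> P' e)"
      by (rule Sg_SucI[of _ _ "\<lambda>a e. R a e \<and> R' a e"]) (use kd(1) R R' in auto)
    have 1: "Sg Q k (\<lambda>e. R (e 1) (\<lambda>i. e (Suc (Suc (Suc i)))))"
      using re[OF R(1), of "\<lambda>j. case j of 0 \<Rightarrow> 1 | Suc i \<Rightarrow> Suc (Suc (Suc i))"] by simp
    have 2: "Sg Q k (\<lambda>e. R' (e 0) (\<lambda>i. e (Suc (Suc (Suc i)))))"
      using re[OF R'(1), of "\<lambda>j. case j of 0 \<Rightarrow> 0 | Suc i \<Rightarrow> Suc (Suc (Suc i))"] by simp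
    have "Sg Q k (\<lambda>e. \<forall>b\<in>D. b \<prec> e 1 \<longrightarrow> R (e 0) (\<lambda>i. e (Suc (Suc i))) \<or> R' b (\<lambda>i. e (Suc (Suc i))))"
      by (rule kd(4)) (use kd(2)[OF 1 2] in simp)
    then have "Sg Q k (\<lambda>e. \<forall>a\<in>D. a \<prec> e 0 \<longrightarrow> (\<forall>b\<in>D. b \<prec> e 0 \<longrightarrow> R a (\<lambda>i. e (Suc i)) \<or> R' b (\<lambda>i. e (Suc i))))"
      by - (rule kd(4), simp)
    then show "Sg Q (Suc k) (\<lambda>e. P e \<and> P' e)"
      by (rule Sg_SucI[of _ _ "\<lambda>c e. \<forall>a\<in>D. a \<prec> c \<longrightarrow> (\<forall>b\<in>D. b \<prec> c \<longrightarrow> R a e \<or> R' b e)"])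
        (use ub in \<open>auto simp: R(2) R'(2), blast\<close>)
  next
    fix R :: "'a \<Rightarrow> (nat \<Rightarrow> 'a) \<Rightarrow> bool" and j assume "Sg Q (Suc k) (\<lambda>e. R (e 0) (\<lambda>i. e (Suc i)))"
    then obtain T where T: "Sg Q k (\<lambda>e. T (e 0) (\<lambda>i. e (Suc i)))"
       "\<And>e. e \<in> asg \<Longrightarrow> R (e 0) (\<lambda>i. e (Suc i)) = (\<exists>a\<in>D. \<not> T a e)" by auto
    have RT: "R x e = (\<exists>a\<in>D. \<not> T a (case_nat x e))" if "x \<in> D" "e \<in> asg" for x e
      using T(2)[of "case_nat x e"] that by (auto simp: asg_def split: nat.splits)
    have 1: "Sg Q k (\<lambda>e. T (e 1) (case_nat (e 0) (\<lambda>i. e (Suc (Suc i)))))"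
    proof (rule Sg_cong[OF re[OF T(1), of "\<lambda>j. case j of 0 \<Rightarrow> 1 | Suc 0 \<Rightarrow> 0 | Suc i \<Rightarrow> Suc i"]])
      fix e :: "nat \<Rightarrow> 'a"
      have "(\<lambda>i. e (case Suc i of 0 \<Rightarrow> 1 | Suc 0 \<Rightarrow> 0 | Suc i \<Rightarrow> Suc i)) = case_nat (e 0) (\<lambda>i. e (Suc (Suc i)))"
        by (auto simp: fun_eq_iff split: nat.split)
      then show "T (e (case 0 of 0 \<Rightarrow> 1 | Suc 0 \<Rightarrow> 0 | Suc i \<Rightarrow> Suc i)) (\<lambda>i. e (case Suc i of 0 \<Rightarrow> 1 | Suc 0 \<Rightarrow> 0 | Suc i \<Rightarrow> Suc i))
        = T (e 1) (case_nat (e 0) (\<lambda>i. e (Suc (Suc i))))" by simp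
    qed
    have "Sg Q k (\<lambda>e. \<forall>x\<in>D. x \<prec> e (Suc j) \<longrightarrow> T (e 0) (case_nat x (\<lambda>i. e (Suc i))))"
      by (rule kd(4)) (use 1 in simp)
    then show "Sg Q (Suc k) (\<lambda>e. \<exists>x\<in>D. x \<prec> e j \<and> R x e)"
      by (rule Sg_SucI[of _ _ "\<lambda>a e. \<forall>x\<in>D. x \<prec> e j \<longrightarrow> T a (case_nat x e)"]) (auto simp: RT)
    have 2: "Sg Q k (\<lambda>e. T (e 0) (case_nat (e 1) (\<lambda>i. e (Suc (Suc (Suc i))))))"
    proof (rule Sg_cong[OF re[OF 1, of "\<lambda>j. case j of 0 \<Rightarrow> 1 | Suc 0 \<Rightarrow> 0 | Suc (Suc i) \<Rightarrow> Suc (Suc (Suc i))"]])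
    qed simp
    have "Sg Q k (\<lambda>e. \<forall>a\<in>D. a \<prec> e 1 \<longrightarrow> T a (case_nat (e 0) (\<lambda>i. e (Suc (Suc i)))))"
      by (rule kd(4)) (use 2 in simp)
    then have "Sg Q k (\<lambda>e. \<exists>x\<in>D. x \<prec> e (Suc j) \<and> (\<forall>a\<in>D. a \<prec> e 0 \<longrightarrow> T a (case_nat x (\<lambda>i. e (Suc i)))))"
      by - (rule kd(3), simp)
    then show "Sg Q (Suc k) (\<lambda>e. \<forall>x\<in>D. x \<prec> e j \<longrightarrow> R x e)"
    proof (rule Sg_SucI[of _ _ "\<lambda>b e. \<exists>x\<in>D. x \<prec> e j \<and> (\<forall>a\<in>D. a \<prec> b \<longrightarrow> T a (case_nat x e))"])
      fix e assume e: "e \<in> asg"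
      have D: "Df (\<lambda>e. \<not> T (e 1) (case_nat (e 0) (\<lambda>i. e (Suc (Suc i)))))"
        by (intro Df.c_not Sg_Df[OF 1 Q])
      show "(\<forall>x\<in>D. x \<prec> e j \<longrightarrow> R x e) = (\<exists>a\<in>D. \<not> (\<exists>x\<in>D. x \<prec> e j \<and> (\<forall>aa\<in>D. aa \<prec> a \<longrightarrow> T aa (case_nat x e))))"
        (is "?l = ?r")
      proof
        assume ?l
        then have "\<exists>B\<in>D. \<forall>x\<in>D. x \<prec> e j \<longrightarrow> (\<exists>a\<in>D. a \<prec> B \<and> \<not> T a (case_nat x e))"
          using collection_env[of "\<lambda>x a e. \<not> T a (case_nat x e)", OF D e, of "e j"] e RT by (simp add: asgD)
        then show ?r by blast
      next
        assume ?r then show ?l using RT e by blast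
      qed
    qed
  qed
qed

lemma cl_Sg: "cl (Sg Q k)"
  by (induction k) (rule cl_0, rule cl_Suc)

text \<open>Two quantifiers are contracted by a common bound rather than by a pair: bounded
  quantifiers are available at every level, while substitution of functions such as pairing into
  \<open>\<Sigma>\<close> predicates relies on this lemma.\<close>

lemma Sg_ex: 
  assumes "Sg Q (Suc k) (\<lambda>e. R (e 0) (\<lambda>i. e (Suc i)))" shows "Sg Q (Suc k) (\<lambda>e. \<exists>a\<in>D. R a e)"
proof -
  note kd = clD[OF cl_Sg[of k]]
  obtain T where T: "Sg Q k (\<lambda>e. T (e 0) (\<lambda>i. e (Suc i)))"
       "\<And>e. e \<in> asg \<Longrightarrow> R (e 0) (\<lambda>i. e (Suc i)) = (\<exists>a\<in>D. \<not> T a e)" using assms by auto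
  have RT: "R x e = (\<exists>a\<in>D. \<not> T a (case_nat x e))" if "x \<in> D" "e \<in> asg" for x e
      using T(2)[of "case_nat x e"] that by (auto simp: asg_def split: nat.splits)
  have 1: "Sg Q k (\<lambda>e. T (e 0) (case_nat (e 1) (\<lambda>i. e (Suc (Suc (Suc i))))))"
  proof (rule Sg_cong[OF Sg_re[OF Q T(1), of "\<lambda>j. case j of 0 \<Rightarrow> 0 | Suc 0 \<Rightarrow> 1 | Suc i \<Rightarrow> Suc (Suc i)"]])
    fix e :: "nat \<Rightarrow> 'a"
    have "(\<lambda>i. e (case Suc i of 0 \<Rightarrow> 0 | Suc 0 \<Rightarrow> 1 | Suc i \<Rightarrow> Suc (Suc i))) = case_nat (e 1) (\<lambda>i. e (Suc (Suc (Suc i))))"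
      by (auto simp: fun_eq_iff split: nat.split)
    then show "T (e (case 0 of 0 \<Rightarrow> 0 | Suc 0 \<Rightarrow> 1 | Suc i \<Rightarrow> Suc (Suc i))) (\<lambda>i. e (case Suc i of 0 \<Rightarrow> 0 | Suc 0 \<Rightarrow> 1 | Suc i \<Rightarrow> Suc (Suc i)))
      = T (e 0) (case_nat (e 1) (\<lambda>i. e (Suc (Suc (Suc i)))))" by simp
  qed
  have "Sg Q k (\<lambda>e. \<forall>a\<in>D. a \<prec> e 1 \<longrightarrow> T a (case_nat (e 0) (\<lambda>i. e (Suc (Suc i)))))"
    by (rule kd(4)) (use 1 in simp)
  then have "Sg Q k (\<lambda>e. \<forall>x\<in>D. x \<prec> e 0 \<longrightarrow> (\<forall>a\<in>D. a \<prec> e 0 \<longrightarrow> T a (case_nat x (\<lambda>i. e (Suc i)))))"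
    by - (rule kd(4), simp)
  then show ?thesis
  proof (rule Sg_SucI[of _ _ "\<lambda>b e. \<forall>x\<in>D. x \<prec> b \<longrightarrow> (\<forall>a\<in>D. a \<prec> b \<longrightarrow> T a (case_nat x e))"])
    fix e assume e: "e \<in> asg"
    have ub: "\<exists>c\<in>D. a \<prec> c \<and> b \<prec> c" if "a \<in> D" "b \<in> D" for a b
      using that by (intro bexI[of _ "\<S> (a \<oplus> b)"]) auto
    show "(\<exists>a\<in>D. R a e) = (\<exists>a\<in>D. \<not> (\<forall>x\<in>D. x \<prec> a \<longrightarrow> (\<forall>aa\<in>D. aa \<prec> a \<longrightarrow> T aa (case_nat x e))))"
      using RT[OF _ e] ub by blast
  qed
qed

lemma Sg_Suc_neg: "Sg Q k P \<Longrightarrow> Sg Q (Suc k) (\<lambda>e. \<not> P e)"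
  using Sg_SucI[of Q k "\<lambda>a e. P e" "\<lambda>e. \<not> P e"] Sg_re[OF Q, of k P Suc] D0 by blast

text \<open>Adding a quantifier in front changes the sign, so the induction raises the matrix
  instead; at level zero negation is available.\<close>

lemma Sg_Suc: "Sg Q k P \<Longrightarrow> Sg Q (Suc k) P"
proof (induction k arbitrary: P)
  case 0 then show ?case using Sg_Suc_neg[OF Sg0_not[OF 0]] by simp
next
  case (Suc k)
  then obtain R where R: "Sg Q k (\<lambda>e. R (e 0) (\<lambda>i. e (Suc i)))" "\<And>e. e \<in> asg \<Longrightarrow> P e = (\<exists>a\<in>D. \<not> R a e)" by auto
  have "Sg Q (Suc k) (\<lambda>e. R (e 0) (\<lambda>i. e (Suc i)))" by (rule Suc.IH[OF R(1)])
  then show ?case using R(2) unfolding Sg.simps(2)[of Q "Suc k"] by blast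
qed

lemma Sg_0: "Sg Q 0 P \<Longrightarrow> Sg Q k P" by (induction k) (simp, rule Sg_Suc)

end

section \<open>The class of \<open>\<Delta>\<close> predicates and its functions\<close>

definition Dl :: "'a set \<Rightarrow> nat \<Rightarrow> ((nat \<Rightarrow> 'a) \<Rightarrow> bool) \<Rightarrow> bool" where
  "Dl Q k P \<longleftrightarrow> Sg Q k P \<and> Sg Q k (\<lambda>e. \<not> P e)"

end

text \<open>The working class is \<open>Dl Q (Suc k)\<close>, the \<open>\<Delta>\<close> predicates
  of level \<open>k + 1\<close> with parameters in \<open>Q\<close>. Zero belongs to
  \<open>Q\<close> because a representation has to assign some element of \<open>Q\<close> to each
  odd variable.\<close>

locale lev = pa M for M :: "'a struc" +
  fixes Q :: "'a set" and k :: nat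
  assumes QD: "Q \<subseteq> D" and Q0: "\<zero> \<in> Q"
begin

lemma sg_sub:
  assumes "Sg Q (Suc k) (\<lambda>e. R (e 0) (\<lambda>i. e (Suc i)))" "\<And>e. e \<in> asg \<Longrightarrow> f e \<in> D"
    "Sg Q (Suc k) (\<lambda>e. e 0 = f (\<lambda>i. e (Suc i)))"
  shows "Sg Q (Suc k) (\<lambda>e. R (f e) e)"
proof -
  have "Sg Q (Suc k) (\<lambda>e. e 0 = f (\<lambda>i. e (Suc i)) \<and> R (e 0) (\<lambda>i. e (Suc i)))"
    by (intro clD(1)[OF cl_Sg[OF QD]] assms)
  from Sg_ex[OF QD, of k "\<lambda>a e. a = f e \<and> R a e", OF this]
  show ?thesis by (rule Sg_cong) (use assms(2) in auto)
qed

end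

text \<open>Closure under substitution holds because \<open>R (f e) e\<close> and its negation both
  become existential statements about the value of \<open>f\<close>.\<close>

sublocale lev \<subseteq> R: calcD M "Dl Q (Suc k)" Q
proof
  note c = clD[OF cl_Sg[OF QD]]
  let ?C = "Dl Q (Suc k)"
  show "?C P'" if "?C P" "\<And>e. e \<in> asg \<Longrightarrow> P e = P' e" for P P'
    using that Sg_cong[of Q "Suc k" P P'] Sg_cong[of Q "Suc k" "\<lambda>e. \<not> P e" "\<lambda>e. \<not> P' e"]
    unfolding Dl_def by simp
  show "?C (\<lambda>e. \<not> P e)" if "?C P" for P using that by (simp add: Dl_def)
  show "?C (\<lambda>e. P e \<and> P' e)" if "?C P" "?C P'" for P P'
    using that c(1)[of "Suc k" P P'] c(2)[of "Suc k" "\<lambda>e. \<not> P e" "\<lambda>e. \<not> P' e"]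
    unfolding Dl_def de_Morgan_conj by simp
  show "?C (\<lambda>e. \<exists>a\<in>D. a \<prec> e j \<and> R a e)" if "?C (\<lambda>e. R (e 0) (\<lambda>i. e (Suc i)))" for R j
    using c(3)[of "Suc k" R j] c(4)[of "Suc k" "\<lambda>a e. \<not> R a e" j] that unfolding Dl_def by simp
  show "?C (\<lambda>e. P (\<lambda>i. e (\<sigma> i)))" if "?C P" for P \<sigma>
    using that Sg_re[OF QD, of "Suc k" P \<sigma>] Sg_re[OF QD, of "Suc k" "\<lambda>e. \<not> P e" \<sigma>] unfolding Dl_def by simp
  show "?C (\<lambda>e. R (f e) e)" if "?C (\<lambda>e. R (e 0) (\<lambda>i. e (Suc i)))" "\<And>e. e \<in> asg \<Longrightarrow> f e \<in> D"
    "?C (\<lambda>e. e 0 = f (\<lambda>i. e (Suc i)))" for R f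
    using that sg_sub[of R f] sg_sub[of "\<lambda>a e. \<not> R a e" f] unfolding Dl_def by simp
  have a: "?C P" if "rep delta0 Q P" for P
    using Sg_0[OF QD, of P] Sg_0[OF QD Sg0_not[OF QD], of P] that unfolding Dl_def by (simp del: Sg.simps(2))
  show "?C (\<lambda>e. e 0 = e 1)" "?C (\<lambda>e. e 0 \<prec> e 1)" "?C (\<lambda>e. e 0 = e 1 \<oplus> e 2)" "?C (\<lambda>e. e 0 = e 1 \<otimes> e 2)"
     "?C (\<lambda>e. e 0 = \<S> (e 1))" "?C (\<lambda>e. e 0 = \<zero>)" by (intro a rep_atoms[OF good_delta0 QD Q0])+
  show "?C (\<lambda>e. e 0 = c)" if "c \<in> Q" for c by (rule a, rule rep_atoms(7)[OF good_delta0 QD that])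
  show "Df P" if "?C P" for P using that Sg_Df[of Q "Suc k" P, OF _ QD] unfolding Dl_def by blast
qed (rule QD)

context lev begin

abbreviation "SG \<equiv> Sg Q (Suc k)"

lemma sg_C [cintro]: "Dl Q (Suc k) P \<Longrightarrow> SG P" by (simp add: Dl_def)
lemma sg_and: "SG P \<Longrightarrow> SG P' \<Longrightarrow> SG (\<lambda>e. P e \<and> P' e)" by (rule clD(1)[OF cl_Sg[OF QD]])
lemma sg_or: "SG P \<Longrightarrow> SG P' \<Longrightarrow> SG (\<lambda>e. P e \<or> P' e)" by (rule clD(2)[OF cl_Sg[OF QD]])
lemma sg_ex: "SG (\<lambda>e. R (e 0) (\<lambda>i. e (Suc i))) \<Longrightarrow> SG (\<lambda>e. \<exists>a\<in>D. R a e)" by (rule Sg_ex[OF QD])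

lemma sg_subF: "SG (\<lambda>e. R (e 0) (\<lambda>i. e (Suc i))) \<Longrightarrow> R.Fn f \<Longrightarrow> SG (\<lambda>e. R (f e) e)"
  by (rule sg_sub) (auto simp: R.Fn_def Dl_def)

lemma sg_ball:
  assumes "R.Fn f" "SG (\<lambda>e. R (e 0) (\<lambda>i. e (Suc i)))" shows "SG (\<lambda>e. \<forall>a\<in>D. a \<prec> f e \<longrightarrow> R a e)"
proof -
  have "SG (\<lambda>e. R (e 0) (\<lambda>i. e (Suc (Suc i))))"
    using Sg_re[OF QD assms(2), of "\<lambda>j. case j of 0 \<Rightarrow> 0 | Suc i \<Rightarrow> Suc (Suc i)"] by simp
  then have "SG (\<lambda>e. \<forall>a\<in>D. a \<prec> e 0 \<longrightarrow> R a (\<lambda>i. e (Suc i)))"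
    using clD(4)[OF cl_Sg[OF QD], of "Suc k" "\<lambda>a e. R a (\<lambda>i. e (Suc i))" 0] by simp
  from sg_subF[of "\<lambda>b e. \<forall>a\<in>D. a \<prec> b \<longrightarrow> R a e", OF this assms(1)] show ?thesis .
qed

lemma sg_r2:
  assumes "SG (\<lambda>e. R (e 0) (e 1))" "R.Fn f" "R.Fn g" shows "SG (\<lambda>e. R (f e) (g e))"
proof -
  have "SG (\<lambda>e. R (e (Suc 0)) (e 0))" using Sg_re[OF QD assms(1), of "\<lambda>i. if i = 0 then 1 else 0"] by simp
  from sg_subF[of "\<lambda>b e. R (e 0) b", OF this R.Fn_re[OF assms(3), of Suc]]
  have "SG (\<lambda>e. R (e 0) (g (\<lambda>i. e (Suc i))))" .
  from sg_subF[of "\<lambda>a e. R a (g e)", OF this assms(2)] show ?thesis .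
qed

text \<open>A total function with a \<open>\<Sigma>\<close> graph has a \<open>\<Delta>\<close>
  graph: a number is not the value if some different number is.\<close>

lemma Fn_sgI:
  assumes D: "\<And>e. e \<in> asg \<Longrightarrow> f e \<in> D" and g: "SG (\<lambda>e. e 0 = f (\<lambda>i. e (Suc i)))"
  shows "R.Fn f"
proof -
  have 1: "SG (\<lambda>e. e 0 = f (\<lambda>i. e (Suc (Suc i))))"
    using Sg_re[OF QD g, of "\<lambda>j. case j of 0 \<Rightarrow> 0 | Suc i \<Rightarrow> Suc (Suc i)"] by simp
  have "SG (\<lambda>e. \<exists>a\<in>D. a = f (\<lambda>i. e (Suc i)) \<and> a \<noteq> e 0)"
    by (intro sg_ex sg_and 1 cintro)
  then have "SG (\<lambda>e. e 0 \<noteq> f (\<lambda>i. e (Suc i)))" by (rule Sg_cong) (use D in auto)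
  then show ?thesis using g D by (auto simp: R.Fn_def Dl_def)
qed

end

context pa begin

declare Sg.simps(2) [simp del]

end

context calc begin

lemma Fn_if [cintro]: assumes "C P" "Fn f" "Fn g" shows "Fn (\<lambda>e. if P e then f e else g e)"
proof -
  have "C (\<lambda>e. (P (\<lambda>i. e (Suc i)) \<and> e 0 = f (\<lambda>i. e (Suc i))) \<or> (\<not> P (\<lambda>i. e (Suc i)) \<and> e 0 = g (\<lambda>i. e (Suc i))))"
    by (intro cintro c_re[OF assms(1), of Suc] Fn_re[OF assms(2), of Suc] Fn_re[OF assms(3), of Suc])
  then have "C (\<lambda>e. e 0 = (if P (\<lambda>i. e (Suc i)) then f (\<lambda>i. e (Suc i)) else g (\<lambda>i. e (Suc i))))"
    by (rule c_cong) auto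
  then show ?thesis using assms by (simp add: Fn_def)
qed

end

subsection \<open>Prenex formulas and iteration\<close>

lemma Sigma_Pi_ren:
  "Sigma k p \<Longrightarrow> inj_on f (vars p) \<Longrightarrow> Sigma k (ren f p)"
  "Pi k p \<Longrightarrow> inj_on f (vars p) \<Longrightarrow> Pi k (ren f p)"
  by (induction rule: Sigma_Pi.inducts) (auto intro: Sigma_Pi.intros delta0_ren inj_on_subset)

lemma Sigma_Pi_neg:
  "Sigma k p \<Longrightarrow> \<exists>p'. Pi k p' \<and> (\<forall>s. sat (K :: 'b struc) s p' = (\<not> sat K s p))"
  "Pi k p \<Longrightarrow> \<exists>p'. Sigma k p' \<and> (\<forall>s. sat (K :: 'b struc) s p' = (\<not> sat K s p))"
proof (induction rule: Sigma_Pi.inducts)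
  case (1 p) then show ?case by (intro exI[of _ "Neg p"]) (auto intro: Sigma_Pi.intros delta0.intros)
next
  case (2 p) then show ?case by (intro exI[of _ "Neg p"]) (auto intro: Sigma_Pi.intros delta0.intros)
next
  case (3 n p) then show ?case by (auto intro: Sigma_Pi.intros)
next
  case (4 n p x)
  then obtain p' where "Pi (Suc n) p'" "\<forall>s. sat K s p' = (\<not> sat K s p)" by auto
  then show ?case by (intro exI[of _ "All x p'"]) (auto intro: Sigma_Pi.intros)
next
  case (5 n p) then show ?case by (auto intro: Sigma_Pi.intros)
next
  case (6 n p x)
  then obtain p' where "Sigma (Suc n) p'" "\<forall>s. sat K s p' = (\<not> sat K s p)" by auto
  then show ?case by (intro exI[of _ "Ex x p'"]) (auto intro: Sigma_Pi.intros)
qed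

context pa begin

text \<open>Leads from the semantic hierarchy back to prenex formulas. It is used to enumerate the
  functions of the class and to exhibit the formula that defines \<open>A\<close>.\<close>

lemma Sg_literal: "Sg Q k P \<Longrightarrow> rep (Sigma k) Q P"
proof (induction k arbitrary: P)
  case 0 then show ?case by (auto intro: rep_mono Sigma_Pi.intros)
next
  case (Suc k)
  then obtain R where R: "Sg Q k (\<lambda>e. R (e 0) (\<lambda>i. e (Suc i)))" "\<And>e. e \<in> asg \<Longrightarrow> P e = (\<exists>a\<in>D. \<not> R a e)"
    by (auto simp: Sg.simps(2))
  obtain p \<rho> where p: "Sigma k p" "\<forall>i. \<rho> i \<in> Q" "\<forall>e\<in>asg. R (e 0) (\<lambda>i. e (Suc i)) = sat M (pe \<rho> e) p"
    using Suc.IH[OF R(1)] by (auto simp: rep_def)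
  obtain p' where "Pi k p'" "\<forall>s. sat M s p' = (\<not> sat M s p)" using Sigma_Pi_neg(1)[OF p(1)] by blast
  with p have "rep (Pi k) Q (\<lambda>e. \<not> R (e 0) (\<lambda>i. e (Suc i)))" unfolding rep_def by blast
  then have "rep (Sigma (Suc k)) Q (\<lambda>e. \<exists>a\<in>D. \<not> R a e)"
    by (rule rep_ex[where P = "\<lambda>a e. \<not> R a e" and \<Phi> = "Pi k", rotated 1]) (auto intro: Sigma_Pi.intros Sigma_Pi_ren)
  then show ?case by (rule rep_cong) (simp add: R(2))
qed

text \<open>A prenex formula may repeat the same quantifier any number of times;
  \<open>Sg_ex\<close> contracts such a block.\<close>

lemma literal_Sg:
  assumes Q: "Q \<subseteq> D" "q \<in> Q"
  shows "Sigma k p \<Longrightarrow> Sg Q k (\<lambda>e. sat M e p)" and "Pi k p \<Longrightarrow> Sg Q k (\<lambda>e. \<not> sat M e p)"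
proof (induction rule: Sigma_Pi.inducts)
  have 0: "Sg Q 0 (\<lambda>e. sat M e p)" if "delta0 p" for p
  proof -
    have i: "inj_on ((*) 2) (vars p)" by (auto simp: inj_on_def)
    have "sat M e p = sat M (pe (\<lambda>_. q) e) (ren ((*) 2) p)" for e
      unfolding sat_ren[OF i] by (rule sat_cong) (simp add: pe_def)
    then show ?thesis using Q delta0_ren[OF that i] unfolding Sg.simps rep_def
      by (intro exI[of _ "ren ((*) 2) p"] exI[of _ "\<lambda>_. q"]) simp
  qed
  case (1 p) then show ?case by (rule 0)
  case (2 p) then show ?case by (rule Sg0_not[OF Q(1) 0])
next
  case (3 n p) then show ?case using Sg_Suc_neg[OF Q(1), of n "\<lambda>e. \<not> sat M e p"] by simp
next
  case (4 n p x)
  have "Sg Q (Suc n) (\<lambda>e. sat M ((\<lambda>i. e (Suc i))(x := e 0)) p)"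
  proof (rule Sg_cong[OF Sg_re[OF Q(1) 4(2), of "\<lambda>i. if i = x then 0 else Suc i"]])
    fix e :: "nat \<Rightarrow> 'a"
    have "(\<lambda>i. e (if i = x then 0 else Suc i)) = (\<lambda>i. e (Suc i))(x := e 0)" by auto
    then show "sat M (\<lambda>i. e (if i = x then 0 else Suc i)) p = sat M ((\<lambda>i. e (Suc i))(x := e 0)) p" by simp
  qed
  from Sg_ex[OF Q(1), of n "\<lambda>a e. sat M (e(x := a)) p", OF this] show ?case by simp
next
  case (5 n p) then show ?case using Sg_Suc_neg[OF Q(1)] by blast
next
  case (6 n p x)
  have "Sg Q (Suc n) (\<lambda>e. \<not> sat M ((\<lambda>i. e (Suc i))(x := e 0)) p)"
  proof (rule Sg_cong[OF Sg_re[OF Q(1) 6(2), of "\<lambda>i. if i = x then 0 else Suc i"]])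
    fix e :: "nat \<Rightarrow> 'a"
    have "(\<lambda>i. e (if i = x then 0 else Suc i)) = (\<lambda>i. e (Suc i))(x := e 0)" by auto
    then show "(\<not> sat M (\<lambda>i. e (if i = x then 0 else Suc i)) p) = (\<not> sat M ((\<lambda>i. e (Suc i))(x := e 0)) p)" by simp
  qed
  from Sg_ex[OF Q(1), of n "\<lambda>a e. \<not> sat M (e(x := a)) p", OF this] show ?case by simp
qed

section \<open>Iteration along elements of the model\<close>

definition isit :: "('a \<Rightarrow> 'a) \<Rightarrow> 'a \<Rightarrow> 'a \<Rightarrow> 'a \<Rightarrow> bool" where
  "isit F k z s \<longleftrightarrow> nth s \<zero> = z \<and> (\<forall>i\<in>D. i \<prec> k \<longrightarrow> nth s (\<S> i) = F (nth s i))"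

definition it :: "('a \<Rightarrow> 'a) \<Rightarrow> 'a \<Rightarrow> 'a \<Rightarrow> 'a" where
  "it F k z = (THE y. \<exists>s\<in>D. isit F k z s \<and> nth s k = y)"

lemma FnD1: "Df.Fn (\<lambda>e. F (e 0)) \<Longrightarrow> a \<in> D \<Longrightarrow> F a \<in> D"
  using Df.FnD[of "\<lambda>e. F (e 0)" "\<lambda>_. a"] by (simp add: asg_def)

context
  fixes F assumes F: "Df.Fn (\<lambda>e. F (e 0))"
begin

lemma isit_ex: assumes k: "k \<in> D" and z: "z \<in> D" shows "\<exists>s\<in>D. isit F k z s"
  unfolding isit_def
proof (rule ind[of "\<lambda>k. \<exists>s\<in>D. nth s \<zero> = z \<and> (\<forall>i\<in>D. i \<prec> k \<longrightarrow> nth s (\<S> i) = F (nth s i))"])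
  show "Df (\<lambda>e. \<exists>s\<in>D. nth s \<zero> = z \<and> (\<forall>i\<in>D. i \<prec> e 0 \<longrightarrow> nth s (\<S> i) = F (nth s i)))"
    using z by (intro cintro Df.Fn_f1[OF F])
  have "Df.Fn (\<lambda>e. z)" using z by (intro cintro)
  from seq_comp[of "\<lambda>_. z", OF this DS[OF D0]] obtain s where
    "s \<in> D" "\<And>i. i \<in> D \<Longrightarrow> i \<prec> \<S> \<zero> \<Longrightarrow> nth s i = z" by blast
  then show "\<exists>s\<in>D. nth s \<zero> = z \<and> (\<forall>i\<in>D. i \<prec> \<zero> \<longrightarrow> nth s (\<S> i) = F (nth s i))"
    by (intro bexI[of _ s]) auto
  fix k assume k: "k \<in> D" "\<exists>s\<in>D. nth s \<zero> = z \<and> (\<forall>i\<in>D. i \<prec> k \<longrightarrow> nth s (\<S> i) = F (nth s i))"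
  then obtain s where s: "s \<in> D" "nth s \<zero> = z" "\<And>i. i \<in> D \<Longrightarrow> i \<prec> k \<Longrightarrow> nth s (\<S> i) = F (nth s i)" by auto
  have "Df.Fn (\<lambda>e. if e 0 \<preceq> k then nth s (e 0) else F (nth s k))"
    using k s by (intro cintro Df.Fn_f1[OF F])
  from seq_comp[of "\<lambda>i. if i \<preceq> k then nth s i else F (nth s k)", OF this DS[OF DS[OF k(1)]]]
  obtain s' where s': "s' \<in> D" "\<And>i. i \<in> D \<Longrightarrow> i \<prec> \<S> (\<S> k) \<Longrightarrow> nth s' i = (if i \<preceq> k then nth s i else F (nth s k))" by blast
  have "nth s' (\<S> i) = F (nth s' i)" if i: "i \<in> D" "i \<prec> \<S> k" for i
  proof (cases "i = k")
    case True
    have n: "\<not> \<S> k \<preceq> k" using k by simp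
    have "nth s' (\<S> k) = (if \<S> k \<preceq> k then nth s (\<S> k) else F (nth s k))" by (rule s'(2)) (use k in auto)
    also have "\<dots> = F (nth s k)" by (rule if_not_P[OF n])
    finally have "nth s' (\<S> k) = F (nth s k)" .
    then show ?thesis using True s'(2)[of k] k by (simp add: lt_imp_le)
  next
    case False
    then have "i \<prec> k" using i k by (simp add: le_def)
    moreover from this have "\<S> i \<preceq> k" "i \<preceq> k" using i k by (auto simp: lt_le lt_imp_le)
    moreover from this have "\<S> i \<preceq> \<S> k" using le_trans[of "\<S> i" k "\<S> k"] i k by (simp add: lt_imp_le)
    moreover have "i \<preceq> \<S> k" using i by (simp add: lt_imp_le)
    ultimately show ?thesis using s'(2)[of "\<S> i"] s'(2)[of i] s(3)[of i] i k by simp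
  qed
  then show "\<exists>s\<in>D. nth s \<zero> = z \<and> (\<forall>i\<in>D. i \<prec> \<S> k \<longrightarrow> nth s (\<S> i) = F (nth s i))"
    using s' s k by (intro bexI[of _ s']) auto
qed (use k in auto)

lemma isit_unique:
  assumes "isit F k z s" "isit F k z s'" "s \<in> D" "s' \<in> D" "k \<in> D" and i: "i \<in> D" "i \<preceq> k"
  shows "nth s i = nth s' i"
proof -
  have "i \<preceq> k \<longrightarrow> nth s i = nth s' i"
  proof (rule ind[of "\<lambda>i. i \<preceq> k \<longrightarrow> nth s i = nth s' i"])
    show "Df (\<lambda>e. e 0 \<preceq> k \<longrightarrow> nth s (e 0) = nth s' (e 0))" using assms by (intro cintro)
    show "\<zero> \<preceq> k \<longrightarrow> nth s \<zero> = nth s' \<zero>" using assms by (simp add: isit_def)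
    fix j assume "j \<in> D" "j \<preceq> k \<longrightarrow> nth s j = nth s' j"
    then show "\<S> j \<preceq> k \<longrightarrow> nth s (\<S> j) = nth s' (\<S> j)" using assms lt_imp_le[of j k] by (simp add: isit_def lt_le[symmetric])
  qed (rule i)
  then show ?thesis using i by simp
qed

lemma it_eq: assumes "isit F k z s" "s \<in> D" "k \<in> D" shows "it F k z = nth s k"
  unfolding it_def
proof (rule the_equality)
  show "\<exists>s'\<in>D. isit F k z s' \<and> nth s' k = nth s k" using assms by blast
  fix y assume "\<exists>s'\<in>D. isit F k z s' \<and> nth s' k = y"
  then obtain s' where "s' \<in> D" "isit F k z s'" "nth s' k = y" by blast
  then show "y = nth s k" using isit_unique[OF \<open>isit F k z s'\<close> assms(1) _ assms(2,3,3)] by simp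
qed

lemma it_D: assumes "k \<in> D" "z \<in> D" shows "it F k z \<in> D"
proof -
  obtain s where "s \<in> D" "isit F k z s" using isit_ex[OF assms] by blast
  then show ?thesis using it_eq[of k z s] assms by simp
qed

lemma it_0: assumes "z \<in> D" shows "it F \<zero> z = z"
proof -
  obtain s where "s \<in> D" "isit F \<zero> z s" using isit_ex[OF D0 assms] by blast
  then show ?thesis using it_eq[of "\<zero>" z s] by (simp add: isit_def)
qed

lemma it_S: assumes "k \<in> D" "z \<in> D" shows "it F (\<S> k) z = F (it F k z)"
proof -
  obtain s where s: "s \<in> D" "isit F (\<S> k) z s" using isit_ex[OF DS[OF assms(1)] assms(2)] by blast
  then have "isit F k z s" using assms by (auto simp: isit_def lt_imp_le)
  then show ?thesis using it_eq[of "\<S> k" z s] it_eq[of k z s] s assms by (auto simp: isit_def)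
qed

lemma it_graph: assumes "k \<in> D" "z \<in> D" "y \<in> D" shows "y = it F k z \<longleftrightarrow> (\<exists>s\<in>D. isit F k z s \<and> nth s k = y)"
  using it_eq[of k z] isit_ex[of k z] assms by metis

end

end

context lev begin

text \<open>The graph asserts the existence of a coded run, so it is \<open>\<Sigma>\<close>; since
  the iteration is total, \<open>Fn_sgI\<close> makes it \<open>\<Delta>\<close>.\<close>

lemma Fn_it:
  assumes F: "R.Fn (\<lambda>e. F (e 0))" and f: "R.Fn f" and g: "R.Fn g"
  shows "R.Fn (\<lambda>e. it F (f e) (g e))"
proof -
  note FD = R.Fn_Df[OF F]
  have "SG (\<lambda>e. \<exists>s\<in>D. nth s \<zero> = e 2 \<and> (\<forall>i\<in>D. i \<prec> e 1 \<longrightarrow> nth s (\<S> i) = F (nth s i)) \<and> nth s (e 1) = e 0)"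
    by (intro sg_ex cintro R.Fn_f1[OF F])
  then have "SG (\<lambda>e. e 0 = it F (e 1) (e 2))"
  proof (rule Sg_cong)
    fix e assume "e \<in> asg"
    then have "e 0 \<in> D" "e 1 \<in> D" "e 2 \<in> D" by (auto simp: asgD)
    from it_graph[OF FD this(2,3,1)]
    show "(\<exists>s\<in>D. nth s \<zero> = e 2 \<and> (\<forall>i\<in>D. i \<prec> e 1 \<longrightarrow> nth s (\<S> i) = F (nth s i)) \<and> nth s (e 1) = e 0)
      = (e 0 = it F (e 1) (e 2))" unfolding isit_def by blast
  qed
  then have "R.Fn (\<lambda>e. it F (e 0) (e 1))"
    by (intro Fn_sgI) (simp_all add: it_D[OF FD] asgD numeral_2_eq_2)
  then show ?thesis using f g by (rule R.Fn_f2)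
qed

end

context pa begin

lemma Df_Fn_it:
  assumes F: "Df.Fn (\<lambda>e. F (e 0))" and f: "Df.Fn f" and g: "Df.Fn g"
  shows "Df.Fn (\<lambda>e. it F (f e) (g e))"
proof -
  have "Df (\<lambda>e. \<exists>s\<in>D. nth s \<zero> = e 2 \<and> (\<forall>i\<in>D. i \<prec> e 1 \<longrightarrow> nth s (\<S> i) = F (nth s i)) \<and> nth s (e 1) = e 0)"
    by (intro cintro Df.Fn_f1[OF F])
  then have "Df (\<lambda>e. e 0 = it F (e 1) (e 2))"
  proof (rule Df.c_cong)
    fix e assume "e \<in> asg"
    then have "e 0 \<in> D" "e 1 \<in> D" "e 2 \<in> D" by (auto simp: asgD)
    from it_graph[OF F this(2,3,1)]
    show "(\<exists>s\<in>D. nth s \<zero> = e 2 \<and> (\<forall>i\<in>D. i \<prec> e 1 \<longrightarrow> nth s (\<S> i) = F (nth s i)) \<and> nth s (e 1) = e 0)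
      = (e 0 = it F (e 1) (e 2))" unfolding isit_def by blast
  qed
  then have "Df.Fn (\<lambda>e. it F (e 0) (e 1))"
    unfolding Df.Fn_def by (simp add: it_D[OF F] asgD numeral_2_eq_2)
  then show ?thesis using f g by (rule Df.Fn_f2)
qed

end

subsection \<open>Universal formulas\<close>

context pa begin

primrec nm :: "nat \<Rightarrow> 'a" where "nm 0 = \<zero>" | "nm (Suc i) = \<S> (nm i)"

lemma nm_D [simp]: "nm i \<in> D" by (induction i) auto

lemma nm_eq [simp]: "nm i = nm j \<longleftrightarrow> i = j"
proof (induction i arbitrary: j)
  case 0 show ?case using S_nz by (cases j) (auto dest: sym)
next
  case (Suc i) then show ?case using S_nz by (cases j) auto
qed

abbreviation T where "T s q z v \<equiv> Mem (pr q (pr z v)) s"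

text \<open>Programs of a small functional language are coded by numbers; a code is a tag with two
  operands. \<open>J s q z v\<close> says that the result \<open>v\<close> of program \<open>q\<close> on input \<open>z\<close> is justified by
  the triples in the finite set \<open>s\<close>. Tag 8 is unbounded search for the value 1.\<close>

definition mk :: "nat \<Rightarrow> 'a \<Rightarrow> 'a \<Rightarrow> 'a" where "mk i a b = pr (nm i) (pr a b)"

definition J :: "'a \<Rightarrow> 'a \<Rightarrow> 'a \<Rightarrow> 'a \<Rightarrow> bool" where
  "J s q z v \<longleftrightarrow>
     fs q = nm 0 \<and> v = fs (sn q)
   \<or> fs q = nm 1 \<and> v = fs z
   \<or> fs q = nm 2 \<and> v = sn z
   \<or> fs q = nm 3 \<and> v = fs z \<oplus> sn z
   \<or> fs q = nm 4 \<and> v = fs z \<otimes> sn z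
   \<or> fs q = nm 5 \<and> v = (if fs z \<prec> sn z then nm 1 else nm 0)
   \<or> fs q = nm 6 \<and> (\<exists>w\<in>D. w \<prec> s \<and> T s (sn (sn q)) z w \<and> T s (fs (sn q)) w v)
   \<or> fs q = nm 7 \<and> (\<exists>x\<in>D. x \<prec> s \<and> (\<exists>y\<in>D. y \<prec> s \<and> T s (fs (sn q)) z x \<and> T s (sn (sn q)) z y \<and> v = pr x y))
   \<or> fs q = nm 8 \<and> T s (fs (sn q)) (pr v z) (nm 1) \<and> (\<forall>w\<in>D. w \<prec> v \<longrightarrow> T s (fs (sn q)) (pr w z) (nm 0))"

text \<open>Triples may support one another freely inside \<open>s\<close>. A justification refers
  only to operands of the program, whose codes are smaller than its own, so it cannot be
  circular.\<close>

definition der :: "'a \<Rightarrow> bool" where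
  "der s \<longleftrightarrow> (\<forall>t\<in>D. t \<prec> s \<longrightarrow> Mem t s \<longrightarrow> t = pr (fs t) (pr (fs (sn t)) (sn (sn t)))
      \<and> J s (fs t) (fs (sn t)) (sn (sn t)))"

end

context calc begin

lemma Fn_nm [cintro]: "Fn (\<lambda>e. nm i)" using Fn_0 by (induction i) (simp_all add: Fn_S)

lemma c_der [cintro]: "Fn f \<Longrightarrow> C (\<lambda>e. der (f e))"
proof (rule c_r1[of der])
  show "C (\<lambda>e. der (e 0))" unfolding der_def J_def by (intro cintro)
qed

end

context pa begin

lemma T_lt: "T s q z v \<Longrightarrow> s \<in> D \<Longrightarrow> q \<in> D \<Longrightarrow> z \<in> D \<Longrightarrow> v \<in> D \<Longrightarrow> v \<prec> s"
  using Mem_lt[of "pr q (pr z v)" s] lt_trans[of "pr z v" "pr q (pr z v)" s] lt_trans[of v "pr z v" s] by simp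

lemma J_mono:
  assumes "J s q z v" "\<And>t. t \<in> D \<Longrightarrow> Mem t s \<Longrightarrow> Mem t s'" "s \<in> D" "s' \<in> D" "q \<in> D" "z \<in> D" "v \<in> D"
  shows "J s' q z v"
proof -
  have T: "T s q z v \<Longrightarrow> T s' q z v" if "q \<in> D" "z \<in> D" "v \<in> D" for q z v using that assms by simp
  have lt: "w \<prec> s'" if "w \<in> D" "T s q z w" "q \<in> D" "z \<in> D" for w q z
    by (rule T_lt[OF T[OF that(3,4,1,2)]]) (use that assms in auto)
  have a: "fs (sn q) \<in> D" "sn (sn q) \<in> D" using assms by auto
  have 6: "\<exists>w\<in>D. w \<prec> s' \<and> T s' (sn (sn q)) z w \<and> T s' (fs (sn q)) w v"
    if "\<exists>w\<in>D. w \<prec> s \<and> T s (sn (sn q)) z w \<and> T s (fs (sn q)) w v"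
    using that T lt a assms(6,7) by metis
  have 7: "\<exists>x\<in>D. x \<prec> s' \<and> (\<exists>y\<in>D. y \<prec> s' \<and> T s' (fs (sn q)) z x \<and> T s' (sn (sn q)) z y \<and> v = pr x y)"
    if "\<exists>x\<in>D. x \<prec> s \<and> (\<exists>y\<in>D. y \<prec> s \<and> T s (fs (sn q)) z x \<and> T s (sn (sn q)) z y \<and> v = pr x y)"
    using that T lt a assms(6,7) by metis
  have 8: "T s' (fs (sn q)) (pr v z) (nm 1) \<and> (\<forall>w\<in>D. w \<prec> v \<longrightarrow> T s' (fs (sn q)) (pr w z) (nm 0))"
    if "T s (fs (sn q)) (pr v z) (nm 1) \<and> (\<forall>w\<in>D. w \<prec> v \<longrightarrow> T s (fs (sn q)) (pr w z) (nm 0))"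
    using that T a assms by (auto simp del: nm.simps)
  show ?thesis using assms(1) 6 7 8 unfolding J_def by metis
qed

lemma der_J:
  assumes "der s" "T s q z v" "s \<in> D" "q \<in> D" "z \<in> D" "v \<in> D" shows "J s q z v"
  using assms Mem_lt[of "pr q (pr z v)" s] unfolding der_def by fastforce

text \<open>A search needs the computations for all smaller candidates in one set, and there may be
  nonstandardly many of them. Hence unions of bounded definable families, not only of two
  sets.\<close>

lemma der_Union:
  assumes P: "Df (\<lambda>e. P (e 0))" and B: "B \<in> D" and d: "\<And>s. s \<in> D \<Longrightarrow> P s \<Longrightarrow> der s"
  shows "\<exists>u\<in>D. der u \<and> (\<forall>t\<in>D. Mem t u \<longleftrightarrow> (\<exists>s\<in>D. s \<prec> B \<and> P s \<and> Mem t s))"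
proof -
  have "Df (\<lambda>e. \<exists>s\<in>D. s \<prec> B \<and> P s \<and> Mem (e 0) s)" using B by (intro cintro Df.c_r1[OF P])
  from comprehension[of "\<lambda>t. \<exists>s\<in>D. s \<prec> B \<and> P s \<and> Mem t s", OF this B]
  obtain u where u: "u \<in> D" "\<And>t. t \<in> D \<Longrightarrow> Mem t u \<longleftrightarrow> t \<prec> B \<and> (\<exists>s\<in>D. s \<prec> B \<and> P s \<and> Mem t s)" by auto
  have m: "Mem t u \<longleftrightarrow> (\<exists>s\<in>D. s \<prec> B \<and> P s \<and> Mem t s)" if t: "t \<in> D" for t
    using u(2)[OF t] Mem_lt[OF _ t] lt_trans[of t _ B] B t by blast
  have "der u" unfolding der_def
  proof (intro ballI impI)
    fix t assume t: "t \<in> D" "t \<prec> u" "Mem t u"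
    then obtain s where s: "s \<in> D" "s \<prec> B" "P s" "Mem t s" using m by auto
    have 1: "t = pr (fs t) (pr (fs (sn t)) (sn (sn t)))" "J s (fs t) (fs (sn t)) (sn (sn t))"
      using d[OF s(1,3)] s t Mem_lt[OF s(4) t(1) s(1)] unfolding der_def by auto
    have "J u (fs t) (fs (sn t)) (sn (sn t))"
      by (rule J_mono[OF 1(2)]) (use m s u t in auto)
    with 1(1) show "t = pr (fs t) (pr (fs (sn t)) (sn (sn t))) \<and> J u (fs t) (fs (sn t)) (sn (sn t))" ..
  qed
  then show ?thesis using u(1) m by blast
qed

lemma der_un:
  assumes "der s" "der s'" "s \<in> D" "s' \<in> D"
  shows "\<exists>u\<in>D. der u \<and> (\<forall>t\<in>D. Mem t u \<longleftrightarrow> Mem t s \<or> Mem t s')"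
proof -
  have "Df (\<lambda>e. e 0 = s \<or> e 0 = s')" using assms by (intro cintro)
  moreover have "s \<prec> \<S> (s \<oplus> s')" "s' \<prec> \<S> (s \<oplus> s')" using assms by auto
  ultimately show ?thesis
    using der_Union[of "\<lambda>x. x = s \<or> x = s'" "\<S> (s \<oplus> s')"] assms by (smt (verit) DS Dpl)
qed

lemma der_insert:
  assumes "der u" "J u q z v" "u \<in> D" "q \<in> D" "z \<in> D" "v \<in> D"
  shows "\<exists>s\<in>D. der s \<and> T s q z v"
proof -
  let ?t = "pr q (pr z v)"
  have "Df (\<lambda>e. Mem (e 0) u \<or> e 0 = ?t)" using assms by (intro cintro) auto
  from comprehension[of "\<lambda>x. Mem x u \<or> x = ?t", OF this, of "\<S> (u \<oplus> ?t)"]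
  obtain s where s: "s \<in> D" "\<And>x. x \<in> D \<Longrightarrow> Mem x s \<longleftrightarrow> x \<prec> \<S> (u \<oplus> ?t) \<and> (Mem x u \<or> x = ?t)"
    using assms by auto
  have m: "Mem x s \<longleftrightarrow> Mem x u \<or> x = ?t" if "x \<in> D" for x
  proof -
    have "x \<preceq> u \<oplus> ?t" if "Mem x u"
      using Mem_lt[OF that] \<open>x \<in> D\<close> assms lt_imp_le le_trans[of x u "u \<oplus> ?t"] by simp
    then show ?thesis using s(2)[OF that] that assms by auto
  qed
  have J: "J s q z v" if "J u q z v" "q \<in> D" "z \<in> D" "v \<in> D" for q z v
    by (rule J_mono[OF that(1)]) (use m that assms s in auto)
  have "der s" unfolding der_def
  proof (intro ballI impI)
    fix t assume t: "t \<in> D" "t \<prec> s" "Mem t s"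
    then consider "Mem t u" | "t = ?t" using m by auto
    then show "t = pr (fs t) (pr (fs (sn t)) (sn (sn t))) \<and> J s (fs t) (fs (sn t)) (sn (sn t))"
    proof cases
      case 1
      then show ?thesis using assms(1) t Mem_lt[OF 1 t(1) assms(3)] J unfolding der_def by simp
    next
      case 2 then show ?thesis using J assms by simp
    qed
  qed
  then show ?thesis using s(1) m assms by auto
qed

lemma der_empty: "\<exists>u\<in>D. der u"
  using der_Union[of "\<lambda>x. False" "\<zero>"] Df.c_not[OF Df.c_True] by auto

text \<open>The result is required to be the same in every derivation, so that uniqueness is
  inherited by programs composed of \<open>q\<close>.\<close>

definition cmp :: "'a \<Rightarrow> ('a \<Rightarrow> 'a) \<Rightarrow> bool" where
  "cmp q F \<longleftrightarrow> q \<in> D \<and> (\<forall>z\<in>D. F z \<in> D) \<and>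
     (\<forall>z\<in>D. (\<exists>s\<in>D. der s \<and> T s q z (F z)) \<and> (\<forall>s\<in>D. \<forall>v\<in>D. der s \<longrightarrow> T s q z v \<longrightarrow> v = F z))"

lemma cmpD: assumes "cmp q F"
  shows "q \<in> D" "z \<in> D \<Longrightarrow> F z \<in> D" "z \<in> D \<Longrightarrow> \<exists>s\<in>D. der s \<and> T s q z (F z)"
    "z \<in> D \<Longrightarrow> s \<in> D \<Longrightarrow> v \<in> D \<Longrightarrow> der s \<Longrightarrow> T s q z v \<Longrightarrow> v = F z"
  using assms unfolding cmp_def by blast+

lemma cmpI:
  assumes "q \<in> D" "\<And>z. z \<in> D \<Longrightarrow> F z \<in> D" "\<And>z. z \<in> D \<Longrightarrow> \<exists>u\<in>D. der u \<and> J u q z (F z)"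
    "\<And>z s v. z \<in> D \<Longrightarrow> s \<in> D \<Longrightarrow> v \<in> D \<Longrightarrow> der s \<Longrightarrow> J s q z v \<Longrightarrow> v = F z"
  shows "cmp q F"
  unfolding cmp_def
proof (intro conjI ballI impI assms(1,2))
  fix z assume z: "z \<in> D"
  show "\<exists>s\<in>D. der s \<and> T s q z (F z)" using assms(3)[OF z] der_insert[OF _ _ _ assms(1) z assms(2)[OF z]] by blast
  fix s v assume "s \<in> D" "v \<in> D" "der s" "T s q z v"
  then show "v = F z" using assms(4)[OF z, of s v] der_J[of s q z v] assms(1) z by blast
qed

lemma cmp_Fn: assumes "cmp q F" shows "Df.Fn (\<lambda>e. F (e 0))"
proof -
  have "Df (\<lambda>e. \<exists>s\<in>D. der s \<and> T s q (e 1) (e 0))" using cmpD(1)[OF assms] by (intro cintro)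
  then have "Df (\<lambda>e. e 0 = F (e 1))"
  proof (rule Df.c_cong)
    fix e assume "e \<in> asg"
    then have "e 0 \<in> D" "e 1 \<in> D" by (auto simp: asgD)
    then show "(\<exists>s\<in>D. der s \<and> T s q (e 1) (e 0)) = (e 0 = F (e 1))"
      using cmpD(3)[OF assms \<open>e 1 \<in> D\<close>] cmpD(4)[OF assms \<open>e 1 \<in> D\<close> _ \<open>e 0 \<in> D\<close>] by metis
  qed
  then show ?thesis using cmpD(2)[OF assms] by (simp add: Df.Fn_def asgD)
qed

lemma mk_D [simp]: "a \<in> D \<Longrightarrow> b \<in> D \<Longrightarrow> mk i a b \<in> D" by (simp add: mk_def)

lemma J_mk:
  assumes "a \<in> D" "b \<in> D"
  shows "J s (mk 0 a b) z v \<longleftrightarrow> v = a" "J s (mk 1 a b) z v \<longleftrightarrow> v = fs z" "J s (mk 2 a b) z v \<longleftrightarrow> v = sn z"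
    "J s (mk 3 a b) z v \<longleftrightarrow> v = fs z \<oplus> sn z" "J s (mk 4 a b) z v \<longleftrightarrow> v = fs z \<otimes> sn z"
    "J s (mk 5 a b) z v \<longleftrightarrow> v = (if fs z \<prec> sn z then nm 1 else nm 0)"
    "J s (mk 6 a b) z v \<longleftrightarrow> (\<exists>w\<in>D. w \<prec> s \<and> T s b z w \<and> T s a w v)"
    "J s (mk 7 a b) z v \<longleftrightarrow> (\<exists>x\<in>D. x \<prec> s \<and> (\<exists>y\<in>D. y \<prec> s \<and> T s a z x \<and> T s b z y \<and> v = pr x y))"
    "J s (mk 8 a b) z v \<longleftrightarrow> T s a (pr v z) (nm 1) \<and> (\<forall>w\<in>D. w \<prec> v \<longrightarrow> T s a (pr w z) (nm 0))"
  using assms unfolding J_def mk_def by (simp_all del: nm.simps)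

text \<open>Reads \<open>z\<close> as a stack, so that one input number carries a whole
  assignment.\<close>

definition dec :: "'a \<Rightarrow> nat \<Rightarrow> 'a" where "dec z i = fs ((sn ^^ i) z)"

lemma snpow_D: "z \<in> D \<Longrightarrow> (sn ^^ i) z \<in> D" by (induction i) auto
lemma dec_asg: "z \<in> D \<Longrightarrow> dec z \<in> asg" by (auto simp: asg_def dec_def snpow_D)
lemma dec_pr: "a \<in> D \<Longrightarrow> z \<in> D \<Longrightarrow> dec (pr a z) = case_nat a (dec z)"
  by (auto simp: fun_eq_iff dec_def funpow_Suc_right simp del: funpow.simps split: nat.split)

text \<open>Universal for level \<open>k + 1\<close>. At the bottom it says that program
  \<open>q\<close> halts on \<open>z\<close>; each further level adds one quantifier whose value is
  pushed onto the input stack.\<close>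

primrec U :: "nat \<Rightarrow> 'a \<Rightarrow> 'a \<Rightarrow> bool" where
  "U 0 q z = (\<exists>s\<in>D. \<exists>v\<in>D. der s \<and> T s q z v)"
| "U (Suc k) q z = (\<exists>a\<in>D. \<not> U k q (pr a z))"

end

text \<open>Closure under \<open>nm\<close> and \<open>pr\<close> puts the codes of all programs with parameters in \<open>CQ\<close>
  into \<open>CQ\<close>.\<close>

locale programs = pa M for M :: "'a struc" +
  fixes CQ :: "'a set"
  assumes CQD: "CQ \<subseteq> D" and CQ_nm: "nm i \<in> CQ" and CQ_pr: "a \<in> CQ \<Longrightarrow> b \<in> CQ \<Longrightarrow> pr a b \<in> CQ"
begin

definition cpt :: "('a \<Rightarrow> 'a) \<Rightarrow> bool" where "cpt F \<longleftrightarrow> (\<exists>q\<in>CQ. cmp q F)"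

lemma CQ_0 [simp]: "\<zero> \<in> CQ" using CQ_nm[of 0] by simp

lemma mk_C: "a \<in> CQ \<Longrightarrow> b \<in> CQ \<Longrightarrow> mk i a b \<in> CQ" unfolding mk_def by (intro CQ_pr CQ_nm)

lemma cpt_basic:
  "c \<in> CQ \<Longrightarrow> cpt (\<lambda>z. c)" "cpt fs" "cpt sn" "cpt (\<lambda>z. fs z \<oplus> sn z)" "cpt (\<lambda>z. fs z \<otimes> sn z)"
  "cpt (\<lambda>z. if fs z \<prec> sn z then nm 1 else nm 0)"
proof -
  have *: "cpt F" if "\<And>s z v. J s (mk i a \<zero>) z v \<longleftrightarrow> v = F z" "\<And>z. z \<in> D \<Longrightarrow> F z \<in> D" "a \<in> CQ" for i F a
  proof -
    have "a \<in> D" using that(3) CQD by blast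
    note aD = this
    show ?thesis unfolding cpt_def
      by (rule bexI[of _ "mk i a \<zero>"], rule cmpI) (use aD that mk_C[of a "\<zero>" i] der_empty in auto)
  qed
  show "cpt (\<lambda>z. c)" if c: "c \<in> CQ"
  proof -
    have "c \<in> D" using c CQD by blast
    then show ?thesis by (intro *[of 0 c] c) (simp_all only: J_mk D0)
  qed
  show "cpt fs" by (rule *[of 1 "\<zero>"]) (simp_all only: J_mk CQ_0 D0 fs_D)
  show "cpt sn" by (rule *[of 2 "\<zero>"]) (simp_all only: J_mk CQ_0 D0 sn_D)
  show "cpt (\<lambda>z. fs z \<oplus> sn z)" by (rule *[of 3 "\<zero>"]) (simp_all only: J_mk CQ_0 D0 fs_D sn_D Dpl)
  show "cpt (\<lambda>z. fs z \<otimes> sn z)" by (rule *[of 4 "\<zero>"]) (simp_all only: J_mk CQ_0 D0 fs_D sn_D Dtm)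
  show "cpt (\<lambda>z. if fs z \<prec> sn z then nm 1 else nm 0)"
    by (rule *[of 5 "\<zero>"]) (auto simp only: J_mk CQ_0 D0 fs_D sn_D nm_D split: if_split)
qed

lemma cpt_comp: assumes "cpt F" "cpt G" shows "cpt (\<lambda>z. F (G z))"
proof -
  obtain a b where C: "a \<in> CQ" "b \<in> CQ" and a: "cmp a F" and b: "cmp b G" using assms unfolding cpt_def by blast
  note aD = cmpD[OF a] and bD = cmpD[OF b]
  have "cmp (mk 6 a b) (\<lambda>z. F (G z))"
  proof (rule cmpI)
    show "mk 6 a b \<in> D" using aD(1) bD(1) by simp
    fix z assume z: "z \<in> D" then show "F (G z) \<in> D" using aD(2) bD(2) by blast
    obtain s s' where s: "s \<in> D" "der s" "T s b z (G z)" "s' \<in> D" "der s'" "T s' a (G z) (F (G z))"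
      using aD(3) bD(3) bD(2) z by meson
    obtain u where u: "u \<in> D" "der u" "\<And>t. t \<in> D \<Longrightarrow> Mem t u \<longleftrightarrow> Mem t s \<or> Mem t s'"
      using der_un[OF s(2,5,1,4)] by blast
    have "T u b z (G z)" "T u a (G z) (F (G z))" using u(3) s z aD(1,2) bD(1,2) by auto
    moreover have "G z \<prec> u" using T_lt[OF calculation(1) u(1) bD(1) z bD(2)[OF z]] .
    ultimately have "J u (mk 6 a b) z (F (G z))" unfolding J_mk(7)[OF aD(1) bD(1)] using bD(2)[OF z] by metis
    then show "\<exists>u\<in>D. der u \<and> J u (mk 6 a b) z (F (G z))" using u by blast
  next
    fix z s v assume "z \<in> D" "s \<in> D" "v \<in> D" "der s" "J s (mk 6 a b) z v"
    then show "v = F (G z)" unfolding J_mk(7)[OF aD(1) bD(1)] by (metis aD(4) bD(4))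
  qed
  then show ?thesis using mk_C[OF C, of 6] unfolding cpt_def by blast
qed

lemma cpt_pair: assumes "cpt F" "cpt G" shows "cpt (\<lambda>z. pr (F z) (G z))"
proof -
  obtain a b where C: "a \<in> CQ" "b \<in> CQ" and a: "cmp a F" and b: "cmp b G" using assms unfolding cpt_def by blast
  note aD = cmpD[OF a] and bD = cmpD[OF b]
  have "cmp (mk 7 a b) (\<lambda>z. pr (F z) (G z))"
  proof (rule cmpI)
    show "mk 7 a b \<in> D" using aD(1) bD(1) by simp
    fix z assume z: "z \<in> D" then show "pr (F z) (G z) \<in> D" using aD(2) bD(2) by simp
    obtain s s' where s: "s \<in> D" "der s" "T s b z (G z)" "s' \<in> D" "der s'" "T s' a z (F z)"
      using aD(3) bD(3) z by meson
    obtain u where u: "u \<in> D" "der u" "\<And>t. t \<in> D \<Longrightarrow> Mem t u \<longleftrightarrow> Mem t s \<or> Mem t s'"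
      using der_un[OF s(2,5,1,4)] by blast
    have "T u b z (G z)" "T u a z (F z)" using u(3) s z aD(1,2) bD(1,2) by auto
    moreover have "G z \<prec> u" "F z \<prec> u"
      using T_lt[OF calculation(1) u(1) bD(1) z bD(2)[OF z]] T_lt[OF calculation(2) u(1) aD(1) z aD(2)[OF z]] by auto
    ultimately have "J u (mk 7 a b) z (pr (F z) (G z))" unfolding J_mk(8)[OF aD(1) bD(1)]
      using bD(2)[OF z] aD(2)[OF z] by metis
    then show "\<exists>u\<in>D. der u \<and> J u (mk 7 a b) z (pr (F z) (G z))" using u by blast
  next
    fix z s v assume "z \<in> D" "s \<in> D" "v \<in> D" "der s" "J s (mk 7 a b) z v"
    then show "v = pr (F z) (G z)" unfolding J_mk(8)[OF aD(1) bD(1)] by (metis aD(4) bD(4))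
  qed
  then show ?thesis using mk_C[OF C, of 7] unfolding cpt_def by blast
qed

definition ch :: "bool \<Rightarrow> 'a" where "ch b = (if b then nm 1 else nm 0)"
lemma ch_D [simp]: "ch b \<in> D" by (simp add: ch_def del: nm.simps)
lemma ch_eq [simp]: "ch b = nm 1 \<longleftrightarrow> b" "ch b = nm 0 \<longleftrightarrow> \<not> b" by (auto simp: ch_def simp del: nm.simps)

lemma cpt_lt: assumes "cpt F" "cpt G" shows "cpt (\<lambda>z. ch (F z \<prec> G z))"
proof -
  obtain a b where "cmp a F" "cmp b G" using assms unfolding cpt_def by blast
  then have D: "F z \<in> D" "G z \<in> D" if "z \<in> D" for z using cmpD(2) that by auto
  have "cpt (\<lambda>z. if fs (pr (F z) (G z)) \<prec> sn (pr (F z) (G z)) then nm 1 else nm 0)"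
    by (rule cpt_comp[OF cpt_basic(6) cpt_pair[OF assms]])
  then obtain q where q: "q \<in> CQ" and "cmp q (\<lambda>z. if fs (pr (F z) (G z)) \<prec> sn (pr (F z) (G z)) then nm 1 else nm 0)"
    unfolding cpt_def by blast
  then have "cmp q (\<lambda>z. ch (F z \<prec> G z))" unfolding cmp_def ch_def using D by (simp del: nm.simps cong: ball_cong)
  then show ?thesis using q unfolding cpt_def by blast
qed

lemma cpt_cong: assumes "cpt F" "\<And>z. z \<in> D \<Longrightarrow> F z = G z" shows "cpt G"
  using assms unfolding cpt_def cmp_def by (metis (no_types, lifting))

lemma cpt_D: "cpt F \<Longrightarrow> z \<in> D \<Longrightarrow> F z \<in> D" unfolding cpt_def using cmpD(2) by blast

lemma cpt_pl: assumes "cpt F" "cpt G" shows "cpt (\<lambda>z. F z \<oplus> G z)"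
  by (rule cpt_cong[OF cpt_comp[OF cpt_basic(4) cpt_pair[OF assms]]]) (simp add: cpt_D assms)
lemma cpt_tm: assumes "cpt F" "cpt G" shows "cpt (\<lambda>z. F z \<otimes> G z)"
  by (rule cpt_cong[OF cpt_comp[OF cpt_basic(5) cpt_pair[OF assms]]]) (simp add: cpt_D assms)

lemma cpt_not: assumes "cpt (\<lambda>z. ch (P z))" shows "cpt (\<lambda>z. ch (\<not> P z))"
proof (rule cpt_cong[OF cpt_lt[OF assms cpt_basic(1)[OF CQ_nm[of 1]]]])
  fix z
  have "nm 0 \<prec> nm 1" by simp
  moreover have "\<not> nm 1 \<prec> nm 1" by (rule lt_irrefl) simp
  ultimately show "ch (ch (P z) \<prec> nm 1) = ch (\<not> P z)" by (cases "P z") (simp_all add: ch_def del: nm.simps not_lt)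
qed

lemma cpt_and: assumes "cpt (\<lambda>z. ch (P z))" "cpt (\<lambda>z. ch (P' z))" shows "cpt (\<lambda>z. ch (P z \<and> P' z))"
proof (rule cpt_cong[OF cpt_tm[OF assms]])
  fix z show "ch (P z) \<otimes> ch (P' z) = ch (P z \<and> P' z)"
    by (cases "P z"; cases "P' z") (simp_all add: ch_def tm_S)
qed

lemma cpt_or: assumes "cpt (\<lambda>z. ch (P z))" "cpt (\<lambda>z. ch (P' z))" shows "cpt (\<lambda>z. ch (P z \<or> P' z))"
  using cpt_not[OF cpt_and[OF cpt_not[OF assms(1)] cpt_not[OF assms(2)]]] by simp

lemma cpt_eq: assumes "cpt F" "cpt G" shows "cpt (\<lambda>z. ch (F z = G z))"
proof (rule cpt_cong[OF cpt_and[OF cpt_not[OF cpt_lt[OF assms]] cpt_not[OF cpt_lt[OF assms(2,1)]]]])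
  fix z assume "z \<in> D"
  then have "F z \<in> D" "G z \<in> D" using assms cpt_D by auto
  then have "(\<not> F z \<prec> G z \<and> \<not> G z \<prec> F z) = (F z = G z)" using le_antisym by auto
  then show "ch (\<not> F z \<prec> G z \<and> \<not> G z \<prec> F z) = ch (F z = G z)" by simp
qed

text \<open>For existence, collection bounds derivations for all candidates up to the least
  solution, and their union supports the search. The second part does not presuppose a solution, so
  the search halts precisely when there is one.\<close>

lemma mu:
  assumes a: "cmp a (\<lambda>s. ch (P s))" and z: "z \<in> D"
  shows "x \<in> D \<Longrightarrow> P (pr x z) \<Longrightarrow> \<exists>u\<in>D. der u \<and> J u (mk 8 a a) z (lst (\<lambda>x. P (pr x z)))"
    and "s \<in> D \<Longrightarrow> v \<in> D \<Longrightarrow> der s \<Longrightarrow> J s (mk 8 a a) z v \<Longrightarrow> P (pr v z) \<and> v = lst (\<lambda>x. P (pr x z))"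
    and "Df (\<lambda>e. P (pr (e 0) z))"
proof -
  note aD = cmpD[OF a]
  have P: "Df (\<lambda>e. P (pr (e 0) z))"
  proof (rule Df.c_cong)
    show "Df (\<lambda>e. ch (P (pr (e 0) z)) = nm 1)" using z by (intro cintro Df.Fn_f1[OF cmp_Fn[OF a]])
  qed (rule ch_eq(1))
  then show "Df (\<lambda>e. P (pr (e 0) z))" .
  show "\<exists>u\<in>D. der u \<and> J u (mk 8 a a) z (lst (\<lambda>x. P (pr x z)))" if x: "x \<in> D" "P (pr x z)"
  proof -
    note l = lst[OF P x]
    let ?l = "lst (\<lambda>x. P (pr x z))"
    have d: "Df (\<lambda>e. der (e 1) \<and> T (e 1) a (pr (e 0) z) (ch (P (pr (e 0) z))))"
      using z aD(1) by (intro cintro Df.Fn_f1[OF cmp_Fn[OF a]])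
    obtain B where B: "B \<in> D" "\<And>i. i \<in> D \<Longrightarrow> i \<prec> \<S> ?l \<Longrightarrow> \<exists>s\<in>D. s \<prec> B \<and> der s \<and> T s a (pr i z) (ch (P (pr i z)))"
      using collection[of "\<lambda>i s. der s \<and> T s a (pr i z) (ch (P (pr i z)))", OF d, of "\<S> ?l"] aD(3) z l(1) by auto
    have "Df (\<lambda>e. der (e 0))" by (intro cintro)
    from der_Union[of der, OF this B(1)] obtain u where u: "u \<in> D" "der u"
      "\<And>t. t \<in> D \<Longrightarrow> Mem t u \<longleftrightarrow> (\<exists>s\<in>D. s \<prec> B \<and> der s \<and> Mem t s)" by auto
    have Tu: "T u a (pr i z) (ch (P (pr i z)))" if "i \<in> D" "i \<preceq> ?l" for i
      using B(2)[of i] u(3)[of "pr a (pr (pr i z) (ch (P (pr i z))))"] that l(1) z aD(1) by auto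
    have 1: "T u a (pr ?l z) (nm 1)" using Tu[OF l(1) le_refl] l(2) by (simp add: ch_def del: nm.simps)
    have "T u a (pr w z) (nm 0)" if "w \<in> D" "w \<prec> ?l" for w
      using Tu[OF that(1) lt_imp_le[OF that(2)]] l(3)[OF that] by (simp add: ch_def del: nm.simps)
    with 1 u show ?thesis unfolding J_mk(9)[OF aD(1) aD(1)] by metis
  qed
  show "P (pr v z) \<and> v = lst (\<lambda>x. P (pr x z))" if "s \<in> D" "v \<in> D" "der s" "J s (mk 8 a a) z v"
  proof -
    have 1: "T s a (pr v z) (nm 1)" "\<And>w. w \<in> D \<Longrightarrow> w \<prec> v \<Longrightarrow> T s a (pr w z) (nm 0)"
      using that(4) unfolding J_mk(9)[OF aD(1) aD(1)] by auto
    have "nm 1 = ch (P (pr v z))" by (rule aD(4)[OF _ that(1) _ that(3) 1(1)]) (use that z in auto)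
    then have p: "P (pr v z)" by (metis ch_eq(1))
    have "\<not> P (pr w z)" if "w \<in> D" "w \<prec> v" for w
    proof -
      have "nm 0 = ch (P (pr w z))" by (rule aD(4)[OF _ \<open>s \<in> D\<close> _ \<open>der s\<close> 1(2)[OF that]]) (use that z in auto)
      then show ?thesis by (metis ch_eq(2))
    qed
    then have "lst (\<lambda>x. P (pr x z)) = v" using p that by (intro lst_eq) auto
    with p show ?thesis by simp
  qed
qed

lemma cpt_mu:
  assumes P: "cpt (\<lambda>s. ch (P s))" and ex: "\<And>z. z \<in> D \<Longrightarrow> \<exists>x\<in>D. P (pr x z)"
  shows "cpt (\<lambda>z. lst (\<lambda>x. P (pr x z)))"
proof -
  obtain a where C: "a \<in> CQ" and a: "cmp a (\<lambda>s. ch (P s))" using P unfolding cpt_def by blast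
  have "cmp (mk 8 a a) (\<lambda>z. lst (\<lambda>x. P (pr x z)))"
  proof (rule cmpI)
    show "mk 8 a a \<in> D" using cmpD(1)[OF a] by simp
    fix z assume z: "z \<in> D"
    then obtain x where x: "x \<in> D" "P (pr x z)" using ex by blast
    show "lst (\<lambda>x. P (pr x z)) \<in> D" using lst(1)[OF mu(3)[OF a z] x] .
    show "\<exists>u\<in>D. der u \<and> J u (mk 8 a a) z (lst (\<lambda>x. P (pr x z)))" using mu(1)[OF a z x] .
  next
    fix z s v assume "z \<in> D" "s \<in> D" "v \<in> D" "der s" "J s (mk 8 a a) z v"
    then show "v = lst (\<lambda>x. P (pr x z))" using mu(2)[OF a, of z s v] by simp
  qed
  then show ?thesis using mk_C[OF C C, of 8] unfolding cpt_def by blast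
qed

text \<open>Bounded quantification is a search that always succeeds: \<open>R\<close> holds from the
  bound on, and a witness exists if the least solution stays below the bound.\<close>

lemma cpt_bex:
  assumes P: "cpt (\<lambda>s. ch (P (fs s) (sn s)))" and b: "cpt b"
  shows "cpt (\<lambda>z. ch (\<exists>a\<in>D. a \<prec> b z \<and> P a z))"
proof -
  define R where "R s \<longleftrightarrow> \<not> fs s \<prec> b (sn s) \<or> P (fs s) (sn s)" for s
  have R: "cpt (\<lambda>s. ch (R s))" unfolding R_def
    by (rule cpt_or[OF cpt_not[OF cpt_lt[OF cpt_basic(2) cpt_comp[OF b cpt_basic(3)]]] P])
  have bD: "b z \<in> D" if "z \<in> D" for z using cpt_D b that by auto
  have ex: "R (pr (b z) z)" if "z \<in> D" for z unfolding R_def using that bD[OF that] by simp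
  then have m: "cpt (\<lambda>z. lst (\<lambda>x. R (pr x z)))" using R bD by (intro cpt_mu) auto
  obtain a where a: "cmp a (\<lambda>s. ch (R s))" using R unfolding cpt_def by blast
  show ?thesis
  proof (rule cpt_cong[OF cpt_lt[OF m b]])
    fix z assume z: "z \<in> D"
    define m where "m = lst (\<lambda>x. R (pr x z))"
    note l = lst[OF mu(3)[OF a z] bD[OF z] ex[OF z], folded m_def]
    have RR: "R (pr x z) \<longleftrightarrow> \<not> x \<prec> b z \<or> P x z" if "x \<in> D" for x using that z by (simp add: R_def)
    have "(m \<prec> b z) = (\<exists>a\<in>D. a \<prec> b z \<and> P a z)"
    proof
      assume "m \<prec> b z"
      then show "\<exists>a\<in>D. a \<prec> b z \<and> P a z" using l(1,2) RR[OF l(1)] by blast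
    next
      assume "\<exists>a\<in>D. a \<prec> b z \<and> P a z"
      then obtain x where x: "x \<in> D" "x \<prec> b z" "P x z" by auto
      then have "m \<preceq> x" using l(4)[of x] RR[of x] by simp
      then show "m \<prec> b z" using le_lt_trans[of m x "b z"] x l(1) bD[OF z] by simp
    qed
    then show "ch (lst (\<lambda>x. R (pr x z)) \<prec> b z) = ch (\<exists>a\<in>D. a \<prec> b z \<and> P a z)" unfolding m_def by simp
  qed
qed

lemma cpt_term: "(\<And>v. cpt (c v)) \<Longrightarrow> cpt (\<lambda>z. eval_t M (\<lambda>v. c v z) t)"
proof (induction t)
  case (S t)
  then have "cpt (\<lambda>z. eval_t M (\<lambda>v. c v z) t \<oplus> nm 1)" by (intro cpt_pl cpt_basic CQ_nm) auto
  then show ?case by (rule cpt_cong) (use cpt_D[OF S.IH[OF S.prems]] in \<open>simp add: pl_S\<close>)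
qed (auto intro: cpt_basic cpt_pl cpt_tm)

lemma cpt_delta0: "delta0 p \<Longrightarrow> (\<And>v. cpt (c v)) \<Longrightarrow> cpt (\<lambda>z. ch (sat M (\<lambda>v. c v z) p))"
proof (induction arbitrary: c rule: delta0.induct)
  case (1 t u) then show ?case by (simp add: cpt_eq cpt_term)
next
  case (2 t u) then show ?case by (simp add: cpt_lt cpt_term)
next
  case (3 p) then show ?case by (simp add: cpt_not)
next
  case (4 p q) then show ?case by (simp add: cpt_and)
next
  case (5 p q) then show ?case by (simp add: cpt_or)
next
  case (6 p x t)
  have c': "cpt (\<lambda>s. if v = x then fs s else c v (sn s))" for v
    using cpt_comp[OF 6(4) cpt_basic(3)] cpt_basic(2) by (cases "v = x") auto
  have "cpt (\<lambda>s. ch (sat M (\<lambda>v. if v = x then fs s else c v (sn s)) p))" by (rule 6(3)[OF c'])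
  moreover have "(\<lambda>v. if v = x then a else c v z) = (\<lambda>v. c v z)(x := a)" for a z by auto
  ultimately have "cpt (\<lambda>s. ch (sat M ((\<lambda>v. c v (sn s))(x := fs s)) p))" by simp
  from cpt_bex[of "\<lambda>a z. sat M ((\<lambda>v. c v z)(x := a)) p", OF this cpt_term[OF 6(4)]]
  have *: "cpt (\<lambda>z. ch (\<exists>a\<in>D. a \<prec> eval_t M (\<lambda>v. c v z) t \<and> sat M ((\<lambda>v. c v z)(x := a)) p))" .
  have "eval_t M ((\<lambda>v. c v z)(x := a)) t = eval_t M (\<lambda>v. c v z) t" for a z
    by (rule eval_t_cong) (use 6(2) in auto)
  then show ?case using * by simp
next
  case (7 p x t)
  have c': "cpt (\<lambda>s. if v = x then fs s else c v (sn s))" for v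
    using cpt_comp[OF 7(4) cpt_basic(3)] cpt_basic(2) by (cases "v = x") auto
  have "cpt (\<lambda>s. ch (sat M (\<lambda>v. if v = x then fs s else c v (sn s)) p))" by (rule 7(3)[OF c'])
  moreover have "(\<lambda>v. if v = x then a else c v z) = (\<lambda>v. c v z)(x := a)" for a z by auto
  ultimately have "cpt (\<lambda>s. ch (\<not> sat M ((\<lambda>v. c v (sn s))(x := fs s)) p))" by (intro cpt_not) simp
  from cpt_not[OF cpt_bex[of "\<lambda>a z. \<not> sat M ((\<lambda>v. c v z)(x := a)) p", OF this cpt_term[OF 7(4)]]]
  have *: "cpt (\<lambda>z. ch (\<not> (\<exists>a\<in>D. a \<prec> eval_t M (\<lambda>v. c v z) t \<and> \<not> sat M ((\<lambda>v. c v z)(x := a)) p)))" .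
  have e: "eval_t M ((\<lambda>v. c v z)(x := a)) t = eval_t M (\<lambda>v. c v z) t" for a z
    by (rule eval_t_cong) (use 7(2) in auto)
  have "(\<not> (\<exists>a\<in>D. a \<prec> eval_t M (\<lambda>v. c v z) t \<and> \<not> sat M ((\<lambda>v. c v z)(x := a)) p))
    = sat M (\<lambda>v. c v z) (All x (Disj (Neg (Lt (Var x) t)) p))" for z
    unfolding sat.simps eval_t.simps e fun_upd_same by blast
  then show ?case using * by simp
qed

text \<open>At the bottom level the quantifier becomes an unbounded search over a decidable matrix,
  which halts if there is a witness. Above it, the two hierarchies add quantifiers in the same
  way.\<close>

lemma U_universal:
  assumes "Q \<subseteq> CQ"
  shows "Sg Q (Suc k) P \<Longrightarrow> \<exists>q\<in>CQ. \<forall>z\<in>D. P (dec z) \<longleftrightarrow> U k q z"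
proof (induction k arbitrary: P)
  case 0
  then obtain R where R: "rep delta0 Q (\<lambda>e. R (e 0) (\<lambda>i. e (Suc i)))" "\<And>e. e \<in> asg \<Longrightarrow> P e = (\<exists>a\<in>D. \<not> R a e)"
    by (auto simp: Sg.simps(2))
  then obtain p \<rho> where p: "delta0 p" "\<And>i. \<rho> i \<in> Q" "\<And>e. e \<in> asg \<Longrightarrow> R (e 0) (\<lambda>i. e (Suc i)) = sat M (pe \<rho> e) p"
    unfolding rep_def by blast
  have c1: "cpt (\<lambda>z. (sn ^^ Suc i) z)" for i
    by (induction i) (use cpt_basic(3) cpt_comp[OF cpt_basic(3)] in auto)
  have c2: "cpt (\<lambda>z. dec z i)" for i
    using cpt_basic(2) cpt_comp[OF cpt_basic(2) c1] by (cases i) (simp_all add: dec_def)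
  have "cpt (\<lambda>z. pe \<rho> (dec z) v)" for v
    using c2 cpt_basic(1) p(2) assms by (cases "even v") (auto simp: pe_def)
  from cpt_not[OF cpt_delta0[OF p(1), of "\<lambda>v z. pe \<rho> (dec z) v", OF this]]
  have "cpt (\<lambda>z. ch (\<not> sat M (pe \<rho> (dec z)) p))" by simp
  then obtain a where C: "a \<in> CQ" and a: "cmp a (\<lambda>z. ch (\<not> sat M (pe \<rho> (dec z)) p))" unfolding cpt_def by blast
  have "P (dec z) \<longleftrightarrow> U 0 (mk 8 a a) z" if z: "z \<in> D" for z
  proof -
    have e: "sat M (pe \<rho> (dec (pr x z))) p = R x (dec z)" if "x \<in> D" for x
      using p(3)[OF dec_asg[of "pr x z"]] that z by (simp add: dec_pr)
    have aD: "mk 8 a a \<in> D" using cmpD(1)[OF a] by simp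
    show ?thesis unfolding R(2)[OF dec_asg[OF z]]
    proof
      assume "\<exists>x\<in>D. \<not> R x (dec z)"
      then obtain x where x: "x \<in> D" "\<not> sat M (pe \<rho> (dec (pr x z))) p" using e by auto
      let ?l = "lst (\<lambda>x. \<not> sat M (pe \<rho> (dec (pr x z))) p)"
      obtain u where u: "u \<in> D" "der u" "J u (mk 8 a a) z ?l" using mu(1)[OF a z x] by blast
      have l: "?l \<in> D" by (rule lst(1)[OF mu(3)[OF a z] x])
      from der_insert[OF u(2,3,1) aD z l] l show "U 0 (mk 8 a a) z" by auto
    next
      assume "U 0 (mk 8 a a) z"
      then obtain s v where "s \<in> D" "v \<in> D" "der s" "T s (mk 8 a a) z v" by auto
      with mu(2)[OF a z this(1,2,3) der_J] aD z have "\<not> sat M (pe \<rho> (dec (pr v z))) p" by blast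
      then show "\<exists>x\<in>D. \<not> R x (dec z)" using e \<open>v \<in> D\<close> by auto
    qed
  qed
  then show ?case using mk_C[OF C C, of 8] by blast
next
  case (Suc k)
  then obtain R where R: "Sg Q (Suc k) (\<lambda>e. R (e 0) (\<lambda>i. e (Suc i)))" "\<And>e. e \<in> asg \<Longrightarrow> P e = (\<exists>a\<in>D. \<not> R a e)"
    unfolding Sg.simps(2)[of Q "Suc k"] by blast
  from Suc.IH[OF R(1)] obtain q where q: "q \<in> CQ" "\<And>z. z \<in> D \<Longrightarrow> R (dec z 0) (\<lambda>i. dec z (Suc i)) \<longleftrightarrow> U k q z" by auto
  have "P (dec z) \<longleftrightarrow> U (Suc k) q z" if z: "z \<in> D" for z
  proof -
    have "R a (dec z) \<longleftrightarrow> U k q (pr a z)" if "a \<in> D" for a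
      using q(2)[of "pr a z"] that z by (simp add: dec_pr)
    then show ?thesis unfolding R(2)[OF dec_asg[OF z]] U.simps by blast
  qed
  then show ?case using q(1) by blast
qed

end

context pa begin

lemma U_Sg:
  assumes "Q \<subseteq> D" "\<zero> \<in> Q" shows "Sg Q (Suc k) (\<lambda>e. U k (e 0) (e 1))"
proof (induction k)
  case 0
  interpret l: lev M Q 0 using assms by unfold_locales
  show ?case unfolding U.simps by (intro l.sg_ex l.sg_C cintro)
next
  case (Suc k)
  interpret l: lev M Q k using assms by unfold_locales
  have "Sg Q (Suc k) (\<lambda>e. U k (e (Suc 0)) (pr (e 0) (e (Suc (Suc 0)))))"
    by (intro l.sg_r2[OF Suc] cintro)
  then show ?case by - (rule Sg_SucI[of _ _ "\<lambda>a e. U k (e 0) (pr a (e 1))"], simp_all)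
qed

end

subsection \<open>Definable limits and a Ramsey theorem\<close>

context pa begin

definition unb :: "('a \<Rightarrow> bool) \<Rightarrow> bool" where "unb X \<longleftrightarrow> (\<forall>b\<in>D. \<exists>x\<in>D. b \<preceq> x \<and> X x)"

text \<open>Truncation keeps the values up to \<open>b\<close> and identifies all larger ones. It
  turns an arbitrary function into a colouring with boundedly many colours without losing its small
  values.\<close>

definition mn :: "'a \<Rightarrow> 'a \<Rightarrow> 'a" where "mn a b = (if a \<preceq> b then a else b)"

lemma mn_D [simp]: "a \<in> D \<Longrightarrow> b \<in> D \<Longrightarrow> mn a b \<in> D" by (simp add: mn_def)
lemma mn_le [simp]: "a \<in> D \<Longrightarrow> b \<in> D \<Longrightarrow> mn a b \<preceq> b" by (simp add: mn_def)
lemma mn_id: "a \<preceq> b \<Longrightarrow> mn a b = a" by (simp add: mn_def)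
lemma mn_mn: assumes "b \<preceq> c" "a \<in> D" "b \<in> D" "c \<in> D" shows "mn (mn a c) b = mn a b"
proof (cases "a \<preceq> c")
  case False
  then have "b \<preceq> a" using assms le_trans[of b c a] by (simp add: lt_imp_le)
  then show ?thesis using False assms le_antisym[of a b] le_antisym[of c b] by (auto simp: mn_def)
qed (simp add: mn_def)

text \<open>Successive decisions: the values \<open>f i\<close> are fixed one after the other so that the remaining
  set stays unbounded. The result is a definable function although there are nonstandardly many steps.\<close>

context
  fixes P f b
  assumes P: "Df (\<lambda>e. P (e 0) (e 1))" and f: "Df.Fn (\<lambda>e. f (e 0) (e 1))" and b: "Df.Fn (\<lambda>e. b (e 0))"
    and dec: "\<And>m m' x. m \<in> D \<Longrightarrow> m' \<in> D \<Longrightarrow> x \<in> D \<Longrightarrow> m \<preceq> m' \<Longrightarrow> P m' x \<Longrightarrow> P m x"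
    and unb: "\<And>m. m \<in> D \<Longrightarrow> unb (P m)"
    and bd: "\<And>i x. i \<in> D \<Longrightarrow> x \<in> D \<Longrightarrow> f i x \<preceq> b i"
begin

definition Lg :: "'a \<Rightarrow> 'a \<Rightarrow> 'a \<Rightarrow> bool" where
  "Lg s i c \<longleftrightarrow> (\<forall>m\<in>D. \<forall>B\<in>D. \<exists>x\<in>D. B \<preceq> x \<and> P m x \<and> (\<forall>j\<in>D. j \<prec> i \<longrightarrow> f j x = nth s j) \<and> f i x = c)"

text \<open>\<open>Lg s i c\<close> says that \<open>c\<close> remains possible as limit of
  \<open>f i\<close> after the decisions in \<open>s\<close>. Taking the least possible value makes
  the decisions unique, and therefore the limit definable.\<close>

definition gd :: "'a \<Rightarrow> 'a \<Rightarrow> bool" where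
  "gd s n \<longleftrightarrow> (\<forall>i\<in>D. i \<prec> n \<longrightarrow> Lg s i (nth s i) \<and> (\<forall>c\<in>D. c \<prec> nth s i \<longrightarrow> \<not> Lg s i c))"

lemma Lg_Df: "Df.Fn f1 \<Longrightarrow> Df.Fn f2 \<Longrightarrow> Df.Fn f3 \<Longrightarrow> Df (\<lambda>e. Lg (f1 e) (f2 e) (f3 e))"
proof (rule Df.c_r3[of Lg])
  show "Df (\<lambda>e. Lg (e 0) (e 1) (e 2))" unfolding Lg_def
    by (intro cintro Df.c_r2[OF P] Df.Fn_f2[OF f])
qed

lemma gd_Df: "Df.Fn f1 \<Longrightarrow> Df.Fn f2 \<Longrightarrow> Df (\<lambda>e. gd (f1 e) (f2 e))"
proof (rule Df.c_r2[of gd])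
  show "Df (\<lambda>e. gd (e 0) (e 1))" unfolding gd_def by (intro cintro Lg_Df)
qed

lemma Lg_cong: assumes "\<And>j. j \<in> D \<Longrightarrow> j \<prec> i \<Longrightarrow> nth s j = nth s' j" shows "Lg s i c = Lg s' i c"
  using assms unfolding Lg_def by (metis (no_types, lifting))

text \<open>A pigeonhole argument by collection. If each of the boundedly many values
  \<open>c\<close> failed for some \<open>m\<close> beyond some \<open>B\<close>, a common bound
  \<open>W\<close> for these failures would contradict the existence of a suitable \<open>x\<close>
  above \<open>W\<close> in \<open>P W\<close>. Here it matters that \<open>P\<close> decreases in
  its first argument.\<close>

lemma gd_step:
  assumes n: "n \<in> D" and s: "s \<in> D" "gd s n"
    and u: "\<forall>m\<in>D. \<forall>B\<in>D. \<exists>x\<in>D. B \<preceq> x \<and> P m x \<and> (\<forall>i\<in>D. i \<prec> n \<longrightarrow> f i x = nth s i)"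
  shows "\<exists>s'\<in>D. gd s' (\<S> n) \<and> (\<forall>m\<in>D. \<forall>B\<in>D. \<exists>x\<in>D. B \<preceq> x \<and> P m x \<and> (\<forall>i\<in>D. i \<prec> \<S> n \<longrightarrow> f i x = nth s' i))"
proof -
  have bD: "b i \<in> D" if "i \<in> D" for i using FnD1[OF b that] .
  have fD: "f i x \<in> D" if "i \<in> D" "x \<in> D" for i x
    using Df.FnD[OF f, of "\<lambda>j. if j = 0 then i else x"] that by (simp add: asg_def)
  have "\<exists>c\<in>D. Lg s n c"
  proof (rule ccontr)
    assume no: "\<not> ?thesis"
    let ?R = "\<lambda>c w. \<forall>x\<in>D. sn w \<preceq> x \<longrightarrow> P (fs w) x \<longrightarrow> (\<forall>j\<in>D. j \<prec> n \<longrightarrow> f j x = nth s j) \<longrightarrow> f n x \<noteq> c"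
    have "Df (\<lambda>e. ?R (e 0) (e 1))" using n s by (intro cintro Df.c_r2[OF P] Df.Fn_f2[OF f])
    then have RD: "Df (\<lambda>e. ?R (e 0) (e 1))" .
    have Rex: "\<exists>w\<in>D. ?R c w" if c: "c \<in> D" for c
    proof -
      obtain m B where mB: "m \<in> D" "B \<in> D" "\<not> (\<exists>x\<in>D. B \<preceq> x \<and> P m x \<and> (\<forall>j\<in>D. j \<prec> n \<longrightarrow> f j x = nth s j) \<and> f n x = c)"
        using no c unfolding Lg_def by blast
      have "?R c (pr m B)" unfolding fs_pr[OF mB(1,2)] sn_pr[OF mB(1,2)] using mB(3) by blast
      then show ?thesis using mB(1,2) pr_D by blast
    qed
    have "\<exists>W\<in>D. \<forall>c\<in>D. c \<prec> \<S> (b n) \<longrightarrow> (\<exists>w\<in>D. w \<prec> W \<and> ?R c w)"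
      by (rule collection[of ?R, OF RD DS[OF bD[OF n]]]) (rule Rex)
    then obtain W where W: "W \<in> D" "\<forall>c\<in>D. c \<prec> \<S> (b n) \<longrightarrow> (\<exists>w\<in>D. w \<prec> W \<and> ?R c w)" by (rule bexE)
    obtain x where x: "x \<in> D" "W \<preceq> x" "P W x" "\<forall>i\<in>D. i \<prec> n \<longrightarrow> f i x = nth s i" using u W(1) by blast
    have "f n x \<prec> \<S> (b n)" using bd[OF n x(1)] bD[OF n] fD[OF n x(1)] by simp
    then obtain w where w: "w \<in> D" "w \<prec> W" "?R (f n x) w" using W(2) fD[OF n x(1)] by blast
    have "fs w \<preceq> W" using le_trans[of "fs w" w W] fs_le w W by (simp add: lt_imp_le)
    moreover have "sn w \<preceq> x" using le_trans[of "sn w" w x] le_trans[of w W x] sn_le[of w] w W x by (simp add: lt_imp_le)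
    ultimately have *: "P (fs w) x" "sn w \<preceq> x" using dec[of "fs w" W x] x w W by simp_all
    show False using w(3)[rule_format, OF x(1) *(2,1)] x(4) by blast
  qed
  then obtain c0 where "c0 \<in> D" "Lg s n c0" by blast
  moreover have "Df (\<lambda>e. Lg s n (e 0))" using n s by (intro Lg_Df cintro)
  ultimately obtain c where c: "c \<in> D" "Lg s n c" "\<And>c'. c' \<in> D \<Longrightarrow> c' \<prec> c \<Longrightarrow> \<not> Lg s n c'"
    using LNP[of "Lg s n"] by blast
  have "Df.Fn (\<lambda>e. if e 0 \<prec> n then nth s (e 0) else c)" using n s c by (intro cintro)
  from seq_comp[of "\<lambda>i. if i \<prec> n then nth s i else c", OF this DS[OF n]]
  obtain s' where s': "s' \<in> D" "\<And>i. i \<in> D \<Longrightarrow> i \<prec> \<S> n \<Longrightarrow> nth s' i = (if i \<prec> n then nth s i else c)" by blast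
  have s1: "nth s' i = nth s i" if "i \<in> D" "i \<prec> n" for i using s'(2)[of i] that n by (simp add: lt_imp_le)
  have s2: "nth s' n = c" using s'(2)[of n] n lt_irrefl[OF n] by (metis lt_S)
  have Sn: "i \<prec> \<S> n \<longleftrightarrow> i \<prec> n \<or> i = n" if "i \<in> D" for i using that n by (simp add: le_def)
  have lc: "Lg s' i d = Lg s i d" if "i \<in> D" "i \<prec> n \<or> i = n" for i d
    by (rule Lg_cong) (use s1 lt_trans[of _ i n] that n in blast)
  have "gd s' (\<S> n)" unfolding gd_def
  proof (intro ballI impI)
    fix i assume i: "i \<in> D" "i \<prec> \<S> n"
    then consider "i \<prec> n" | "i = n" using Sn by blast
    then show "Lg s' i (nth s' i) \<and> (\<forall>c\<in>D. c \<prec> nth s' i \<longrightarrow> \<not> Lg s' i c)"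
    proof cases
      case 1 then show ?thesis using s(2) i(1) s1[OF i(1) 1] lc[OF i(1)] unfolding gd_def by simp
    next
      case 2 then show ?thesis using c s2 lc[OF i(1)] by simp
    qed
  qed
  moreover have "\<forall>m\<in>D. \<forall>B\<in>D. \<exists>x\<in>D. B \<preceq> x \<and> P m x \<and> (\<forall>i\<in>D. i \<prec> \<S> n \<longrightarrow> f i x = nth s' i)"
  proof (intro ballI)
    fix m B assume "m \<in> D" "B \<in> D"
    then obtain x where x: "x \<in> D" "B \<preceq> x" "P m x" "\<forall>j\<in>D. j \<prec> n \<longrightarrow> f j x = nth s j" "f n x = c"
      using c(2) unfolding Lg_def by blast
    have "\<forall>i\<in>D. i \<prec> \<S> n \<longrightarrow> f i x = nth s' i" using x(4,5) s1 s2 Sn by metis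
    then show "\<exists>x\<in>D. B \<preceq> x \<and> P m x \<and> (\<forall>i\<in>D. i \<prec> \<S> n \<longrightarrow> f i x = nth s' i)" using x by blast
  qed
  ultimately show ?thesis using s' by blast
qed

lemma gd_ex:
  assumes n: "n \<in> D"
  shows "\<exists>s\<in>D. gd s n \<and> (\<forall>m\<in>D. \<forall>B\<in>D. \<exists>x\<in>D. B \<preceq> x \<and> P m x \<and> (\<forall>i\<in>D. i \<prec> n \<longrightarrow> f i x = nth s i))"
proof (rule ind[of "\<lambda>n. \<exists>s\<in>D. gd s n \<and> (\<forall>m\<in>D. \<forall>B\<in>D. \<exists>x\<in>D. B \<preceq> x \<and> P m x \<and> (\<forall>i\<in>D. i \<prec> n \<longrightarrow> f i x = nth s i))"])
  show "Df (\<lambda>e. \<exists>s\<in>D. gd s (e 0) \<and> (\<forall>m\<in>D. \<forall>B\<in>D. \<exists>x\<in>D. B \<preceq> x \<and> P m x \<and> (\<forall>i\<in>D. i \<prec> e 0 \<longrightarrow> f i x = nth s i)))"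
    by (intro cintro gd_Df Df.c_r2[OF P] Df.Fn_f2[OF f])
  show "\<exists>s\<in>D. gd s \<zero> \<and> (\<forall>m\<in>D. \<forall>B\<in>D. \<exists>x\<in>D. B \<preceq> x \<and> P m x \<and> (\<forall>i\<in>D. i \<prec> \<zero> \<longrightarrow> f i x = nth s i))"
    using unb unfolding gd_def unb_def by (intro bexI[of _ "\<zero>"]) auto
qed (use gd_step n in blast)+

lemma gd_unique:
  assumes "gd s n" "gd s' n" "s \<in> D" "s' \<in> D" "n \<in> D" "i \<in> D" "i \<prec> n" shows "nth s i = nth s' i"
proof -
  have "i \<prec> n \<longrightarrow> nth s i = nth s' i"
  proof (rule sind[of "\<lambda>i. i \<prec> n \<longrightarrow> nth s i = nth s' i"])
    show "Df (\<lambda>e. e 0 \<prec> n \<longrightarrow> nth s (e 0) = nth s' (e 0))" using assms by (intro cintro)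
    fix i assume i: "i \<in> D" and IH: "\<And>j. j \<in> D \<Longrightarrow> j \<prec> i \<Longrightarrow> j \<prec> n \<longrightarrow> nth s j = nth s' j"
    show "i \<prec> n \<longrightarrow> nth s i = nth s' i"
    proof
      assume "i \<prec> n"
      have l: "Lg s i c = Lg s' i c" for c
        by (rule Lg_cong) (use IH lt_trans[of _ i n] \<open>i \<prec> n\<close> i assms(5) in blast)
      have 1: "Lg s i (nth s i)" "\<And>c. c \<in> D \<Longrightarrow> c \<prec> nth s i \<Longrightarrow> \<not> Lg s i c"
        using assms(1) i \<open>i \<prec> n\<close> unfolding gd_def by blast+
      have 2: "Lg s' i (nth s' i)" "\<And>c. c \<in> D \<Longrightarrow> c \<prec> nth s' i \<Longrightarrow> \<not> Lg s' i c"
        using assms(2) i \<open>i \<prec> n\<close> unfolding gd_def by blast+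
      show "nth s i = nth s' i"
        using linear[of "nth s i" "nth s' i"] 1 2 l i assms(3,4) nth_D by blast
    qed
  qed (use assms in simp)
  then show ?thesis using assms by simp
qed

lemma limit:
  "\<exists>g. Df.Fn (\<lambda>e. g (e 0)) \<and> (\<forall>m\<in>D. unb (\<lambda>x. P m x \<and> (\<forall>i\<in>D. i \<preceq> m \<longrightarrow> f i x = g i)))"
proof -
  define g where "g i = (THE c. \<exists>s\<in>D. gd s (\<S> i) \<and> nth s i = c)" for i
  have geq: "g i = nth s i" if "gd s (\<S> i)" "s \<in> D" "i \<in> D" for s i
    unfolding g_def
  proof (rule the_equality)
    show "\<exists>s'\<in>D. gd s' (\<S> i) \<and> nth s' i = nth s i" using that by blast
    fix c assume "\<exists>s'\<in>D. gd s' (\<S> i) \<and> nth s' i = c"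
    then obtain s' where "s' \<in> D" "gd s' (\<S> i)" "nth s' i = c" by blast
    then show "c = nth s i" using gd_unique[of s "\<S> i" s' i] that by simp
  qed
  have gex: "\<exists>s\<in>D. gd s (\<S> i)" if "i \<in> D" for i using gd_ex[OF DS[OF that]] by blast
  have "Df (\<lambda>e. \<exists>s\<in>D. gd s (\<S> (e 1)) \<and> nth s (e 1) = e 0)" by (intro cintro gd_Df)
  then have "Df (\<lambda>e. e 0 = g (e 1))"
  proof (rule Df.c_cong)
    fix e assume "e \<in> asg"
    then have "e 1 \<in> D" by (auto simp: asgD)
    then show "(\<exists>s\<in>D. gd s (\<S> (e 1)) \<and> nth s (e 1) = e 0) = (e 0 = g (e 1))" using geq gex by metis
  qed
  moreover have "g i \<in> D" if "i \<in> D" for i using gex[OF that] geq that by auto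
  ultimately have gF: "Df.Fn (\<lambda>e. g (e 0))" by (simp add: Df.Fn_def asgD)
  have "unb (\<lambda>x. P m x \<and> (\<forall>i\<in>D. i \<preceq> m \<longrightarrow> f i x = g i))" if m: "m \<in> D" for m
  proof -
    obtain s where s: "s \<in> D" "gd s (\<S> m)"
      "\<forall>m'\<in>D. \<forall>B\<in>D. \<exists>x\<in>D. B \<preceq> x \<and> P m' x \<and> (\<forall>i\<in>D. i \<prec> \<S> m \<longrightarrow> f i x = nth s i)"
      using gd_ex[OF DS[OF m]] by blast
    have "g i = nth s i" if i: "i \<in> D" "i \<preceq> m" for i
    proof (rule geq[OF _ s(1) i(1)])
      have "j \<prec> \<S> m" if "j \<in> D" "j \<prec> \<S> i" for j using that i m le_trans[of j i m] by simp
      then show "gd s (\<S> i)" using s(2) unfolding gd_def by blast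
    qed
    moreover have "i \<prec> \<S> m \<longleftrightarrow> i \<preceq> m" if "i \<in> D" for i using that m by simp
    ultimately show ?thesis using s(3) m unfolding unb_def by metis
  qed
  then show ?thesis using gF by blast
qed

end

end

context calc begin
lemma Fn_mn [cintro]: "Fn f \<Longrightarrow> Fn g \<Longrightarrow> Fn (\<lambda>e. mn (f e) (g e))"
  unfolding mn_def by (intro cintro)
end

context pa begin

lemma FnD2: "Df.Fn (\<lambda>e. F (e 0) (e 1)) \<Longrightarrow> a \<in> D \<Longrightarrow> b \<in> D \<Longrightarrow> F a b \<in> D"
  using Df.FnD[of "\<lambda>e. F (e 0) (e 1)" "\<lambda>j. if j = 0 then a else b"] by (simp add: asg_def)

lemma lst_Fn_Df:
  assumes R: "Df (\<lambda>e. R (e 0) (e 1))" and ex: "\<And>z. z \<in> D \<Longrightarrow> \<exists>a\<in>D. R a z"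
  shows "Df.Fn (\<lambda>e. lst (\<lambda>a. R a (e 0)))" "\<And>z. z \<in> D \<Longrightarrow> R (lst (\<lambda>a. R a z)) z"
proof -
  show "Df.Fn (\<lambda>e. lst (\<lambda>a. R a (e 0)))"
    by (rule Df.Fn_lst[of "\<lambda>a e. R a (e 0)"]) (use R ex in \<open>simp_all add: asgD\<close>)
  fix z assume z: "z \<in> D"
  have d: "Df (\<lambda>e. R (e 0) z)" using z by (intro Df.c_r2[OF R] cintro)
  obtain a where "a \<in> D" "R a z" using ex[OF z] by (rule bexE)
  then show "R (lst (\<lambda>a. R a z)) z" using lst(2)[of "\<lambda>a. R a z", OF d] by simp
qed

text \<open>The argument of Erdos and Rado inside the model. With the limit colouring
  \<open>g\<close>, the next element is the first one that agrees with \<open>g\<close> at all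
  indices permitted by the earlier elements; \<open>E\<close> iterates this choice.\<close>

lemma end_homogeneous:
  assumes f: "Df.Fn (\<lambda>e. f (e 0) (e 1))" and b: "b \<in> D" and B: "Df.Fn (\<lambda>e. B (e 0))"
    and bd: "\<And>i x. i \<in> D \<Longrightarrow> x \<in> D \<Longrightarrow> f i x \<preceq> b"
  shows "\<exists>E g. Df.Fn (\<lambda>e. E (e 0)) \<and> Df.Fn (\<lambda>e. g (e 0)) \<and> (\<forall>a\<in>D. \<forall>c\<in>D. a \<prec> c \<longrightarrow> E a \<prec> E c) \<and> (\<forall>a\<in>D. a \<preceq> E a)
    \<and> (\<forall>a\<in>D. \<forall>c\<in>D. a \<prec> c \<longrightarrow> (\<forall>i\<in>D. i \<preceq> B (E a) \<longrightarrow> f i (E c) = g i)) \<and> (\<forall>i\<in>D. g i \<preceq> b)"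
proof -
  have "\<exists>g. Df.Fn (\<lambda>e. g (e 0)) \<and> (\<forall>m\<in>D. unb (\<lambda>x. True \<and> (\<forall>i\<in>D. i \<preceq> m \<longrightarrow> f i x = g i)))"
  proof (rule limit[of "\<lambda>_ _. True" f "\<lambda>_. b"])
    show "Df.Fn (\<lambda>e. b)" using b by (intro cintro)
    show "Df (\<lambda>e. True)" by (rule Df.c_True)
    show "unb (\<lambda>_. True)" unfolding unb_def using le_refl by blast
  qed (use f bd in simp_all)
  then obtain g where g: "Df.Fn (\<lambda>e. g (e 0))" "\<And>m. m \<in> D \<Longrightarrow> unb (\<lambda>x. \<forall>i\<in>D. i \<preceq> m \<longrightarrow> f i x = g i)" by auto
  have BD: "B z \<in> D" if "z \<in> D" for z using FnD1[OF B that] .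
  have fD: "f i x \<in> D" if "i \<in> D" "x \<in> D" for i x using FnD2[OF f that] .
  let ?R = "\<lambda>v z. z \<prec> v \<and> (\<forall>y\<in>D. y \<preceq> z \<longrightarrow> (\<forall>i\<in>D. i \<preceq> B y \<longrightarrow> f i v = g i))"
  have R: "Df (\<lambda>e. ?R (e 0) (e 1))" by (intro cintro Df.Fn_f2[OF f] Df.Fn_f1[OF g(1)] Df.Fn_f1[OF B])
  have ex: "\<exists>v\<in>D. ?R v z" if z: "z \<in> D" for z
  proof -
    obtain W where W: "W \<in> D" "\<And>y. y \<in> D \<Longrightarrow> y \<prec> \<S> z \<Longrightarrow> B y \<prec> W" using bounding[OF B DS[OF z]] by blast
    obtain v where v: "v \<in> D" "\<S> z \<preceq> v" "\<forall>i\<in>D. i \<preceq> W \<longrightarrow> f i v = g i" using g(2)[OF W(1)] z DS unfolding unb_def by blast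
    have "f i v = g i" if "y \<in> D" "y \<preceq> z" "i \<in> D" "i \<preceq> B y" for y i
      using v(3) W that z BD le_trans[of i "B y" W] by (simp add: lt_imp_le)
    then show ?thesis using v z lt_le[of z v] by auto
  qed
  define nx where "nx z = lst (\<lambda>v. ?R v z)" for z
  have nF: "Df.Fn (\<lambda>e. nx (e 0))" unfolding nx_def by (rule lst_Fn_Df(1)[OF R ex])
  have nR: "?R (nx z) z" if "z \<in> D" for z unfolding nx_def by (rule lst_Fn_Df(2)[OF R ex that])
  have nD: "nx z \<in> D" if "z \<in> D" for z using FnD1[OF nF that] .
  define E where "E a = it nx (\<S> a) \<zero>" for a
  have EF: "Df.Fn (\<lambda>e. E (e 0))" unfolding E_def by (intro Df_Fn_it[OF nF] cintro)
  have ED: "E a \<in> D" if "a \<in> D" for a using FnD1[OF EF that] .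
  have ES: "E (\<S> a) = nx (E a)" if "a \<in> D" for a using that unfolding E_def by (simp add: it_S[OF nF])
  have inc: "a \<prec> c \<longrightarrow> E a \<prec> E c" if a: "a \<in> D" and c: "c \<in> D" for a c
  proof (rule ind[of "\<lambda>c. a \<prec> c \<longrightarrow> E a \<prec> E c"])
    show "Df (\<lambda>e. a \<prec> e 0 \<longrightarrow> E a \<prec> E (e 0))" using a ED by (intro cintro Df.Fn_f1[OF EF]) auto
    fix c assume c: "c \<in> D" "a \<prec> c \<longrightarrow> E a \<prec> E c"
    have "E c \<prec> E (\<S> c)" using nR[OF ED[OF c(1)]] ES[OF c(1)] by simp
    then show "a \<prec> \<S> c \<longrightarrow> E a \<prec> E (\<S> c)"
      using c a lt_trans[of "E a" "E c" "E (\<S> c)"] ED by (auto simp: le_def)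
  qed (use a c in auto)
  have ge: "a \<preceq> E a" if a: "a \<in> D" for a
  proof (rule ind[of "\<lambda>a. a \<preceq> E a"])
    show "Df (\<lambda>e. e 0 \<preceq> E (e 0))" by (intro cintro Df.Fn_f1[OF EF])
    show "\<zero> \<preceq> E \<zero>" using ED by simp
    fix a assume a: "a \<in> D" "a \<preceq> E a"
    then have "a \<prec> E (\<S> a)" using inc[of a "\<S> a"] ED le_lt_trans[of a "E a" "E (\<S> a)"] by simp
    then show "\<S> a \<preceq> E (\<S> a)" using a ED by (simp add: lt_le)
  qed (rule a)
  have hom: "f i (E c) = g i" if h: "a \<in> D" "c \<in> D" "a \<prec> c" "i \<in> D" "i \<preceq> B (E a)" for a c i
    using h(2)
  proof (cases rule: cases0)
    case 1 then show ?thesis using h by simp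
  next
    case (2 d)
    then have "a \<preceq> d" using h by simp
    then have "E a \<preceq> E d" using inc[OF h(1) 2(1)] by (auto simp: le_def)
    then have "f i (nx (E d)) = g i" using nR[OF ED[OF 2(1)]] ED[OF h(1)] h(4,5) by blast
    then show ?thesis using ES[OF 2(1)] 2 by simp
  qed
  have gb: "g i \<preceq> b" if i: "i \<in> D" for i
  proof -
    obtain x where "x \<in> D" "f i x = g i" using g(2)[OF i] i unfolding unb_def by (metis D0 le_refl)
    then show ?thesis using bd[OF i, of x] by simp
  qed
  show ?thesis
    by (intro exI[of _ E] exI[of _ g] conjI ballI impI EF g(1) ge gb inc[rule_format] hom)
qed

section \<open>The finite Ramsey statement\<close>

definition INC :: "'a \<Rightarrow> 'a \<Rightarrow> 'a \<Rightarrow> bool" where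
  "INC N n t \<longleftrightarrow> (\<forall>a\<in>D. a \<prec> n \<longrightarrow> nth t a \<prec> N \<and> (\<forall>b\<in>D. b \<prec> a \<longrightarrow> nth t b \<prec> nth t a))"

text \<open>The colours of \<open>b\<close> and \<open>c\<close> agree for all side arguments
  \<open>i\<close> that are small relative to an earlier entry \<open>a\<close>. With
  \<open>B = SB\<close> these include the codes of all descending stacks up to that entry. The
  number of colours grows with the length \<open>n\<close> of the list.\<close>

definition PH :: "('a \<Rightarrow> 'a) \<Rightarrow> 'a \<Rightarrow> 'a \<Rightarrow> 'a \<Rightarrow> bool" where
  "PH B n p t \<longleftrightarrow> (\<forall>b\<in>D. b \<prec> n \<longrightarrow> (\<forall>c\<in>D. c \<prec> n \<longrightarrow> (\<forall>a\<in>D. a \<prec> b \<longrightarrow> a \<prec> c \<longrightarrow>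
     (\<forall>i\<in>D. i \<preceq> B (nth t a) \<longrightarrow> mn (nth p (pr (nth t b) i)) n = mn (nth p (pr (nth t c) i)) n))))"

definition Arr :: "('a \<Rightarrow> 'a) \<Rightarrow> 'a \<Rightarrow> 'a \<Rightarrow> bool" where
  "Arr B N n \<longleftrightarrow> (\<forall>p\<in>D. \<exists>t\<in>D. INC N n t \<and> PH B n p t)"

end

context calc begin

lemma c_INC [cintro]: "Fn f \<Longrightarrow> Fn g \<Longrightarrow> Fn h \<Longrightarrow> C (\<lambda>e. INC (f e) (g e) (h e))"
proof (rule c_r3[of INC])
  show "C (\<lambda>e. INC (e 0) (e 1) (e 2))" unfolding INC_def by (intro cintro)
qed

lemma c_PH: "Fn (\<lambda>e. B (e 0)) \<Longrightarrow> Fn f \<Longrightarrow> Fn g \<Longrightarrow> Fn h \<Longrightarrow> C (\<lambda>e. PH B (f e) (g e) (h e))"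
proof (rule c_r3[of "PH B"])
  assume B: "Fn (\<lambda>e. B (e 0))"
  show "C (\<lambda>e. PH B (e 0) (e 1) (e 2))" unfolding PH_def by (intro cintro Fn_f1[OF B])
qed

end

context pa begin

text \<open>Compactness inside the model. Least counterexamples \<open>\<phi> N\<close> converge,
  along \<open>E1\<close>, to a colouring \<open>g1\<close>, for which \<open>E2\<close> is an
  unbounded homogeneous sequence. Its first \<open>n\<close> entries refute the counterexample
  \<open>\<phi> N\<close> for an \<open>N\<close> so late that \<open>\<phi> N\<close> agrees with
  \<open>g1\<close> wherever this matters.\<close>

lemma Arr_ex:
  assumes B: "Df.Fn (\<lambda>e. B (e 0))" and n: "n \<in> D"
  shows "\<exists>N\<in>D. Arr B N n"
proof (rule ccontr)
  assume no: "\<not> ?thesis"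
  have BD: "B z \<in> D" if "z \<in> D" for z using FnD1[OF B that] .
  let ?bad = "\<lambda>p N. \<not> (\<exists>t\<in>D. INC N n t \<and> PH B n p t)"
  have R: "Df (\<lambda>e. ?bad (e 0) (e 1))" using n by (intro cintro Df.c_PH[OF B])
  have ex: "\<exists>p\<in>D. ?bad p N" if "N \<in> D" for N using no that unfolding Arr_def by blast
  define \<phi> where "\<phi> N = lst (\<lambda>p. ?bad p N)" for N
  have \<phi>F: "Df.Fn (\<lambda>e. \<phi> (e 0))" unfolding \<phi>_def by (rule lst_Fn_Df(1)[OF R ex])
  have bad: "?bad (\<phi> N) N" if "N \<in> D" for N unfolding \<phi>_def by (rule lst_Fn_Df(2)[OF R ex that])
  have \<phi>D: "\<phi> N \<in> D" if "N \<in> D" for N using FnD1[OF \<phi>F that] .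
  have f1: "Df.Fn (\<lambda>e. mn (nth (\<phi> (e 1)) (e 0)) n)" using n by (intro cintro Df.Fn_f1[OF \<phi>F])
  have idF: "Df.Fn (\<lambda>e. e 0)" by (intro cintro)
  obtain E1 g1 where E1: "Df.Fn (\<lambda>e. E1 (e 0))" "Df.Fn (\<lambda>e. g1 (e 0))" "\<And>a. a \<in> D \<Longrightarrow> a \<preceq> E1 a"
    "\<And>a c i. a \<in> D \<Longrightarrow> c \<in> D \<Longrightarrow> a \<prec> c \<Longrightarrow> i \<in> D \<Longrightarrow> i \<preceq> E1 a \<Longrightarrow> mn (nth (\<phi> (E1 c)) i) n = g1 i"
    "\<And>i. i \<in> D \<Longrightarrow> g1 i \<preceq> n"
    using end_homogeneous[of "\<lambda>i x. mn (nth (\<phi> x) i) n" n "\<lambda>z. z", OF f1 n idF] \<phi>D n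
      mn_le[OF nth_D n] by metis
  have E1D: "E1 a \<in> D" "g1 a \<in> D" if "a \<in> D" for a using FnD1[OF E1(1) that] FnD1[OF E1(2) that] by auto
  have f2: "Df.Fn (\<lambda>e. g1 (pr (e 1) (e 0)))" by (intro cintro Df.Fn_f1[OF E1(2)])
  have f2b: "g1 (pr x i) \<preceq> n" if "i \<in> D" "x \<in> D" for i x using E1(5) that by simp
  from end_homogeneous[of "\<lambda>i x. g1 (pr x i)" n B, OF f2 n B f2b]
  obtain E2 g2 where E2: "Df.Fn (\<lambda>e. E2 (e 0))" "\<And>a c. a \<in> D \<Longrightarrow> c \<in> D \<Longrightarrow> a \<prec> c \<Longrightarrow> E2 a \<prec> E2 c"
    "\<And>a c i. a \<in> D \<Longrightarrow> c \<in> D \<Longrightarrow> a \<prec> c \<Longrightarrow> i \<in> D \<Longrightarrow> i \<preceq> B (E2 a) \<Longrightarrow> g1 (pr (E2 c) i) = g2 i"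
    by blast
  have E2D: "E2 a \<in> D" if "a \<in> D" for a using FnD1[OF E2(1) that] .
  obtain t where t: "t \<in> D" "\<And>a. a \<in> D \<Longrightarrow> a \<prec> n \<Longrightarrow> nth t a = E2 a" using seq_comp[OF E2(1) n] by blast
  obtain W1 where W1: "W1 \<in> D" "\<And>a. a \<in> D \<Longrightarrow> a \<prec> n \<Longrightarrow> E2 a \<prec> W1" using bounding[OF E2(1) n] by blast
  have "Df.Fn (\<lambda>e. B (E2 (e 0)))" by (intro Df.Fn_f1[OF B] E2(1))
  from bounding[of "\<lambda>a. B (E2 a)", OF this n] obtain W2 where W2: "W2 \<in> D" "\<And>a. a \<in> D \<Longrightarrow> a \<prec> n \<Longrightarrow> B (E2 a) \<prec> W2"
    by blast
  \<comment> \<open>\<open>W\<close> bounds all arguments at which \<open>PH\<close> consults the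
    colouring for the first \<open>n\<close> entries of \<open>E2\<close>.\<close>
  define W where "W = pr W1 W2"
  have W: "W \<in> D" using W1 W2 by (simp add: W_def)
  define N where "N = E1 (\<S> W)"
  have N: "N \<in> D" using W E1D by (simp add: N_def)
  have "W \<prec> N" using E1(3)[of "\<S> W"] W N by (simp add: N_def lt_le)
  have key: "mn (nth (\<phi> N) (pr (E2 b) i)) n = g1 (pr (E2 b) i)"
    if "a \<in> D" "a \<prec> n" "b \<in> D" "b \<prec> n" "i \<in> D" "i \<preceq> B (E2 a)" for a b i
    unfolding N_def
  proof (rule E1(4)[of W "\<S> W"])
    have "i \<prec> W2" using le_lt_trans[of i "B (E2 a)" W2] W2 that BD E2D by simp
    then have "pr (E2 b) i \<preceq> W" unfolding W_def using W1 W2 that E2D by (intro pr_mono) (auto simp: lt_imp_le)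
    then show "pr (E2 b) i \<preceq> E1 W" using le_trans[of "pr (E2 b) i" W "E1 W"] E1(3)[OF W] W E1D E2D that by simp
  qed (use W E2D that in auto)
  have "INC N n t" unfolding INC_def
  proof (intro ballI impI)
    fix a assume a: "a \<in> D" "a \<prec> n"
    have "W1 \<prec> W" using W1 W2 by (simp add: W_def)
    then have "E2 a \<prec> N" using W1 a \<open>W \<prec> N\<close> lt_trans[of "E2 a" W1 W] lt_trans[of "E2 a" W N] W N E2D by simp
    moreover have "nth t b \<prec> nth t a" if "b \<in> D" "b \<prec> a" for b
      using t(2)[of b] t(2)[OF a] E2(2)[of b a] lt_trans[of b a n] that a n by simp
    ultimately show "nth t a \<prec> N \<and> (\<forall>b\<in>D. b \<prec> a \<longrightarrow> nth t b \<prec> nth t a)" using t(2)[OF a] by simp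
  qed
  moreover have "PH B n (\<phi> N) t" unfolding PH_def
  proof (intro ballI impI)
    fix b c a i assume h: "b \<in> D" "b \<prec> n" "c \<in> D" "c \<prec> n" "a \<in> D" "a \<prec> b" "a \<prec> c" "i \<in> D" "i \<preceq> B (nth t a)"
    have "a \<prec> n" using lt_trans[of a b n] h n by simp
    then have i: "i \<preceq> B (E2 a)" using h t(2)[of a] by simp
    show "mn (nth (\<phi> N) (pr (nth t b) i)) n = mn (nth (\<phi> N) (pr (nth t c) i)) n"
      unfolding t(2)[OF h(1,2)] t(2)[OF h(3,4)]
      using key[OF h(5) \<open>a \<prec> n\<close> h(1,2,8) i] key[OF h(5) \<open>a \<prec> n\<close> h(3,4,8) i] E2(3)[OF h(5,1,6,8) i] E2(3)[OF h(5,3,7,8) i]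
      by simp
  qed
  ultimately show False using bad[OF N] t(1) by blast
qed

lemma Arr_mono:
  assumes "Arr B N n" "N \<preceq> N'" "N \<in> D" "N' \<in> D"
  shows "Arr B N' n"
  unfolding Arr_def
proof
  fix p assume p: "p \<in> D"
  obtain t where t: "t \<in> D" "INC N n t" "PH B n p t" using assms(1) p unfolding Arr_def by blast
  have "INC N' n t" unfolding INC_def
  proof (intro ballI impI conjI)
    fix a assume a: "a \<in> D" "a \<prec> n"
    then show "nth t a \<prec> N'" using t lt_le_trans[of "nth t a" N N'] assms(2-4) unfolding INC_def by simp
    show "nth t b \<prec> nth t a" if "b \<in> D" "b \<prec> a" for b using that a t unfolding INC_def by blast
  qed
  then show "\<exists>t\<in>D. INC N' n t \<and> PH B n p t" using t by blast
qed

end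

subsection \<open>A recursive bound for the Ramsey theorem\<close>

context pa begin

text \<open>\<open>cb b\<close> bounds the codes of all sequences of length \<open>b\<close> with values up to \<open>b\<close>. It makes the
  quantifier over colourings in the Ramsey theorem bounded.\<close>

definition cbs :: "'a \<Rightarrow> 'a \<Rightarrow> 'a \<Rightarrow> bool" where
  "cbs z b k \<longleftrightarrow> (\<forall>j\<in>D. j \<prec> k \<longrightarrow> (\<forall>s\<in>D. s \<preceq> nth z j \<longrightarrow> (\<forall>v\<in>D. v \<preceq> b \<longrightarrow>
     (\<exists>s'\<in>D. s' \<preceq> nth z (\<S> j) \<and> nth s' j = v \<and> (\<forall>i\<in>D. i \<prec> j \<longrightarrow> nth s' i = nth s i)))))"

definition cb :: "'a \<Rightarrow> 'a" where "cb b = nth (lst (\<lambda>z. cbs z b b)) b"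

end

context calc begin

lemma c_cbs [cintro]: "Fn f \<Longrightarrow> Fn g \<Longrightarrow> Fn h \<Longrightarrow> C (\<lambda>e. cbs (f e) (g e) (h e))"
proof (rule c_r3[of cbs])
  show "C (\<lambda>e. cbs (e 0) (e 1) (e 2))" unfolding cbs_def by (intro cintro)
qed

end

context pa begin

text \<open>\<open>z\<close> lists bounds for the lengths up to \<open>k\<close>. The bound for the
  next length comes from collection over the boundedly many pairs of an old code and a new
  value.\<close>

lemma cbs_ex:
  assumes b: "b \<in> D" and k: "k \<in> D"
  shows "\<exists>z\<in>D. cbs z b k"
proof (rule ind[of "\<lambda>k. \<exists>z\<in>D. cbs z b k"])
  show "Df (\<lambda>e. \<exists>z\<in>D. cbs z b (e 0))" using b by (intro cintro)
  show "\<exists>z\<in>D. cbs z b \<zero>" unfolding cbs_def by (intro bexI[of _ "\<zero>"]) auto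
  fix k assume k: "k \<in> D" and "\<exists>z\<in>D. cbs z b k"
  then obtain z where z: "z \<in> D" "cbs z b k" by blast
  let ?c = "nth z k"
  let ?R = "\<lambda>i s'. nth s' k = sn i \<and> (\<forall>j\<in>D. j \<prec> k \<longrightarrow> nth s' j = nth (fs i) j)"
  have R: "Df (\<lambda>e. ?R (e 0) (e 1))" using k by (intro cintro)
  have ex: "\<exists>s'\<in>D. ?R i s'" if i: "i \<in> D" for i
  proof -
    have "Df.Fn (\<lambda>e. if e 0 \<prec> k then nth (fs i) (e 0) else sn i)" using k i by (intro cintro) auto
    from seq_comp[of "\<lambda>j. if j \<prec> k then nth (fs i) j else sn i", OF this DS[OF k]]
    obtain s' where s': "s' \<in> D" "\<And>j. j \<in> D \<Longrightarrow> j \<prec> \<S> k \<Longrightarrow> nth s' j = (if j \<prec> k then nth (fs i) j else sn i)" by blast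
    then show ?thesis using k by (intro bexI[of _ s']) (auto simp: lt_imp_le)
  qed
  have "\<exists>B\<in>D. \<forall>i\<in>D. i \<prec> \<S> (pr ?c b) \<longrightarrow> (\<exists>s'\<in>D. s' \<prec> B \<and> ?R i s')"
    by (rule collection[of ?R, OF R]) (use b k z ex in auto)
  then obtain B where B: "B \<in> D" "\<And>i. i \<in> D \<Longrightarrow> i \<preceq> pr ?c b \<Longrightarrow> \<exists>s'\<in>D. s' \<prec> B \<and> ?R i s'"
    using b k z by auto
  have "Df.Fn (\<lambda>e. if e 0 \<preceq> k then nth z (e 0) else B)" using k z B by (intro cintro)
  from seq_comp[of "\<lambda>j. if j \<preceq> k then nth z j else B", OF this DS[OF DS[OF k]]]
  obtain z' where z': "z' \<in> D" "\<And>j. j \<in> D \<Longrightarrow> j \<prec> \<S> (\<S> k) \<Longrightarrow> nth z' j = (if j \<preceq> k then nth z j else B)" by blast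
  have zj: "nth z' j = nth z j" if "j \<in> D" "j \<preceq> k" for j
    using z'(2)[of j] that k le_trans[of j k "\<S> k"] by (simp add: lt_imp_le)
  have "\<not> \<S> k \<preceq> k" using k by simp
  then have zS: "nth z' (\<S> k) = B" using z'(2)[of "\<S> k"] k by (simp only: if_False DS lt_S)
  have "cbs z' b (\<S> k)" unfolding cbs_def
  proof (intro ballI impI)
    fix j s v assume h: "j \<in> D" "j \<prec> \<S> k" "s \<in> D" "s \<preceq> nth z' j" "v \<in> D" "v \<preceq> b"
    then have jk: "j \<preceq> k" using k by simp
    show "\<exists>s'\<in>D. s' \<preceq> nth z' (\<S> j) \<and> nth s' j = v \<and> (\<forall>i\<in>D. i \<prec> j \<longrightarrow> nth s' i = nth s i)"
    proof (cases "j = k")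
      case True
      have "pr s v \<preceq> pr ?c b" using h z k b True zj[OF k] by (intro pr_mono) auto
      then obtain s' where s': "s' \<in> D" "s' \<prec> B" "nth s' k = sn (pr s v) \<and> (\<forall>i\<in>D. i \<prec> k \<longrightarrow> nth s' i = nth (fs (pr s v)) i)"
        using B(2)[of "pr s v"] h by auto
      then show ?thesis using True zS h by (intro bexI[of _ s']) (simp_all add: lt_imp_le)
    next
      case False
      then have "j \<prec> k" using jk by (simp add: le_def)
      then have "nth z' (\<S> j) = nth z (\<S> j)" "nth z' j = nth z j" using zj h k by (auto simp: lt_le jk)
      then show ?thesis using z(2) h \<open>j \<prec> k\<close> unfolding cbs_def by simp
    qed
  qed
  then show "\<exists>z\<in>D. cbs z b (\<S> k)" using z' by blast
qed (rule k)

lemma cb_bound: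
  assumes b: "b \<in> D" and s: "s \<in> D"
  shows "\<exists>s'\<in>D. s' \<preceq> cb b \<and> (\<forall>i\<in>D. i \<prec> b \<longrightarrow> nth s' i = mn (nth s i) b)"
proof -
  define z where "z = lst (\<lambda>z. cbs z b b)"
  obtain z0 where z0: "z0 \<in> D" "cbs z0 b b" using cbs_ex[OF b b] by blast
  have d: "Df (\<lambda>e. cbs (e 0) b b)" using b by (intro cintro)
  have z: "z \<in> D" "cbs z b b" using lst(1,2)[of "\<lambda>z. cbs z b b", OF d z0] by (simp_all add: z_def)
  have "b \<preceq> b \<longrightarrow> (\<exists>s'\<in>D. s' \<preceq> nth z b \<and> (\<forall>i\<in>D. i \<prec> b \<longrightarrow> nth s' i = mn (nth s i) b))"
  proof (rule ind[of "\<lambda>k. k \<preceq> b \<longrightarrow> (\<exists>s'\<in>D. s' \<preceq> nth z k \<and> (\<forall>i\<in>D. i \<prec> k \<longrightarrow> nth s' i = mn (nth s i) b))", OF _ _ _ b])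
    show "Df (\<lambda>e. e 0 \<preceq> b \<longrightarrow> (\<exists>s'\<in>D. s' \<preceq> nth z (e 0) \<and> (\<forall>i\<in>D. i \<prec> e 0 \<longrightarrow> nth s' i = mn (nth s i) b)))"
      using b s z by (intro cintro)
    show "\<zero> \<preceq> b \<longrightarrow> (\<exists>s'\<in>D. s' \<preceq> nth z \<zero> \<and> (\<forall>i\<in>D. i \<prec> \<zero> \<longrightarrow> nth s' i = mn (nth s i) b))"
      using z by (intro impI bexI[of _ "\<zero>"]) auto
    fix k assume k: "k \<in> D" and IH: "k \<preceq> b \<longrightarrow> (\<exists>s'\<in>D. s' \<preceq> nth z k \<and> (\<forall>i\<in>D. i \<prec> k \<longrightarrow> nth s' i = mn (nth s i) b))"
    show "\<S> k \<preceq> b \<longrightarrow> (\<exists>s'\<in>D. s' \<preceq> nth z (\<S> k) \<and> (\<forall>i\<in>D. i \<prec> \<S> k \<longrightarrow> nth s' i = mn (nth s i) b))"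
    proof
      assume "\<S> k \<preceq> b"
      then have kb: "k \<prec> b" using k b by (simp add: lt_le)
      then obtain t where t: "t \<in> D" "t \<preceq> nth z k" "\<forall>i\<in>D. i \<prec> k \<longrightarrow> nth t i = mn (nth s i) b"
        using IH by (auto simp: lt_imp_le)
      have m: "mn (nth s k) b \<in> D" "mn (nth s k) b \<preceq> b" using s k b by auto
      obtain t' where t': "t' \<in> D" "t' \<preceq> nth z (\<S> k)" "nth t' k = mn (nth s k) b" "\<forall>i\<in>D. i \<prec> k \<longrightarrow> nth t' i = nth t i"
        using z(2)[unfolded cbs_def, rule_format, OF k kb t(1,2) m] by blast
      have "nth t' i = mn (nth s i) b" if "i \<in> D" "i \<prec> \<S> k" for i
        using that k t t' by (cases "i = k") (auto simp: le_def)
      then show "\<exists>s'\<in>D. s' \<preceq> nth z (\<S> k) \<and> (\<forall>i\<in>D. i \<prec> \<S> k \<longrightarrow> nth s' i = mn (nth s i) b)" using t' by blast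
    qed
  qed
  then show ?thesis by (simp add: cb_def z_def)
qed

end

context calcD begin

lemma Fn_cb [cintro]: "Fn f \<Longrightarrow> Fn (\<lambda>e. cb (f e))"
proof (rule Fn_f1[of cb])
  have "Fn (\<lambda>e. lst (\<lambda>z. cbs z (e 0) (e 0)))"
    by (rule Fn_lst[of "\<lambda>z e. cbs z (e 0) (e 0)"]) (intro cintro, simp add: cbs_ex asgD)
  then show "Fn (\<lambda>e. cb (e 0))" unfolding cb_def by (intro cintro)
qed

end

context pa begin

text \<open>\<open>SB z\<close> is the stack of all numbers from \<open>z\<close> down to zero,
  which majorises every descending stack with top at most \<open>z\<close>. The top entry doubles as
  the counter of the iteration.\<close>

definition SB :: "'a \<Rightarrow> 'a" where "SB z = it (\<lambda>a. pr (\<S> (fs a)) a) z (pr \<zero> \<zero>)"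

lemma SBF: "Df.Fn (\<lambda>e. pr (\<S> (fs (e 0))) (e 0))" by (intro cintro)

lemma SB_D [simp]: "z \<in> D \<Longrightarrow> SB z \<in> D" unfolding SB_def by (intro it_D[OF SBF] pr_D D0)

lemma SB_Fn: "Df.Fn (\<lambda>e. SB (e 0))" unfolding SB_def by (intro Df_Fn_it[OF SBF] cintro)

lemma fs_SB: assumes "z \<in> D" shows "fs (SB z) = z"
proof (rule ind[of "\<lambda>z. fs (SB z) = z"])
  show "Df (\<lambda>e. fs (SB (e 0)) = e 0)" by (intro cintro SB_Fn)
  show "fs (SB \<zero>) = \<zero>" by (simp add: SB_def it_0[OF SBF])
  fix b assume "b \<in> D" "fs (SB b) = b"
  then show "fs (SB (\<S> b)) = \<S> b" using SB_D[of b] by (simp add: SB_def it_S[OF SBF])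
qed (rule assms)

lemma SB_S: "z \<in> D \<Longrightarrow> SB (\<S> z) = pr (\<S> z) (SB z)"
  using fs_SB[of z] by (simp add: SB_def it_S[OF SBF])

lemma le_SB: "z \<in> D \<Longrightarrow> z \<preceq> SB z" using fs_le[of "SB z"] fs_SB[of z] by simp

lemma SB_mono: assumes "a \<preceq> b" "a \<in> D" "b \<in> D" shows "SB a \<preceq> SB b"
proof -
  have "a \<preceq> b \<longrightarrow> SB a \<preceq> SB b"
  proof (rule ind[of "\<lambda>b. a \<preceq> b \<longrightarrow> SB a \<preceq> SB b", OF _ _ _ assms(3)])
    show "Df (\<lambda>e. a \<preceq> e 0 \<longrightarrow> SB a \<preceq> SB (e 0))" using assms by (intro cintro SB_Fn) auto
    show "a \<preceq> \<zero> \<longrightarrow> SB a \<preceq> SB \<zero>" using assms by auto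
    fix c assume c: "c \<in> D" "a \<preceq> c \<longrightarrow> SB a \<preceq> SB c"
    show "a \<preceq> \<S> c \<longrightarrow> SB a \<preceq> SB (\<S> c)"
    proof
      assume "a \<preceq> \<S> c"
      then consider "a = \<S> c" | "a \<preceq> c" using assms c by (auto simp: le_def)
      then show "SB a \<preceq> SB (\<S> c)"
        by cases (use c assms le_lt_trans[of "SB a" "SB c" "SB (\<S> c)"] in \<open>auto simp: SB_S lt_imp_le\<close>)
    qed
  qed
  then show ?thesis using assms by simp
qed

text \<open>Decreasing lists of elements above \<open>w\<close>, coded as stacks with \<open>w\<close> at the bottom.\<close>

primrec stk :: "'a list \<Rightarrow> 'a \<Rightarrow> 'a" where "stk [] w = w" | "stk (a # as) w = pr a (stk as w)"

definition top :: "'a list \<Rightarrow> 'a \<Rightarrow> 'a" where "top as w = (case as of [] \<Rightarrow> w | a # _ \<Rightarrow> a)"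

primrec dsc :: "'a list \<Rightarrow> 'a \<Rightarrow> bool" where
  "dsc [] w = (w \<in> D)" | "dsc (a # as) w = (a \<in> D \<and> top as w \<prec> a \<and> dsc as w)"

lemma top_simps [simp]: "top [] w = w" "top (a # as) w = a" by (simp_all add: top_def)

lemma dsc_D: "dsc as w \<Longrightarrow> w \<in> D \<and> set as \<subseteq> D \<and> stk as w \<in> D \<and> top as w \<in> D"
  by (induction as) auto

lemma stk_SB: "dsc as w \<Longrightarrow> stk as w \<preceq> SB (top as w)"
proof (induction as)
  case Nil then show ?case by (simp add: le_SB)
next
  case (Cons a as)
  then have *: "a \<in> D" "top as w \<prec> a" "stk as w \<preceq> SB (top as w)" "top as w \<in> D" "stk as w \<in> D"
    using dsc_D[of as w] by auto
  obtain b where b: "b \<in> D" "a = \<S> b" using *(1)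
  proof (cases rule: cases0)
    case 1 then show ?thesis using * by simp
  qed
  have "top as w \<preceq> b" using * b by simp
  then have "stk as w \<preceq> SB b" using * b le_trans[of "stk as w" "SB (top as w)" "SB b"] SB_mono by simp
  then show ?case using b * by (simp add: SB_S pr_mono)
qed

text \<open>A version of \<open>Arr SB (fs z) n\<close> without unbounded quantifiers:
  \<open>sn z\<close> bounds the homogeneous lists, and \<open>cb\<close> bounds a set of colourings
  that represents all of them on the relevant arguments. Hence \<open>rho\<close> lies in the class
  even for \<open>k = 0\<close>. The summand \<open>\<S> n\<close> makes sure that the colours up to
  \<open>n\<close> are kept apart.\<close>

definition arr :: "'a \<Rightarrow> 'a \<Rightarrow> bool" where
  "arr n z \<longleftrightarrow> (\<forall>p\<in>D. p \<preceq> cb (pr (fs z) (SB (fs z)) \<oplus> \<S> n) \<longrightarrow> (\<exists>t\<in>D. t \<preceq> sn z \<and> INC (fs z) n t \<and> PH SB n p t))"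

definition rho :: "'a \<Rightarrow> 'a" where "rho n = fs (lst (arr n))"

text \<open>Truncated subtraction of \<open>d\<close> from \<open>x\<close>.\<close>

definition sb :: "'a \<Rightarrow> 'a \<Rightarrow> 'a" where "sb x d = lst (\<lambda>a. x \<preceq> a \<oplus> d)"

lemma cb_D: "b \<in> D \<Longrightarrow> cb b \<in> D" using Df.FnD[OF Df.Fn_cb[OF Df.Fn_var], of "\<lambda>_. b" 0] by (simp add: asg_def)

text \<open>Only boundedly many colourings occur in \<open>arr\<close>, so collection bounds the
  lists they need.\<close>

lemma Arr_arr:
  assumes A: "Arr SB N n" and D: "N \<in> D" "n \<in> D"
  shows "\<exists>z\<in>D. arr n z"
proof -
  have R: "Df (\<lambda>e. INC N n (e 1) \<and> PH SB n (e 0) (e 1))" using D by (intro cintro Df.c_PH[OF SB_Fn])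
  have c: "cb (pr N (SB N) \<oplus> \<S> n) \<in> D" using D by (simp add: cb_D)
  have "\<exists>B\<in>D. \<forall>p\<in>D. p \<prec> \<S> (cb (pr N (SB N) \<oplus> \<S> n)) \<longrightarrow> (\<exists>t\<in>D. t \<prec> B \<and> INC N n t \<and> PH SB n p t)"
    by (rule collection[of "\<lambda>p t. INC N n t \<and> PH SB n p t", OF R DS[OF c]]) (use A in \<open>simp add: Arr_def\<close>)
  then obtain B where B: "B \<in> D" "\<forall>p\<in>D. p \<prec> \<S> (cb (pr N (SB N) \<oplus> \<S> n)) \<longrightarrow> (\<exists>t\<in>D. t \<prec> B \<and> INC N n t \<and> PH SB n p t)" by blast
  have "\<exists>t\<in>D. t \<preceq> B \<and> INC N n t \<and> PH SB n p t" if "p \<in> D" "p \<preceq> cb (pr N (SB N) \<oplus> \<S> n)" for p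
    using B(2)[rule_format, of p] that c lt_imp_le by auto
  then have "arr n (pr N B)" unfolding arr_def using D B(1) by simp
  then show ?thesis using D \<open>B \<in> D\<close> by (intro bexI[of _ "pr N B"]) auto
qed

text \<open>An arbitrary colouring is replaced by one below \<open>cb\<close> that agrees with it,
  up to truncation at \<open>n\<close>, wherever \<open>PH\<close> consults it.\<close>

lemma arr_Arr:
  assumes A: "arr n z" and D: "z \<in> D" "n \<in> D"
  shows "Arr SB (fs z) n"
  unfolding Arr_def
proof
  let ?W = "pr (fs z) (SB (fs z)) \<oplus> \<S> n"
  fix p assume p: "p \<in> D"
  obtain p' where p': "p' \<in> D" "p' \<preceq> cb ?W" "\<forall>i\<in>D. i \<prec> ?W \<longrightarrow> nth p' i = mn (nth p i) ?W"
    using cb_bound[of ?W p] p D by auto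
  obtain t where t: "t \<in> D" "INC (fs z) n t" "PH SB n p' t" using A p' unfolding arr_def by blast
  have e: "mn (nth p' (pr (nth t b) i)) n = mn (nth p (pr (nth t b) i)) n"
    if h: "b \<in> D" "b \<prec> n" "a \<in> D" "a \<prec> b" "i \<in> D" "i \<preceq> SB (nth t a)" for a b i
  proof -
    have "a \<prec> n" using h D lt_trans[of a b n] by simp
    then have l: "nth t b \<preceq> fs z" "nth t a \<preceq> fs z" using t h unfolding INC_def by (auto simp: lt_imp_le)
    then have "i \<preceq> SB (fs z)" using le_trans[OF h(6) SB_mono[of "nth t a" "fs z"]] h t D by simp
    then have "pr (nth t b) i \<preceq> pr (fs z) (SB (fs z))" using l h t D by (intro pr_mono) auto
    moreover have "pr (fs z) (SB (fs z)) \<prec> ?W" using D by (simp add: pl_S)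
    ultimately have "pr (nth t b) i \<prec> ?W" using le_lt_trans[of "pr (nth t b) i" "pr (fs z) (SB (fs z))" ?W] h t D by simp
    then have "nth p' (pr (nth t b) i) = mn (nth p (pr (nth t b) i)) ?W" using p' h t by simp
    moreover have "n \<preceq> ?W" using D le_trans[of n "\<S> n" ?W] by (simp add: lt_imp_le)
    ultimately show ?thesis using mn_mn[of n ?W] h t p D by simp
  qed
  have "PH SB n p t" unfolding PH_def
  proof (intro ballI impI)
    fix b c a i assume h: "b \<in> D" "b \<prec> n" "c \<in> D" "c \<prec> n" "a \<in> D" "a \<prec> b" "a \<prec> c" "i \<in> D" "i \<preceq> SB (nth t a)"
    then show "mn (nth p (pr (nth t b) i)) n = mn (nth p (pr (nth t c) i)) n"
      using t(3)[unfolded PH_def, rule_format, of b c a i] e[of b a i] e[of c a i] by simp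
  qed
  then show "\<exists>t\<in>D. INC (fs z) n t \<and> PH SB n p t" using t by blast
qed

lemma arr_ex: "n \<in> D \<Longrightarrow> \<exists>z\<in>D. arr n z"
  using Arr_ex[of SB, OF SB_Fn] Arr_arr by blast

end

context lev begin

lemma Fn_SB [cintro]: "R.Fn f \<Longrightarrow> R.Fn (\<lambda>e. SB (f e))"
  unfolding SB_def by (rule Fn_it[of "\<lambda>a. pr (\<S> (fs a)) a"]) (intro cintro | simp)+

lemma c_arr [cintro]: "R.Fn f \<Longrightarrow> R.Fn g \<Longrightarrow> Dl Q (Suc k) (\<lambda>e. arr (f e) (g e))"
proof (rule R.c_r2[of arr])
  have SBv: "R.Fn (\<lambda>e. SB (e 0))" by (intro cintro)
  show "Dl Q (Suc k) (\<lambda>e. arr (e 0) (e 1))" unfolding arr_def by (intro cintro R.c_PH[OF SBv])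
qed

lemma Fn_rho [cintro]: "R.Fn f \<Longrightarrow> R.Fn (\<lambda>e. rho (f e))"
proof (rule R.Fn_f1[of rho])
  have "R.Fn (\<lambda>e. lst (\<lambda>z. arr (e 0) z))"
    by (rule R.Fn_lst[of "\<lambda>z e. arr (e 0) z"]) (intro cintro, simp add: arr_ex asgD)
  then show "R.Fn (\<lambda>e. rho (e 0))" unfolding rho_def by (intro cintro)
qed

end

context calcD begin

lemma Fn_sb [cintro]: "Fn f \<Longrightarrow> Fn g \<Longrightarrow> Fn (\<lambda>e. sb (f e) (g e))"
  unfolding sb_def
proof (rule Fn_f2[of "\<lambda>x d. lst (\<lambda>a. x \<preceq> a \<oplus> d)"])
  show "Fn (\<lambda>e. lst (\<lambda>a. e 0 \<preceq> a \<oplus> e 1))"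
    by (rule Fn_lst[of "\<lambda>a e. e 0 \<preceq> a \<oplus> e 1"]) (intro cintro, metis asgD le_pl1)
qed

end

context lev begin

lemma rho: assumes "n \<in> D" shows "rho n \<in> D" "Arr SB (rho n) n"
proof -
  obtain z where z: "z \<in> D" "arr n z" using arr_ex[OF assms] by blast
  have d: "Df (\<lambda>e. arr n (e 0))"
    using assms unfolding arr_def by (intro cintro Df.c_PH[OF SB_Fn] Df.Fn_f1[OF SB_Fn])
  show "rho n \<in> D" "Arr SB (rho n) n"
    using lst(1,2)[of "arr n", OF d z] arr_Arr[of n] assms unfolding rho_def by auto
qed

end

context pa begin

lemma sb_pl: assumes "a \<in> D" "d \<in> D" shows "sb (a \<oplus> d) d = a"
  unfolding sb_def
proof (rule lst_eq)
  fix b assume "b \<in> D" "b \<prec> a"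
  then have "b \<oplus> d \<prec> a \<oplus> d" using assms by (intro pl_lt_mono) auto
  then show "\<not> a \<oplus> d \<preceq> b \<oplus> d" using assms \<open>b \<in> D\<close> by simp
qed (use assms in auto)

lemma sb_D [simp]: "x \<in> D \<Longrightarrow> d \<in> D \<Longrightarrow> sb x d \<in> D"
  using FnD2[OF Df.Fn_sb[OF Df.Fn_var[of 0] Df.Fn_var[of 1]]] by simp

lemma sb_S: assumes "\<S> d \<preceq> x" "x \<in> D" "d \<in> D" shows "sb x d = \<S> (sb x (\<S> d))"
proof -
  obtain c where c: "c \<in> D" "x = \<S> d \<oplus> c" using leE[of "\<S> d" x] assms by auto
  have 1: "x = c \<oplus> \<S> d" "x = \<S> c \<oplus> d" using c assms by (simp_all add: ring)
  have "sb x (\<S> d) = c" unfolding 1(1) by (rule sb_pl) (use c assms in auto)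
  moreover have "sb x d = \<S> c" unfolding 1(2) by (rule sb_pl) (use c assms in auto)
  ultimately show ?thesis by simp
qed

end

subsection \<open>Homogeneous sets in long intervals\<close>

context pa begin

text \<open>Used to translate a stack of indices into a stack of elements while keeping its
  bottom.\<close>

primrec mapst :: "nat \<Rightarrow> ('a \<Rightarrow> 'a) \<Rightarrow> 'a \<Rightarrow> 'a" where
  "mapst 0 h a = a" | "mapst (Suc r) h a = pr (h (fs a)) (mapst r h (sn a))"

lemma nm_mono: "i \<le> j \<Longrightarrow> nm i \<preceq> nm j"
proof (induction rule: dec_induct)
  case (step m) then show ?case using le_trans[of "nm i" "nm m" "nm (Suc m)"] by (simp add: lt_imp_le)
qed simp

lemma nth_INC: assumes "INC N n t" "t \<in> D" "n \<in> D" "a \<in> D" "a \<prec> n" shows "a \<preceq> nth t a"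
proof -
  have "a \<prec> n \<longrightarrow> a \<preceq> nth t a"
  proof (rule ind[of "\<lambda>a. a \<prec> n \<longrightarrow> a \<preceq> nth t a", OF _ _ _ assms(4)])
    show "Df (\<lambda>e. e 0 \<prec> n \<longrightarrow> e 0 \<preceq> nth t (e 0))" using assms by (intro cintro)
    fix a assume a: "a \<in> D" "a \<prec> n \<longrightarrow> a \<preceq> nth t a"
    show "\<S> a \<prec> n \<longrightarrow> \<S> a \<preceq> nth t (\<S> a)"
    proof
      assume s: "\<S> a \<prec> n"
      then have "nth t a \<prec> nth t (\<S> a)" using assms(1) a unfolding INC_def by simp
      moreover have "a \<preceq> nth t a" using a s lt_trans[of a "\<S> a" n] assms by simp
      ultimately show "\<S> a \<preceq> nth t (\<S> a)" using a assms le_lt_trans[of a "nth t a" "nth t (\<S> a)"] by (simp add: lt_le)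
    qed
  qed (use assms in simp)
  then show ?thesis using assms by simp
qed

end

context lev begin

text \<open>The length from which one thinning leaves \<open>v\<close> elements. The homogeneous
  list has \<open>2 * v + 2\<close> entries: at most \<open>v + 1\<close> at the beginning are
  skipped to get above \<open>y x\<close>, then \<open>v\<close> are kept, and one more serves as
  the constant \<open>L x\<close> of \<open>arr_step\<close>.\<close>

definition Psi :: "'a \<Rightarrow> 'a" where "Psi v = rho (v \<oplus> \<S> (\<S> v)) \<oplus> v"

lemma Psi_D [simp]: "v \<in> D \<Longrightarrow> Psi v \<in> D" unfolding Psi_def using rho(1)[of "v \<oplus> \<S> (\<S> v)"] by simp

lemma Fn_Psi [cintro]: "R.Fn f \<Longrightarrow> R.Fn (\<lambda>e. Psi (f e))" unfolding Psi_def by (intro cintro)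

lemma PsiF: "Df.Fn (\<lambda>e. Psi (e 0))" by (rule R.Fn_Df) (intro cintro)

lemma Fn_itPsi [cintro]: "R.Fn f \<Longrightarrow> R.Fn g \<Longrightarrow> R.Fn (\<lambda>e. it Psi (f e) (g e))"
  by (rule Fn_it) (intro cintro)

lemma it_Psi_ge: assumes "z \<in> D" "j \<in> D" shows "z \<preceq> it Psi j z"
proof (rule ind[of "\<lambda>j. z \<preceq> it Psi j z", OF _ _ _ assms(2)])
  show "Df (\<lambda>e. z \<preceq> it Psi (e 0) z)" using assms by (intro cintro Df_Fn_it[OF PsiF])
  show "z \<preceq> it Psi \<zero> z" using assms by (simp add: it_0[OF PsiF])
  fix b assume b: "b \<in> D" "z \<preceq> it Psi b z"
  have i: "it Psi b z \<in> D" using b assms it_D[OF PsiF] by simp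
  have "it Psi b z \<preceq> Psi (it Psi b z)"
    using i rho(1)[of "it Psi b z \<oplus> \<S> (\<S> (it Psi b z))"] by (simp add: Psi_def[of "it Psi b z"])
  then show "z \<preceq> it Psi (\<S> b) z" using le_trans[OF b(2), of "Psi (it Psi b z)"] i b assms by (simp add: it_S[OF PsiF])
qed

lemma Fn_mapst: "R.Fn (\<lambda>e. H (e 0) (e 1)) \<Longrightarrow> R.Fn f \<Longrightarrow> R.Fn g \<Longrightarrow> R.Fn (\<lambda>e. mapst r (H (f e)) (g e))"
proof (induction r arbitrary: g)
  case (Suc r)
  show ?case unfolding mapst.simps by (intro cintro R.Fn_f2[OF Suc.prems(1)] Suc.IH Suc.prems)
qed simp

context
  fixes y :: "'a \<Rightarrow> 'a"
  assumes y: "R.Fn (\<lambda>e. y (e 0))"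
begin

lemma y_D [simp]: "x \<in> D \<Longrightarrow> y x \<in> D" using FnD1[OF R.Fn_Df[OF y]] .

text \<open>The number of elements left after \<open>d\<close> thinnings. At the start
  \<open>x\<close> applications of \<open>Psi\<close> are in stock and each thinning uses up one, so
  \<open>d\<close> thinnings are possible as soon as \<open>nm d \<preceq> x\<close>.\<close>

definition V :: "nat \<Rightarrow> 'a \<Rightarrow> 'a" where "V d x = it Psi (sb x (nm d)) (y x \<oplus> x)"

lemma V_D [simp]: "x \<in> D \<Longrightarrow> V d x \<in> D" unfolding V_def by (intro it_D[OF PsiF]) auto

lemma Fn_V: "R.Fn f \<Longrightarrow> R.Fn (\<lambda>e. V d (f e))"
  unfolding V_def by (intro cintro R.Fn_f1[OF y])

lemma V_Suc: "x \<in> D \<Longrightarrow> nm (Suc d) \<preceq> x \<Longrightarrow> V d x = Psi (V (Suc d) x)"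
  using sb_S[of "nm d" x] by (simp add: V_def it_S[OF PsiF])

lemma V_ge: assumes "x \<in> D" shows "y x \<preceq> V d x" "x \<preceq> V d x"
proof -
  have "y x \<oplus> x \<preceq> V d x" unfolding V_def using assms by (intro it_Psi_ge) auto
  then show "y x \<preceq> V d x" "x \<preceq> V d x"
    using assms le_trans[of "y x" "y x \<oplus> x" "V d x"] le_trans[of x "y x \<oplus> x" "V d x"] by auto
qed

context
  fixes Z :: "'a \<Rightarrow> 'a"
begin

text \<open>The state after \<open>d\<close> thinnings: \<open>H x\<close> lists in increasing order
  the elements of the gap that are still in use.\<close>

definition good :: "('a \<Rightarrow> 'a \<Rightarrow> 'a) \<Rightarrow> nat \<Rightarrow> bool" where
  "good H d \<longleftrightarrow> R.Fn (\<lambda>e. H (e 0) (e 1)) \<and> (\<forall>x\<in>D. nm d \<preceq> x \<longrightarrow> (\<forall>a\<in>D. a \<prec> V d x \<longrightarrow>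
     y x \<prec> H x a \<and> H x a \<prec> Z x \<and> (\<forall>b\<in>D. b \<prec> a \<longrightarrow> H x b \<prec> H x a)))"

definition rng :: "('a \<Rightarrow> 'a \<Rightarrow> 'a) \<Rightarrow> nat \<Rightarrow> 'a \<Rightarrow> 'a set" where
  "rng H d x = {H x a | a. a \<in> D \<and> a \<prec> V d x}"

definition hom :: "nat \<Rightarrow> ('a \<Rightarrow> 'a \<Rightarrow> 'a) \<Rightarrow> ('a \<Rightarrow> 'a \<Rightarrow> 'a) \<Rightarrow> nat \<Rightarrow> bool" where
  "hom r G H d \<longleftrightarrow> (\<forall>x w as bs. x \<in> D \<longrightarrow> nm d \<preceq> x \<longrightarrow> w \<preceq> y x \<longrightarrow> dsc as w \<longrightarrow> dsc bs w \<longrightarrow>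
     length as = r \<longrightarrow> length bs = r \<longrightarrow> set as \<subseteq> rng H d x \<longrightarrow> set bs \<subseteq> rng H d x \<longrightarrow>
     mn (G x (stk as w)) (y x) = mn (G x (stk bs w)) (y x))"

text \<open>One thinning makes the truncated value independent of the top entry, which may be
  exchanged for the fixed \<open>L x\<close>. The Ramsey statement is applied to indices instead of
  elements, since it is the indices that \<open>V d x\<close> bounds; \<open>mapst\<close>
  translates between the two.\<close>

lemma arr_step:
  assumes g: "good H d" and G: "R.Fn (\<lambda>e. G (e 0) (e 1))"
  shows "\<exists>H' L. good H' (Suc d) \<and> R.Fn (\<lambda>e. L (e 0)) \<and> (\<forall>x\<in>D. nm (Suc d) \<preceq> x \<longrightarrow> rng H' (Suc d) x \<subseteq> rng H d x \<and>
    (\<forall>w b as. w \<preceq> y x \<longrightarrow> length as = r \<longrightarrow> dsc (b # as) w \<longrightarrow> set (b # as) \<subseteq> rng H' (Suc d) x \<longrightarrow>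
       mn (G x (pr b (stk as w))) (y x) = mn (G x (pr (L x) (stk as w))) (y x)))"
proof -
  have H: "R.Fn (\<lambda>e. H (e 0) (e 1))" using g by (simp add: good_def)
  note HD = FnD2[OF R.Fn_Df[OF H]] and GD = FnD2[OF R.Fn_Df[OF G]]
  let ?V = "V (Suc d)"
  define n where "n x = ?V x \<oplus> \<S> (\<S> (?V x))" for x
  have nD [simp]: "n x \<in> D" if "x \<in> D" for x using that by (simp add: n_def)
  define Gi where "Gi x b i = G x (pr (H x b) (mapst r (H x) i))" for x b i
  have mF: "R.Fn (\<lambda>e. mapst r (H (e 0)) (e 1))" by (intro Fn_mapst[OF H] cintro)
  note mD = FnD2[OF R.Fn_Df[OF mF]]
  have GiD [simp]: "Gi x b i \<in> D" if "x \<in> D" "b \<in> D" "i \<in> D" for x b i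
    unfolding Gi_def by (intro GD pr_D HD mD that)
  define PP where "PP x t \<longleftrightarrow> INC (V d x) (n x) t \<and> (\<forall>b\<in>D. b \<prec> n x \<longrightarrow> (\<forall>c\<in>D. c \<prec> n x \<longrightarrow> (\<forall>a\<in>D. a \<prec> b \<longrightarrow> a \<prec> c \<longrightarrow>
     (\<forall>i\<in>D. i \<preceq> SB (nth t a) \<longrightarrow> mn (Gi x (nth t b) i) (n x) = mn (Gi x (nth t c) i) (n x)))))" for x t
  have PPc: "Dl Q (Suc k) (\<lambda>e. PP (e 1) (e 0))" unfolding PP_def Gi_def n_def
    by (intro cintro R.Fn_f2[OF G] R.Fn_f2[OF H] Fn_mapst[OF H] Fn_V)
  have ex: "\<exists>t\<in>D. PP x t" if x: "x \<in> D" "nm (Suc d) \<preceq> x" for x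
  proof -
    have "rho (n x) \<preceq> V d x" unfolding V_Suc[OF x] Psi_def n_def[symmetric] using x rho(1)[of "n x"] by simp
    from Arr_mono[OF rho(2) this] have A: "Arr SB (V d x) (n x)" using x rho(1)[of "n x"] by simp
    let ?W = "\<S> (pr (V d x) (SB (V d x)))"
    have "Df.Fn (\<lambda>e. Gi x (fs (e 0)) (sn (e 0)))" unfolding Gi_def
      using x(1) by (intro Df.Fn_f2[OF R.Fn_Df[OF G]] Df.Fn_f2[OF R.Fn_Df[OF H]] Df.Fn_f2[OF R.Fn_Df[OF mF]] cintro)
    from seq_comp[of "\<lambda>j. Gi x (fs j) (sn j)", OF this, of ?W] x(1)
    obtain p where p: "p \<in> D" "\<And>j. j \<in> D \<Longrightarrow> j \<prec> ?W \<Longrightarrow> nth p j = Gi x (fs j) (sn j)" by auto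
    obtain t where t: "t \<in> D" "INC (V d x) (n x) t" "PH SB (n x) p t" using A p(1) unfolding Arr_def by blast
    have e: "nth p (pr (nth t b) i) = Gi x (nth t b) i"
      if h: "b \<in> D" "b \<prec> n x" "a \<in> D" "a \<prec> b" "i \<in> D" "i \<preceq> SB (nth t a)" for a b i
    proof -
      have "a \<prec> n x" using h x lt_trans[of a b "n x"] by simp
      then have l: "nth t b \<preceq> V d x" "nth t a \<preceq> V d x" using t h unfolding INC_def by (auto simp: lt_imp_le)
      then have "i \<preceq> SB (V d x)" using le_trans[OF h(6) SB_mono[of "nth t a" "V d x"]] h t x by simp
      then have "pr (nth t b) i \<preceq> pr (V d x) (SB (V d x))" using l h t x by (intro pr_mono) auto
      then show ?thesis using p(2)[of "pr (nth t b) i"] h t x by simp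
    qed
    have "PP x t" unfolding PP_def
    proof (intro conjI ballI impI t(2))
      fix b c a i assume h: "b \<in> D" "b \<prec> n x" "c \<in> D" "c \<prec> n x" "a \<in> D" "a \<prec> b" "a \<prec> c" "i \<in> D" "i \<preceq> SB (nth t a)"
      then show "mn (Gi x (nth t b) i) (n x) = mn (Gi x (nth t c) i) (n x)"
        using t(3)[unfolded PH_def, rule_format, of b c a i] e[of b a i] e[of c a i] by simp
    qed
    then show ?thesis using t by blast
  qed
  \<comment> \<open>The guard makes the choice of \<open>T x\<close> total, so that \<open>T\<close>
    belongs to the class.\<close>
  let ?C = "\<lambda>t x. nm (Suc d) \<preceq> x \<longrightarrow> PP x t"
  have C: "Dl Q (Suc k) (\<lambda>e. ?C (e 0) (e 1))" by (intro R.c_imp PPc cintro)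
  have Cex: "\<exists>t\<in>D. ?C t x" if "x \<in> D" for x using ex[OF that] D0 by blast
  define T where "T x = lst (\<lambda>t. ?C t x)" for x
  have TF: "R.Fn (\<lambda>e. T (e 0))" unfolding T_def
    by (rule R.Fn_lst[of "\<lambda>t e. ?C t (e 0)"]) (use C in simp, rule Cex, simp add: asgD)
  have TD [simp]: "T x \<in> D" if "x \<in> D" for x using FnD1[OF R.Fn_Df[OF TF] that] .
  have PPT: "PP x (T x)" if x: "x \<in> D" "nm (Suc d) \<preceq> x" for x
    using lst_Fn_Df(2)[of ?C, OF R.C_Df[OF C] Cex x(1)] x unfolding T_def by blast
  \<comment> \<open>Entry number \<open>j\<close> of an increasing list is at least
    \<open>j\<close>; skipping \<open>\<S> (y x)\<close> entries therefore leaves only indices above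
    \<open>y x\<close>.\<close>
  define p where "p x a = nth (T x) (a \<oplus> \<S> (y x))" for x a
  have pD [simp]: "p x a \<in> D" if "x \<in> D" "a \<in> D" for x a using that by (simp add: p_def)
  define H' where "H' x a = H x (p x a)" for x a
  \<comment> \<open>The list entry right after those used by \<open>H'\<close>.\<close>
  define L where "L x = H x (p x (?V x))" for x
  have H'F: "R.Fn (\<lambda>e. H' (e 0) (e 1))" unfolding H'_def p_def by (intro R.Fn_f2[OF H] R.Fn_f1[OF TF] R.Fn_f1[OF y] cintro)
  have LF: "R.Fn (\<lambda>e. L (e 0))" unfolding L_def p_def
    by (intro R.Fn_f2[OF H] R.Fn_f1[OF TF] R.Fn_f1[OF y] cintro Fn_V)
  have H'D [simp]: "H' x a \<in> D" if "x \<in> D" "a \<in> D" for x a unfolding H'_def by (intro HD pD that)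
  have main: "good H' (Suc d)" (is ?g)
    and "\<forall>x\<in>D. nm (Suc d) \<preceq> x \<longrightarrow> rng H' (Suc d) x \<subseteq> rng H d x \<and>
    (\<forall>w b as. w \<preceq> y x \<longrightarrow> length as = r \<longrightarrow> dsc (b # as) w \<longrightarrow> set (b # as) \<subseteq> rng H' (Suc d) x \<longrightarrow>
       mn (G x (pr b (stk as w))) (y x) = mn (G x (pr (L x) (stk as w))) (y x))" (is ?h)
  proof -
    have *: "(\<forall>a\<in>D. a \<preceq> ?V x \<longrightarrow> a \<oplus> \<S> (y x) \<prec> n x \<and> p x a \<prec> V d x \<and> y x \<prec> p x a \<and> (\<forall>b\<in>D. b \<prec> a \<longrightarrow> p x b \<prec> p x a))
       \<and> (\<forall>a\<in>D. a \<prec> V d x \<longrightarrow> y x \<prec> H x a \<and> H x a \<prec> Z x \<and> (\<forall>b\<in>D. b \<prec> a \<longrightarrow> H x b \<prec> H x a))"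
      if x: "x \<in> D" "nm (Suc d) \<preceq> x" for x
    proof (rule conjI)
      have I: "INC (V d x) (n x) (T x)" using PPT[OF x] by (simp add: PP_def)
      show "\<forall>a\<in>D. a \<preceq> ?V x \<longrightarrow> a \<oplus> \<S> (y x) \<prec> n x \<and> p x a \<prec> V d x \<and> y x \<prec> p x a \<and> (\<forall>b\<in>D. b \<prec> a \<longrightarrow> p x b \<prec> p x a)"
      proof (intro ballI impI)
        fix a assume a: "a \<in> D" "a \<preceq> ?V x"
        have "a \<oplus> \<S> (y x) \<preceq> ?V x \<oplus> \<S> (?V x)" using a x V_ge[OF x(1), of "Suc d"] by (intro pl_mono) auto
        moreover have "?V x \<oplus> \<S> (?V x) \<prec> n x" using x by (simp add: n_def pl_S)
        ultimately have l: "a \<oplus> \<S> (y x) \<prec> n x" using le_lt_trans[of "a \<oplus> \<S> (y x)" "?V x \<oplus> \<S> (?V x)" "n x"] a x by simp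
        have "\<S> (y x) \<preceq> p x a" unfolding p_def
          using nth_INC[OF I _ _ _ l] le_trans[of "\<S> (y x)" "a \<oplus> \<S> (y x)" "nth (T x) (a \<oplus> \<S> (y x))"] a x by simp
        then have "y x \<prec> p x a" using a x by (simp add: lt_le)
        moreover have "p x b \<prec> p x a" if "b \<in> D" "b \<prec> a" for b
        proof -
          have "b \<oplus> \<S> (y x) \<prec> a \<oplus> \<S> (y x)" using that a x by (intro pl_lt_mono) auto
          then show ?thesis using I l that a x unfolding INC_def p_def by simp
        qed
        moreover have "p x a \<prec> V d x" using I l a x unfolding INC_def p_def by simp
        ultimately show "a \<oplus> \<S> (y x) \<prec> n x \<and> p x a \<prec> V d x \<and> y x \<prec> p x a \<and> (\<forall>b\<in>D. b \<prec> a \<longrightarrow> p x b \<prec> p x a)" using l by blast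
      qed
      have "nm d \<preceq> x" using le_trans[of "nm d" "nm (Suc d)" x] x by (simp add: lt_imp_le)
      then show "\<forall>a\<in>D. a \<prec> V d x \<longrightarrow> y x \<prec> H x a \<and> H x a \<prec> Z x \<and> (\<forall>b\<in>D. b \<prec> a \<longrightarrow> H x b \<prec> H x a)"
        using g x unfolding good_def by blast
    qed
    have inc: "H' x b \<prec> H' x a" if "x \<in> D" "nm (Suc d) \<preceq> x" "a \<in> D" "a \<prec> ?V x" "b \<in> D" "b \<prec> a" for x a b
      using *[OF that(1,2)] that lt_imp_le[OF that(4)] unfolding H'_def by simp
    show ?g unfolding good_def
    proof (intro conjI H'F ballI impI)
      fix x a assume h: "x \<in> D" "nm (Suc d) \<preceq> x" "a \<in> D" "a \<prec> ?V x"
      then show "y x \<prec> H' x a" "H' x a \<prec> Z x" using *[OF h(1,2)] lt_imp_le[OF h(4)] unfolding H'_def by simp_all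
      show "H' x b \<prec> H' x a" if "b \<in> D" "b \<prec> a" for b using inc h that by simp
    qed
    show ?h
    proof (intro ballI impI conjI allI)
      fix x assume x: "x \<in> D" "nm (Suc d) \<preceq> x"
      show "rng H' (Suc d) x \<subseteq> rng H d x"
        unfolding rng_def H'_def using *[OF x] x by (auto simp: lt_imp_le)
      have injp: "p x b \<prec> p x a" if h: "a \<in> D" "b \<in> D" "a \<prec> ?V x" "b \<prec> ?V x" "H' x b \<prec> H' x a" for a b
      proof (rule ccontr)
        assume "\<not> p x b \<prec> p x a"
        then consider "p x a = p x b" | "p x a \<prec> p x b" using x h by (auto simp: le_def)
        then show False
        proof cases
          case 1 then show ?thesis using h x by (simp add: H'_def HD)
        next
          case 2
          then have "H' x a \<prec> H' x b" unfolding H'_def using *[OF x] h x by (simp add: lt_imp_le)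
          then show ?thesis using h x lt_trans[of "H' x a" "H' x b" "H' x a"] by simp
        qed
      qed
      fix w assume w: "w \<preceq> y x"
      \<comment> \<open>A descending stack of elements of the thinned set comes from a descending
        stack of indices with the same bottom \<open>w\<close>.\<close>
      have idx: "\<exists>is. stk as w = mapst (length as) (H x) (stk is w) \<and> dsc is w
           \<and> (as = [] \<and> is = [] \<or> (\<exists>\<beta>\<in>D. \<beta> \<prec> ?V x \<and> top is w = p x \<beta> \<and> top as w = H' x \<beta>))"
        if "dsc as w" "set as \<subseteq> rng H' (Suc d) x" for as
        using that
      proof (induction as)
        case Nil then show ?case by (intro exI[of _ "[]"]) simp
      next
        case (Cons b as)
        then obtain "is" where i: "stk as w = mapst (length as) (H x) (stk is w)" "dsc is w"
          "as = [] \<and> is = [] \<or> (\<exists>\<beta>\<in>D. \<beta> \<prec> ?V x \<and> top is w = p x \<beta> \<and> top as w = H' x \<beta>)" by auto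
        obtain \<beta> where \<beta>: "\<beta> \<in> D" "\<beta> \<prec> ?V x" "b = H' x \<beta>" using Cons.prems unfolding rng_def by auto
        have wD: "w \<in> D" "stk is w \<in> D" using dsc_D[OF i(2)] by auto
        have "top is w \<prec> p x \<beta>" using i(3)
        proof
          assume "as = [] \<and> is = []"
          moreover have "y x \<prec> p x \<beta>" using *[OF x] \<beta> by (simp add: lt_imp_le)
          ultimately show ?thesis using le_lt_trans[OF w] wD x \<beta> by simp
        next
          assume "\<exists>\<beta>\<in>D. \<beta> \<prec> ?V x \<and> top is w = p x \<beta> \<and> top as w = H' x \<beta>"
          then obtain \<gamma> where "\<gamma> \<in> D" "\<gamma> \<prec> ?V x" "top is w = p x \<gamma>" "top as w = H' x \<gamma>" by blast
          then show ?thesis using injp[of \<beta> \<gamma>] \<beta> Cons.prems by simp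
        qed
        then show ?case using i \<beta> x wD
          by (intro exI[of _ "p x \<beta> # is"]) (auto simp: H'_def)
      qed
      fix b as assume as: "length as = r" "dsc (b # as) w" "set (b # as) \<subseteq> rng H' (Suc d) x"
      obtain \<beta> where \<beta>: "\<beta> \<in> D" "\<beta> \<prec> ?V x" "b = H' x \<beta>" using as unfolding rng_def by auto
      obtain "is" where i: "stk as w = mapst r (H x) (stk is w)" "dsc is w"
          "as = [] \<and> is = [] \<or> (\<exists>\<beta>\<in>D. \<beta> \<prec> ?V x \<and> top is w = p x \<beta> \<and> top as w = H' x \<beta>)" using idx[of as] as by auto
      have wD: "w \<in> D" "stk is w \<in> D" "top is w \<in> D" using dsc_D[OF i(2)] by auto
      have Vn: "a \<oplus> \<S> (y x) \<prec> n x" if "a \<in> D" "a \<preceq> ?V x" for a using *[OF x] that by blast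
      \<comment> \<open>\<open>PH\<close> requires an earlier position \<open>a\<close> whose entry
        controls the rest of the stack: position \<open>y x\<close> if only \<open>w\<close> is
        left, and otherwise the position of the next entry of the stack.\<close>
      have "\<exists>a\<in>D. a \<prec> \<beta> \<oplus> \<S> (y x) \<and> a \<prec> ?V x \<oplus> \<S> (y x) \<and> top is w \<preceq> nth (T x) a" using i(3)
      proof
        assume n: "as = [] \<and> is = []"
        have l: "y x \<prec> a \<oplus> \<S> (y x)" if "a \<in> D" for a using that x by (simp add: pl_S)
        have "y x \<prec> n x" using lt_trans[OF l[of "?V x"] Vn] x by simp
        then have "y x \<preceq> nth (T x) (y x)" using PPT[OF x] nth_INC[of "V d x" "n x" "T x" "y x"] x by (simp add: PP_def)
        then show ?thesis using n l \<beta> x le_trans[OF w] wD by (intro bexI[of _ "y x"]) auto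
      next
        assume "\<exists>\<beta>\<in>D. \<beta> \<prec> ?V x \<and> top is w = p x \<beta> \<and> top as w = H' x \<beta>"
        then obtain \<gamma> where \<gamma>: "\<gamma> \<in> D" "\<gamma> \<prec> ?V x" "top is w = p x \<gamma>" "top as w = H' x \<gamma>" by blast
        have "\<gamma> \<prec> \<beta>"
        proof (rule ccontr)
          assume "\<not> \<gamma> \<prec> \<beta>"
          then have "H' x \<beta> \<preceq> H' x \<gamma>" using \<beta> \<gamma> inc[OF x, of \<gamma> \<beta>] by (auto simp: le_def)
          then show False using \<gamma> \<beta> as x le_lt_trans[of "H' x \<beta>" "H' x \<gamma>" "H' x \<beta>"] by simp
        qed
        then show ?thesis using \<gamma> \<beta> x unfolding p_def
          by (intro bexI[of _ "\<gamma> \<oplus> \<S> (y x)"]) (auto intro!: pl_lt_mono)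
      qed
      then obtain a where a: "a \<in> D" "a \<prec> \<beta> \<oplus> \<S> (y x)" "a \<prec> ?V x \<oplus> \<S> (y x)" "top is w \<preceq> nth (T x) a" by blast
      have "stk is w \<preceq> SB (nth (T x) a)"
        using le_trans[OF stk_SB[OF i(2)] SB_mono[OF a(4)]] wD a x by simp
      then have "mn (Gi x (p x \<beta>) (stk is w)) (n x) = mn (Gi x (p x (?V x)) (stk is w)) (n x)"
        unfolding p_def using PPT[OF x, unfolded PP_def] Vn[of \<beta>] Vn[of "?V x"] \<beta> a x wD lt_imp_le[OF \<beta>(2)] by simp
      moreover have "y x \<preceq> n x" unfolding n_def using le_trans[OF V_ge(1)[OF x(1)], of "Suc d" "n x"] x by (simp add: n_def)
      ultimately have "mn (Gi x (p x \<beta>) (stk is w)) (y x) = mn (Gi x (p x (?V x)) (stk is w)) (y x)"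
        using mn_mn[of "y x" "n x" "Gi x (p x \<beta>) (stk is w)"] mn_mn[of "y x" "n x" "Gi x (p x (?V x)) (stk is w)"] x wD \<beta> by simp
      then show "mn (G x (pr b (stk as w))) (y x) = mn (G x (pr (L x) (stk as w))) (y x)"
        by (simp add: Gi_def \<beta>(3) i(1) L_def H'_def)
    qed
  qed
  then show ?thesis using LF by blast
qed

text \<open>\<open>arr_step\<close> is repeated for each of the \<open>r\<close> entries: with the
  top fixed as \<open>L x\<close>, the value is a function of a shorter stack, to which the
  induction hypothesis applies.\<close>

lemma hom_step:
  assumes "good H d" and "R.Fn (\<lambda>e. G (e 0) (e 1))"
  shows "\<exists>H' d'. good H' d' \<and> d \<le> d' \<and> (\<forall>x\<in>D. nm d' \<preceq> x \<longrightarrow> rng H' d' x \<subseteq> rng H d x) \<and> hom r G H' d'"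
  using assms
proof (induction r arbitrary: H d G)
  case 0
  have "hom 0 G H d" by (simp add: hom_def)
  then show ?case using 0 by blast
next
  case (Suc r)
  obtain H1 L where 1: "good H1 (Suc d)" "R.Fn (\<lambda>e. L (e 0))"
    and 2: "\<And>x. x \<in> D \<Longrightarrow> nm (Suc d) \<preceq> x \<Longrightarrow> rng H1 (Suc d) x \<subseteq> rng H d x"
    and 3: "\<And>x w b as. x \<in> D \<Longrightarrow> nm (Suc d) \<preceq> x \<Longrightarrow> w \<preceq> y x \<Longrightarrow> length as = r \<Longrightarrow> dsc (b # as) w \<Longrightarrow> set (b # as) \<subseteq> rng H1 (Suc d) x \<Longrightarrow>
       mn (G x (pr b (stk as w))) (y x) = mn (G x (pr (L x) (stk as w))) (y x)"
    using arr_step[of H d G r, OF Suc.prems] by blast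
  have G1: "R.Fn (\<lambda>e. G (e 0) (pr (L (e 0)) (e 1)))"
    by (intro R.Fn_f2[OF Suc.prems(2)] R.Fn_f1[OF 1(2)] cintro)
  obtain H' d' where 4: "good H' d'" "Suc d \<le> d'" "\<And>x. x \<in> D \<Longrightarrow> nm d' \<preceq> x \<Longrightarrow> rng H' d' x \<subseteq> rng H1 (Suc d) x"
    "hom r (\<lambda>x a. G x (pr (L x) a)) H' d'"
    using Suc.IH[of H1 "Suc d" "\<lambda>x a. G x (pr (L x) a)", OF 1(1) G1] by blast
  have nm_mono: "nm (Suc d) \<preceq> x" if "x \<in> D" "nm d' \<preceq> x" for x
    using le_trans[of "nm (Suc d)" "nm d'" x] that nm_mono[OF 4(2)] by simp
  have "hom (Suc r) G H' d'" unfolding hom_def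
  proof (intro allI impI)
    fix x w as bs assume h: "x \<in> D" "nm d' \<preceq> x" "w \<preceq> y x" "dsc as w" "dsc bs w" "length as = Suc r" "length bs = Suc r"
      "set as \<subseteq> rng H' d' x" "set bs \<subseteq> rng H' d' x"
    obtain a as' b bs' where ab: "as = a # as'" "bs = b # bs'" using h by (cases as; cases bs) auto
    note n = nm_mono[OF h(1,2)]
    have s: "set as \<subseteq> rng H1 (Suc d) x" "set bs \<subseteq> rng H1 (Suc d) x" using 4(3)[OF h(1,2)] h by auto
    have "mn (G x (pr (L x) (stk as' w))) (y x) = mn (G x (pr (L x) (stk bs' w))) (y x)"
      using 4(4)[unfolded hom_def, rule_format, of x w as' bs'] h ab by simp
    then show "mn (G x (stk as w)) (y x) = mn (G x (stk bs w)) (y x)"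
      using 3[OF h(1) n h(3), of as' a] 3[OF h(1) n h(3), of bs' b] s h ab by simp
  qed
  moreover have "rng H' d' x \<subseteq> rng H d x" if "x \<in> D" "nm d' \<preceq> x" for x using 4(3)[OF that] 2[OF that(1) nm_mono[OF that]] by blast
  ultimately show ?case using 4(1,2) by (intro exI[of _ H'] exI[of _ d']) auto
qed

text \<open>A canonical descending stack for which, by homogeneity, any other one of the same height
  may be exchanged.\<close>

primrec can :: "('a \<Rightarrow> 'a \<Rightarrow> 'a) \<Rightarrow> 'a \<Rightarrow> nat \<Rightarrow> 'a list" where
  "can H x 0 = []" | "can H x (Suc N) = H x (nm N) # can H x N"

lemma can:
  assumes g: "good H d" and x: "x \<in> D" "nm d \<preceq> x" and w: "w \<in> D" "w \<preceq> y x"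
  shows "nm N \<preceq> x \<Longrightarrow> length (can H x N) = N \<and> set (can H x N) \<subseteq> rng H d x \<and> dsc (can H x N) w"
proof (induction N)
  case (Suc N)
  have HD: "H x (nm i) \<in> D" for i using FnD2[OF R.Fn_Df, of H] g x unfolding good_def by simp
  have l: "nm N \<preceq> x" "nm N \<prec> x" using Suc.prems x by (auto simp: lt_le lt_imp_le)
  have lV: "nm N \<prec> V d x" using lt_le_trans[OF l(2) V_ge(2)] x by simp
  have "H x (nm N) \<in> rng H d x" using lV unfolding rng_def by (intro CollectI exI[of _ "nm N"]) simp
  moreover have "top (can H x N) w \<prec> H x (nm N)"
  proof (cases N)
    case 0 then show ?thesis using g x w lV le_lt_trans[of w "y x" "H x \<zero>"] HD[of 0] unfolding good_def by simp
  next
    case (Suc m)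
    moreover have "nm m \<prec> nm N" using Suc by simp
    ultimately show ?thesis using g[unfolded good_def] x lV by simp
  qed
  ultimately show ?case using Suc.IH[OF l(1)] HD by simp
qed (use w in simp)

end

text \<open>The elements of \<open>X s x\<close> lie between \<open>y x\<close> and \<open>Z x\<close>. The values of the functions \<open>Fs i\<close>,
  truncated at \<open>y x\<close>, do not depend on the choice of the arguments above \<open>y x\<close>, provided that these
  come from a sufficiently late set \<open>X s x\<close>.\<close>

definition gapped :: "(nat \<Rightarrow> 'a \<Rightarrow> 'a) \<Rightarrow> ('a \<Rightarrow> 'a) \<Rightarrow> (nat \<Rightarrow> 'a \<Rightarrow> 'a set) \<Rightarrow> (nat \<Rightarrow> nat) \<Rightarrow> bool" where
  "gapped Fs Z X d \<longleftrightarrow>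
    (\<forall>(s :: nat) x u. x \<in> D \<longrightarrow> nm (d s) \<preceq> x \<longrightarrow> u \<in> X s x \<longrightarrow> u \<in> D \<and> y x \<prec> u \<and> u \<prec> Z x)
    \<and> (\<forall>s s'. s \<le> s' \<longrightarrow> d s \<le> d s' \<and> (\<forall>x\<in>D. nm (d s') \<preceq> x \<longrightarrow> X s' x \<subseteq> X s x))
    \<and> (\<forall>s N x. x \<in> D \<longrightarrow> nm (d s) \<preceq> x \<longrightarrow> nm N \<preceq> x \<longrightarrow> (\<exists>us. length us = N \<and> set us \<subseteq> X s x \<and> dsc us (y x)))
    \<and> (\<forall>(i :: nat) r. \<exists>s F'. R.Fn (\<lambda>e. F' (e 0) (e 1)) \<and> (\<forall>x w as. x \<in> D \<longrightarrow> nm (d s) \<preceq> x \<longrightarrow> nm r \<preceq> x \<longrightarrow> w \<preceq> y x \<longrightarrow>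
         dsc as w \<longrightarrow> length as = r \<longrightarrow> set as \<subseteq> X s x \<longrightarrow> mn (Fs i (stk as w)) (y x) = mn (F' x w) (y x)))"

text \<open>The pairs of a function and a stack height are treated in turn, each by
  \<open>hom_step\<close> applied to the previous set, and \<open>prod_decode\<close> reaches them
  all. The function \<open>F'\<close> evaluates \<open>Fs i\<close> on the canonical stack of the
  set obtained for its pair.\<close>

theorem gap:
  assumes Fs: "\<And>i. R.Fn (\<lambda>e. Fs i (e 0))"
  shows "\<exists>Z X d. R.Fn (\<lambda>e. Z (e 0)) \<and> gapped Fs Z X d"
proof -
  define Z where "Z x = y x \<oplus> \<S> (V 0 x)" for x
  have ZF: "R.Fn (\<lambda>e. Z (e 0))" unfolding Z_def by (intro cintro R.Fn_f1[OF y] Fn_V)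
  let ?good = "good Z"
  let ?P = "\<lambda>(s :: nat) st. ?good (fst st) (snd st)"
  let ?Q = "\<lambda>s st st'. snd st \<le> snd st' \<and> (\<forall>x\<in>D. nm (snd st') \<preceq> x \<longrightarrow> rng (fst st') (snd st') x \<subseteq> rng (fst st) (snd st) x)
     \<and> hom (snd (prod_decode s)) (\<lambda>x. Fs (fst (prod_decode s))) (fst st') (snd st')"
  have "?good (\<lambda>x a. y x \<oplus> \<S> a) 0"
    unfolding good_def
  proof (intro conjI ballI impI)
    show "R.Fn (\<lambda>e. y (e 0) \<oplus> \<S> (e 1))" by (intro cintro R.Fn_f1[OF y])
    fix x a assume h: "x \<in> D" "a \<in> D" "a \<prec> V 0 x"
    show "y x \<prec> y x \<oplus> \<S> a" using h by (simp add: pl_S)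
    show "y x \<oplus> \<S> a \<prec> Z x" using h pl_lt_mono[of a "V 0 x" "\<S> (y x)" "\<S> (y x)"] by (simp add: Z_def ring)
    show "y x \<oplus> \<S> b \<prec> y x \<oplus> \<S> a" if "b \<in> D" "b \<prec> a" for b
      using h that pl_lt_mono[of b a "\<S> (y x)" "\<S> (y x)"] by (simp add: ring)
  qed
  then have "\<exists>st. ?P 0 st" by force
  moreover have "\<exists>st'. ?P (Suc s) st' \<and> ?Q s st st'" if g: "?P s st" for s st
  proof -
    have "R.Fn (\<lambda>e. Fs (fst (prod_decode s)) (e 1))" by (intro R.Fn_f1[OF Fs] cintro)
    from hom_step[of Z "fst st" "snd st" "\<lambda>x. Fs (fst (prod_decode s))", OF g this]
    obtain H' d' where "good Z H' d'" "snd st \<le> d'" "\<forall>x\<in>D. nm d' \<preceq> x \<longrightarrow> rng H' d' x \<subseteq> rng (fst st) (snd st) x"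
      "hom (snd (prod_decode s)) (\<lambda>x. Fs (fst (prod_decode s))) H' d'" by blast
    then show ?thesis by (intro exI[of _ "(H', d')"]) simp
  qed
  ultimately obtain st where "\<forall>s. ?P s (st s) \<and> ?Q s (st s) (st (Suc s))"
    using dependent_nat_choice[of ?P ?Q] by blast
  then have st: "\<And>s. ?P s (st s)" "\<And>s. ?Q s (st s) (st (Suc s))" by blast+
  define d where "d s = snd (st s)" for s
  define X where "X s x = rng (fst (st s)) (d s) x" for s x
  have g: "good Z (fst (st s)) (d s)" for s using st(1) by (simp add: d_def)
  note HF = g[unfolded good_def, THEN conjunct1]
  have dm: "d s \<le> d s' \<and> (\<forall>x\<in>D. nm (d s') \<preceq> x \<longrightarrow> X s' x \<subseteq> X s x)" if "s \<le> s'" for s s'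
    using that
  proof (induction rule: dec_induct)
    case (step m)
    have 1: "d m \<le> d (Suc m)" and 2: "\<And>x. x \<in> D \<Longrightarrow> nm (d (Suc m)) \<preceq> x \<Longrightarrow> X (Suc m) x \<subseteq> X m x"
      using st(2)[of m] unfolding d_def X_def by blast+
    have "X (Suc m) x \<subseteq> X s x" if "x \<in> D" "nm (d (Suc m)) \<preceq> x" for x
      using 2[OF that] step.IH that le_trans[OF nm_mono[OF 1] that(2)] by auto
    then show ?case using step.IH 1 by auto
  qed simp
  have A: "u \<in> D \<and> y x \<prec> u \<and> u \<prec> Z x" if "x \<in> D" "nm (d s) \<preceq> x" "u \<in> X s x" for s x u
    using that g[of s] FnD2[OF R.Fn_Df[OF HF[of s]]] unfolding X_def rng_def good_def by auto
  have B: "\<exists>us. length us = N \<and> set us \<subseteq> X s x \<and> dsc us (y x)" if "x \<in> D" "nm (d s) \<preceq> x" "nm N \<preceq> x" for s N x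
    using can[of Z "fst (st s)" "d s" x "y x" N, OF g] that unfolding X_def by auto
  have E: "\<exists>s F'. R.Fn (\<lambda>e. F' (e 0) (e 1)) \<and> (\<forall>x w as. x \<in> D \<longrightarrow> nm (d s) \<preceq> x \<longrightarrow> nm r \<preceq> x \<longrightarrow> w \<preceq> y x \<longrightarrow>
         dsc as w \<longrightarrow> length as = r \<longrightarrow> set as \<subseteq> X s x \<longrightarrow> mn (Fs i (stk as w)) (y x) = mn (F' x w) (y x))" for i r
  proof -
    define s where "s = Suc (prod_encode (i, r))"
    let ?H = "fst (st s)"
    have h: "hom r (\<lambda>x. Fs i) ?H (d s)" using st(2)[of "prod_encode (i, r)"] by (simp add: s_def d_def)
    have "R.Fn (\<lambda>e. stk (can ?H (e 0) N) (e 1))" for N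
      by (induction N) (simp_all, intro cintro, intro cintro R.Fn_f2[OF HF])
    then have "R.Fn (\<lambda>e. Fs i (stk (can ?H (e 0) r) (e 1)))" by (intro R.Fn_f1[OF Fs])
    moreover have "mn (Fs i (stk as w)) (y x) = mn (Fs i (stk (can ?H x r) w)) (y x)"
      if a: "x \<in> D" "nm (d s) \<preceq> x" "nm r \<preceq> x" "w \<preceq> y x" "dsc as w" "length as = r" "set as \<subseteq> X s x" for x w as
    proof -
      have "w \<in> D" using dsc_D[OF a(5)] by simp
      from can[of Z ?H "d s" x w r, OF g a(1,2) this a(4,3)] show ?thesis
        using h[unfolded hom_def, rule_format, of x w as "can ?H x r"] a unfolding X_def by blast
    qed
    ultimately show ?thesis by (intro exI[of _ s] exI[of _ "\<lambda>x w. Fs i (stk (can ?H x r) w)"]) blast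
  qed
  show ?thesis unfolding gapped_def
    by (rule exI[of _ Z], rule exI[of _ X], rule exI[of _ d]) (rule conjI[OF ZF conjI], use A in simp, rule conjI, use dm in simp, rule conjI, use B in simp, rule allI, rule allI, rule E)
qed

end

end

subsection \<open>Flexible functions and bounding sequences\<close>

context lev begin

text \<open>Selection for \<open>\<Sigma>\<close> predicates: the pair of a solution and a witness
  for the matrix is minimised, and being such a pair is a \<open>\<Delta>\<close> condition.\<close>

lemma unif:
  assumes P: "SG (\<lambda>e. P (e 0) (e 1))" and ex: "\<And>z. z \<in> D \<Longrightarrow> \<exists>a\<in>D. P a z"
  shows "\<exists>G. R.Fn (\<lambda>e. G (e 0)) \<and> (\<forall>z\<in>D. P (G z) z)"
proof -
  obtain T where T: "Sg Q k (\<lambda>e. T (e 0) (\<lambda>i. e (Suc i)))" "\<And>e. e \<in> asg \<Longrightarrow> P (e 0) (e 1) = (\<exists>a\<in>D. \<not> T a e)"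
    using P unfolding Sg.simps(2) by blast
  define T' where "T' b a z = T b (\<lambda>i. if i = 0 then a else z)" for b a z
  let ?s = "\<lambda>j. if j = 0 then 0 else if j = 1 then 1 else (2 :: nat)"
  have s: "Sg Q k (\<lambda>e. T' (e 0) (e 1) (e 2))"
  proof (rule Sg_cong[OF Sg_re[OF QD T(1), of ?s]])
    fix e :: "nat \<Rightarrow> 'a"
    have "(\<lambda>i. e (?s (Suc i))) = (\<lambda>i. if i = 0 then e (Suc 0) else e 2)" by auto
    then show "T (e (?s 0)) (\<lambda>i. e (?s (Suc i))) = T' (e 0) (e 1) (e 2)" by (simp add: T'_def)
  qed
  have T'c: "Dl Q (Suc k) (\<lambda>e. T' (e 0) (e 1) (e 2))"
    unfolding Dl_def using Sg_Suc[OF QD s] Sg_Suc_neg[OF QD s] by blast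
  have PT: "P a z \<longleftrightarrow> (\<exists>b\<in>D. \<not> T' b a z)" if "a \<in> D" "z \<in> D" for a z
    using T(2)[of "\<lambda>i. if i = 0 then a else z"] that by (simp add: T'_def asg_def)
  let ?C = "\<lambda>c z. \<not> T' (sn c) (fs c) z"
  have C: "Dl Q (Suc k) (\<lambda>e. ?C (e 0) (e 1))" by (intro R.c_not R.c_r3[OF T'c] cintro)
  have Cex: "\<exists>c\<in>D. ?C c z" if z: "z \<in> D" for z
  proof -
    obtain a b where "a \<in> D" "b \<in> D" "\<not> T' b a z" using ex[OF z] PT z by blast
    then show ?thesis by (intro bexI[of _ "pr a b"]) auto
  qed
  have cF: "R.Fn (\<lambda>e. lst (\<lambda>c. ?C c (e 0)))"
    by (rule R.Fn_lst[of "\<lambda>c e. ?C c (e 0)"]) (use C in simp, rule Cex, simp add: asgD)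
  have "P (fs (lst (\<lambda>c. ?C c z))) z" if z: "z \<in> D" for z
  proof -
    have c: "lst (\<lambda>c. ?C c z) \<in> D" by (rule FnD1[of "\<lambda>z. lst (\<lambda>c. ?C c z)", OF R.Fn_Df[OF cF] z])
    show ?thesis unfolding PT[OF fs_D[OF c] z]
      by (rule bexI[of _ "sn (lst (\<lambda>c. ?C c z))"], rule lst_Fn_Df(2)[of ?C, OF R.C_Df[OF C] _ z], rule Cex, assumption, rule sn_D[OF c])
  qed
  then show ?thesis using R.Fn_fs[OF cF] by (intro exI[of _ "\<lambda>z. fs (lst (\<lambda>c. ?C c z))"]) simp
qed

text \<open>A priority argument: the request \<open>r\<close> codes \<open>p\<close>, \<open>a\<close> and a bound \<open>b\<close> and asks for some
  \<open>x\<close> above \<open>b\<close> in \<open>R p\<close> where the value is \<open>a\<close>. The least request that can act does so, and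
  each request acts at most once.\<close>

lemma flexible:
  assumes R: "Dl Q (Suc k) (\<lambda>e. R (e 0) (e 1))"
  shows "\<exists>w. R.Fn (\<lambda>e. w (e 0)) \<and> (\<forall>p\<in>D. unb (R p) \<longrightarrow> (\<forall>a\<in>D. unb (\<lambda>x. R p x \<and> w x = a)))"
proof -
  \<comment> \<open>The history \<open>s\<close> lists the values chosen at earlier stages. An idle
    stage \<open>x'\<close> gets the value \<open>\<S> x'\<close>, so the clause
    \<open>r \<preceq> x'\<close> separates genuine actions of \<open>r\<close> from idle
    stages.\<close>
  define ok where "ok s x r \<longleftrightarrow> r \<preceq> x \<and> R (fs r) x \<and> sn (sn r) \<preceq> x \<and> (\<forall>x'\<in>D. x' \<prec> x \<longrightarrow> r \<preceq> x' \<longrightarrow> nth s x' \<noteq> r)" for s x r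
  have okc: "Dl Q (Suc k) (\<lambda>e. ok (e 0) (e 1) (e 2))" unfolding ok_def by (intro cintro R.c_r2[OF R])
  define G where "G s x = lst (\<lambda>r. ok s x r \<or> r = \<S> x)" for s x
  have Gc: "Dl Q (Suc k) (\<lambda>e. ok (e 1) (e 2) (e 0) \<or> e 0 = \<S> (e 2))" by (intro cintro R.c_r3[OF okc])
  have GF: "R.Fn (\<lambda>e. G (e 0) (e 1))" unfolding G_def
    by (rule R.Fn_lst[of "\<lambda>r e. ok (e 0) (e 1) r \<or> r = \<S> (e 1)"])
      (use Gc in \<open>simp add: numeral_2_eq_2\<close>, metis asgD DS)
  let ?A = "\<lambda>s' c. nth s' (fs c) = G (sn c) (fs c) \<and> (\<forall>i\<in>D. i \<prec> fs c \<longrightarrow> nth s' i = nth (sn c) i)"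
  have Ac: "Dl Q (Suc k) (\<lambda>e. ?A (e 0) (e 1))" by (intro cintro R.Fn_f2[OF GF])
  have GD: "G s x \<in> D" if "s \<in> D" "x \<in> D" for s x using FnD2[OF R.Fn_Df[OF GF] that] .
  have Aex: "\<exists>s'\<in>D. ?A s' c" if c: "c \<in> D" for c
  proof -
    have "Df.Fn (\<lambda>e. if e 0 \<prec> fs c then nth (sn c) (e 0) else G (sn c) (fs c))" using c GD by (intro cintro) auto
    from seq_comp[of "\<lambda>i. if i \<prec> fs c then nth (sn c) i else G (sn c) (fs c)", OF this DS[OF fs_D[OF c]]]
    obtain s' where s': "s' \<in> D" "\<And>i. i \<in> D \<Longrightarrow> i \<prec> \<S> (fs c) \<Longrightarrow> nth s' i = (if i \<prec> fs c then nth (sn c) i else G (sn c) (fs c))" by blast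
    then show ?thesis using c by (intro bexI[of _ s']) (auto simp: lt_imp_le)
  qed
  define nx where "nx c = pr (\<S> (fs c)) (lst (\<lambda>s'. ?A s' c))" for c
  have nxF: "R.Fn (\<lambda>e. nx (e 0))" unfolding nx_def
    by (intro cintro, rule R.Fn_lst[of "\<lambda>s' e. ?A s' (e 0)"]) (use Ac in simp, rule Aex, simp add: asgD)
  note nxFD = R.Fn_Df[OF nxF]
  \<comment> \<open>The state before stage \<open>z\<close>: the number \<open>z\<close> together
    with the history so far.\<close>
  define \<sigma> where "\<sigma> z = it nx z (pr \<zero> \<zero>)" for z
  have \<sigma>F: "R.Fn (\<lambda>e. \<sigma> (e 0))" unfolding \<sigma>_def by (intro Fn_it[OF nxF] cintro)
  have \<sigma>D [simp]: "\<sigma> z \<in> D" if "z \<in> D" for z using FnD1[OF R.Fn_Df[OF \<sigma>F] that] .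
  have \<sigma>0: "\<sigma> \<zero> = pr \<zero> \<zero>" by (simp add: \<sigma>_def it_0[OF nxFD])
  have \<sigma>S: "\<sigma> (\<S> z) = nx (\<sigma> z)" if "z \<in> D" for z using that by (simp add: \<sigma>_def it_S[OF nxFD])
  have lA: "?A (lst (\<lambda>s'. ?A s' c)) c" if "c \<in> D" for c
    by (rule lst_Fn_Df(2)[of ?A, OF R.C_Df[OF Ac] Aex that])
  have nxD: "nx c \<in> D" "lst (\<lambda>s'. ?A s' c) \<in> D" if "c \<in> D" for c
    using FnD1[OF nxFD that] FnD1[OF lst_Fn_Df(1)[of ?A, OF R.C_Df[OF Ac] Aex], OF _ that] by simp_all
  have fs\<sigma>: "fs (\<sigma> z) = z" if z: "z \<in> D" for z
  proof (rule ind[of "\<lambda>z. fs (\<sigma> z) = z", OF _ _ _ z])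
    show "Df (\<lambda>e. fs (\<sigma> (e 0)) = e 0)" by (intro cintro Df.Fn_f1[OF R.Fn_Df[OF \<sigma>F]])
    fix b assume "b \<in> D" "fs (\<sigma> b) = b"
    then show "fs (\<sigma> (\<S> b)) = \<S> b" unfolding \<sigma>S[OF \<open>b \<in> D\<close>] nx_def using nxD[of "\<sigma> b"] by simp
  qed (simp add: \<sigma>0)
  define W where "W x = G (sn (\<sigma> x)) x" for x
  have WF: "R.Fn (\<lambda>e. W (e 0))" unfolding W_def by (intro R.Fn_f2[OF GF] R.Fn_f1[OF \<sigma>F] cintro)
  have WD [simp]: "W x \<in> D" if "x \<in> D" for x using FnD1[OF R.Fn_Df[OF WF] that] .
  have \<sigma>W: "nth (sn (\<sigma> z)) i = W i" if h: "z \<in> D" "i \<in> D" "i \<prec> z" for z i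
  proof -
    have "\<forall>i\<in>D. i \<prec> z \<longrightarrow> nth (sn (\<sigma> z)) i = W i"
    proof (rule ind[of "\<lambda>z. \<forall>i\<in>D. i \<prec> z \<longrightarrow> nth (sn (\<sigma> z)) i = W i", OF _ _ _ h(1)])
      show "Df (\<lambda>e. \<forall>i\<in>D. i \<prec> e 0 \<longrightarrow> nth (sn (\<sigma> (e 0))) i = W i)"
        by (intro cintro Df.Fn_f1[OF R.Fn_Df[OF \<sigma>F]] Df.Fn_f1[OF R.Fn_Df[OF WF]])
      fix z assume z: "z \<in> D" "\<forall>i\<in>D. i \<prec> z \<longrightarrow> nth (sn (\<sigma> z)) i = W i"
      have "sn (\<sigma> (\<S> z)) = lst (\<lambda>s'. ?A s' (\<sigma> z))"
        unfolding \<sigma>S[OF z(1)] nx_def using nxD[of "\<sigma> z"] z by simp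
      then have 1: "nth (sn (\<sigma> (\<S> z))) z = W z" "\<forall>i\<in>D. i \<prec> z \<longrightarrow> nth (sn (\<sigma> (\<S> z))) i = nth (sn (\<sigma> z)) i"
        using lA[OF \<sigma>D[OF z(1)]] fs\<sigma>[OF z(1)] by (simp_all add: W_def)
      show "\<forall>i\<in>D. i \<prec> \<S> z \<longrightarrow> nth (sn (\<sigma> (\<S> z))) i = W i"
      proof (intro ballI impI)
        fix i assume "i \<in> D" "i \<prec> \<S> z"
        then consider "i = z" | "i \<prec> z" using z by (auto simp: le_def)
        then show "nth (sn (\<sigma> (\<S> z))) i = W i" using 1 z \<open>i \<in> D\<close> by cases simp_all
      qed
    qed simp
    then show ?thesis using h by blast
  qed
  define act where "act x r \<longleftrightarrow> r \<preceq> x \<and> R (fs r) x \<and> sn (sn r) \<preceq> x \<and> (\<forall>x'\<in>D. x' \<prec> x \<longrightarrow> r \<preceq> x' \<longrightarrow> W x' \<noteq> r)" for x r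
  have okact: "ok (sn (\<sigma> x)) x r = act x r" if "x \<in> D" for x r
    unfolding ok_def act_def using \<sigma>W[OF that] by metis
  have Wl: "(act x (W x) \<or> W x = \<S> x) \<and> (\<forall>r\<in>D. act x r \<longrightarrow> W x \<preceq> r)" if x: "x \<in> D" for x
  proof -
    have d: "Df (\<lambda>e. ok (sn (\<sigma> x)) x (e 0) \<or> e 0 = \<S> x)" using x by (intro cintro Df.c_r3[OF R.C_Df[OF okc]]) auto
    note l = lst[of "\<lambda>r. ok (sn (\<sigma> x)) x r \<or> r = \<S> x", OF d DS[OF x] disjI2[OF refl], folded G_def, folded W_def]
    show ?thesis using l(2) l(4) okact[OF x] by simp
  qed
  have "unb (\<lambda>x. R p x \<and> fs (sn (W x)) = a)" if h: "p \<in> D" "unb (R p)" "a \<in> D" for p a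
    unfolding unb_def
  proof
    fix b assume b: "b \<in> D"
    define r where "r = pr p (pr a b)"
    have r: "r \<in> D" "fs r = p" "fs (sn r) = a" "sn (sn r) = b" using h b by (simp_all add: r_def)
    show "\<exists>x\<in>D. b \<preceq> x \<and> R p x \<and> fs (sn (W x)) = a"
    proof (cases "\<exists>x\<in>D. W x = r \<and> r \<preceq> x")
      case True
      then obtain x where x: "x \<in> D" "W x = r" "r \<preceq> x" by blast
      then have "act x r" using Wl[OF x(1)] le_lt_trans[of "\<S> x" x "\<S> x"] by auto
      then show ?thesis using x r unfolding act_def by auto
    next
      case False
      \<comment> \<open>\<open>X\<close> is a stage at which \<open>r'\<close> acts, if there is
        any. Collection yields a \<open>B\<close> after the actions of all requests below
        \<open>r\<close>.\<close>
      let ?E = "\<lambda>r' X. (W X = r' \<and> r' \<preceq> X) \<or> (\<forall>x\<in>D. \<not> (W x = r' \<and> r' \<preceq> x))"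
      have "Df (\<lambda>e. ?E (e 0) (e 1))" by (intro cintro Df.Fn_f1[OF R.Fn_Df[OF WF]])
      moreover have "\<exists>X\<in>D. ?E r' X" for r' using D0 by blast
      ultimately have "\<exists>B\<in>D. \<forall>r'\<in>D. r' \<prec> r \<longrightarrow> (\<exists>X\<in>D. X \<prec> B \<and> ?E r' X)"
        using collection[of ?E r] r(1) by blast
      then obtain B where B: "B \<in> D" "\<And>r'. r' \<in> D \<Longrightarrow> r' \<prec> r \<Longrightarrow> \<exists>X\<in>D. X \<prec> B \<and> ?E r' X" by blast
      have "B \<oplus> r \<in> D" using B r by simp
      then obtain x where x: "x \<in> D" "B \<oplus> r \<preceq> x" "R p x" using h(2) unfolding unb_def by blast
      have l: "B \<preceq> x" "r \<preceq> x" using le_trans[of B "B \<oplus> r" x] le_trans[of r "B \<oplus> r" x] x B r by simp_all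
      have "b \<preceq> r" using sn_le[of "sn r"] sn_le[of r] le_trans[of "sn (sn r)" "sn r" r] r b by simp
      then have "b \<preceq> x" using le_trans[of b r x] l b r x by simp
      moreover have "\<forall>x'\<in>D. x' \<prec> x \<longrightarrow> r \<preceq> x' \<longrightarrow> W x' \<noteq> r" using False by blast
      ultimately have "act x r" unfolding act_def using l x r by simp
      then have w: "W x \<preceq> r" using Wl[OF x(1)] r by blast
      then have "W x \<preceq> x" using le_trans[OF w l(2)] x r by simp
      then have "W x \<noteq> \<S> x" using le_lt_trans[of "\<S> x" x "\<S> x"] x by auto
      then have a: "act x (W x)" using Wl[OF x(1)] by blast
      have "W x \<noteq> r" using False x l by blast
      then have "W x \<prec> r" using w by (simp add: le_def)
      \<comment> \<open>A request smaller than \<open>r\<close> that acts at \<open>x\<close> has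
        acted before \<open>B\<close> already, which contradicts that no request acts twice.\<close>
      then obtain X where X: "X \<in> D" "X \<prec> B" "?E (W x) X" using B(2)[of "W x"] x by auto
      then have "W X = W x \<and> W x \<preceq> X" using x \<open>W x \<preceq> x\<close> by blast
      moreover have "X \<prec> x" using lt_le_trans[OF X(2) l(1)] X B x by simp
      ultimately show ?thesis using a X(1) unfolding act_def by blast
    qed
  qed
  moreover have "R.Fn (\<lambda>e. fs (sn (W (e 0))))" by (intro cintro WF)
  ultimately show ?thesis by (intro exI[of _ "\<lambda>x. fs (sn (W x))"]) blast
qed

text \<open>\<open>p\<close> codes the earlier decisions, the value of \<open>w\<close>, a number of
  queries and the list of their answers. Query \<open>e\<close> asks for the value of
  \<open>F\<close> at parameter \<open>fs e\<close>, truncated at \<open>sn e\<close>.\<close>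

definition ext :: "('a \<Rightarrow> 'a \<Rightarrow> bool) \<Rightarrow> ('a \<Rightarrow> 'a) \<Rightarrow> ('a \<Rightarrow> 'a) \<Rightarrow> 'a \<Rightarrow> 'a \<Rightarrow> bool" where
  "ext R w F p x \<longleftrightarrow> R (fs p) x \<and> w x = fs (sn p) \<and>
     (\<forall>e\<in>D. e \<prec> fs (sn (sn p)) \<longrightarrow> mn (F (pr (fs e) x)) (sn e) = nth (sn (sn (sn p))) e)"

text \<open>The sum \<open>t x\<close> majorises all the bounds that are required; pairing it with
  \<open>w x\<close> lets the flexible value be read off as first component.\<close>

lemma bounding_step:
  assumes y: "R.Fn (\<lambda>e. y (e 0))" and Z: "R.Fn (\<lambda>e. Z (e 0))" and w: "R.Fn (\<lambda>e. w (e 0))" and F: "R.Fn (\<lambda>e. F (e 0))"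
  shows "\<exists>y'. R.Fn (\<lambda>e. y' (e 0)) \<and> (\<forall>x\<in>D. fs (y' x) = w x \<and> pr x x \<preceq> y' x \<and> y x \<preceq> y' x \<and> SB (Z x) \<preceq> y' x
     \<and> (\<forall>z\<in>D. z \<preceq> y x \<longrightarrow> F z \<preceq> y' x))"
proof -
  note FD = FnD1[OF R.Fn_Df[OF F]]
  let ?R = "\<lambda>b x. \<forall>z\<in>D. z \<preceq> y x \<longrightarrow> F z \<preceq> b"
  have Rc: "Dl Q (Suc k) (\<lambda>e. ?R (e 0) (e 1))" by (intro cintro R.Fn_f1[OF F] R.Fn_f1[OF y])
  have ex: "\<exists>b\<in>D. ?R b x" if x: "x \<in> D" for x
  proof -
    have yD: "y x \<in> D" using FnD1[OF R.Fn_Df[OF y] x] .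
    obtain B where B: "B \<in> D" "\<forall>i\<in>D. i \<prec> \<S> (y x) \<longrightarrow> F i \<prec> B" using bounding[OF R.Fn_Df[OF F] DS[OF yD]] by blast
    then show ?thesis using yD FD by (intro bexI[of _ B]) (simp_all add: lt_imp_le)
  qed
  define mx where "mx x = lst (\<lambda>b. ?R b x)" for x
  have mxF: "R.Fn (\<lambda>e. mx (e 0))" unfolding mx_def
    by (rule R.Fn_lst[of "\<lambda>b e. ?R b (e 0)"]) (use Rc in simp, rule ex, simp add: asgD)
  have mx: "?R (mx x) x" if "x \<in> D" for x unfolding mx_def by (rule lst_Fn_Df(2)[of ?R, OF R.C_Df[OF Rc] ex that])
  define t where "t x = y x \<oplus> (mx x \<oplus> (SB (Z x) \<oplus> pr x x))" for x
  have tF: "R.Fn (\<lambda>e. t (e 0))" unfolding t_def by (intro cintro R.Fn_f1[OF y] R.Fn_f1[OF Z] mxF)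
  have "R.Fn (\<lambda>e. pr (w (e 0)) (t (e 0)))" by (intro cintro w tF)
  moreover have "fs (pr (w x) (t x)) = w x \<and> pr x x \<preceq> pr (w x) (t x) \<and> y x \<preceq> pr (w x) (t x) \<and> SB (Z x) \<preceq> pr (w x) (t x)
     \<and> (\<forall>z\<in>D. z \<preceq> y x \<longrightarrow> F z \<preceq> pr (w x) (t x))" if x: "x \<in> D" for x
  proof -
    have D: "w x \<in> D" "t x \<in> D" "y x \<in> D" "mx x \<in> D" "SB (Z x) \<in> D" "pr x x \<in> D"
      using FnD1[OF R.Fn_Df[OF w] x] FnD1[OF R.Fn_Df[OF tF] x] FnD1[OF R.Fn_Df[OF y] x] FnD1[OF R.Fn_Df[OF mxF] x]
        FnD1[OF R.Fn_Df[OF Z] x] x by simp_all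
    have up: "a \<preceq> pr (w x) (t x)" if "a \<preceq> t x" "a \<in> D" for a
      using le_lt_trans[OF that(1) pr_gt2[OF D(1,2)]] that D by (simp add: lt_imp_le)
    have 1: "y x \<preceq> t x" using D by (simp add: t_def)
    have 2: "mx x \<preceq> t x" unfolding t_def using le_trans[of "mx x" "mx x \<oplus> (SB (Z x) \<oplus> pr x x)"] D by simp
    have "SB (Z x) \<oplus> pr x x \<preceq> t x" unfolding t_def
      using le_trans[of "SB (Z x) \<oplus> pr x x" "mx x \<oplus> (SB (Z x) \<oplus> pr x x)"] D by simp
    then have 3: "SB (Z x) \<preceq> t x" "pr x x \<preceq> t x"
      using le_trans[of "SB (Z x)" "SB (Z x) \<oplus> pr x x" "t x"] le_trans[of "pr x x" "SB (Z x) \<oplus> pr x x" "t x"] D by simp_all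
    have "F z \<preceq> t x" if "z \<in> D" "z \<preceq> y x" for z using mx[OF x] that le_trans[of "F z" "mx x" "t x"] 2 D FD by simp
    then show ?thesis using up 1 3 D FD by simp
  qed
  ultimately show ?thesis by (intro exI[of _ "\<lambda>x. pr (w x) (t x)"]) blast
qed

text \<open>The family of sets \<open>{x. Rp i p x}\<close> records finitely many decisions about heads \<open>w\<close> and
  about truncated values of the functions \<open>Fs\<close>.\<close>

lemma bounding_sequence:
  assumes Fs: "\<And>i. R.Fn (\<lambda>e. Fs i (e 0))"
  shows "\<exists>Rp w y Z X d. (\<forall>p x. Rp 0 p x) \<and> (\<forall>i. Rp (Suc i) = ext (Rp i) (w i) (Fs i))
    \<and> (\<forall>i. Dl Q (Suc k) (\<lambda>e. Rp i (e 0) (e 1)) \<and> R.Fn (\<lambda>e. w i (e 0)) \<and> R.Fn (\<lambda>e. y i (e 0)) \<and> R.Fn (\<lambda>e. Z i (e 0)) \<and> gapped (y i) Fs (Z i) (X i) (d i))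
    \<and> (\<forall>i. \<forall>p\<in>D. unb (Rp i p) \<longrightarrow> (\<forall>a\<in>D. unb (\<lambda>x. Rp i p x \<and> w i x = a)))
    \<and> (\<forall>i. \<forall>x\<in>D. fs (y i x) = w i x \<and> pr x x \<preceq> y i x \<and> y i x \<preceq> y (Suc i) x \<and> SB (Z i x) \<preceq> y (Suc i) x
        \<and> (\<forall>z\<in>D. z \<preceq> y i x \<longrightarrow> Fs i z \<preceq> y (Suc i) x))"
proof -
  let ?P = "\<lambda>(i :: nat) (R, w, y, Z, X, d). Dl Q (Suc k) (\<lambda>e. R (e 0) (e 1)) \<and> R.Fn (\<lambda>e. w (e 0)) \<and> R.Fn (\<lambda>e. y (e 0)) \<and> R.Fn (\<lambda>e. Z (e 0))
    \<and> gapped y Fs Z X d \<and> (\<forall>p\<in>D. unb (R p) \<longrightarrow> (\<forall>a\<in>D. unb (\<lambda>x. R p x \<and> w x = a))) \<and> (\<forall>x\<in>D. fs (y x) = w x \<and> pr x x \<preceq> y x)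
    \<and> (i = 0 \<longrightarrow> (\<forall>p x. R p x))"
  let ?Q = "\<lambda>i (R, w, y, Z, X, d) (R', w', y', Z', X', d'). R' = ext R w (Fs i) \<and>
    (\<forall>x\<in>D. y x \<preceq> y' x \<and> SB (Z x) \<preceq> y' x \<and> (\<forall>z\<in>D. z \<preceq> y x \<longrightarrow> Fs i z \<preceq> y' x))"
  have step: "\<exists>w' y' Z' X' d'. R.Fn (\<lambda>e. w' (e 0)) \<and> R.Fn (\<lambda>e. y' (e 0)) \<and> R.Fn (\<lambda>e. Z' (e 0))
    \<and> gapped y' Fs Z' X' d' \<and> (\<forall>p\<in>D. unb (R p) \<longrightarrow> (\<forall>a\<in>D. unb (\<lambda>x. R p x \<and> w' x = a)))
    \<and> (\<forall>x\<in>D. fs (y' x) = w' x \<and> pr x x \<preceq> y' x \<and> y x \<preceq> y' x \<and> SB (Z x) \<preceq> y' x \<and> (\<forall>z\<in>D. z \<preceq> y x \<longrightarrow> Fs i z \<preceq> y' x))"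
    if R: "Dl Q (Suc k) (\<lambda>e. R (e 0) (e 1))" and y: "R.Fn (\<lambda>e. y (e 0))" "R.Fn (\<lambda>e. Z (e 0))" for R y Z i
  proof -
    obtain w' where w': "R.Fn (\<lambda>e. w' (e 0))" "\<forall>p\<in>D. unb (R p) \<longrightarrow> (\<forall>a\<in>D. unb (\<lambda>x. R p x \<and> w' x = a))"
      using flexible[of R, OF R] by (elim exE conjE)
    obtain y' where y': "R.Fn (\<lambda>e. y' (e 0))" "\<forall>x\<in>D. fs (y' x) = w' x \<and> pr x x \<preceq> y' x \<and> y x \<preceq> y' x \<and> SB (Z x) \<preceq> y' x
       \<and> (\<forall>z\<in>D. z \<preceq> y x \<longrightarrow> Fs i z \<preceq> y' x)"
      using bounding_step[of y Z w' "Fs i", OF y w'(1) Fs] by (elim exE conjE)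
    obtain Z' X' d' where "R.Fn (\<lambda>e. Z' (e 0))" "gapped y' Fs Z' X' d'" using gap[of y' Fs, OF y'(1) Fs] by (elim exE conjE)
    then show ?thesis using w' y'
      by (intro exI[of _ w'] exI[of _ y'] exI[of _ Z'] exI[of _ X'] exI[of _ d'] conjI) assumption+
  qed
  have z: "R.Fn (\<lambda>e. \<zero>)" by (intro cintro)
  have T: "Dl Q (Suc k) (\<lambda>e. True)" by (rule R.c_True)
  have c0: "\<exists>st. ?P 0 st"
  proof -
    obtain w' y' Z' X' d' where "R.Fn (\<lambda>e. w' (e 0))" "R.Fn (\<lambda>e. y' (e 0))" "R.Fn (\<lambda>e. Z' (e 0))"
      "gapped y' Fs Z' X' d'" "\<forall>p\<in>D. unb (\<lambda>x. True) \<longrightarrow> (\<forall>a\<in>D. unb (\<lambda>x. True \<and> w' x = a))"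
      "\<forall>x\<in>D. fs (y' x) = w' x \<and> pr x x \<preceq> y' x \<and> \<zero> \<preceq> y' x \<and> SB \<zero> \<preceq> y' x \<and> (\<forall>z\<in>D. z \<preceq> \<zero> \<longrightarrow> Fs 0 z \<preceq> y' x)"
      using step[of "\<lambda>_ _. True" "\<lambda>_. \<zero>" "\<lambda>_. \<zero>" 0, OF T z z] by (elim exE conjE)
    then have "?P 0 (\<lambda>_ _. True, w', y', Z', X', d')" using T by (simp only: prod.case simp_thms) blast
    then show ?thesis ..
  qed
  have cS: "\<exists>st'. ?P (Suc i) st' \<and> ?Q i st st'" if P: "?P i st" for i st
  proof -
    obtain R w y Z X d where st: "st = (R, w, y, Z, X, d)" by (cases st) auto
    note P' = P[unfolded st prod.case]
    note h = P'[THEN conjunct1] P'[THEN conjunct2, THEN conjunct1] P'[THEN conjunct2, THEN conjunct2, THEN conjunct1]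
      P'[THEN conjunct2, THEN conjunct2, THEN conjunct2, THEN conjunct1]
    have R': "Dl Q (Suc k) (\<lambda>e. ext R w (Fs i) (e 0) (e 1))" unfolding ext_def
      by (intro cintro R.c_r2[OF h(1)] R.Fn_f1[OF h(2)] R.Fn_f1[OF Fs])
    \<comment> \<open>The new \<open>w'\<close> is flexible for the sets that already record the
      decisions about \<open>w\<close> and \<open>Fs i\<close>, so its value stays free after
      them.\<close>
    obtain w' y' Z' X' d' where "R.Fn (\<lambda>e. w' (e 0))" "R.Fn (\<lambda>e. y' (e 0))" "R.Fn (\<lambda>e. Z' (e 0))"
      "gapped y' Fs Z' X' d'" "\<forall>p\<in>D. unb (ext R w (Fs i) p) \<longrightarrow> (\<forall>a\<in>D. unb (\<lambda>x. ext R w (Fs i) p x \<and> w' x = a))"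
      "\<forall>x\<in>D. fs (y' x) = w' x \<and> pr x x \<preceq> y' x \<and> y x \<preceq> y' x \<and> SB (Z x) \<preceq> y' x \<and> (\<forall>z\<in>D. z \<preceq> y x \<longrightarrow> Fs i z \<preceq> y' x)"
      using step[of "ext R w (Fs i)" y Z i, OF R' h(3,4)] by (elim exE conjE)
    then have "?P (Suc i) (ext R w (Fs i), w', y', Z', X', d') \<and> ?Q i st (ext R w (Fs i), w', y', Z', X', d')"
      unfolding st prod.case using R' by simp
    then show ?thesis ..
  qed
  have "\<exists>f. \<forall>i. ?P i (f i) \<and> ?Q i (f i) (f (Suc i))"
    by (rule dependent_nat_choice[of ?P ?Q, OF c0]) (rule cS)
  then obtain f where f: "\<forall>i. ?P i (f i) \<and> ?Q i (f i) (f (Suc i))" by (elim exE)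
  define Rp w y Z X d where "Rp i = fst (f i)" and "w i = fst (snd (f i))" and "y i = fst (snd (snd (f i)))"
    and "Z i = fst (snd (snd (snd (f i))))" and "X i = fst (snd (snd (snd (snd (f i)))))" and "d i = snd (snd (snd (snd (snd (f i)))))" for i
  have fi: "f i = (Rp i, w i, y i, Z i, X i, d i)" for i unfolding Rp_def w_def y_def Z_def X_def d_def by simp
  have P: "?P i (Rp i, w i, y i, Z i, X i, d i)" and Q: "?Q i (Rp i, w i, y i, Z i, X i, d i) (Rp (Suc i), w (Suc i), y (Suc i), Z (Suc i), X (Suc i), d (Suc i))" for i
    using f[rule_format, of i] unfolding fi by blast+
  note P' = P[unfolded prod.case] and Q' = Q[unfolded prod.case]
  have A: "Dl Q (Suc k) (\<lambda>e. Rp i (e 0) (e 1)) \<and> R.Fn (\<lambda>e. w i (e 0)) \<and> R.Fn (\<lambda>e. y i (e 0)) \<and> R.Fn (\<lambda>e. Z i (e 0)) \<and> gapped (y i) Fs (Z i) (X i) (d i)" for i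
    using P'[of i] by (elim conjE) (intro conjI, assumption+)
  have B: "\<forall>p\<in>D. unb (Rp i p) \<longrightarrow> (\<forall>a\<in>D. unb (\<lambda>x. Rp i p x \<and> w i x = a))" for i
    using P'[of i] by (elim conjE)
  have C: "\<forall>p x. Rp 0 p x" using P'[of 0] by (elim conjE) simp
  have E: "Rp (Suc i) = ext (Rp i) (w i) (Fs i)" for i using Q'[of i] by (elim conjE)
  have F: "\<forall>x\<in>D. fs (y i x) = w i x \<and> pr x x \<preceq> y i x \<and> y i x \<preceq> y (Suc i) x \<and> SB (Z i x) \<preceq> y (Suc i) x
        \<and> (\<forall>z\<in>D. z \<preceq> y i x \<longrightarrow> Fs i z \<preceq> y (Suc i) x)" for i
    using P'[of i] Q'[of i] by (elim conjE) simp
  show ?thesis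
    by (rule exI[of _ Rp], rule exI[of _ w], rule exI[of _ y], rule exI[of _ Z], rule exI[of _ X], rule exI[of _ d])
      (rule conjI[OF C conjI[OF allI[OF E] conjI[OF allI[OF A] conjI[OF allI[OF B] allI[OF F]]]]])
qed

text \<open>The heads \<open>h i\<close> are fixed only after all functions have been constructed.\<close>

lemma decisions:
  assumes Fs: "\<And>i. R.Fn (\<lambda>e. Fs i (e 0))" and w: "\<And>i. R.Fn (\<lambda>e. w i (e 0))" and h: "\<And>i. h i \<in> D"
    and R: "\<And>i. Dl Q (Suc k) (\<lambda>e. Rp i (e 0) (e 1))" and R0: "\<And>p x. Rp 0 p x" and RS: "\<And>i. Rp (Suc i) = ext (Rp i) (w i) (Fs i)"
    and fl: "\<And>i p a. p \<in> D \<Longrightarrow> unb (Rp i p) \<Longrightarrow> a \<in> D \<Longrightarrow> unb (\<lambda>x. Rp i p x \<and> w i x = a)"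
  shows "\<exists>P g. (\<forall>i. \<forall>m\<in>D. unb (P i m)) \<and> (\<forall>i. \<forall>m\<in>D. \<forall>m'\<in>D. m \<preceq> m' \<longrightarrow> (\<forall>x\<in>D. P i m' x \<longrightarrow> P i m x))
    \<and> (\<forall>i. \<forall>m\<in>D. \<forall>x\<in>D. P (Suc i) m x \<longrightarrow> P i m x \<and> w i x = h i \<and> (\<forall>e\<in>D. e \<prec> m \<longrightarrow> mn (Fs i (pr (fs e) x)) (sn e) = g i e))"
proof -
  let ?P = "\<lambda>(i :: nat) p. Df.Fn (\<lambda>e. p (e 0)) \<and> (\<forall>m\<in>D. unb (Rp i (p m)))
     \<and> (\<forall>m\<in>D. \<forall>m'\<in>D. m \<preceq> m' \<longrightarrow> (\<forall>x\<in>D. Rp i (p m') x \<longrightarrow> Rp i (p m) x))"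
  let ?Q = "\<lambda>i p p'. \<exists>g. \<forall>m\<in>D. \<forall>x\<in>D. Rp (Suc i) (p' m) x \<longrightarrow> Rp i (p m) x \<and> w i x = h i \<and> (\<forall>e\<in>D. e \<prec> m \<longrightarrow> mn (Fs i (pr (fs e) x)) (sn e) = g e)"
  have u: "unb (Rp 0 q)" for q unfolding unb_def using R0 le_refl by blast
  have "Df.Fn (\<lambda>e. \<zero>)" by (intro cintro)
  then have "?P 0 (\<lambda>_. \<zero>)" using u R0 by simp
  then have "\<exists>p. ?P 0 p" by (rule exI[of _ "\<lambda>_. \<zero>"])
  moreover have "\<exists>p'. ?P (Suc i) p' \<and> ?Q i p p'" if p: "?P i p" for i p
  proof -
    note pF = p[THEN conjunct1]
    have pu: "unb (Rp i (p m))" if "m \<in> D" for m using p that by blast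
    have pm: "Rp i (p m) x" if "m \<in> D" "m' \<in> D" "m \<preceq> m'" "x \<in> D" "Rp i (p m') x" for m m' x using p that by blast
    have pD: "p m \<in> D" if "m \<in> D" for m using FnD1[OF pF that] .
    let ?f = "\<lambda>e x. mn (Fs i (pr (fs e) x)) (sn e)"
    have FsD: "Fs i z \<in> D" if "z \<in> D" for z using FnD1[OF R.Fn_Df[OF Fs] that] .
    \<comment> \<open>Flexibility fixes the value of \<open>w i\<close>; then \<open>limit\<close>
      decides the truncated values of \<open>Fs i\<close> for all queries from \<open>M\<close> at
      once.\<close>
    have "\<exists>g. Df.Fn (\<lambda>e. g (e 0)) \<and> (\<forall>m\<in>D. unb (\<lambda>x. (Rp i (p m) x \<and> w i x = h i) \<and> (\<forall>e\<in>D. e \<preceq> m \<longrightarrow> ?f e x = g e)))"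
    proof (rule limit[of "\<lambda>m x. Rp i (p m) x \<and> w i x = h i" ?f sn])
      show "Df (\<lambda>e. Rp i (p (e 0)) (e 1) \<and> w i (e 1) = h i)"
        by (intro cintro Df.c_r2[OF R.C_Df[OF R]] Df.Fn_f1[OF pF] Df.Fn_f1[OF R.Fn_Df[OF w]] h)
      show "Df.Fn (\<lambda>e. ?f (e 0) (e 1))" by (intro cintro Df.Fn_f1[OF R.Fn_Df[OF Fs]])
      show "Df.Fn (\<lambda>e. sn (e 0))" by (intro cintro)
      show "unb (\<lambda>x. Rp i (p m) x \<and> w i x = h i)" if "m \<in> D" for m by (rule fl[OF pD[OF that] pu[OF that] h])
      show "Rp i (p m) x \<and> w i x = h i" if "m \<in> D" "m' \<in> D" "x \<in> D" "m \<preceq> m'" "Rp i (p m') x \<and> w i x = h i" for m m' x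
        using pm[of m m' x] that by blast
      show "?f e x \<preceq> sn e" if "e \<in> D" "x \<in> D" for e x using that FsD by simp
    qed
    then obtain g where g: "Df.Fn (\<lambda>e. g (e 0))" "\<And>m. m \<in> D \<Longrightarrow> unb (\<lambda>x. (Rp i (p m) x \<and> w i x = h i) \<and> (\<forall>e\<in>D. e \<preceq> m \<longrightarrow> ?f e x = g e))" by blast
    let ?S = "\<lambda>s m. \<forall>e\<in>D. e \<prec> m \<longrightarrow> nth s e = g e"
    have Sd: "Df (\<lambda>e. ?S (e 0) (e 1))" by (intro cintro Df.Fn_f1[OF g(1)])
    have Sex: "\<exists>s\<in>D. ?S s m" if "m \<in> D" for m using seq_comp[OF g(1) that] by blast
    define s where "s m = lst (\<lambda>s. ?S s m)" for m
    have sF: "Df.Fn (\<lambda>e. s (e 0))" unfolding s_def by (rule lst_Fn_Df(1)[of ?S, OF Sd Sex])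
    have s: "?S (s m) m" if "m \<in> D" for m unfolding s_def by (rule lst_Fn_Df(2)[of ?S, OF Sd Sex that])
    have sD: "s m \<in> D" if "m \<in> D" for m using FnD1[OF sF that] .
    \<comment> \<open>The code for \<open>m\<close> records the answers to the queries below
      \<open>m\<close>, so larger \<open>m\<close> give smaller sets, all of them unbounded.\<close>
    define p' where "p' m = pr (p m) (pr (h i) (pr m (s m)))" for m
    have p'F: "Df.Fn (\<lambda>e. p' (e 0))" unfolding p'_def by (intro cintro pF sF h)
    have iff: "Rp (Suc i) (p' m) x \<longleftrightarrow> Rp i (p m) x \<and> w i x = h i \<and> (\<forall>e\<in>D. e \<prec> m \<longrightarrow> ?f e x = g e)" if m: "m \<in> D" for m x
      unfolding RS ext_def p'_def using pD[OF m] sD[OF m] s[OF m] h[of i] m by simp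
    have "unb (Rp (Suc i) (p' m))" if m: "m \<in> D" for m
      unfolding unb_def iff[OF m]
    proof
      fix b assume "b \<in> D"
      then obtain x where x: "x \<in> D" "b \<preceq> x" "Rp i (p m) x" "w i x = h i" "\<forall>e\<in>D. e \<preceq> m \<longrightarrow> ?f e x = g e"
        using g(2)[OF m] unfolding unb_def by blast
      have "\<forall>e\<in>D. e \<prec> m \<longrightarrow> ?f e x = g e" using x(5) lt_imp_le by blast
      then show "\<exists>x\<in>D. b \<preceq> x \<and> Rp i (p m) x \<and> w i x = h i \<and> (\<forall>e\<in>D. e \<prec> m \<longrightarrow> ?f e x = g e)" using x by blast
    qed
    moreover have "Rp (Suc i) (p' m) x" if m: "m \<in> D" "m' \<in> D" "m \<preceq> m'" "x \<in> D" "Rp (Suc i) (p' m') x" for m m' x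
    proof -
      have 1: "Rp i (p m') x" "w i x = h i" "\<forall>e\<in>D. e \<prec> m' \<longrightarrow> ?f e x = g e" using m(5) unfolding iff[OF m(2)] by blast+
      have "?f e x = g e" if "e \<in> D" "e \<prec> m" for e using 1(3) that lt_le_trans[OF that(2) m(3)] m by simp
      then show ?thesis unfolding iff[OF m(1)] using 1 pm[OF m(1-4)] by blast
    qed
    moreover have "?Q i p p'" using iff by (intro exI[of _ g]) blast
    ultimately show ?thesis using p'F by (intro exI[of _ p']) blast
  qed
  ultimately obtain p where p: "\<forall>i. ?P i (p i) \<and> ?Q i (p i) (p (Suc i))" using dependent_nat_choice[of ?P ?Q] by blast
  then have "\<forall>i. \<exists>g. \<forall>m\<in>D. \<forall>x\<in>D. Rp (Suc i) (p (Suc i) m) x \<longrightarrow> Rp i (p i m) x \<and> w i x = h i \<and> (\<forall>e\<in>D. e \<prec> m \<longrightarrow> mn (Fs i (pr (fs e) x)) (sn e) = g e)" by blast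
  then obtain g where g: "\<forall>i. \<forall>m\<in>D. \<forall>x\<in>D. Rp (Suc i) (p (Suc i) m) x \<longrightarrow> Rp i (p i m) x \<and> w i x = h i \<and> (\<forall>e\<in>D. e \<prec> m \<longrightarrow> mn (Fs i (pr (fs e) x)) (sn e) = g i e)"
    by (rule choice[THEN exE])
  show ?thesis
    by (rule exI[of _ "\<lambda>i m. Rp i (p i m)"], rule exI[of _ g]) (use p g in blast)
qed

end

subsection \<open>Ultrafilters and countable elementary submodels\<close>

text \<open>Zorn's lemma gives a family that is maximal with the finite intersection property;
  maximality yields closure under intersections and supersets and the decision of every set.\<close>

lemma ultrafilter_exists:
  fixes B :: "'w set set"
  assumes ne: "B \<noteq> {}" "{} \<notin> B" and dir: "\<And>X Y. X \<in> B \<Longrightarrow> Y \<in> B \<Longrightarrow> \<exists>Z\<in>B. Z \<subseteq> X \<inter> Y"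
  shows "\<exists>F :: 'w filter. F \<noteq> bot \<and> (\<forall>X\<in>B. eventually (\<lambda>w. w \<in> X) F) \<and> (\<forall>P. eventually P F \<or> eventually (\<lambda>w. \<not> P w) F)"
proof -
  define fip where "fip G \<longleftrightarrow> (\<forall>X\<subseteq>G. finite X \<longrightarrow> \<Inter>X \<noteq> {})" for G :: "'w set set"
  have "\<exists>Z\<in>B. Z \<subseteq> \<Inter>X" if "finite X" "X \<subseteq> B" for X
    using that
  proof (induction X)
    case empty then show ?case using ne by auto
  next
    case (insert x X)
    then obtain Z where "Z \<in> B" "Z \<subseteq> \<Inter>X" by auto
    moreover from this obtain Z' where "Z' \<in> B" "Z' \<subseteq> x \<inter> Z" using dir[of x Z] insert.prems by blast
    ultimately show ?case by (intro bexI[of _ Z']) auto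
  qed
  then have "fip B" unfolding fip_def using ne by (metis subset_empty)
  let ?A = "{G. B \<subseteq> G \<and> fip G}"
  have "\<exists>G\<in>?A. \<forall>X\<in>?A. G \<subseteq> X \<longrightarrow> X = G"
  proof (rule subset_Zorn_nonempty)
    show "?A \<noteq> {}" using \<open>fip B\<close> by blast
    fix C assume C: "C \<noteq> {}" "subset.chain ?A C"
    have "fip (\<Union>C)" unfolding fip_def
    proof (intro allI impI)
      fix X assume X: "X \<subseteq> \<Union>C" "finite X"
      then obtain G where "G \<in> C" "X \<subseteq> G" using finite_subset_Union_chain[OF X(2,1) C] by blast
      then show "\<Inter>X \<noteq> {}" using C(2) X(2) unfolding subset.chain_def fip_def by blast
    qed
    then show "\<Union>C \<in> ?A" using C unfolding subset.chain_def by blast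
  qed
  then obtain G where G: "B \<subseteq> G" "fip G" "\<And>X. B \<subseteq> X \<Longrightarrow> fip X \<Longrightarrow> G \<subseteq> X \<Longrightarrow> X = G" by auto
  have add: "Y \<in> G" if "\<And>X. X \<subseteq> G \<Longrightarrow> finite X \<Longrightarrow> \<Inter>X \<inter> Y \<noteq> {}" for Y
  proof -
    have "fip (insert Y G)" unfolding fip_def
    proof (intro allI impI)
      fix X assume X: "X \<subseteq> insert Y G" "finite X"
      then have "\<Inter>(X - {Y}) \<inter> Y \<noteq> {}" by (intro that) auto
      then show "\<Inter>X \<noteq> {}" by blast
    qed
    then show ?thesis using G(1) G(3)[of "insert Y G"] by blast
  qed
  have in1: "\<exists>X\<subseteq>G. finite X \<and> \<Inter>X \<subseteq> - Y" if "Y \<notin> G" for Y using add[of Y] that by blast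
  have up: "Y \<in> G" if "X \<subseteq> G" "finite X" "\<Inter>X \<subseteq> Y" for X Y
  proof (rule add)
    fix X' assume "X' \<subseteq> G" "finite X'"
    then have "\<Inter>(X' \<union> X) \<noteq> {}" using G(2) that unfolding fip_def by (meson finite_UnI le_sup_iff)
    then show "\<Inter>X' \<inter> Y \<noteq> {}" using that(3) by blast
  qed
  have emp: "{} \<notin> G" using G(2) unfolding fip_def by (metis Inf_lower empty_subsetI finite.intros insert_subset singletonI subset_empty)
  have "is_filter (\<lambda>P. {w. P w} \<in> G)"
  proof
    show "{w. True} \<in> G" by (rule up[of "{}"]) auto
    show "{w. P w \<and> Q w} \<in> G" if "{w. P w} \<in> G" "{w. Q w} \<in> G" for P Q by (rule up[of "{{w. P w}, {w. Q w}}"]) (use that in auto)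
    show "{w. Q w} \<in> G" if "\<forall>w. P w \<longrightarrow> Q w" "{w. P w} \<in> G" for P Q by (rule up[of "{{w. P w}}"]) (use that in auto)
  qed
  then have ev: "eventually P (Abs_filter (\<lambda>P. {w. P w} \<in> G)) \<longleftrightarrow> {w. P w} \<in> G" for P by (rule eventually_Abs_filter)
  have "{w. P w} \<in> G \<or> {w. \<not> P w} \<in> G" for P
  proof (rule disjCI)
    assume "{w. \<not> P w} \<notin> G"
    from in1[OF this] obtain X where "X \<subseteq> G" "finite X" "\<Inter>X \<subseteq> - {w. \<not> P w}" by (elim exE conjE)
    then show "{w. P w} \<in> G" by (intro up[of X]) auto
  qed
  moreover have "Abs_filter (\<lambda>P. {w. P w} \<in> G) \<noteq> bot" unfolding trivial_limit_def ev using emp by simp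
  moreover have "\<forall>X\<in>B. {w. w \<in> X} \<in> G" using G(1) by auto
  ultimately show ?thesis by (intro exI[of _ "Abs_filter (\<lambda>P. {w. P w} \<in> G)"] conjI) (simp_all only: ev simp_thms)
qed

section \<open>Isomorphic copies and countable elementary submodels\<close>

lemma sat_iso:
  assumes K: "wf_struc K" and h: "h ` dom K = dom N" "inj_on h (dom K)"
    and z: "h (zer K) = zer N" and s: "\<And>a. a \<in> dom K \<Longrightarrow> h (sc K a) = sc N (h a)"
    and pt: "\<And>a b. a \<in> dom K \<Longrightarrow> b \<in> dom K \<Longrightarrow> h (pl K a b) = pl N (h a) (h b) \<and> h (tm K a b) = tm N (h a) (h b) \<and> (lt K a b \<longleftrightarrow> lt N (h a) (h b))"
  shows "(\<And>v. e v \<in> dom K) \<Longrightarrow> sat K e p \<longleftrightarrow> sat N (h \<circ> e) p"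
proof (induction p arbitrary: e)
  have ev: "eval_t K e t \<in> dom K \<and> h (eval_t K e t) = eval_t N (h \<circ> e) t" if "\<And>v. e v \<in> dom K" for e t
  proof (induction t)
    case (S t) then show ?case using K s[of "eval_t K e t"] by (simp add: wf_struc_def)
  next
    case (Plus t u) then show ?case using K pt[of "eval_t K e t" "eval_t K e u"] by (simp add: wf_struc_def)
  next
    case (Times t u) then show ?case using K pt[of "eval_t K e t" "eval_t K e u"] by (simp add: wf_struc_def)
  qed (use that K z in \<open>simp_all add: wf_struc_def\<close>)
  { case (Eq t u) 
    then show ?case using ev[of e t, OF Eq.prems] ev[of e u, OF Eq.prems] inj_on_eq_iff[OF h(2), of "eval_t K e t" "eval_t K e u"]
      unfolding sat.simps by metis }
  { case (Lt t u) then show ?case using ev[of e t, OF Lt.prems] ev[of e u, OF Lt.prems] pt[of "eval_t K e t" "eval_t K e u"]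
      unfolding sat.simps by metis }
  have up: "h \<circ> e(x := a) = (h \<circ> e)(x := h a)" for e x a by auto
  { case (Ex x p)
    have "sat K (e(x := a)) p = sat N ((h \<circ> e)(x := h a)) p" if "a \<in> dom K" for a
    proof -
      have "(e(x := a)) v \<in> dom K" for v using Ex.prems that by simp
      from Ex.IH[of "e(x := a)", OF this] show ?thesis unfolding up .
    qed
    then show ?case unfolding sat.simps h(1)[symmetric] by simp }
  { case (All x p)
    have "sat K (e(x := a)) p = sat N ((h \<circ> e)(x := h a)) p" if "a \<in> dom K" for a
    proof -
      have "(e(x := a)) v \<in> dom K" for v using All.prems that by simp
      from All.IH[of "e(x := a)", OF this] show ?thesis unfolding up .
    qed
    then show ?case unfolding sat.simps h(1)[symmetric] by simp }
qed auto

lemma finite_fv: "finite (fv p)" by (induction p) (auto simp: finite_vars_t)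

lemma countable_fm: "countable (UNIV :: fm set)"
proof -
  have t: "inj code_t"
  proof (rule injI)
    show "code_t t = code_t u \<Longrightarrow> t = u" for t u by (induction t arbitrary: u) (case_tac u; simp)+
  qed
  have "code_fm p = code_fm q \<Longrightarrow> p = q" for p q
    by (induction p arbitrary: q) (case_tac q; simp add: inj_eq[OF t])+
  then show ?thesis by (intro countableI[of code_fm]) (simp add: inj_on_def)
qed

text \<open>\<open>proves\<close> refers to structures on the natural numbers only, and
  \<open>M\<close> may be uncountable. Witnesses are chosen for a formula with a finite list of
  parameters, not for whole assignments, which keeps the closure countable.\<close>

lemma countable_elementary_submodel:
  fixes M :: "'a struc" and s :: "nat \<Rightarrow> 'a"
  assumes M: "wf_struc M" and s: "\<And>v. s v \<in> dom M"
  shows "\<exists>(K :: nat struc) h t. wf_struc K \<and> (\<forall>v. t v \<in> dom K) \<and> (\<forall>a\<in>dom K. h a \<in> dom M) \<and> (\<forall>v. h (t v) = s v)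
    \<and> (\<forall>e p. (\<forall>v. e v \<in> dom K) \<longrightarrow> sat K e p = sat M (h \<circ> e) p)"
proof -
  define en where "en l = (\<lambda>i. if i < length l then l ! i else zer M)" for l :: "'a list"
  define W where "W = (\<lambda>(p, x, l). if \<exists>a\<in>dom M. sat M ((en l)(x := a)) p then SOME a. a \<in> dom M \<and> sat M ((en l)(x := a)) p else zer M)"
  have Wsat: "sat M ((en l)(x := W (p, x, l))) p" if "\<exists>a\<in>dom M. sat M ((en l)(x := a)) p" for p x l
    using someI_ex[of "\<lambda>a. a \<in> dom M \<and> sat M ((en l)(x := a)) p"] that unfolding W_def by auto
  have WD: "W q \<in> dom M" for q
  proof -
    obtain p x l where q: "q = (p, x, l)" by (cases q)
    show ?thesis
      using M someI_ex[of "\<lambda>a. a \<in> dom M \<and> sat M ((en l)(x := a)) p"] unfolding q W_def wf_struc_def by auto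
  qed
  define N where "N = rec_nat (range s \<union> {zer M}) (\<lambda>_ X. X \<union> W ` (UNIV \<times> UNIV \<times> lists X))"
  have N0: "N 0 = range s \<union> {zer M}" and NS: "N (Suc i) = N i \<union> W ` (UNIV \<times> UNIV \<times> lists (N i))" for i by (simp_all add: N_def)
  define H where "H = (\<Union>i. N i)"
  have cN: "countable (N i)" for i
  proof (induction i)
    case (Suc i) then show ?case unfolding NS by (intro countable_Un countable_image countable_SIGMA countable_fm countable_lists) auto
  next
    case 0 show ?case unfolding N0 by (intro countable_Un countable_image countableI_type countable_insert countable_empty)
  qed
  have "N i \<subseteq> dom M" for i using s M WD by (induction i) (auto simp: N0 NS wf_struc_def)
  then have HM: "H \<subseteq> dom M" unfolding H_def by blast
  have cH: "countable H" unfolding H_def using cN by (intro countable_UN) auto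
  have Nm: "i \<le> j \<Longrightarrow> N i \<subseteq> N j" for i j by (induction rule: dec_induct) (auto simp: NS)
  have zH: "zer M \<in> H" unfolding H_def using N0 by blast
  have sH: "s v \<in> H" for v unfolding H_def using N0 by blast
  have wit: "\<exists>a\<in>H. sat M (e(x := a)) p" if e: "\<And>v. e v \<in> H" and ex: "\<exists>a\<in>dom M. sat M (e(x := a)) p" for e x p
  proof -
    obtain B where B: "fv p \<subseteq> {..<B}" using finite_nat_bounded[OF finite_fv] by blast
    define l where "l = map e [0..<B]"
    have el: "sat M ((en l)(x := a)) p = sat M (e(x := a)) p" for a
      by (rule sat_cong) (use B in \<open>auto simp: en_def l_def\<close>)
    have "\<exists>i. set l \<subseteq> N i"
    proof -
      have "\<forall>v. \<exists>i. e v \<in> N i" using e unfolding H_def by blast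
      then obtain f where f: "\<And>v. e v \<in> N (f v)" by metis
      have "e v \<in> N (Max (f ` {..<B}))" if "v < B" for v using f[of v] Nm[of "f v" "Max (f ` {..<B})"] that by auto
      then show ?thesis unfolding l_def by (intro exI[of _ "Max (f ` {..<B})"]) auto
    qed
    then obtain i where "l \<in> lists (N i)" by (auto simp: in_lists_conv_set)
    then have "W (p, x, l) \<in> H" unfolding H_def using NS[of i] by blast
    moreover have "sat M (e(x := W (p, x, l))) p" using Wsat[of l x p] ex el by simp
    ultimately show ?thesis by blast
  qed
  define M0 where "M0 = M\<lparr>dom := H\<rparr>"
  have ev0: "eval_t M0 e t = eval_t M e t" for e t by (induction t) (simp_all add: M0_def)
  \<comment> \<open>The value of a term is the only witness for its equation with a fresh variable,
    so closure under the operations follows from closure under witnesses.\<close>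
  have cl: "eval_t M e t \<in> H" if eH: "\<And>v. e v \<in> H" for e t
  proof -
    obtain B where B: "vars_t t \<subseteq> {..<B}" using finite_nat_bounded[OF finite_vars_t] by blast
    have "eval_t M e' t \<in> dom M" if "\<And>v. e' v \<in> dom M" for e' using that M by (induction t) (auto simp: wf_struc_def)
    then have "\<exists>a\<in>dom M. sat M (e(B := a)) (Eq (Var B) t)"
      using that HM B eval_t_cong[of t e "e(B := _)" M] by (intro bexI[of _ "eval_t M e t"]) (auto intro!: eval_t_cong)
    then obtain a where "a \<in> H" "a = eval_t M (e(B := a)) t" using wit[of e B "Eq (Var B) t", OF eH] by auto
    moreover have "eval_t M (e(B := a)) t = eval_t M e t" by (rule eval_t_cong) (use B in auto)
    ultimately show ?thesis by simp
  qed
  have wf0: "wf_struc M0" unfolding wf_struc_def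
  proof (intro conjI ballI)
    fix a b assume ab: "a \<in> dom M0" "b \<in> dom M0"
    have "\<And>v. (if v = 0 then a else b) \<in> H" using ab by (simp add: M0_def)
    note c = cl[of "\<lambda>v. if v = 0 then a else b", OF this]
    show "pl M0 a b \<in> dom M0" "tm M0 a b \<in> dom M0" using c[of "Plus (Var 0) (Var 1)"] c[of "Times (Var 0) (Var 1)"] by (simp_all add: M0_def)
  next
    fix a assume "a \<in> dom M0"
    then show "sc M0 a \<in> dom M0" using cl[of "\<lambda>v. a" "S (Var 0)"] by (simp add: M0_def)
  qed (use zH in \<open>simp add: M0_def\<close>)
  have sat0: "(\<And>v. e v \<in> H) \<Longrightarrow> sat M0 e p = sat M e p" for e p
  proof (induction p arbitrary: e)
    case (Ex x p)
    have "sat M0 (e(x := a)) p = sat M (e(x := a)) p" if "a \<in> H" for a by (rule Ex.IH) (use Ex.prems that in simp)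
    then show ?case using wit[of e x p] Ex.prems HM by (auto simp: M0_def)
  next
    case (All x p)
    have "sat M0 (e(x := a)) p = sat M (e(x := a)) p" if "a \<in> H" for a by (rule All.IH) (use All.prems that in simp)
    then show ?case using wit[of e x "Neg p"] All.prems HM by (auto simp: M0_def)
  qed (auto simp: ev0, simp_all add: M0_def)
  define g where "g = to_nat_on H"
  define h where "h = from_nat_into H"
  have hg: "h (g a) = a" if "a \<in> H" for a using that cH by (simp add: h_def g_def)
  define K :: "nat struc" where "K = \<lparr>dom = g ` H, zer = g (zer M), sc = \<lambda>a. g (sc M (h a)), pl = \<lambda>a b. g (pl M (h a) (h b)),
     tm = \<lambda>a b. g (tm M (h a) (h b)), lt = \<lambda>a b. lt M (h a) (h b)\<rparr>"
  have c0: "sc M a \<in> H" "pl M a b \<in> H" "tm M a b \<in> H" if "a \<in> H" "b \<in> H" for a b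
    using wf0 that unfolding wf_struc_def by (simp_all add: M0_def)
  have wfK: "wf_struc K" unfolding wf_struc_def K_def using zH c0 hg by auto
  have iso: "sat K e p = sat M0 (h \<circ> e) p" if e: "\<And>v. e v \<in> dom K" for e p
  proof (rule sat_iso[OF wfK])
    show "h ` dom K = dom M0" using hg by (auto simp: K_def M0_def image_image)
    show "inj_on h (dom K)" using hg by (auto simp: K_def inj_on_def)
  qed (use e hg zH c0 in \<open>auto simp: K_def M0_def\<close>)
  have "sat K e p = sat M (h \<circ> e) p" if e: "\<And>v. e v \<in> dom K" for e p
    unfolding iso[OF e] by (rule sat0) (use e hg in \<open>auto simp: K_def\<close>, metis hg imageE)
  then show ?thesis using wfK sH hg HM
    by (intro exI[of _ K] exI[of _ h] exI[of _ "g \<circ> s"]) (auto simp: K_def)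
qed

lemma proves_sat:
  assumes M: "models M T" and p: "proves T p" and s: "\<And>v. s v \<in> dom M"
  shows "sat M s p"
proof -
  obtain K :: "nat struc" and h t where K: "wf_struc K" "\<forall>v. t v \<in> dom K" "\<forall>a\<in>dom K. h a \<in> dom M" "\<forall>v. h (t v) = s v"
    "\<And>e p. (\<forall>v. e v \<in> dom K) \<Longrightarrow> sat K e p = sat M (h \<circ> e) p"
    using countable_elementary_submodel[of M s] M s unfolding models_def by metis
  have "models K T" unfolding models_def using K M by (simp add: models_def)
  then have "sat K t p" using p K(2) unfolding proves_def by blast
  moreover have "h \<circ> t = s" using K(4) by auto
  ultimately show ?thesis using K(5)[OF K(2)] by simp
qed

text \<open>Reduces the truth of \<open>p\<close> in an extension to that of a \<open>\<Pi>\<close>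
  formula: the witnesses for the leading existential quantifiers are kept in \<open>e'\<close>, and
  their images serve as witnesses in \<open>K\<close>.\<close>

lemma Sigma_strip:
  assumes "Sigma (Suc j) p" "sat M e p" "\<And>v. e v \<in> dom M"
  shows "\<exists>q e'. Pi j q \<and> sat M e' q \<and> (\<forall>v. e' v \<in> dom M) \<and>
    (\<forall>(K :: 'b struc) h. (\<forall>a\<in>dom M. h a \<in> dom K) \<longrightarrow> sat K (h \<circ> e') q \<longrightarrow> sat K (h \<circ> e) p)"
  using assms
proof (induction "Suc j" p arbitrary: e rule: Sigma_Pi.inducts(1)[where ?P2.0 = "\<lambda>_ _. True"])
  case (3 p) then show ?case by auto
next
  case (4 p x)
  then obtain a where a: "a \<in> dom M" "sat M (e(x := a)) p" by auto
  have "(e(x := a)) v \<in> dom M" for v using a 4(4) by simp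
  from 4(2)[OF a(2) this] obtain q e' where q: "Pi j q" "sat M e' q" "\<forall>v. e' v \<in> dom M"
    "\<forall>(K :: 'b struc) h. (\<forall>a\<in>dom M. h a \<in> dom K) \<longrightarrow> sat K (h \<circ> e') q \<longrightarrow> sat K (h \<circ> e(x := a)) p"
    by blast
  have "h \<circ> e(x := a) = (h \<circ> e)(x := h a)" for h :: "'a \<Rightarrow> 'b" by auto
  then have "sat K (h \<circ> e) (Ex x p)" if "\<forall>a\<in>dom M. h a \<in> dom K" "sat K (h \<circ> e') q" for K :: "'b struc" and h
    using q(4)[rule_format, of h K] that a(1) by auto
  then show ?case using q by (intro exI[of _ q] exI[of _ e']) simp
qed auto

subsection \<open>Restricted ultrapowers\<close>

text \<open>Simultaneous substitution by successive single ones. The functions \<open>f i\<close>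
  read their arguments from positions shifted by \<open>B\<close>, which are not overwritten
  meanwhile.\<close>

lemma finite_substitution:
  fixes C :: "((nat \<Rightarrow> 'a) \<Rightarrow> bool) \<Rightarrow> bool"
  assumes re: "\<And>P \<sigma>. C P \<Longrightarrow> C (\<lambda>e. P (\<lambda>i. e (\<sigma> i)))"
    and sub: "\<And>R f. C (\<lambda>e. R (e 0) (\<lambda>i. e (Suc i))) \<Longrightarrow> Fn f \<Longrightarrow> C (\<lambda>e. R (f e) e)"
    and Fre: "\<And>f \<sigma>. Fn f \<Longrightarrow> Fn (\<lambda>e. f (\<lambda>i. e (\<sigma> i)))"
    and P: "C P" and f: "\<And>i. Fn (f i)" and B: "\<And>e e'. (\<And>i. i < B \<Longrightarrow> e i = e' i) \<Longrightarrow> P e = P e'"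
  shows "C (\<lambda>e. P (\<lambda>i. f i e))"
proof -
  have "C (\<lambda>e. P (\<lambda>i. if i < j then f i (\<lambda>l. e (l + B)) else e i))" if "j \<le> B" for j
    using that
  proof (induction j)
    case 0 then show ?case using P by simp
  next
    case (Suc j)
    let ?R = "\<lambda>a e. P (\<lambda>i. if i < j then f i (\<lambda>l. e (l + B)) else if i = j then a else e i)"
    have "C (\<lambda>e. ?R (e 0) (\<lambda>i. e (Suc i)))"
    proof -
      have "C (\<lambda>e. P (\<lambda>i. if i < j then f i (\<lambda>l. e (l + B)) else e i))" using Suc by simp
      from re[OF this, of "\<lambda>i. if i = j then 0 else Suc i"]
      have "C (\<lambda>e. P (\<lambda>i. if i < j then f i (\<lambda>l. e (if l + B = j then 0 else Suc (l + B))) else e (if i = j then 0 else Suc i)))" .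
      moreover have "(if l + B = j then 0 else Suc (l + B)) = Suc (l + B)" for l using Suc.prems by simp
      ultimately have "C (\<lambda>e. P (\<lambda>i. if i < j then f i (\<lambda>l. e (Suc (l + B))) else e (if i = j then 0 else Suc i)))"
        by (simp only:)
      moreover have "(\<lambda>i. if i < j then f i (\<lambda>l. e (Suc (l + B))) else e (if i = j then 0 else Suc i)) =
        (\<lambda>i. if i < j then f i (\<lambda>l. e (Suc (l + B))) else if i = j then e 0 else e (Suc i))" for e :: "nat \<Rightarrow> 'a" by auto
      ultimately show ?thesis by simp
    qed
    from sub[of ?R, OF this Fre[OF f[of j], of "\<lambda>l. l + B"]]
    have "C (\<lambda>e. P (\<lambda>i. if i < j then f i (\<lambda>l. e (l + B)) else if i = j then f j (\<lambda>l. e (l + B)) else e i))" .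
    moreover have "(\<lambda>i. if i < j then f i (\<lambda>l. e (l + B)) else if i = j then f j (\<lambda>l. e (l + B)) else e i) =
      (\<lambda>i. if i < Suc j then f i (\<lambda>l. e (l + B)) else e i)" for e :: "nat \<Rightarrow> 'a"
      by (auto simp: fun_eq_iff less_Suc_eq)
    ultimately show ?case by simp
  qed
  from re[OF this[OF order_refl], of "\<lambda>i. i - B"]
  have "C (\<lambda>e. P (\<lambda>i. if i < B then f i e else e (i - B)))" unfolding add_diff_cancel_right' .
  moreover have "P (\<lambda>i. if i < B then f i e else e (i - B)) = P (\<lambda>i. f i e)" for e by (rule B) simp
  ultimately show ?thesis by simp
qed

context pa begin

primrec enc :: "(nat \<Rightarrow> 'a) \<Rightarrow> nat \<Rightarrow> 'a" where
  "enc s 0 = \<zero>" | "enc s (Suc B) = pr (s 0) (enc (\<lambda>i. s (Suc i)) B)"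

lemma enc_D: "(\<And>i. s i \<in> D) \<Longrightarrow> enc s B \<in> D" by (induction B arbitrary: s) auto

lemma dec_enc: "(\<And>i. s i \<in> D) \<Longrightarrow> i < B \<Longrightarrow> dec (enc s B) i = s i"
proof (induction B arbitrary: s i)
  case (Suc B)
  have "enc (\<lambda>i. s (Suc i)) B \<in> D" by (rule enc_D) (rule Suc.prems)
  then show ?case using Suc.IH[of "\<lambda>i. s (Suc i)"] Suc.prems by (cases i) (simp_all add: dec_pr)
qed simp

end

text \<open>\<open>\<nu>\<close> assigns names to the classes modulo \<open>F\<close>. The names
  stay abstract so that elements of \<open>M\<close> can later be the names of their own constant
  functions.\<close>

locale ultra = lev M Q k for M :: "'a struc" and Q :: "'a set" and k :: nat +
  fixes \<B> :: "('w \<Rightarrow> 'a) set" and F :: "'w filter" and \<nu> :: "('w \<Rightarrow> 'a) \<Rightarrow> 'b"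
  assumes B_D: "f \<in> \<B> \<Longrightarrow> f \<xi> \<in> D"
    and B_con: "m \<in> D \<Longrightarrow> (\<lambda>_. m) \<in> \<B>"
    and B_pr: "f \<in> \<B> \<Longrightarrow> g \<in> \<B> \<Longrightarrow> (\<lambda>\<xi>. pr (f \<xi>) (g \<xi>)) \<in> \<B>"
    and B_F: "R.Fn (\<lambda>e. G (e 0)) \<Longrightarrow> f \<in> \<B> \<Longrightarrow> (\<lambda>\<xi>. G (f \<xi>)) \<in> \<B>"
    and F_bot: "F \<noteq> bot" and F_ultra: "eventually P F \<or> eventually (\<lambda>\<xi>. \<not> P \<xi>) F"
    and nu: "f \<in> \<B> \<Longrightarrow> g \<in> \<B> \<Longrightarrow> \<nu> f = \<nu> g \<longleftrightarrow> eventually (\<lambda>\<xi>. f \<xi> = g \<xi>) F"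
begin

abbreviation ev where "ev P \<equiv> eventually P F"

lemma ev_not: "ev (\<lambda>\<xi>. \<not> P \<xi>) \<longleftrightarrow> \<not> ev P"
proof
  assume n: "ev (\<lambda>\<xi>. \<not> P \<xi>)"
  show "\<not> ev P"
  proof
    assume "ev P"
    with n have "ev (\<lambda>\<xi>. False)" by eventually_elim simp
    then show False using F_bot by (simp add: trivial_limit_def)
  qed
qed (use F_ultra in blast)

lemma ev_or: "ev (\<lambda>\<xi>. P \<xi> \<or> P' \<xi>) \<longleftrightarrow> ev P \<or> ev P'"
  using ev_not[of P] ev_not[of P'] ev_not[of "\<lambda>\<xi>. P \<xi> \<or> P' \<xi>"] by (auto simp: eventually_conj_iff)

definition rp :: "'b \<Rightarrow> 'w \<Rightarrow> 'a" where "rp a = (SOME f. f \<in> \<B> \<and> \<nu> f = a)"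

definition K :: "'b struc" where
  "K = \<lparr>dom = \<nu> ` \<B>, zer = \<nu> (\<lambda>_. \<zero>), sc = \<lambda>a. \<nu> (\<lambda>\<xi>. \<S> (rp a \<xi>)), pl = \<lambda>a b. \<nu> (\<lambda>\<xi>. rp a \<xi> \<oplus> rp b \<xi>),
     tm = \<lambda>a b. \<nu> (\<lambda>\<xi>. rp a \<xi> \<otimes> rp b \<xi>), lt = \<lambda>a b. ev (\<lambda>\<xi>. rp a \<xi> \<prec> rp b \<xi>)\<rparr>"

lemma rp: assumes "f \<in> \<B>" shows "rp (\<nu> f) \<in> \<B>" "ev (\<lambda>\<xi>. rp (\<nu> f) \<xi> = f \<xi>)"
proof -
  have *: "rp (\<nu> f) \<in> \<B> \<and> \<nu> (rp (\<nu> f)) = \<nu> f"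
    unfolding rp_def by (rule someI[of "\<lambda>g. g \<in> \<B> \<and> \<nu> g = \<nu> f" f]) (use assms in simp)
  then show "rp (\<nu> f) \<in> \<B>" by simp
  then show "ev (\<lambda>\<xi>. rp (\<nu> f) \<xi> = f \<xi>)" using * nu[of "rp (\<nu> f)" f] assms by simp
qed

lemma B_F2: assumes "R.Fn (\<lambda>e. G (e 0) (e 1))" "f \<in> \<B>" "g \<in> \<B>" shows "(\<lambda>\<xi>. G (f \<xi>) (g \<xi>)) \<in> \<B>"
proof -
  have "R.Fn (\<lambda>e. G (fs (e 0)) (sn (e 0)))" by (intro R.Fn_f2[OF assms(1)] cintro)
  from B_F[OF this B_pr[OF assms(2,3)]] show ?thesis using B_D[OF assms(2)] B_D[OF assms(3)] by simp
qed

lemma B_ops: assumes "f \<in> \<B>" "g \<in> \<B>"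
  shows "(\<lambda>\<xi>. \<S> (f \<xi>)) \<in> \<B>" "(\<lambda>\<xi>. f \<xi> \<oplus> g \<xi>) \<in> \<B>" "(\<lambda>\<xi>. f \<xi> \<otimes> g \<xi>) \<in> \<B>"
proof -
  show "(\<lambda>\<xi>. \<S> (f \<xi>)) \<in> \<B>" by (rule B_F[of "\<lambda>a. \<S> a", OF _ assms(1)]) (intro cintro)
  show "(\<lambda>\<xi>. f \<xi> \<oplus> g \<xi>) \<in> \<B>" by (rule B_F2[of "\<lambda>a b. a \<oplus> b", OF _ assms]) (intro cintro)
  show "(\<lambda>\<xi>. f \<xi> \<otimes> g \<xi>) \<in> \<B>" by (rule B_F2[of "\<lambda>a b. a \<otimes> b", OF _ assms]) (intro cintro)
qed

lemma K_ops:
  assumes f: "f \<in> \<B>" and g: "g \<in> \<B>"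
  shows "sc K (\<nu> f) = \<nu> (\<lambda>\<xi>. \<S> (f \<xi>))" "pl K (\<nu> f) (\<nu> g) = \<nu> (\<lambda>\<xi>. f \<xi> \<oplus> g \<xi>)"
    "tm K (\<nu> f) (\<nu> g) = \<nu> (\<lambda>\<xi>. f \<xi> \<otimes> g \<xi>)" "lt K (\<nu> f) (\<nu> g) \<longleftrightarrow> ev (\<lambda>\<xi>. f \<xi> \<prec> g \<xi>)"
proof -
  note r = rp[OF f] rp[OF g]
  have b: "ev (\<lambda>\<xi>. rp (\<nu> f) \<xi> = f \<xi> \<and> rp (\<nu> g) \<xi> = g \<xi>)" using r(2,4) by eventually_elim simp
  have "ev (\<lambda>\<xi>. \<S> (rp (\<nu> f) \<xi>) = \<S> (f \<xi>))" using b by eventually_elim simp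
  then show "sc K (\<nu> f) = \<nu> (\<lambda>\<xi>. \<S> (f \<xi>))"
    using nu[OF B_ops(1)[OF r(1,1)] B_ops(1)[OF f f]] by (simp add: K_def)
  have "ev (\<lambda>\<xi>. rp (\<nu> f) \<xi> \<oplus> rp (\<nu> g) \<xi> = f \<xi> \<oplus> g \<xi>)" using b by eventually_elim simp
  then show "pl K (\<nu> f) (\<nu> g) = \<nu> (\<lambda>\<xi>. f \<xi> \<oplus> g \<xi>)"
    using nu[OF B_ops(2)[OF r(1,3)] B_ops(2)[OF f g]] by (simp add: K_def)
  have "ev (\<lambda>\<xi>. rp (\<nu> f) \<xi> \<otimes> rp (\<nu> g) \<xi> = f \<xi> \<otimes> g \<xi>)" using b by eventually_elim simp
  then show "tm K (\<nu> f) (\<nu> g) = \<nu> (\<lambda>\<xi>. f \<xi> \<otimes> g \<xi>)"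
    using nu[OF B_ops(3)[OF r(1,3)] B_ops(3)[OF f g]] by (simp add: K_def)
  have "ev (\<lambda>\<xi>. (rp (\<nu> f) \<xi> \<prec> rp (\<nu> g) \<xi>) = (f \<xi> \<prec> g \<xi>))" using b by eventually_elim simp
  then have "ev (\<lambda>\<xi>. rp (\<nu> f) \<xi> \<prec> rp (\<nu> g) \<xi>) \<longleftrightarrow> ev (\<lambda>\<xi>. f \<xi> \<prec> g \<xi>)" by (rule eventually_subst)
  then show "lt K (\<nu> f) (\<nu> g) \<longleftrightarrow> ev (\<lambda>\<xi>. f \<xi> \<prec> g \<xi>)" by (simp add: K_def)
qed

lemma dom_K: "dom K = \<nu> ` \<B>" by (simp add: K_def)

lemma wf_K: "wf_struc K" unfolding wf_struc_def dom_K
proof (intro conjI ballI)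
  show "zer K \<in> \<nu> ` \<B>" using B_con[OF D0] by (auto simp: K_def)
  fix a assume "a \<in> \<nu> ` \<B>"
  then obtain f where f: "f \<in> \<B>" "a = \<nu> f" by auto
  then show "sc K a \<in> \<nu> ` \<B>" using K_ops(1)[OF f(1,1)] B_ops(1)[OF f(1,1)] by simp
  fix b assume "b \<in> \<nu> ` \<B>"
  then obtain g where g: "g \<in> \<B>" "b = \<nu> g" by auto
  then show "pl K a b \<in> \<nu> ` \<B>" "tm K a b \<in> \<nu> ` \<B>"
    using K_ops(2,3)[OF f(1) g(1)] B_ops(2,3)[OF f(1) g(1)] f by simp_all
qed

lemma eval_K: assumes s: "\<And>v. s v \<in> \<B>"
  shows "(\<lambda>\<xi>. eval_t M (\<lambda>v. s v \<xi>) t) \<in> \<B> \<and> eval_t K (\<lambda>v. \<nu> (s v)) t = \<nu> (\<lambda>\<xi>. eval_t M (\<lambda>v. s v \<xi>) t)"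
proof (induction t)
  case (S t) then show ?case using B_ops(1)[of "\<lambda>\<xi>. eval_t M (\<lambda>v. s v \<xi>) t" "\<lambda>\<xi>. eval_t M (\<lambda>v. s v \<xi>) t"] K_ops(1)[of "\<lambda>\<xi>. eval_t M (\<lambda>v. s v \<xi>) t" "\<lambda>\<xi>. eval_t M (\<lambda>v. s v \<xi>) t"] by simp
next
  case (Plus t u) then show ?case
    using B_ops(2)[of "\<lambda>\<xi>. eval_t M (\<lambda>v. s v \<xi>) t" "\<lambda>\<xi>. eval_t M (\<lambda>v. s v \<xi>) u"]
      K_ops(2)[of "\<lambda>\<xi>. eval_t M (\<lambda>v. s v \<xi>) t" "\<lambda>\<xi>. eval_t M (\<lambda>v. s v \<xi>) u"] by simp
next
  case (Times t u) then show ?case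
    using B_ops(3)[of "\<lambda>\<xi>. eval_t M (\<lambda>v. s v \<xi>) t" "\<lambda>\<xi>. eval_t M (\<lambda>v. s v \<xi>) u"]
      K_ops(3)[of "\<lambda>\<xi>. eval_t M (\<lambda>v. s v \<xi>) t" "\<lambda>\<xi>. eval_t M (\<lambda>v. s v \<xi>) u"] by simp
qed (use s B_con[OF D0] in \<open>simp_all add: K_def\<close>)

section \<open>The theorem of Los for the restricted ultrapower\<close>

definition dl :: "fm \<Rightarrow> bool" where "dl p \<longleftrightarrow> Dl Q (Suc k) (\<lambda>e. sat M e p)"

text \<open>Each quantified subformula is in the class together with its body: this is what a Skolem
  function inside the class requires.\<close>

primrec hdl :: "fm \<Rightarrow> bool" where
  "hdl (Eq t u) = True" | "hdl (Lt t u) = True" | "hdl (Neg p) = hdl p" | "hdl (Conj p q) = (hdl p \<and> hdl q)" | "hdl (Disj p q) = (hdl p \<and> hdl q)"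
| "hdl (Ex x p) = (dl (Ex x p) \<and> dl p \<and> hdl p)" | "hdl (All x p) = (dl (All x p) \<and> dl p \<and> hdl p)"

lemma sat_subst:
  assumes "dl p" "\<And>i. R.Fn (f i)" shows "Dl Q (Suc k) (\<lambda>e. sat M (\<lambda>i. f i e) p)"
proof -
  obtain B where B: "fv p \<subseteq> {..<B}" using finite_nat_bounded[OF finite_fv] by blast
  show ?thesis
  proof (rule finite_substitution[where Fn = "R.Fn" and f = f and B = B and P = "\<lambda>e. sat M e p"])
    show "sat M e p = sat M e' p" if "\<And>i. i < B \<Longrightarrow> e i = e' i" for e e' by (rule sat_cong) (use B that in auto)
  qed (use assms R.c_re R.c_sub R.Fn_re in \<open>auto simp: dl_def\<close>)
qed

lemma Fn_dec: "R.Fn f \<Longrightarrow> R.Fn (\<lambda>e. dec (f e) i)"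
proof -
  assume f: "R.Fn f"
  have "R.Fn (\<lambda>e. (sn ^^ i) (f e))" using f by (induction i) (simp_all, intro cintro)
  then show ?thesis unfolding dec_def by (intro cintro)
qed

lemma B_enc: "(\<And>i. s i \<in> \<B>) \<Longrightarrow> (\<lambda>\<xi>. enc (\<lambda>i. s i \<xi>) B) \<in> \<B>"
  by (induction B arbitrary: s) (simp_all add: B_con B_pr)

text \<open>The Skolem function takes the least solution. As the existence of a solution is itself
  decided in the class, it can be made total; \<open>enc\<close> packs the finitely many relevant
  values into one argument.\<close>

lemma witness:
  assumes p: "dl p" "dl (Ex x p)" and s: "\<And>v. s v \<in> \<B>"
  shows "\<exists>g\<in>\<B>. \<forall>\<xi>. (\<exists>a\<in>D. sat M ((\<lambda>v. s v \<xi>)(x := a)) p) \<longrightarrow> sat M ((\<lambda>v. s v \<xi>)(x := g \<xi>)) p"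
proof -
  let ?R = "\<lambda>a z. sat M ((dec z)(x := a)) p"
  have 1: "Dl Q (Suc k) (\<lambda>e. ?R (e 0) (e 1))"
  proof -
    have "R.Fn (\<lambda>e. if i = x then e 0 else dec (e 1) i)" for i by (cases "i = x") (simp_all add: Fn_dec R.Fn_var)
    note sF = this
    have "Dl Q (Suc k) (\<lambda>e. sat M (\<lambda>i. if i = x then e 0 else dec (e 1) i) p)"
      by (rule sat_subst[of p "\<lambda>i e. if i = x then e 0 else dec (e 1) i", OF p(1)]) (rule sF)
    moreover have "(\<lambda>i. if i = x then e 0 else dec (e 1) i) = (dec (e 1))(x := e 0)" for e :: "nat \<Rightarrow> 'a" by auto
    ultimately show ?thesis by simp
  qed
  have 2: "Dl Q (Suc k) (\<lambda>e. \<exists>a\<in>D. ?R a (e 0))"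
    using sat_subst[of "Ex x p" "\<lambda>i e. dec (e 0) i", OF p(2) Fn_dec[OF R.Fn_var]] by simp
  let ?R' = "\<lambda>a z. ?R a z \<or> \<not> (\<exists>a\<in>D. ?R a z)"
  have 3: "Dl Q (Suc k) (\<lambda>e. ?R' (e 0) (e 1))" by (intro R.c_or R.c_not 1 R.c_r1[OF 2] R.Fn_var)
  have ex: "\<exists>a\<in>D. ?R' a z" for z using D0 by blast
  define G where "G z = lst (\<lambda>a. ?R' a z)" for z
  have GF: "R.Fn (\<lambda>e. G (e 0))" unfolding G_def
    by (rule R.Fn_lst[of "\<lambda>a e. ?R' a (e 0)"]) (use 3 in simp, rule ex)
  have G: "?R' (G z) z" if "z \<in> D" for z unfolding G_def by (rule lst_Fn_Df(2)[of ?R', OF R.C_Df[OF 3] ex that])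
  obtain B where B: "fv p \<subseteq> {..<B}" using finite_nat_bounded[OF finite_fv] by blast
  let ?z = "\<lambda>\<xi>. enc (\<lambda>i. s i \<xi>) B"
  have zB: "?z \<in> \<B>" by (rule B_enc[OF s])
  have c: "?R a (?z \<xi>) = sat M ((\<lambda>v. s v \<xi>)(x := a)) p" for a \<xi>
    by (rule sat_cong) (use B in \<open>auto simp: dec_enc B_D[OF s]\<close>)
  have "sat M ((\<lambda>v. s v \<xi>)(x := G (?z \<xi>))) p" if "\<exists>a\<in>D. sat M ((\<lambda>v. s v \<xi>)(x := a)) p" for \<xi>
    using G[OF B_D[OF zB], of \<xi>] that unfolding c by blast
  then show ?thesis using B_F[OF GF zB] by (intro bexI[of _ "\<lambda>\<xi>. G (?z \<xi>)"]) auto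
qed

lemma upd_nu: "(\<lambda>v. \<nu> (s v))(x := \<nu> g) = (\<lambda>v. \<nu> ((s(x := g)) v))" by auto
lemma upd_app: "(\<lambda>v. (s(x := g)) v \<xi>) = (\<lambda>v. s v \<xi>)(x := g \<xi>)" by auto

text \<open>Stated for an abstract \<open>P\<close> in place of satisfaction in \<open>K\<close>, so
  that it serves for \<open>Ex\<close> and, with negations, for \<open>All\<close>.\<close>

lemma los_Ex:
  assumes p: "dl p" "dl (Ex x p)" and s: "\<And>v. s v \<in> \<B>"
    and IH: "\<And>s. (\<And>v. s v \<in> \<B>) \<Longrightarrow> P (\<lambda>v. \<nu> (s v)) \<longleftrightarrow> ev (\<lambda>\<xi>. sat M (\<lambda>v. s v \<xi>) p)"
  shows "(\<exists>a\<in>dom K. P ((\<lambda>v. \<nu> (s v))(x := a))) \<longleftrightarrow> ev (\<lambda>\<xi>. \<exists>a\<in>D. sat M ((\<lambda>v. s v \<xi>)(x := a)) p)"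
proof
  assume "\<exists>a\<in>dom K. P ((\<lambda>v. \<nu> (s v))(x := a))"
  then obtain g where g: "g \<in> \<B>" "P ((\<lambda>v. \<nu> (s v))(x := \<nu> g))" by (auto simp: dom_K)
  have "(s(x := g)) v \<in> \<B>" for v using s g by simp
  from IH[of "s(x := g)", OF this] have "ev (\<lambda>\<xi>. sat M ((\<lambda>v. s v \<xi>)(x := g \<xi>)) p)" using g(2) unfolding upd_nu upd_app by blast
  then show "ev (\<lambda>\<xi>. \<exists>a\<in>D. sat M ((\<lambda>v. s v \<xi>)(x := a)) p)" by (rule eventually_mono) (use B_D[OF g(1)] in blast)
next
  assume e: "ev (\<lambda>\<xi>. \<exists>a\<in>D. sat M ((\<lambda>v. s v \<xi>)(x := a)) p)"
  obtain g where g: "g \<in> \<B>" "\<forall>\<xi>. (\<exists>a\<in>D. sat M ((\<lambda>v. s v \<xi>)(x := a)) p) \<longrightarrow> sat M ((\<lambda>v. s v \<xi>)(x := g \<xi>)) p"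
    using witness[of p x s, OF p s] by blast
  have "ev (\<lambda>\<xi>. sat M ((\<lambda>v. s v \<xi>)(x := g \<xi>)) p)" using e by (rule eventually_mono) (use g(2) in blast)
  moreover have "(s(x := g)) v \<in> \<B>" for v using s g by simp
  ultimately have "P ((\<lambda>v. \<nu> (s v))(x := \<nu> g))" using IH[of "s(x := g)"] unfolding upd_nu upd_app by blast
  then show "\<exists>a\<in>dom K. P ((\<lambda>v. \<nu> (s v))(x := a))" using g(1) dom_K by blast
qed

lemma dl_Neg: "dl p \<Longrightarrow> dl (Neg p)" unfolding dl_def by (simp add: R.c_not)

theorem los: "hdl p \<Longrightarrow> (\<And>v. s v \<in> \<B>) \<Longrightarrow> sat K (\<lambda>v. \<nu> (s v)) p \<longleftrightarrow> ev (\<lambda>\<xi>. sat M (\<lambda>v. s v \<xi>) p)"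
proof (induction p arbitrary: s)
  case (Eq t u) then show ?case using eval_K[of s t] eval_K[of s u] nu[of "\<lambda>\<xi>. eval_t M (\<lambda>v. s v \<xi>) t" "\<lambda>\<xi>. eval_t M (\<lambda>v. s v \<xi>) u"] by simp
next
  case (Lt t u) then show ?case using eval_K[of s t] eval_K[of s u] K_ops(4)[of "\<lambda>\<xi>. eval_t M (\<lambda>v. s v \<xi>) t" "\<lambda>\<xi>. eval_t M (\<lambda>v. s v \<xi>) u"] by simp
next
  case (Neg p) then show ?case by (simp add: ev_not)
next
  case (Conj p q) then show ?case by (simp add: eventually_conj_iff)
next
  case (Disj p q) then show ?case by (simp add: ev_or)
next
  case (Ex x p)
  then show ?case using los_Ex[of p x s "\<lambda>e. sat K e p"] by simp
next
  case (All x p)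
  have "dl (Ex x (Neg p))" using All.prems(1) dl_Neg[of "All x p"] by (simp add: dl_def)
  moreover have "(\<not> sat K (\<lambda>v. \<nu> (s v)) p) = ev (\<lambda>\<xi>. sat M (\<lambda>v. s v \<xi>) (Neg p))" if "\<And>v. s v \<in> \<B>" for s
    using All.IH[OF _ that] All.prems(1) by (simp add: ev_not)
  ultimately have "(\<exists>a\<in>dom K. \<not> sat K ((\<lambda>v. \<nu> (s v))(x := a)) p) = ev (\<lambda>\<xi>. \<exists>a\<in>D. \<not> sat M ((\<lambda>v. s v \<xi>)(x := a)) p)"
    using los_Ex[of "Neg p" x s "\<lambda>e. \<not> sat K e p"] All.prems dl_Neg[of p] by simp
  moreover have "ev (\<lambda>\<xi>. \<exists>a\<in>D. \<not> sat M ((\<lambda>v. s v \<xi>)(x := a)) p) = (\<not> ev (\<lambda>\<xi>. \<forall>a\<in>D. sat M ((\<lambda>v. s v \<xi>)(x := a)) p))"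
    using ev_not[of "\<lambda>\<xi>. \<forall>a\<in>D. sat M ((\<lambda>v. s v \<xi>)(x := a)) p"] by simp
  ultimately show ?case unfolding sat.simps by blast
qed

lemma Sg_up: "j \<le> j' \<Longrightarrow> Sg Q j P \<Longrightarrow> Sg Q j' P"
  by (induction rule: dec_induct) (auto intro: Sg_Suc[OF QD])

text \<open>Formulas of level at most \<open>k\<close> fall into the class of level
  \<open>k + 1\<close>, hence within the reach of \<open>los\<close>. This is the source of
  \<open>\<Sigma>\<close> elementarity at level \<open>k\<close>.\<close>

lemma Sigma_Pi_dl: "Sigma j p \<Longrightarrow> j \<le> k \<Longrightarrow> dl p" "Pi j p \<Longrightarrow> j \<le> k \<Longrightarrow> dl p"
proof -
  assume p: "Sigma j p" "j \<le> k"
  note s = literal_Sg(1)[OF QD Q0 p(1)]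
  show "dl p" unfolding dl_def Dl_def using Sg_up[OF _ s, of "Suc k"] Sg_up[OF _ Sg_Suc_neg[OF QD s], of "Suc k"] p by simp
next
  assume p: "Pi j p" "j \<le> k"
  note s = literal_Sg(2)[OF QD Q0 p(1)]
  show "dl p" unfolding dl_def Dl_def using Sg_up[OF _ s, of "Suc k"] Sg_up[OF _ Sg_Suc_neg[OF QD s], of "Suc k"] p by simp
qed

lemma delta0_hdl: "delta0 p \<Longrightarrow> hdl p"
proof -
  have d: "dl p" if "delta0 p" for p by (rule Sigma_Pi_dl(1)[of 0]) (use that in \<open>auto intro: Sigma_Pi.intros\<close>)
  show "delta0 p \<Longrightarrow> hdl p" by (induction rule: delta0.induct) (auto intro!: d delta0.intros)
qed

lemma Sigma_Pi_hdl: "Sigma j p \<Longrightarrow> j \<le> k \<longrightarrow> hdl p" "Pi j p \<Longrightarrow> j \<le> k \<longrightarrow> hdl p"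
proof (induction rule: Sigma_Pi.inducts)
  case (4 n p x) then show ?case using Sigma_Pi_dl(1)[of "Suc n" p] Sigma_Pi_dl(1)[of "Suc n" "Ex x p"] by (auto intro: Sigma_Pi.intros)
next
  case (6 n p x) then show ?case using Sigma_Pi_dl(2)[of "Suc n" p] Sigma_Pi_dl(2)[of "Suc n" "All x p"] by (auto intro: Sigma_Pi.intros)
qed (auto intro: delta0_hdl)

text \<open>Only the leading existential block lies beyond \<open>los\<close>, and a witness in
  \<open>K\<close> is represented by a function whose values are witnesses in
  \<open>M\<close>.\<close>

lemma sigma_down:
  assumes "Sigma (Suc k) p" "\<And>v. s v \<in> \<B>" "sat K (\<lambda>v. \<nu> (s v)) p"
  shows "ev (\<lambda>\<xi>. sat M (\<lambda>v. s v \<xi>) p)"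
  using assms
proof (induction "Suc k" p arbitrary: s rule: Sigma_Pi.inducts(1)[where ?P2.0 = "\<lambda>_ _. True"])
  case (3 p) then show ?case using los[of p s] Sigma_Pi_hdl(2)[of k p] by simp
next
  case (4 p x)
  then obtain g where g: "g \<in> \<B>" "sat K (\<lambda>v. \<nu> ((s(x := g)) v)) p" by (auto simp: dom_K upd_nu)
  have "(s(x := g)) v \<in> \<B>" for v using 4 g by simp
  from 4(2)[of "s(x := g)", OF this g(2)] have "ev (\<lambda>\<xi>. sat M ((\<lambda>v. s v \<xi>)(x := g \<xi>)) p)" unfolding upd_app .
  then show ?case by (rule eventually_mono) (use B_D[OF g(1)] in auto)
qed auto

text \<open>Here witnesses in \<open>M\<close> have to be collected into a function of the class.
  \<open>unif\<close> does this if the assignment depends on one argument through functions of the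
  class and \<open>p\<close> is true throughout a set \<open>C\<close> of the class, not merely at
  the values of \<open>f\<close>.\<close>

lemma sigma_up:
  assumes "Sigma (Suc k) p" "\<And>v. R.Fn (\<lambda>e. E v (e 0))" "Dl Q (Suc k) (\<lambda>e. C (e 0))" "\<And>z. z \<in> D \<Longrightarrow> C z \<Longrightarrow> sat M (\<lambda>v. E v z) p"
    "f \<in> \<B>" "ev (\<lambda>\<xi>. C (f \<xi>))"
  shows "sat K (\<lambda>v. \<nu> (\<lambda>\<xi>. E v (f \<xi>))) p"
  using assms
proof (induction "Suc k" p arbitrary: E rule: Sigma_Pi.inducts(1)[where ?P2.0 = "\<lambda>_ _. True"])
  case (3 p)
  have "(\<lambda>\<xi>. E v (f \<xi>)) \<in> \<B>" for v by (rule B_F[OF "3.prems"(1) "3.prems"(4)])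
  from los[of p "\<lambda>v \<xi>. E v (f \<xi>)", OF _ this]
  have "sat K (\<lambda>v. \<nu> (\<lambda>\<xi>. E v (f \<xi>))) p = ev (\<lambda>\<xi>. sat M (\<lambda>v. E v (f \<xi>)) p)" using Sigma_Pi_hdl(2)[OF 3(1)] by simp
  moreover have "ev (\<lambda>\<xi>. sat M (\<lambda>v. E v (f \<xi>)) p)" using "3.prems"(5) by (rule eventually_mono) (use "3.prems"(3) B_D[OF "3.prems"(4)] in blast)
  ultimately show ?case by simp
next
  case (4 p x)
  have P: "SG (\<lambda>e. sat M e p)" using literal_Sg(1)[OF QD Q0 4(1)] .
  obtain B where B: "fv p \<subseteq> {..<B}" using finite_nat_bounded[OF finite_fv] by blast
  have "SG (\<lambda>e. sat M (\<lambda>i. if i = x then e 0 else E i (e 1)) p)"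
  proof (rule finite_substitution[where Fn = "R.Fn" and f = "\<lambda>i e. if i = x then e 0 else E i (e 1)" and B = B and P = "\<lambda>e. sat M e p"])
    show "sat M e p = sat M e' p" if "\<And>i. i < B \<Longrightarrow> e i = e' i" for e e' by (rule sat_cong) (use B that in auto)
    show "R.Fn (\<lambda>e. if i = x then e 0 else E i (e 1))" for i
      using R.Fn_f1[of "E i", OF "4.prems"(1) R.Fn_var[of 1]] R.Fn_var[of 0] by (cases "i = x") simp_all
    show "SG (\<lambda>e. P (\<lambda>i. e (\<sigma> i)))" if "SG P" for P \<sigma> using Sg_re[OF QD that] .
  qed (use P sg_subF R.Fn_re in auto)
  moreover have u: "(\<lambda>i. if i = x then a else E i z) = (\<lambda>v. E v z)(x := a)" for a z by auto
  ultimately have 1: "SG (\<lambda>e. sat M ((\<lambda>v. E v (e 1))(x := e 0)) p)" by simp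
  have "SG (\<lambda>e. \<not> C (e 1) \<or> sat M ((\<lambda>v. E v (e 1))(x := e 0)) p)"
    by (intro sg_or 1 sg_C R.c_not R.c_r1[OF "4.prems"(2)] R.Fn_var)
  from unif[of "\<lambda>a z. \<not> C z \<or> sat M ((\<lambda>v. E v z)(x := a)) p", OF this]
  obtain G where G: "R.Fn (\<lambda>e. G (e 0))" "\<forall>z\<in>D. \<not> C z \<or> sat M ((\<lambda>v. E v z)(x := G z)) p" using "4.prems"(3) D0 by auto
  let ?E = "\<lambda>v z. if v = x then G z else E v z"
  have "sat K (\<lambda>v. \<nu> (\<lambda>\<xi>. ?E v (f \<xi>))) p"
  proof (rule 4(2)[of "?E", OF _ "4.prems"(2)])
    show "R.Fn (\<lambda>e. ?E v (e 0))" for v using G(1) "4.prems"(1) by (cases "v = x") simp_all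
    show "sat M (\<lambda>v. ?E v z) p" if "z \<in> D" "C z" for z unfolding u using G(2) that by blast
  qed (use "4.prems" in auto)
  moreover have "(\<lambda>v. \<nu> (\<lambda>\<xi>. ?E v (f \<xi>))) = (\<lambda>v. \<nu> (\<lambda>\<xi>. E v (f \<xi>)))(x := \<nu> (\<lambda>\<xi>. G (f \<xi>)))" by auto
  ultimately show ?case using B_F[OF G(1) "4.prems"(4)] by (auto simp: dom_K)
qed auto

text \<open>A value of an outer universal quantifier is given by an arbitrary \<open>g\<close>.
  Pairing \<open>g\<close> with \<open>f\<close> makes the new assignment again depend on one
  argument through functions of the class.\<close>

lemma pi_up:
  assumes "Pi (Suc (Suc k)) p" "\<And>v. R.Fn (\<lambda>e. E v (e 0))" "\<And>z. z \<in> D \<Longrightarrow> sat M (\<lambda>v. E v z) p" "f \<in> \<B>"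
  shows "sat K (\<lambda>v. \<nu> (\<lambda>\<xi>. E v (f \<xi>))) p"
  using assms
proof (induction "Suc (Suc k)" p arbitrary: E f rule: Sigma_Pi.inducts(2)[where ?P1.0 = "\<lambda>_ _. True"])
  case (5 p) then show ?case by (intro sigma_up[of p E "\<lambda>_. True"]) (auto simp: R.c_True)
next
  case (6 p x)
  have "sat K ((\<lambda>v. \<nu> (\<lambda>\<xi>. E v (f \<xi>)))(x := \<nu> g)) p" if g: "g \<in> \<B>" for g
  proof -
    let ?E = "\<lambda>v z. if v = x then fs z else E v (sn z)"
    have "sat K (\<lambda>v. \<nu> (\<lambda>\<xi>. ?E v (pr (g \<xi>) (f \<xi>)))) p"
    proof (rule 6(2)[of ?E])
      show "R.Fn (\<lambda>e. ?E v (e 0))" for v 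
        using R.Fn_f1[of "E v", OF "6.prems"(1) R.Fn_sn[OF R.Fn_var[of 0]]] R.Fn_fs[OF R.Fn_var[of 0]] by (cases "v = x") simp_all
      show "sat M (\<lambda>v. ?E v z) p" if "z \<in> D" for z
      proof -
        have "sat M ((\<lambda>v. E v (sn z))(x := fs z)) p" using "6.prems"(2)[of "sn z"] that by simp
        moreover have "(\<lambda>v. E v (sn z))(x := fs z) = (\<lambda>v. ?E v z)" by auto
        ultimately show ?thesis by simp
      qed
      show "(\<lambda>\<xi>. pr (g \<xi>) (f \<xi>)) \<in> \<B>" by (rule B_pr[OF g "6.prems"(3)])
    qed
    moreover have "(\<lambda>v. \<nu> (\<lambda>\<xi>. ?E v (pr (g \<xi>) (f \<xi>)))) = (\<lambda>v. \<nu> (\<lambda>\<xi>. E v (f \<xi>)))(x := \<nu> g)"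
      using B_D[OF g] B_D[OF "6.prems"(3)] by (auto simp: fun_eq_iff)
    ultimately show ?thesis by simp
  qed
  then show ?case by (auto simp: dom_K)
qed auto

end

subsection \<open>The ultrafilter and the functions of the ultrapower\<close>

context lev begin

text \<open>A function of the class is determined by a formula and finitely many parameters from
  \<open>Q\<close>. It is repeated at arbitrarily late positions, so that it can be majorised at a
  stage beyond any given one.\<close>

lemma enumerate_Fn:
  assumes c: "countable Q"
  shows "\<exists>Fs :: nat \<Rightarrow> 'a \<Rightarrow> 'a. (\<forall>i. R.Fn (\<lambda>e. Fs i (e 0))) \<and> (\<forall>F N. R.Fn (\<lambda>e. F (e 0)) \<longrightarrow> (\<exists>i\<ge>N. \<forall>a\<in>D. Fs i a = F a))"
proof -
  define en where "en l = (\<lambda>i. if i < length l then l ! i else \<zero>)" for l :: "'a list"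
  define S where "S pl a = (THE v. v \<in> D \<and> sat M (pe (en (snd pl)) (\<lambda>i. if i = 0 then v else a)) (fst pl))" for pl a
  let ?T = "(UNIV :: fm set) \<times> lists Q"
  have T: "countable ?T" by (intro countable_SIGMA countable_fm countable_lists c)
  define g where "g = from_nat_into ?T"
  define Fs where "Fs i = (if R.Fn (\<lambda>e. S (g (fst (prod_decode i))) (e 0)) then S (g (fst (prod_decode i))) else (\<lambda>_. \<zero>))" for i
  have 1: "R.Fn (\<lambda>e. Fs i (e 0))" for i
    unfolding Fs_def by (cases "R.Fn (\<lambda>e. S (g (fst (prod_decode i))) (e 0))") (simp_all add: R.Fn_0)
  have 2: "\<exists>i\<ge>N. \<forall>a\<in>D. Fs i a = F a" if F: "R.Fn (\<lambda>e. F (e 0))" for F N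
  proof -
    have "SG (\<lambda>e. e 0 = F (e 1))" using F unfolding R.Fn_def Dl_def by simp
    from Sg_literal[OF this] obtain p \<rho> where p: "\<forall>i. \<rho> i \<in> Q" "\<forall>e\<in>asg. (e 0 = F (e 1)) = sat M (pe \<rho> e) p"
      unfolding rep_def by blast
    obtain B where B: "fv p \<subseteq> {..<B}" using finite_nat_bounded[OF finite_fv] by blast
    define l where "l = map \<rho> [0..<B]"
    have S: "S (p, l) a = F a" if a: "a \<in> D" for a
    proof -
      have e: "sat M (pe (en l) (\<lambda>i. if i = 0 then v else a)) p \<longleftrightarrow> v = F a" if "v \<in> D" for v
      proof -
        have "sat M (pe (en l) (\<lambda>i. if i = 0 then v else a)) p = sat M (pe \<rho> (\<lambda>i. if i = 0 then v else a)) p"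
        proof (rule sat_cong)
          fix v' assume "v' \<in> fv p"
          then have "v' div 2 < B" using B le_less_trans[OF div_le_dividend, of v' B 2] by auto
          then show "pe (en l) (\<lambda>i. if i = 0 then v else a) v' = pe \<rho> (\<lambda>i. if i = 0 then v else a) v'"
            by (simp add: pe_def l_def en_def)
        qed
        also have "\<dots> = (v = F a)" using p(2)[rule_format, of "\<lambda>i. if i = 0 then v else a"] that a by (simp add: asg_def)
        finally show ?thesis .
      qed
      show ?thesis unfolding S_def
      proof (rule the_equality)
        have "F a \<in> D" using FnD1[OF R.Fn_Df[OF F] a] .
        then show "F a \<in> D \<and> sat M (pe (en (snd (p, l))) (\<lambda>i. if i = 0 then F a else a)) (fst (p, l))" using e by simp
      qed (use e in auto)
    qed
    have "(p, l) \<in> ?T" using p(1) by (auto simp: l_def)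
    then obtain j where j: "g j = (p, l)" using from_nat_into_surj[OF T] unfolding g_def by blast
    have "R.Fn (\<lambda>e. S (p, l) (e 0))" by (rule R.Fn_cong[OF F]) (simp add: S asgD)
    then have "Fs (prod_encode (j, N)) = S (p, l)" unfolding Fs_def by (simp add: j)
    then show ?thesis using S le_prod_encode_2[of N j] by (intro exI[of _ "prod_encode (j, N)"]) simp
  qed
  show ?thesis using 1 2 by (intro exI[of _ Fs]) simp
qed

end

context pa begin

section \<open>Stacks of generators\<close>

lemma stk_append: "stk (as @ bs) w = stk as (stk bs w)" by (induction as) auto

lemma stk_D: "set as \<subseteq> D \<Longrightarrow> w \<in> D \<Longrightarrow> stk as w \<in> D" by (induction as) auto

lemma sn_stk: "set as \<subseteq> D \<Longrightarrow> w \<in> D \<Longrightarrow> (sn ^^ length as) (stk as w) = w"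
  by (induction as) (simp_all add: funpow_Suc_right stk_D del: funpow.simps)

lemma fs_stk: "set as \<subseteq> D \<Longrightarrow> w \<in> D \<Longrightarrow> i < length as \<Longrightarrow> fs ((sn ^^ i) (stk as w)) = as ! i"
proof (induction as arbitrary: i)
  case (Cons a as)
  show ?case
  proof (cases i)
    case 0 then show ?thesis using Cons.prems by (simp add: stk_D)
  next
    case (Suc j) then show ?thesis using Cons by (simp add: funpow_Suc_right stk_D del: funpow.simps)
  qed
qed simp

lemma dsc_lt: "dsc (a # as) w \<Longrightarrow> b \<in> set as \<Longrightarrow> b \<prec> a"
proof (induction as arbitrary: a)
  case (Cons c as)
  then have *: "c \<prec> a" "dsc (c # as) w" "a \<in> D" by auto
  show ?case
  proof (cases "b = c")
    case False
    then have "b \<prec> c" using Cons.IH[OF *(2)] Cons.prems by simp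
    then show ?thesis using lt_trans[of b c a] * Cons.prems dsc_D[OF *(2)] by auto
  qed (use * in simp)
qed simp

lemma dsc_nth: "dsc us w \<Longrightarrow> i < j \<Longrightarrow> j < length us \<Longrightarrow> us ! j \<prec> us ! i"
proof (induction us arbitrary: i j)
  case (Cons a us)
  then obtain j' where j: "j = Suc j'" by (cases j) auto
  show ?case using Cons j dsc_lt[OF Cons.prems(1), of "us ! j'"] by (cases i) auto
qed simp

end

context lev begin

lemma Fn_snpow: "R.Fn f \<Longrightarrow> R.Fn (\<lambda>e. (sn ^^ i) (f e))"
  by (induction i) (simp_all add: R.Fn_sn)

text \<open>Acts below the top \<open>r\<close> entries, at the bottom of the stack, where
  \<open>x\<close> and the element of \<open>M\<close> are kept.\<close>

primrec chg :: "('a \<Rightarrow> 'a) \<Rightarrow> nat \<Rightarrow> 'a \<Rightarrow> 'a" where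
  "chg f 0 z = f z" | "chg f (Suc r) z = pr (fs z) (chg f r (sn z))"

lemma Fn_chg: "R.Fn (\<lambda>e. f (e 0)) \<Longrightarrow> R.Fn g \<Longrightarrow> R.Fn (\<lambda>e. chg f r (g e))"
proof (induction r arbitrary: g)
  case 0 then show ?case using R.Fn_f1[of f g] by simp
next
  case (Suc r) then show ?case by (simp add: R.Fn_pr R.Fn_fs R.Fn_sn)
qed

lemma chg_stk: "set as \<subseteq> D \<Longrightarrow> w \<in> D \<Longrightarrow> chg f (length as) (stk as w) = stk as (f w)"
  by (induction as) (simp_all add: stk_D)

end

text \<open>The assumptions on \<open>y\<close>, \<open>Z\<close> and the gaps are supplied by
  \<open>bounding_sequence\<close>, those on \<open>P\<close> and \<open>gm\<close> by
  \<open>decisions\<close>. \<open>E\<close> indexes the generators, and \<open>lv\<close> tells in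
  which gap a generator is to lie.\<close>

locale tower = lev M Q k for M :: "'a struc" and Q :: "'a set" and k :: nat +
  fixes Fs w y Z :: "nat \<Rightarrow> 'a \<Rightarrow> 'a" and X :: "nat \<Rightarrow> nat \<Rightarrow> 'a \<Rightarrow> 'a set" and d :: "nat \<Rightarrow> nat \<Rightarrow> nat"
    and P :: "nat \<Rightarrow> 'a \<Rightarrow> 'a \<Rightarrow> bool" and gm :: "nat \<Rightarrow> 'a \<Rightarrow> 'a" and h :: "nat \<Rightarrow> 'a"
    and E :: "'k set" and lv :: "'k \<Rightarrow> nat" and less2 :: "'k \<Rightarrow> 'k \<Rightarrow> bool" (infix "\<sqsubset>" 50)
  assumes Fs_Fn: "R.Fn (\<lambda>e. Fs i (e 0))"
    and Fs_all: "R.Fn (\<lambda>e. G (e 0)) \<Longrightarrow> \<exists>i\<ge>N. \<forall>a\<in>D. Fs i a = G a"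
    and y_Fn: "R.Fn (\<lambda>e. y i (e 0))" and Z_Fn: "R.Fn (\<lambda>e. Z i (e 0))"
    and gp: "gapped (y i) Fs (Z i) (X i) (d i)"
    and y_rel: "x \<in> D \<Longrightarrow> fs (y i x) = w i x \<and> pr x x \<preceq> y i x \<and> y i x \<preceq> y (Suc i) x \<and> SB (Z i x) \<preceq> y (Suc i) x
        \<and> (\<forall>z\<in>D. z \<preceq> y i x \<longrightarrow> Fs i z \<preceq> y (Suc i) x)"
    and P_unb: "m \<in> D \<Longrightarrow> unb (P i m)"
    and P_dec: "m \<in> D \<Longrightarrow> m' \<in> D \<Longrightarrow> m \<preceq> m' \<Longrightarrow> x \<in> D \<Longrightarrow> P i m' x \<Longrightarrow> P i m x"
    and P_Suc: "m \<in> D \<Longrightarrow> x \<in> D \<Longrightarrow> P (Suc i) m x \<Longrightarrow> P i m x \<and> w i x = h i \<and>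
        (\<forall>e\<in>D. e \<prec> m \<longrightarrow> mn (Fs i (pr (fs e) x)) (sn e) = gm i e)"
    and less2_irrefl: "\<not> e \<sqsubset> e" and less2_trans: "e \<sqsubset> e' \<Longrightarrow> e' \<sqsubset> e'' \<Longrightarrow> e \<sqsubset> e''"
    and less2_total: "e \<in> E \<Longrightarrow> e' \<in> E \<Longrightarrow> e \<sqsubset> e' \<or> e = e' \<or> e' \<sqsubset> e" and less2_lv: "e \<sqsubset> e' \<Longrightarrow> lv e \<le> lv e'"
begin

lemma yD [simp]: "x \<in> D \<Longrightarrow> y i x \<in> D" using FnD1[OF R.Fn_Df[OF y_Fn]] .
lemma ZD [simp]: "x \<in> D \<Longrightarrow> Z i x \<in> D" using FnD1[OF R.Fn_Df[OF Z_Fn]] .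
lemma FsD: "z \<in> D \<Longrightarrow> Fs i z \<in> D" using FnD1[OF R.Fn_Df[OF Fs_Fn]] .

lemma y_mono: assumes "i \<le> j" "x \<in> D" shows "y i x \<preceq> y j x"
  using assms(1)
proof (induction rule: dec_induct)
  case (step j) then show ?case using le_trans[of "y i x" "y j x" "y (Suc j) x"] y_rel[OF assms(2), of j] assms by simp
qed simp

lemma Z_y: assumes "i < j" "x \<in> D" shows "SB (Z i x) \<preceq> y j x"
  using le_trans[of "SB (Z i x)" "y (Suc i) x" "y j x"] y_rel[OF assms(2), of i] y_mono[of "Suc i" j x] assms by simp

lemma gp1: "x \<in> D \<Longrightarrow> nm (d i s) \<preceq> x \<Longrightarrow> u \<in> X i s x \<Longrightarrow> u \<in> D \<and> y i x \<prec> u \<and> u \<prec> Z i x"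
  and gp2: "s \<le> s' \<Longrightarrow> d i s \<le> d i s' \<and> (\<forall>x\<in>D. nm (d i s') \<preceq> x \<longrightarrow> X i s' x \<subseteq> X i s x)"
  and gp3: "x \<in> D \<Longrightarrow> nm (d i s) \<preceq> x \<Longrightarrow> nm N \<preceq> x \<Longrightarrow> \<exists>us. length us = N \<and> set us \<subseteq> X i s x \<and> dsc us (y i x)"
  and gp4: "\<exists>s F'. R.Fn (\<lambda>e. F' (e 0) (e 1)) \<and> (\<forall>x w as. x \<in> D \<longrightarrow> nm (d i s) \<preceq> x \<longrightarrow> nm r \<preceq> x \<longrightarrow> w \<preceq> y i x \<longrightarrow>
         dsc as w \<longrightarrow> length as = r \<longrightarrow> set as \<subseteq> X i s x \<longrightarrow> mn (Fs j (stk as w)) (y i x) = mn (F' x w) (y i x))"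
proof -
  note g = gp[of i, unfolded gapped_def[of "y i", OF y_Fn]]
  show "u \<in> D \<and> y i x \<prec> u \<and> u \<prec> Z i x" if "x \<in> D" "nm (d i s) \<preceq> x" "u \<in> X i s x"
    by (rule g[THEN conjunct1, rule_format, OF that])
  show "d i s \<le> d i s' \<and> (\<forall>x\<in>D. nm (d i s') \<preceq> x \<longrightarrow> X i s' x \<subseteq> X i s x)" if "s \<le> s'"
    by (rule g[THEN conjunct2, THEN conjunct1, THEN spec, THEN spec, THEN mp, OF that])
  show "\<exists>us. length us = N \<and> set us \<subseteq> X i s x \<and> dsc us (y i x)" if "x \<in> D" "nm (d i s) \<preceq> x" "nm N \<preceq> x"
    by (rule g[THEN conjunct2, THEN conjunct2, THEN conjunct1, rule_format, OF that])
  show "\<exists>s F'. R.Fn (\<lambda>e. F' (e 0) (e 1)) \<and> (\<forall>x w as. x \<in> D \<longrightarrow> nm (d i s) \<preceq> x \<longrightarrow> nm r \<preceq> x \<longrightarrow> w \<preceq> y i x \<longrightarrow>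
         dsc as w \<longrightarrow> length as = r \<longrightarrow> set as \<subseteq> X i s x \<longrightarrow> mn (Fs j (stk as w)) (y i x) = mn (F' x w) (y i x))"
    by (rule g[THEN conjunct2, THEN conjunct2, THEN conjunct2, THEN spec, THEN spec])
qed

text \<open>A basic condition: \<open>x\<close> lies above \<open>m\<close> in the set
  \<open>P i m\<close>, and finitely many generators lie in a late homogeneous set of their gap and
  are correctly ordered within it. Generators of different gaps are ordered by their gaps.\<close>

definition Bs :: "nat \<Rightarrow> 'a \<Rightarrow> nat \<Rightarrow> 'k set \<Rightarrow> ('a \<times> ('k \<Rightarrow> 'a)) set" where
  "Bs i m s A = {\<xi>. fst \<xi> \<in> D \<and> m \<preceq> fst \<xi> \<and> P i m (fst \<xi>) \<and> (\<forall>e\<in>A. nm (d (lv e) s) \<preceq> fst \<xi> \<and> snd \<xi> e \<in> X (lv e) s (fst \<xi>))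
     \<and> (\<forall>e\<in>A. \<forall>e'\<in>A. lv e = lv e' \<longrightarrow> e \<sqsubset> e' \<longrightarrow> snd \<xi> e \<prec> snd \<xi> e')}"

text \<open>A single large \<open>x\<close> serves all of \<open>A\<close>. In each gap a descending
  list is available, and a generator takes the entry given by its rank among the elements of
  \<open>A\<close> of its level; a higher rank means an earlier entry.\<close>

lemma Bs_ne: assumes m: "m \<in> D" and A: "finite A" shows "Bs i m s A \<noteq> {}"
proof -
  define N where "N = card A"
  define T where "T = (\<Sum>e\<in>A. d (lv e) s) + N"
  have "m \<oplus> nm T \<in> D" using m by simp
  then obtain x where x: "x \<in> D" "m \<oplus> nm T \<preceq> x" "P i m x" using P_unb[OF m] unfolding unb_def by blast
  have l: "m \<preceq> x" "nm T \<preceq> x" using le_trans[of m "m \<oplus> nm T" x] le_trans[of "nm T" "m \<oplus> nm T" x] x m by simp_all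
  have nmx: "nm j \<preceq> x" if "j \<le> T" for j using le_trans[OF nm_mono[OF that] l(2)] x by simp
  have dx: "nm (d (lv e) s) \<preceq> x" if "e \<in> A" for e
    by (rule nmx) (use member_le_sum[OF that _ A, of "\<lambda>e. d (lv e) s"] in \<open>simp add: T_def\<close>)
  define us where "us j = (SOME us. length us = N \<and> set us \<subseteq> X j s x \<and> dsc us (y j x))" for j
  have us: "length (us (lv e)) = N \<and> set (us (lv e)) \<subseteq> X (lv e) s x \<and> dsc (us (lv e)) (y (lv e) x)" if "e \<in> A" for e
    unfolding us_def by (rule someI_ex, rule gp3[OF x(1) dx[OF that] nmx]) (simp add: T_def)
  define rk where "rk e = card {e'\<in>A. lv e' = lv e \<and> e' \<sqsubset> e}" for e
  have rk: "rk e < N" if "e \<in> A" for e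
    unfolding rk_def N_def by (rule psubset_card_mono[OF A]) (use that less2_irrefl in blast)
  have rk_mono: "rk e < rk e'" if "e \<in> A" "lv e = lv e'" "e \<sqsubset> e'" for e e'
    unfolding rk_def
  proof (rule psubset_card_mono)
    have "{x \<in> A. lv x = lv e \<and> x \<sqsubset> e} \<subseteq> {x \<in> A. lv x = lv e' \<and> x \<sqsubset> e'}" using that less2_trans[of _ e e'] by auto
    moreover have "e \<in> {x \<in> A. lv x = lv e' \<and> x \<sqsubset> e'}" "e \<notin> {x \<in> A. lv x = lv e \<and> x \<sqsubset> e}" using that less2_irrefl by auto
    ultimately show "{x \<in> A. lv x = lv e \<and> x \<sqsubset> e} \<subset> {x \<in> A. lv x = lv e' \<and> x \<sqsubset> e'}" by blast
  qed (use A in simp)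
  define u where "u e = us (lv e) ! (N - 1 - rk e)" for e
  have "u e \<in> X (lv e) s x" if "e \<in> A" for e
  proof -
    have "u e \<in> set (us (lv e))" unfolding u_def by (rule nth_mem) (use us[OF that] rk[OF that] in simp)
    then show ?thesis using us[OF that] by blast
  qed
  moreover have "u e \<prec> u e'" if "e \<in> A" "e' \<in> A" "lv e = lv e'" "e \<sqsubset> e'" for e e'
    unfolding u_def that(3)
    by (rule dsc_nth[of _ "y (lv e') x"]) (use us[OF that(2)] rk[OF that(1)] rk[OF that(2)] rk_mono[OF that(1,3,4)] in auto)
  ultimately have "(x, u) \<in> Bs i m s A" unfolding Bs_def using x l dx by simp
  then show ?thesis by blast
qed

lemma P_anti: assumes "i \<le> j" "m \<in> D" "x \<in> D" shows "P j m x \<Longrightarrow> P i m x"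
  using assms(1) by (induction rule: dec_induct) (use P_Suc assms in blast)+

lemma Bs_mono:
  assumes "i \<le> j" "m \<preceq> m'" "m \<in> D" "m' \<in> D" "s \<le> s'" "A \<subseteq> A'"
  shows "Bs j m' s' A' \<subseteq> Bs i m s A"
proof
  fix \<xi> assume o: "\<xi> \<in> Bs j m' s' A'"
  then have x: "fst \<xi> \<in> D" "m' \<preceq> fst \<xi>" "P j m' (fst \<xi>)" unfolding Bs_def by auto
  have "P i m (fst \<xi>)" using P_anti[OF assms(1,3) x(1)] P_dec[OF assms(3,4,2) x(1,3)] by blast
  moreover have "nm (d (lv e) s) \<preceq> fst \<xi> \<and> snd \<xi> e \<in> X (lv e) s (fst \<xi>)" if "e \<in> A" for e
  proof -
    have *: "nm (d (lv e) s') \<preceq> fst \<xi>" "snd \<xi> e \<in> X (lv e) s' (fst \<xi>)" using o that assms unfolding Bs_def by auto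
    then show ?thesis using gp2[OF assms(5), of "lv e"] x le_trans[OF nm_mono *(1)] by auto
  qed
  moreover have "m \<preceq> fst \<xi>" using le_trans[OF assms(2) x(2)] assms x by simp
  moreover have "snd \<xi> e \<prec> snd \<xi> e'" if "e \<in> A" "e' \<in> A" "lv e = lv e'" "e \<sqsubset> e'" for e e'
    using o that assms(6) unfolding Bs_def by blast
  ultimately show "\<xi> \<in> Bs i m s A" using x unfolding Bs_def by simp
qed

section \<open>The ultrafilter\<close>

definition UF :: "('a \<times> ('k \<Rightarrow> 'a)) filter" where
  "UF = (SOME F. F \<noteq> bot \<and> (\<forall>X\<in>{Bs i m s A | i m s A. m \<in> D \<and> finite A \<and> A \<subseteq> E}. eventually (\<lambda>\<xi>. \<xi> \<in> X) F)
     \<and> (\<forall>P. eventually P F \<or> eventually (\<lambda>\<xi>. \<not> P \<xi>) F))"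

abbreviation ev where "ev p \<equiv> eventually p UF"

lemma UF: "UF \<noteq> bot" "ev p \<or> ev (\<lambda>\<xi>. \<not> p \<xi>)" "m \<in> D \<Longrightarrow> finite A \<Longrightarrow> A \<subseteq> E \<Longrightarrow> ev (\<lambda>\<xi>. \<xi> \<in> Bs i m s A)"
proof -
  let ?B = "{Bs i m s A | i m s A. m \<in> D \<and> finite A \<and> A \<subseteq> E}"
  have "\<exists>F. F \<noteq> bot \<and> (\<forall>X\<in>?B. eventually (\<lambda>\<xi>. \<xi> \<in> X) F) \<and> (\<forall>P. eventually P F \<or> eventually (\<lambda>\<xi>. \<not> P \<xi>) F)"
  proof (rule ultrafilter_exists)
    have "Bs 0 \<zero> 0 {} \<in> ?B"
      by (rule CollectI, rule exI[of _ 0], rule exI[of _ "\<zero>"], rule exI[of _ 0], rule exI[of _ "{}"]) simp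
    then show "?B \<noteq> {}" by blast
    show "{} \<notin> ?B" using Bs_ne by blast
    fix X Y assume "X \<in> ?B" "Y \<in> ?B"
    then obtain i m s A i' m' s' A' where X: "X = Bs i m s A" "m \<in> D" "finite A" "A \<subseteq> E" and Y: "Y = Bs i' m' s' A'" "m' \<in> D" "finite A'" "A' \<subseteq> E"
      by blast
    let ?Z = "Bs (max i i') (m \<oplus> m') (max s s') (A \<union> A')"
    have a: "?Z \<subseteq> X" unfolding X(1) by (rule Bs_mono) (use X Y in auto)
    have b: "?Z \<subseteq> Y" unfolding Y(1) by (rule Bs_mono) (use X Y in auto)
    have c: "?Z \<in> ?B" using X(2-4) Y(2-4)
      by (intro CollectI exI[of _ "max i i'"] exI[of _ "m \<oplus> m'"] exI[of _ "max s s'"] exI[of _ "A \<union> A'"]) simp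
    show "\<exists>Z\<in>?B. Z \<subseteq> X \<inter> Y" by (rule bexI[of _ ?Z], rule Int_greatest[OF a b], rule c)
  qed
  note f = someI_ex[OF this, folded UF_def]
  show "UF \<noteq> bot" by (rule f[THEN conjunct1])
  show "ev p \<or> ev (\<lambda>\<xi>. \<not> p \<xi>)" by (rule f[THEN conjunct2, THEN conjunct2, THEN spec])
  assume "m \<in> D" "finite A" "A \<subseteq> E"
  then have "Bs i m s A \<in> ?B" by (intro CollectI exI[of _ i] exI[of _ m] exI[of _ s] exI[of _ A]) simp
  then show "ev (\<lambda>\<xi>. \<xi> \<in> Bs i m s A)" by (rule f[THEN conjunct2, THEN conjunct1, THEN bspec])
qed

text \<open>The coordinates may leave \<open>D\<close> outside the basic sets; the default zero
  makes the functions total with values in \<open>D\<close>.\<close>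

definition xc :: "'a \<times> ('k \<Rightarrow> 'a) \<Rightarrow> 'a" where "xc \<xi> = (if fst \<xi> \<in> D then fst \<xi> else \<zero>)"
definition uc :: "'a \<times> ('k \<Rightarrow> 'a) \<Rightarrow> 'k \<Rightarrow> 'a" where "uc \<xi> e = (if snd \<xi> e \<in> D then snd \<xi> e else \<zero>)"

lemma xc_D [simp]: "xc \<xi> \<in> D" and uc_D [simp]: "uc \<xi> e \<in> D" by (simp_all add: xc_def uc_def)

lemma ev_P: "m \<in> D \<Longrightarrow> ev (\<lambda>\<xi>. m \<preceq> xc \<xi> \<and> P i m (xc \<xi>))"
  using UF(3)[of m "{}" i 0] by (rule eventually_mono) (simp_all add: Bs_def xc_def)

lemma Bs_uc: "\<xi> \<in> Bs i m s A \<Longrightarrow> e \<in> A \<Longrightarrow> xc \<xi> = fst \<xi> \<and> uc \<xi> e = snd \<xi> e"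
  using gp1[of "fst \<xi>" "lv e" s "snd \<xi> e"] by (auto simp: Bs_def xc_def uc_def)

lemma ev_X: "e \<in> E \<Longrightarrow> ev (\<lambda>\<xi>. nm (d (lv e) s) \<preceq> xc \<xi> \<and> uc \<xi> e \<in> X (lv e) s (xc \<xi>))"
  by (rule eventually_mono[OF UF(3)[of "\<zero>" "{e}" 0 s]]) (use Bs_uc[of _ 0 "\<zero>" s "{e}" e] in \<open>auto simp: Bs_def\<close>)

lemma ev_lt: "e \<in> E \<Longrightarrow> e' \<in> E \<Longrightarrow> e \<sqsubset> e' \<Longrightarrow> lv e = lv e' \<Longrightarrow> ev (\<lambda>\<xi>. uc \<xi> e \<prec> uc \<xi> e')"
  by (rule eventually_mono[OF UF(3)[of "\<zero>" "{e, e'}" 0 0]])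
    (use Bs_uc[of _ 0 "\<zero>" 0 "{e, e'}" e] Bs_uc[of _ 0 "\<zero>" 0 "{e, e'}" e'] in \<open>auto simp: Bs_def\<close>)

lemma ev_y: assumes "e \<in> E" shows "ev (\<lambda>\<xi>. y (lv e) (xc \<xi>) \<prec> uc \<xi> e \<and> uc \<xi> e \<prec> Z (lv e) (xc \<xi>))"
  using ev_X[OF assms, of 0] by (rule eventually_mono) (use gp1[OF xc_D] in blast)

section \<open>Functions of generators and the removal of high levels\<close>

definition us :: "'k list \<Rightarrow> 'a \<times> ('k \<Rightarrow> 'a) \<Rightarrow> 'a list" where "us es \<xi> = map (uc \<xi>) es"
definition bt :: "'a \<Rightarrow> 'a \<times> ('k \<Rightarrow> 'a) \<Rightarrow> 'a" where "bt m \<xi> = pr m (xc \<xi>)"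
definition rf :: "'k list \<Rightarrow> 'a \<Rightarrow> ('a \<Rightarrow> 'a) \<Rightarrow> 'a \<times> ('k \<Rightarrow> 'a) \<Rightarrow> 'a" where "rf es m G \<xi> = G (stk (us es \<xi>) (bt m \<xi>))"
definition ord :: "'k list \<Rightarrow> bool" where "ord es \<longleftrightarrow> set es \<subseteq> E \<and> sorted_wrt (\<lambda>a b. b \<sqsubset> a) es"

lemma us_simps [simp]: "us [] \<xi> = []" "us (e # es) \<xi> = uc \<xi> e # us es \<xi>" "us (es @ es') \<xi> = us es \<xi> @ us es' \<xi>"
  "length (us es \<xi>) = length es" "set (us es \<xi>) \<subseteq> D" by (auto simp: us_def)

lemma bt_D [simp]: "m \<in> D \<Longrightarrow> bt m \<xi> \<in> D" by (simp add: bt_def)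

lemma ord_Cons: "ord (e # es) \<longleftrightarrow> e \<in> E \<and> (\<forall>a\<in>set es. a \<sqsubset> e) \<and> ord es" by (auto simp: ord_def)

lemma ord_ex: "finite A \<Longrightarrow> A \<subseteq> E \<Longrightarrow> \<exists>es. set es = A \<and> ord es"
proof (induction A rule: finite_induct)
  case empty then show ?case by (intro exI[of _ "[]"]) (simp add: ord_def)
next
  case (insert e A)
  then obtain es where es: "set es = A" "ord es" by auto
  let ?l = "filter (\<lambda>a. e \<sqsubset> a) es @ e # filter (\<lambda>a. a \<sqsubset> e) es"
  have "set ?l = insert e A" using es less2_total[of _ e] insert.prems insert.hyps(2) by auto
  moreover have "sorted_wrt (\<lambda>a b. b \<sqsubset> a) ?l" using es(2) less2_trans unfolding ord_def by (auto simp: sorted_wrt_append sorted_wrt_filter)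
  ultimately show ?case using insert.prems unfolding ord_def by blast
qed

lemma ev_bt: "m \<in> D \<Longrightarrow> ev (\<lambda>\<xi>. bt m \<xi> \<preceq> y i (xc \<xi>))"
proof -
  assume m: "m \<in> D"
  have "bt m \<xi> \<preceq> y i (xc \<xi>)" if "m \<preceq> xc \<xi>" for \<xi>
    using le_trans[of "bt m \<xi>" "pr (xc \<xi>) (xc \<xi>)" "y i (xc \<xi>)"] pr_mono[OF that le_refl m xc_D xc_D xc_D] y_rel[of "xc \<xi>" i, OF xc_D] m
    by (simp add: bt_def)
  then show ?thesis using ev_P[OF m, of 0] by (auto elim: eventually_mono)
qed

lemma ev_top:
  assumes "ord es" "m \<in> D" "es = [] \<or> lv (hd es) < L"
  shows "ev (\<lambda>\<xi>. top (us es \<xi>) (bt m \<xi>) \<preceq> y L (xc \<xi>))"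
proof (cases es)
  case Nil then show ?thesis using ev_bt[OF assms(2)] by simp
next
  case (Cons e es')
  have "uc \<xi> e \<preceq> y L (xc \<xi>)" if "uc \<xi> e \<prec> Z (lv e) (xc \<xi>)" for \<xi>
  proof -
    have "uc \<xi> e \<preceq> SB (Z (lv e) (xc \<xi>))"
      using le_trans[OF lt_imp_le[OF that] le_SB] by simp
    then show ?thesis using le_trans[OF _ Z_y[of "lv e" L "xc \<xi>"]] assms Cons by simp
  qed
  then show ?thesis using ev_y[of e] assms Cons by (auto simp: ord_Cons elim!: eventually_mono)
qed

lemma ev_dsc:
  assumes "ord es" "m \<in> D" shows "ev (\<lambda>\<xi>. dsc (us es \<xi>) (bt m \<xi>))"
  using assms(1)
proof (induction es)
  case Nil then show ?case using assms by simp
next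
  case (Cons e es)
  then have e: "e \<in> E" "ord es" "\<And>a. a \<in> set es \<Longrightarrow> a \<sqsubset> e" by (auto simp: ord_Cons)
  have "ev (\<lambda>\<xi>. top (us es \<xi>) (bt m \<xi>) \<prec> uc \<xi> e)"
  proof (cases "es = [] \<or> lv (hd es) < lv e")
    case True
    have D: "top (us es \<xi>) (bt m \<xi>) \<in> D" for \<xi> using assms by (cases es) simp_all
    from ev_top[OF e(2) assms(2) True] ev_y[OF e(1)] show ?thesis
      by eventually_elim (use le_lt_trans D in \<open>simp add: le_lt_trans[OF _ _ D yD[OF xc_D] uc_D]\<close>)
  next
    case False
    then obtain a es' where a: "es = a # es'" "\<not> lv a < lv e" by (cases es) auto
    then have "a \<sqsubset> e" "lv a = lv e" "a \<in> E" using e less2_lv[of a e] by (auto simp: ord_Cons)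
    then show ?thesis using ev_lt[of a e] e(1) a by simp
  qed
  with Cons.IH[OF e(2)] show ?case by eventually_elim simp
qed

text \<open>A descending stack is at most \<open>SB\<close> of its top, and
  \<open>SB (Z i x)\<close> is at most the next \<open>y\<close>. So the generators below level
  \<open>L\<close> together form one argument that is small for the gap \<open>L\<close>.\<close>

lemma ev_stk:
  assumes "ord es" "m \<in> D" "es = [] \<or> lv (hd es) < L"
  shows "ev (\<lambda>\<xi>. stk (us es \<xi>) (bt m \<xi>) \<preceq> y L (xc \<xi>))"
proof (cases es)
  case Nil then show ?thesis using ev_bt[OF assms(2)] by simp
next
  case (Cons e es')
  have "e \<in> E" "lv e < L" using assms Cons by (auto simp: ord_Cons)
  from ev_dsc[OF assms(1,2)] ev_y[OF this(1)] show ?thesis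
  proof eventually_elim
    case (elim \<xi>)
    have 1: "stk (us es \<xi>) (bt m \<xi>) \<preceq> SB (uc \<xi> e)" using stk_SB[OF elim(1)] Cons by simp
    have 2: "SB (uc \<xi> e) \<preceq> SB (Z (lv e) (xc \<xi>))" using elim(2) by (intro SB_mono) (auto simp: lt_imp_le)
    have D: "stk (us es \<xi>) (bt m \<xi>) \<in> D" using dsc_D[OF elim(1)] by simp
    show ?case using le_trans[OF le_trans[OF 1 2] Z_y[OF \<open>lv e < L\<close> xc_D]] D by simp
  qed
qed

text \<open>The stack of the generators of lower level plays the part of the bottom
  \<open>W\<close>.\<close>

lemma ev_dsc_level:
  assumes "ord es" "\<And>e. e \<in> set es \<Longrightarrow> lv e = L" "ev (\<lambda>\<xi>. W \<xi> \<in> D \<and> W \<xi> \<preceq> y L (xc \<xi>))"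
  shows "ev (\<lambda>\<xi>. dsc (us es \<xi>) (W \<xi>))"
  using assms(1,2)
proof (induction es)
  case Nil then show ?case using assms(3) by (auto elim: eventually_mono)
next
  case (Cons e es)
  then have e: "e \<in> E" "ord es" "\<And>a. a \<in> set es \<Longrightarrow> a \<sqsubset> e" "lv e = L" by (auto simp: ord_Cons)
  have "ev (\<lambda>\<xi>. top (us es \<xi>) (W \<xi>) \<prec> uc \<xi> e)"
  proof (cases es)
    case Nil
    from assms(3) ev_y[OF e(1)] show ?thesis
      by eventually_elim (use Nil e(4) in \<open>auto intro: le_lt_trans[OF _ _ _ yD[OF xc_D] uc_D]\<close>)
  next
    case (Cons a es')
    then have "a \<sqsubset> e" "lv a = lv e" "a \<in> E" using e Cons.prems(2) \<open>\<And>e'. e' \<in> set (e # es) \<Longrightarrow> lv e' = L\<close> by (auto simp: ord_Cons)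
    then show ?thesis using ev_lt[of a e] e(1) Cons by simp
  qed
  moreover have "ev (\<lambda>\<xi>. dsc (us es \<xi>) (W \<xi>))" using Cons.IH[OF e(2)] Cons.prems(2) by simp
  ultimately show ?case by eventually_elim simp
qed

text \<open>A value up to \<open>y L\<close> equals its own truncation, and by homogeneity the
  truncated value depends only on the part of the stack below gap \<open>L\<close>, from which
  \<open>F'\<close> computes it. The function \<open>q\<close> recovers \<open>x\<close> from the
  bottom of that part.\<close>

lemma strip_level:
  assumes o: "ord (tops @ rest)" and t: "\<And>e. e \<in> set tops \<Longrightarrow> lv e = L" and r: "rest = [] \<or> lv (hd rest) < L"
    and m: "m \<in> D" and G: "R.Fn (\<lambda>e. G (e 0))" and b: "ev (\<lambda>\<xi>. rf (tops @ rest) m G \<xi> \<preceq> y L (xc \<xi>))"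
  shows "\<exists>G'. R.Fn (\<lambda>e. G' (e 0)) \<and> ev (\<lambda>\<xi>. rf (tops @ rest) m G \<xi> = rf rest m G' \<xi>)"
proof -
  have o': "ord tops" "ord rest" using o by (auto simp: ord_def sorted_wrt_append)
  obtain i where i: "\<And>a. a \<in> D \<Longrightarrow> Fs i a = G a" using Fs_all[OF G, of 0] by blast
  from gp4[of L "length tops" i]
  obtain s F' where F': "R.Fn (\<lambda>e. F' (e 0) (e 1))"
    and hom: "\<forall>x w as. x \<in> D \<longrightarrow> nm (d L s) \<preceq> x \<longrightarrow> nm (length tops) \<preceq> x \<longrightarrow> w \<preceq> y L x \<longrightarrow>
         dsc as w \<longrightarrow> length as = length tops \<longrightarrow> set as \<subseteq> X L s x \<longrightarrow> mn (Fs i (stk as w)) (y L x) = mn (F' x w) (y L x)"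
    by (elim exE conjE)
  show ?thesis
  proof (cases "tops = []")
    case True then show ?thesis using G by (intro exI[of _ G]) simp
  next
    case ne: False
    define q where "q z = sn ((sn ^^ length rest) z)" for z
    define G' where "G' z = mn (F' (q z) z) (y L (q z))" for z
    have "R.Fn (\<lambda>e. G' (e 0))" unfolding G'_def q_def
      by (intro R.Fn_mn R.Fn_f2[OF F'] R.Fn_f1[OF y_Fn] R.Fn_sn Fn_snpow R.Fn_var)
    moreover have "ev (\<lambda>\<xi>. rf (tops @ rest) m G \<xi> = rf rest m G' \<xi>)"
    proof -
      let ?W = "\<lambda>\<xi>. stk (us rest \<xi>) (bt m \<xi>)"
      have WD: "?W \<xi> \<in> D" for \<xi> by (intro stk_D us_simps bt_D m)
      have 1: "ev (\<lambda>\<xi>. ?W \<xi> \<preceq> y L (xc \<xi>))" by (rule ev_stk[OF o'(2) m r])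
      have 2: "ev (\<lambda>\<xi>. dsc (us tops \<xi>) (?W \<xi>))" by (rule ev_dsc_level[OF o'(1) t]) (use 1 WD in simp_all)
      have "\<forall>e\<in>set tops. ev (\<lambda>\<xi>. nm (d L s) \<preceq> xc \<xi> \<and> uc \<xi> e \<in> X L s (xc \<xi>))"
      proof
        fix e assume "e \<in> set tops"
        then show "ev (\<lambda>\<xi>. nm (d L s) \<preceq> xc \<xi> \<and> uc \<xi> e \<in> X L s (xc \<xi>))" using ev_X[of e s] t[of e] o'(1) unfolding ord_def by auto
      qed
      then have 3: "ev (\<lambda>\<xi>. \<forall>e\<in>set tops. nm (d L s) \<preceq> xc \<xi> \<and> uc \<xi> e \<in> X L s (xc \<xi>))"
        by (intro eventually_ball_finite) auto
      have 4: "ev (\<lambda>\<xi>. nm (length tops) \<preceq> xc \<xi>)" using ev_P[OF nm_D, of "length tops" 0] by (auto elim: eventually_mono)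
      from 1 2 3 4 b show ?thesis
      proof eventually_elim
        case (elim \<xi>)
        have "mn (Fs i (stk (us tops \<xi>) (?W \<xi>))) (y L (xc \<xi>)) = mn (F' (xc \<xi>) (?W \<xi>)) (y L (xc \<xi>))"
        proof (rule hom[rule_format])
          show "nm (d L s) \<preceq> xc \<xi>" using elim(3) ne by (cases tops) auto
          show "set (us tops \<xi>) \<subseteq> X L s (xc \<xi>)" using elim(3) by (auto simp: us_def)
        qed (use elim in simp_all)
        moreover have "Fs i (stk (us tops \<xi>) (?W \<xi>)) = rf (tops @ rest) m G \<xi>"
          unfolding rf_def us_simps stk_append by (rule i) (intro stk_D us_simps WD)
        moreover have "(sn ^^ length rest) (?W \<xi>) = bt m \<xi>" using sn_stk[of "us rest \<xi>" "bt m \<xi>"] m by simp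
        then have "q (?W \<xi>) = xc \<xi>" using m by (simp add: q_def bt_def)
        ultimately show ?case using elim(5) by (simp add: rf_def[of rest] G'_def mn_id)
      qed
    qed
    ultimately show ?thesis by blast
  qed
qed

text \<open>Whole levels are removed from the highest one down, which is possible because a value up
  to \<open>y j\<close> is also one up to \<open>y L\<close> for all
  \<open>L \<ge> j\<close>.\<close>

lemma strip:
  assumes "ord es" "m \<in> D" "R.Fn (\<lambda>e. G (e 0))" "ev (\<lambda>\<xi>. rf es m G \<xi> \<preceq> y j (xc \<xi>))"
  shows "\<exists>G'. R.Fn (\<lambda>e. G' (e 0)) \<and> ev (\<lambda>\<xi>. rf es m G \<xi> = rf (filter (\<lambda>e. lv e < j) es) m G' \<xi>)"
  using assms
proof (induction "length es" arbitrary: es G rule: less_induct)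
  case less
  have rfD: "rf es m G \<xi> \<in> D" for \<xi> unfolding rf_def
    by (rule FnD1[OF R.Fn_Df[OF less.prems(3)]]) (intro stk_D us_simps bt_D less.prems(2))
  show ?case
  proof (cases es)
    case Nil then show ?thesis using less.prems by (intro exI[of _ G]) simp
  next
    case (Cons e es')
    have le: "lv a \<le> lv e" if "a \<in> set es" for a using that less.prems(1) less2_lv[of a e] Cons by (auto simp: ord_Cons)
    show ?thesis
    proof (cases "lv e < j")
      case True
      then have "filter (\<lambda>e. lv e < j) es = es" by (intro filter_True ballI) (rule le_less_trans[OF le])
      then show ?thesis using less.prems(3) by (intro exI[of _ G]) simp
    next
      case False
      define tops where "tops = takeWhile (\<lambda>a. lv a = lv e) es"
      define rest where "rest = dropWhile (\<lambda>a. lv a = lv e) es"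
      have tr: "es = tops @ rest" by (simp add: tops_def rest_def)
      have t: "lv a = lv e" if "a \<in> set tops" for a using that unfolding tops_def by (blast dest: set_takeWhileD)
      have r: "rest = [] \<or> lv (hd rest) < lv e"
      proof (cases "rest = []")
        case f: False
        then have "lv (hd rest) \<noteq> lv e" using hd_dropWhile[of "\<lambda>a. lv a = lv e" es] by (simp add: rest_def)
        moreover have "hd rest \<in> set es" using f unfolding tr by simp
        ultimately show ?thesis using le[of "hd rest"] by simp
      qed simp
      have o: "ord rest" using less.prems(1) unfolding tr by (auto simp: ord_def sorted_wrt_append)
      have "ev (\<lambda>\<xi>. rf es m G \<xi> \<preceq> y (lv e) (xc \<xi>))"
        using less.prems(4) by (rule eventually_mono) (use le_trans[OF _ y_mono[of j "lv e"] rfD yD[OF xc_D] yD[OF xc_D]] False in simp)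
      from strip_level[of tops rest "lv e" m G, OF less.prems(1)[unfolded tr] t r less.prems(2,3) this[unfolded tr]]
      obtain G1 where G1: "R.Fn (\<lambda>e. G1 (e 0))" "ev (\<lambda>\<xi>. rf es m G \<xi> = rf rest m G1 \<xi>)" unfolding tr[symmetric] by blast
      have "ev (\<lambda>\<xi>. rf rest m G1 \<xi> \<preceq> y j (xc \<xi>))" using G1(2) less.prems(4) by eventually_elim simp
      moreover have "length rest < length es" using Cons unfolding rest_def by (simp add: length_dropWhile_le le_imp_less_Suc)
      ultimately obtain G' where G': "R.Fn (\<lambda>e. G' (e 0))" "ev (\<lambda>\<xi>. rf rest m G1 \<xi> = rf (filter (\<lambda>e. lv e < j) rest) m G' \<xi>)"
        using less.hyps[of rest G1] o less.prems(2) G1(1) by blast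
      have "filter (\<lambda>e. lv e < j) tops = []" using t False by (auto simp: filter_empty_conv)
      then have f: "filter (\<lambda>e. lv e < j) es = filter (\<lambda>e. lv e < j) rest" by (simp add: tr)
      have "ev (\<lambda>\<xi>. rf es m G \<xi> = rf (filter (\<lambda>e. lv e < j) es) m G' \<xi>)" unfolding f using G1(2) G'(2) by eventually_elim simp
      then show ?thesis using G'(1) by blast
    qed
  qed
qed

text \<open>A representation is required over every list \<open>es\<close> that covers
  \<open>A\<close>, so two functions can be written over a common list without any
  reindexing.\<close>

definition BB :: "('a \<times> ('k \<Rightarrow> 'a) \<Rightarrow> 'a) set" where
  "BB = {f. (\<exists>A. finite A \<and> A \<subseteq> E \<and> (\<forall>es. A \<subseteq> set es \<longrightarrow> (\<exists>G m. R.Fn (\<lambda>e. G (e 0)) \<and> m \<in> D \<and> f = rf es m G)))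
     \<and> (\<exists>i. ev (\<lambda>\<xi>. f \<xi> \<preceq> y i (xc \<xi>)))}"

lemma rf_D: "R.Fn (\<lambda>e. G (e 0)) \<Longrightarrow> m \<in> D \<Longrightarrow> rf es m G \<xi> \<in> D"
  unfolding rf_def by (rule FnD1[of G, OF R.Fn_Df], assumption) (intro stk_D us_simps bt_D)

lemma BB_ord: assumes "f \<in> BB" shows "\<exists>es m G. ord es \<and> m \<in> D \<and> R.Fn (\<lambda>e. G (e 0)) \<and> f = rf es m G"
proof -
  obtain A where A: "finite A" "A \<subseteq> E" "\<And>es. A \<subseteq> set es \<Longrightarrow> \<exists>G m. R.Fn (\<lambda>e. G (e 0)) \<and> m \<in> D \<and> f = rf es m G"
    using assms unfolding BB_def by blast
  obtain es where "set es = A" "ord es" using ord_ex[OF A(1,2)] by blast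
  then show ?thesis using A(3)[of es] by blast
qed

lemma BB_D: "f \<in> BB \<Longrightarrow> f \<xi> \<in> D" using BB_ord rf_D by blast

lemma BB_y: "f \<in> BB \<Longrightarrow> \<exists>i. ev (\<lambda>\<xi>. f \<xi> \<preceq> y i (xc \<xi>))" unfolding BB_def by blast

lemma BB_con: assumes m: "m \<in> D" shows "(\<lambda>_. m) \<in> BB"
  unfolding BB_def
proof (intro CollectI conjI exI[of _ "{}"] allI impI)
  show "\<exists>i. ev (\<lambda>\<xi>. m \<preceq> y i (xc \<xi>))"
  proof (rule exI[of _ 0], rule eventually_mono[OF ev_bt[OF m, of 0]])
    fix \<xi> assume "bt m \<xi> \<preceq> y 0 (xc \<xi>)"
    then show "m \<preceq> y 0 (xc \<xi>)" using lt_le_trans[of m "bt m \<xi>" "y 0 (xc \<xi>)"] m by (simp add: bt_def lt_imp_le)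
  qed
  fix es :: "'k list"
  have "R.Fn (\<lambda>e. fs ((sn ^^ length es) (e 0)))" by (intro R.Fn_fs Fn_snpow R.Fn_var)
  moreover have "(\<lambda>_. m) = rf es m (\<lambda>z. fs ((sn ^^ length es) z))"
  proof
    fix \<xi> show "m = rf es m (\<lambda>z. fs ((sn ^^ length es) z)) \<xi>" using sn_stk[of "us es \<xi>" "bt m \<xi>"] m by (simp add: rf_def bt_def)
  qed
  ultimately show "\<exists>G m'. R.Fn (\<lambda>e. G (e 0)) \<and> m' \<in> D \<and> (\<lambda>_. m) = rf es m' G"
    by (intro exI[of _ "\<lambda>z. fs ((sn ^^ length es) z)"] exI[of _ m] conjI m)
qed auto

lemma BB_x: "xc \<in> BB"
  unfolding BB_def
proof (intro CollectI conjI exI[of _ "{}"] allI impI)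
  have "xc \<xi> \<preceq> y 0 (xc \<xi>)" for \<xi>
    using lt_le_trans[of "xc \<xi>" "pr (xc \<xi>) (xc \<xi>)" "y 0 (xc \<xi>)"] y_rel[of "xc \<xi>" 0, OF xc_D] by (simp add: lt_imp_le)
  then show "\<exists>i. ev (\<lambda>\<xi>. xc \<xi> \<preceq> y i (xc \<xi>))" by (intro exI[of _ 0]) simp
  fix es :: "'k list"
  have "R.Fn (\<lambda>e. sn ((sn ^^ length es) (e 0)))" by (intro R.Fn_sn Fn_snpow R.Fn_var)
  moreover have "xc = rf es \<zero> (\<lambda>z. sn ((sn ^^ length es) z))"
  proof
    fix \<xi> show "xc \<xi> = rf es \<zero> (\<lambda>z. sn ((sn ^^ length es) z)) \<xi>" using sn_stk[of "us es \<xi>" "bt \<zero> \<xi>"] by (simp add: rf_def bt_def)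
  qed
  ultimately show "\<exists>G m'. R.Fn (\<lambda>e. G (e 0)) \<and> m' \<in> D \<and> xc = rf es m' G"
    by (intro exI[of _ "\<lambda>z. sn ((sn ^^ length es) z)"] exI[of _ "\<zero>"] conjI D0)
qed auto

lemma BB_u: assumes e: "e \<in> E" shows "(\<lambda>\<xi>. uc \<xi> e) \<in> BB"
  unfolding BB_def
proof (intro CollectI conjI exI[of _ "{e}"] allI impI)
  show "\<exists>i. ev (\<lambda>\<xi>. uc \<xi> e \<preceq> y i (xc \<xi>))"
    using ev_top[of "[e]" "\<zero>" "Suc (lv e)"] e by (intro exI[of _ "Suc (lv e)"]) (simp add: ord_def)
  fix es :: "'k list" assume "{e} \<subseteq> set es"
  then obtain j where j: "j < length es" "es ! j = e" by (auto simp: in_set_conv_nth)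
  have "R.Fn (\<lambda>e. fs ((sn ^^ j) (e 0)))" by (intro R.Fn_fs Fn_snpow R.Fn_var)
  moreover have "(\<lambda>\<xi>. uc \<xi> e) = rf es \<zero> (\<lambda>z. fs ((sn ^^ j) z))"
  proof
    fix \<xi>
    have "fs ((sn ^^ j) (stk (us es \<xi>) (bt \<zero> \<xi>))) = us es \<xi> ! j" by (rule fs_stk) (use j in simp_all)
    then show "uc \<xi> e = rf es \<zero> (\<lambda>z. fs ((sn ^^ j) z)) \<xi>" using j by (simp add: rf_def us_def)
  qed
  ultimately show "\<exists>G m'. R.Fn (\<lambda>e. G (e 0)) \<and> m' \<in> D \<and> (\<lambda>\<xi>. uc \<xi> e) = rf es m' G"
    by (intro exI[of _ "\<lambda>z. fs ((sn ^^ j) z)"] exI[of _ "\<zero>"] conjI D0)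
qed (use e in auto)

lemma ev_y_mono: "ev (\<lambda>\<xi>. f \<xi> \<preceq> y i (xc \<xi>)) \<Longrightarrow> i \<le> j \<Longrightarrow> (\<And>\<xi>. f \<xi> \<in> D) \<Longrightarrow> ev (\<lambda>\<xi>. f \<xi> \<preceq> y j (xc \<xi>))"
  by (erule eventually_mono) (use le_trans[OF _ y_mono] in simp)

text \<open>\<open>H\<close> is some \<open>Fs j\<close> with \<open>j\<close> as late as desired,
  and \<open>y (Suc j)\<close> majorises \<open>Fs j\<close> on all arguments up to
  \<open>y j\<close>.\<close>

lemma BB_F: assumes H: "R.Fn (\<lambda>e. H (e 0))" and f: "f \<in> BB" shows "(\<lambda>\<xi>. H (f \<xi>)) \<in> BB"
proof -
  obtain A where A: "finite A" "A \<subseteq> E" "\<And>es. A \<subseteq> set es \<Longrightarrow> \<exists>G m. R.Fn (\<lambda>e. G (e 0)) \<and> m \<in> D \<and> f = rf es m G"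
    using f unfolding BB_def by blast
  have "\<exists>G m. R.Fn (\<lambda>e. G (e 0)) \<and> m \<in> D \<and> (\<lambda>\<xi>. H (f \<xi>)) = rf es m G" if st: "A \<subseteq> set es" for es
  proof -
    from A(3)[OF st] obtain G m where G: "R.Fn (\<lambda>e. G (e 0))" "m \<in> D" "f = rf es m G" by (elim exE conjE)
    have "R.Fn (\<lambda>e. H (G (e 0)))" by (rule R.Fn_f1[OF H G(1)])
    then show ?thesis using G by (intro exI[of _ "\<lambda>z. H (G z)"] exI[of _ m]) (auto simp: rf_def)
  qed
  moreover obtain i where i: "ev (\<lambda>\<xi>. f \<xi> \<preceq> y i (xc \<xi>))" using BB_y[OF f] by blast
  obtain j where j: "i \<le> j" "\<And>a. a \<in> D \<Longrightarrow> Fs j a = H a" using Fs_all[OF H, of i] by blast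
  have "ev (\<lambda>\<xi>. H (f \<xi>) \<preceq> y (Suc j) (xc \<xi>))"
    using ev_y_mono[OF i j(1) BB_D[OF f]] by (rule eventually_mono) (use y_rel[OF xc_D] j(2) BB_D[OF f] in metis)
  ultimately show ?thesis unfolding BB_def
    by (intro CollectI conjI exI[of _ A] exI[of _ "Suc j"] allI impI A(1,2))
qed

text \<open>The two elements of \<open>M\<close> are paired at the bottom of one stack, from which
  \<open>chg\<close> recovers the two original stacks. For the bound, the function that maps
  \<open>z\<close> to \<open>pr z z\<close> is one of the \<open>Fs l\<close>.\<close>

lemma BB_pr: assumes f: "f \<in> BB" and g: "g \<in> BB" shows "(\<lambda>\<xi>. pr (f \<xi>) (g \<xi>)) \<in> BB"
proof -
  obtain A where A: "finite A" "A \<subseteq> E" "\<And>es. A \<subseteq> set es \<Longrightarrow> \<exists>G m. R.Fn (\<lambda>e. G (e 0)) \<and> m \<in> D \<and> f = rf es m G"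
    using f unfolding BB_def by blast
  obtain T where T: "finite T" "T \<subseteq> E" "\<And>es. T \<subseteq> set es \<Longrightarrow> \<exists>G m. R.Fn (\<lambda>e. G (e 0)) \<and> m \<in> D \<and> g = rf es m G"
    using g unfolding BB_def by blast
  have "\<exists>G m. R.Fn (\<lambda>e. G (e 0)) \<and> m \<in> D \<and> (\<lambda>\<xi>. pr (f \<xi>) (g \<xi>)) = rf es m G" if st: "A \<union> T \<subseteq> set es" for es
  proof -
    have st': "A \<subseteq> set es" "T \<subseteq> set es" using st by auto
    from A(3)[OF st'(1)] obtain G m where G: "R.Fn (\<lambda>e. G (e 0))" "m \<in> D" "f = rf es m G" by (elim exE conjE)
    from T(3)[OF st'(2)] obtain G' m' where G': "R.Fn (\<lambda>e. G' (e 0))" "m' \<in> D" "g = rf es m' G'" by (elim exE conjE)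
    let ?a = "\<lambda>z. pr (fs (fs z)) (sn z)" and ?b = "\<lambda>z. pr (sn (fs z)) (sn z)"
    let ?H = "\<lambda>z. pr (G (chg ?a (length es) z)) (G' (chg ?b (length es) z))"
    have "R.Fn (\<lambda>e. ?H (e 0))"
      by (intro R.Fn_pr R.Fn_f1[OF G(1)] R.Fn_f1[OF G'(1)] Fn_chg R.Fn_fs R.Fn_sn R.Fn_var)
    moreover have "(\<lambda>\<xi>. pr (f \<xi>) (g \<xi>)) = rf es (pr m m') ?H"
    proof
      fix \<xi>
      have "chg ?a (length es) (stk (us es \<xi>) (bt (pr m m') \<xi>)) = stk (us es \<xi>) (bt m \<xi>)"
        "chg ?b (length es) (stk (us es \<xi>) (bt (pr m m') \<xi>)) = stk (us es \<xi>) (bt m' \<xi>)"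
        using chg_stk[of "us es \<xi>" "bt (pr m m') \<xi>" ?a] chg_stk[of "us es \<xi>" "bt (pr m m') \<xi>" ?b] G(2) G'(2) by (simp_all add: bt_def)
      then show "pr (f \<xi>) (g \<xi>) = rf es (pr m m') ?H \<xi>" by (simp add: rf_def G(3) G'(3))
    qed
    ultimately show ?thesis by (intro exI[of _ ?H] exI[of _ "pr m m'"] conjI pr_D G(2) G'(2))
  qed
  moreover obtain i j where ij: "ev (\<lambda>\<xi>. f \<xi> \<preceq> y i (xc \<xi>))" "ev (\<lambda>\<xi>. g \<xi> \<preceq> y j (xc \<xi>))" using BB_y[OF f] BB_y[OF g] by blast
  have "R.Fn (\<lambda>e. pr (e 0) (e 0))" by (intro cintro)
  then obtain l where l: "max i j \<le> l" "\<And>a. a \<in> D \<Longrightarrow> Fs l a = pr a a" using Fs_all[of "\<lambda>z. pr z z" "max i j"] by blast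
  have "ev (\<lambda>\<xi>. f \<xi> \<preceq> y l (xc \<xi>))" "ev (\<lambda>\<xi>. g \<xi> \<preceq> y l (xc \<xi>))"
    using ev_y_mono[OF ij(1) _ BB_D[OF f]] ev_y_mono[OF ij(2) _ BB_D[OF g]] l(1) by simp_all
  then have "ev (\<lambda>\<xi>. pr (f \<xi>) (g \<xi>) \<preceq> y (Suc l) (xc \<xi>))"
  proof eventually_elim
    case (elim \<xi>)
    let ?y = "y l (xc \<xi>)"
    have "pr (f \<xi>) (g \<xi>) \<preceq> pr ?y ?y" using elim BB_D[OF f] BB_D[OF g] by (intro pr_mono) auto
    moreover have "Fs l ?y \<preceq> y (Suc l) (xc \<xi>)" using y_rel[of "xc \<xi>" l, OF xc_D] by simp
    ultimately show ?case using l(2)[of ?y] le_trans[of "pr (f \<xi>) (g \<xi>)" "pr ?y ?y" "y (Suc l) (xc \<xi>)"] BB_D[OF f] BB_D[OF g] by simp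
  qed
  moreover have "finite (A \<union> T)" "A \<union> T \<subseteq> E" using A T by auto
  ultimately show ?thesis unfolding BB_def
    by (intro CollectI conjI exI[of _ "A \<union> T"] exI[of _ "Suc l"] allI impI)
qed

lemma BB_rf: assumes "set es \<subseteq> E" "m \<in> D" "R.Fn (\<lambda>e. G (e 0))" shows "rf es m G \<in> BB"
proof -
  have "(\<lambda>\<xi>. stk (us es \<xi>) (bt m \<xi>)) \<in> BB" using assms(1)
  proof (induction es)
    case Nil then show ?case using BB_pr[OF BB_con[OF assms(2)] BB_x] by (simp add: bt_def)
  next
    case (Cons e es) then show ?case using BB_pr[OF BB_u[of e]] by simp
  qed
  from BB_F[OF assms(3) this] show ?thesis by (simp add: rf_def[abs_def])
qed

text \<open>As there are only countably many \<open>Fs\<close>, this counts the elements of the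
  ultrapower up to \<open>y j\<close>.\<close>

lemma BB_low:
  assumes f: "f \<in> BB" and b: "ev (\<lambda>\<xi>. f \<xi> \<preceq> y j (xc \<xi>))"
  shows "\<exists>es m i. set es \<subseteq> {e\<in>E. lv e < j} \<and> m \<in> D \<and> ev (\<lambda>\<xi>. f \<xi> = rf es m (Fs i) \<xi>)"
proof -
  obtain es m G where f': "ord es" "m \<in> D" "R.Fn (\<lambda>e. G (e 0))" "f = rf es m G" using BB_ord[OF f] by blast
  obtain G' where G': "R.Fn (\<lambda>e. G' (e 0))" "ev (\<lambda>\<xi>. f \<xi> = rf (filter (\<lambda>e. lv e < j) es) m G' \<xi>)"
    using strip[OF f'(1-3) b[unfolded f'(4)]] unfolding f'(4) by blast
  obtain i where i: "\<And>a. a \<in> D \<Longrightarrow> Fs i a = G' a" using Fs_all[OF G'(1), of 0] by blast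
  have "rf es' m (Fs i) \<xi> = rf es' m G' \<xi>" for es' \<xi> unfolding rf_def by (rule i) (intro stk_D us_simps bt_D f'(2))
  then have "ev (\<lambda>\<xi>. f \<xi> = rf (filter (\<lambda>e. lv e < j) es) m (Fs i) \<xi>)" using G'(2) by simp
  then show ?thesis using f'(1,2)
    by (intro exI[of _ "filter (\<lambda>e. lv e < j) es"] exI[of _ m] exI[of _ i]) (auto simp: ord_def)
qed

lemma BB_all: assumes f: "f \<in> BB" shows "\<exists>es m i. set es \<subseteq> E \<and> m \<in> D \<and> ev (\<lambda>\<xi>. f \<xi> = rf es m (Fs i) \<xi>)"
  using BB_y[OF f] BB_low[OF f] by blast

text \<open>A value up to \<open>m\<close> is below \<open>y 0\<close>, so all generators can be
  removed and \<open>f\<close> becomes a function of \<open>x\<close> and one element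
  \<open>m'\<close> of \<open>M\<close>. Its truncation at \<open>m\<close> is the answer to the
  query \<open>q\<close> coding \<open>m'\<close> and \<open>m\<close>, which the sets
  \<open>P\<close> have decided.\<close>

lemma BB_const:
  assumes f: "f \<in> BB" and m: "m \<in> D" and b: "ev (\<lambda>\<xi>. f \<xi> \<preceq> m)"
  shows "\<exists>c\<in>D. ev (\<lambda>\<xi>. f \<xi> = c)"
proof -
  have "ev (\<lambda>\<xi>. f \<xi> \<preceq> y 0 (xc \<xi>))"
    using b ev_bt[OF m, of 0]
  proof eventually_elim
    case (elim \<xi>)
    have "f \<xi> \<preceq> bt m \<xi>" using le_lt_trans[OF elim(1), of "bt m \<xi>"] BB_D[OF f] m by (simp add: bt_def lt_imp_le)
    then show ?case using le_trans[OF _ elim(2)] BB_D[OF f] m by simp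
  qed
  from BB_low[OF f this] obtain es m' i where e: "set es \<subseteq> {e\<in>E. lv e < 0}" "m' \<in> D" "ev (\<lambda>\<xi>. f \<xi> = rf es m' (Fs i) \<xi>)" by blast
  then have es: "es = []" by auto
  define q where "q = pr m' m"
  have q: "q \<in> D" "fs q = m'" "sn q = m" using e m by (simp_all add: q_def)
  from e(3) b ev_P[OF DS[OF q(1)], of "Suc i"]
  have "ev (\<lambda>\<xi>. f \<xi> = gm i q)"
  proof eventually_elim
    case (elim \<xi>)
    have "mn (Fs i (pr m' (xc \<xi>))) m = gm i q" using P_Suc[OF _ xc_D elim(3)[THEN conjunct2]] q by auto
    then show ?case using elim(1,2) es by (simp add: rf_def bt_def mn_id)
  qed
  moreover from this have "\<exists>\<xi>. f \<xi> = gm i q" using UF(1) eventually_happens by blast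
  then have "gm i q \<in> D" using BB_D[OF f] by metis
  ultimately show ?thesis by blast
qed

lemma uc_distinct: assumes "e \<in> E" "e' \<in> E" "e \<sqsubset> e'" shows "ev (\<lambda>\<xi>. uc \<xi> e \<prec> uc \<xi> e')"
proof (cases "lv e = lv e'")
  case True then show ?thesis using ev_lt assms by blast
next
  case False
  then have l: "lv e < lv e'" using less2_lv[OF assms(3)] by simp
  have "ord [e]" using assms by (simp add: ord_def)
  from ev_top[OF this D0, of "lv e'"] have "ev (\<lambda>\<xi>. uc \<xi> e \<preceq> y (lv e') (xc \<xi>))" using l by simp
  with ev_y[OF assms(2)] show ?thesis by eventually_elim (use le_lt_trans[OF _ _ uc_D yD[OF xc_D] uc_D] in blast)
qed

end

subsection \<open>Cardinalities and the final construction\<close>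

lemma card_of_subset_image: "A \<subseteq> f ` B \<Longrightarrow> (card_of A, card_of B) \<in> ordLeq"
  by (rule ordLeq_transitive[OF card_of_mono1 card_of_image])

lemma card_of_Times_bound:
  "infinite Y \<Longrightarrow> (card_of A, card_of Y) \<in> ordLeq \<Longrightarrow> (card_of B, card_of Y) \<in> ordLeq \<Longrightarrow> (card_of (A \<times> B), card_of Y) \<in> ordLeq"
  by (rule card_of_Sigma_ordLeq_infinite) auto

lemma card_of_lists_bound:
  assumes Y: "infinite Y" and L: "(card_of L, card_of Y) \<in> ordLeq" and N: "(card_of N, card_of Y) \<in> ordLeq"
  shows "(card_of ((UNIV :: nat set) \<times> {es. set es \<subseteq> L} \<times> N), card_of Y) \<in> ordLeq"
proof -
  have nat: "(card_of (UNIV :: nat set), card_of Y) \<in> ordLeq" by (rule infinite_iff_card_of_nat[THEN iffD1, OF Y])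
  have "(card_of {es. set es \<subseteq> L \<and> length es = n}, card_of Y) \<in> ordLeq" for n
  proof (induction n)
    case 0
    have *: "{es. set es \<subseteq> L \<and> length es = 0} = {[]}" by auto
    show ?case unfolding * by (rule card_of_singl_ordLeq) (use Y in auto)
  next
    case (Suc n)
    have "{es. set es \<subseteq> L \<and> length es = Suc n} \<subseteq> (\<lambda>(a, l). a # l) ` (L \<times> {es. set es \<subseteq> L \<and> length es = n})"
      by (auto simp: length_Suc_conv image_iff)
    from card_of_subset_image[OF this] card_of_Times_bound[OF Y L Suc.IH] show ?case by (rule ordLeq_transitive)
  qed
  then have "(card_of (\<Union>n\<in>UNIV. {es. set es \<subseteq> L \<and> length es = n}), card_of Y) \<in> ordLeq"
    by (intro card_of_UNION_ordLeq_infinite[OF Y nat]) blast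
  moreover have "(\<Union>n\<in>UNIV. {es. set es \<subseteq> L \<and> length es = n}) = {es. set es \<subseteq> L}" by auto
  ultimately have "(card_of {es. set es \<subseteq> L}, card_of Y) \<in> ordLeq" by simp
  then show ?thesis by (intro card_of_Times_bound Y nat N)
qed

context pa begin

lemma infinite_D: "infinite D"
proof
  assume "finite D"
  then have "finite (range nm)" by (rule finite_subset[rotated]) auto
  moreover have "inj nm" by (simp add: inj_def)
  ultimately show False using finite_imageD by blast
qed

lemma nm_lt: "a \<in> D \<Longrightarrow> a \<prec> nm N \<Longrightarrow> \<exists>i<N. a = nm i"
proof (induction N)
  case (Suc N)
  then consider "a = nm N" | "a \<prec> nm N" by (auto simp: le_def)
  then show ?case using Suc by cases (auto intro: less_SucI)
qed simp

lemma program_closure: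
  assumes B: "countable B" "B \<subseteq> D"
  shows "\<exists>Q. B \<subseteq> Q \<and> countable Q \<and> programs M Q"
proof -
  define N where "N = rec_nat (B \<union> range nm) (\<lambda>_ Y. Y \<union> (\<lambda>(a, b). pr a b) ` (Y \<times> Y))"
  have N0: "N 0 = B \<union> range nm" and NS: "N (Suc i) = N i \<union> (\<lambda>(a, b). pr a b) ` (N i \<times> N i)" for i by (simp_all add: N_def)
  have c: "countable (N i)" for i
  proof (induction i)
    case 0 show ?case unfolding N0 by (intro countable_Un countable_image countableI_type B)
  next
    case (Suc i) then show ?case unfolding NS by (intro countable_Un countable_image countable_SIGMA)
  qed
  have D: "N i \<subseteq> D" for i
  proof (induction i)
    case 0 show ?case using B unfolding N0 by auto
  next
    case (Suc i) then show ?case unfolding NS by (auto intro!: pr_D)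
  qed
  have m: "i \<le> j \<Longrightarrow> N i \<subseteq> N j" for i j by (induction rule: dec_induct) (auto simp: NS)
  have "programs M (\<Union>i. N i)"
  proof
    show "(\<Union>i. N i) \<subseteq> D" using D by blast
    show "nm i \<in> (\<Union>i. N i)" for i using N0 by blast
    fix a b assume "a \<in> (\<Union>i. N i)" "b \<in> (\<Union>i. N i)"
    then obtain i j where "a \<in> N i" "b \<in> N j" by blast
    then have "a \<in> N (max i j)" "b \<in> N (max i j)" using m[of i "max i j"] m[of j "max i j"] by auto
    then have "pr a b \<in> N (Suc (max i j))" unfolding NS by force
    then show "pr a b \<in> (\<Union>i. N i)" by blast
  qed
  moreover have "B \<subseteq> (\<Union>i. N i)" using N0 by blast
  moreover have "countable (\<Union>i. N i)" using c by (intro countable_UN) auto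
  ultimately show ?thesis by blast
qed

end

context tower begin

lemma ev_const: "ev (\<lambda>_. b) \<longleftrightarrow> b" using UF(1) by (cases b) (simp_all add: trivial_limit_def)

text \<open>Constant functions are named by their values, which makes \<open>Inl\<close> the
  embedding of \<open>M\<close>. For the other classes there are enough names in \<open>E\<close>,
  because finite lists over an infinite set are no more numerous than its elements.\<close>

lemma nu_exists:
  assumes E: "infinite E" and DE: "(card_of D, card_of E) \<in> ordLeq"
  shows "\<exists>\<nu> :: ('a \<times> ('k \<Rightarrow> 'a) \<Rightarrow> 'a) \<Rightarrow> 'a + 'k.
    (\<forall>f\<in>BB. \<forall>g\<in>BB. \<nu> f = \<nu> g \<longleftrightarrow> ev (\<lambda>\<xi>. f \<xi> = g \<xi>)) \<and> (\<forall>m\<in>D. \<nu> (\<lambda>_. m) = Inl m)"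
proof -
  define cls where "cls f = {g\<in>BB. ev (\<lambda>\<xi>. f \<xi> = g \<xi>)}" for f
  have sym: "ev (\<lambda>\<xi>. g \<xi> = f \<xi>)" if "ev (\<lambda>\<xi>. f \<xi> = g \<xi>)" for f g :: "'a \<times> ('k \<Rightarrow> 'a) \<Rightarrow> 'a"
    using that by eventually_elim simp
  have trans: "ev (\<lambda>\<xi>. f \<xi> = h \<xi>)" if "ev (\<lambda>\<xi>. f \<xi> = g \<xi>)" "ev (\<lambda>\<xi>. g \<xi> = h \<xi>)" for f g h :: "'a \<times> ('k \<Rightarrow> 'a) \<Rightarrow> 'a"
    using that by eventually_elim simp
  have cls: "cls f = cls g" if "ev (\<lambda>\<xi>. f \<xi> = g \<xi>)" for f g
    unfolding cls_def using trans[OF that] trans[OF sym[OF that]] by blast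
  have cls': "ev (\<lambda>\<xi>. f \<xi> = g \<xi>)" if "f \<in> BB" "g \<in> BB" "cls f = cls g" for f g
  proof -
    have "g \<in> cls g" unfolding cls_def using that(2) by simp
    then have "g \<in> cls f" using that(3) by simp
    then show ?thesis unfolding cls_def by simp
  qed
  let ?R = "(UNIV :: nat set) \<times> {es. set es \<subseteq> E} \<times> D"
  have "cls ` BB \<subseteq> (\<lambda>(i, es, m). cls (rf es m (Fs i))) ` ?R"
  proof
    fix c assume "c \<in> cls ` BB"
    then obtain f where f: "f \<in> BB" "c = cls f" by blast
    obtain es m i where e: "set es \<subseteq> E" "m \<in> D" "ev (\<lambda>\<xi>. f \<xi> = rf es m (Fs i) \<xi>)" using BB_all[OF f(1)] by blast
    have "c = (\<lambda>(i, es, m). cls (rf es m (Fs i))) (i, es, m)" using cls[OF e(3)] f(2) by simp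
    then show "c \<in> (\<lambda>(i, es, m). cls (rf es m (Fs i))) ` ?R" by (rule image_eqI) (use e in simp)
  qed
  from card_of_subset_image[OF this] card_of_lists_bound[OF E card_of_mono1[OF subset_refl] DE]
  have "(card_of (cls ` BB), card_of E) \<in> ordLeq" by (rule ordLeq_transitive)
  from card_of_ordLeq[THEN iffD2, OF this] obtain j where j: "inj_on j (cls ` BB)" and "j ` cls ` BB \<subseteq> E" by (elim exE conjE)
  define cst where "cst f m \<longleftrightarrow> m \<in> D \<and> ev (\<lambda>\<xi>. f \<xi> = m)" for f m
  have cu: "m = m'" if "cst f m" "cst f m'" for f m m'
  proof -
    have "ev (\<lambda>\<xi>. m = m')" using that unfolding cst_def by (auto elim: eventually_elim2)
    then show ?thesis by (simp add: ev_const)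
  qed
  define \<nu> where "\<nu> f = (if \<exists>m. cst f m then Inl (THE m. cst f m) else Inr (j (cls f)))" for f
  have n1: "\<nu> f = Inl m" if "cst f m" for f m
  proof -
    have "(THE m. cst f m) = m" using that cu by blast
    then show ?thesis unfolding \<nu>_def using that by auto
  qed
  have n2: "\<nu> f = Inr (j (cls f))" if "\<not> (\<exists>m. cst f m)" for f unfolding \<nu>_def by (rule if_not_P[OF that])
  have ct: "cst g m" if "cst f m" "ev (\<lambda>\<xi>. f \<xi> = g \<xi>)" for f g m
  proof -
    have "m \<in> D" "ev (\<lambda>\<xi>. f \<xi> = m)" using that(1) unfolding cst_def by simp_all
    moreover have "ev (\<lambda>\<xi>. g \<xi> = m)" using calculation(2) that(2) by eventually_elim simp
    ultimately show ?thesis unfolding cst_def by simp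
  qed
  have "\<nu> f = \<nu> g \<longleftrightarrow> ev (\<lambda>\<xi>. f \<xi> = g \<xi>)" if fg: "f \<in> BB" "g \<in> BB" for f g
  proof (cases "\<exists>m. cst f m")
    case True
    then obtain m where m: "cst f m" by blast
    show ?thesis
    proof (cases "\<exists>m. cst g m")
      case True
      then obtain m' where m': "cst g m'" by blast
      have "\<nu> f = \<nu> g \<longleftrightarrow> m = m'" using n1[OF m] n1[OF m'] by simp
      also have "\<dots> \<longleftrightarrow> ev (\<lambda>\<xi>. f \<xi> = g \<xi>)"
      proof
        assume "m = m'"
        then show "ev (\<lambda>\<xi>. f \<xi> = g \<xi>)" using m m' unfolding cst_def by (auto elim: eventually_elim2)
      next
        assume "ev (\<lambda>\<xi>. f \<xi> = g \<xi>)"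
        then show "m = m'" by (rule cu[OF ct[OF m] m'])
      qed
      finally show ?thesis .
    next
      case False
      then have "\<not> ev (\<lambda>\<xi>. f \<xi> = g \<xi>)" using ct[OF m] by blast
      then show ?thesis using n1[OF m] n2[OF False] by simp
    qed
  next
    case nf: False
    show ?thesis
    proof (cases "\<exists>m. cst g m")
      case True
      then obtain m' where m': "cst g m'" by blast
      then have "\<not> ev (\<lambda>\<xi>. f \<xi> = g \<xi>)" using ct[OF m' sym] nf by blast
      then show ?thesis using n1[OF m'] n2[OF nf] by simp
    next
      case False
      have "\<nu> f = \<nu> g \<longleftrightarrow> cls f = cls g" using n2[OF nf] n2[OF False] inj_on_eq_iff[OF j] fg by simp
      then show ?thesis using cls[of f g] cls'[OF fg] by blast
    qed
  qed
  moreover have "\<nu> (\<lambda>_. m) = Inl m" if "m \<in> D" for m by (rule n1) (simp add: cst_def that)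
  ultimately show ?thesis by blast
qed

end

section \<open>Size, order and theory of the extension\<close>

locale kappa_tower = tower M Q k Fs w y Z X d P gm h E lv less2
  for M :: "'a struc" and Q :: "'a set" and k :: nat and Fs w y Z :: "nat \<Rightarrow> 'a \<Rightarrow> 'a" and X :: "nat \<Rightarrow> nat \<Rightarrow> 'a \<Rightarrow> 'a set"
    and d :: "nat \<Rightarrow> nat \<Rightarrow> nat" and P :: "nat \<Rightarrow> 'a \<Rightarrow> 'a \<Rightarrow> bool" and gm :: "nat \<Rightarrow> 'a \<Rightarrow> 'a" and h :: "nat \<Rightarrow> 'a"
    and E :: "'k set" and lv :: "'k \<Rightarrow> nat" and less2 :: "'k \<Rightarrow> 'k \<Rightarrow> bool" +
  fixes r :: "'k rel" and \<nu> :: "('a \<times> ('k \<Rightarrow> 'a) \<Rightarrow> 'a) \<Rightarrow> 'a + 'k"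
  assumes r: "Card_order r" and E_r: "E = Field r" and D_r: "(card_of (dom M), r) \<in> ordLess"
    and lv_r: "(card_of {e\<in>E. lv e < j}, r) \<in> ordLess"
    and nu_eq: "f \<in> BB \<Longrightarrow> g \<in> BB \<Longrightarrow> \<nu> f = \<nu> g \<longleftrightarrow> eventually (\<lambda>\<xi>. f \<xi> = g \<xi>) UF"
    and nu_con: "m \<in> dom M \<Longrightarrow> \<nu> (\<lambda>_. m) = Inl m"

sublocale kappa_tower \<subseteq> up: ultra M Q k BB UF \<nu>
  by unfold_locales (rule BB_D BB_con BB_pr BB_F UF nu_eq; assumption)+

context kappa_tower begin

lemma dom_K: "dom up.K = \<nu> ` BB" by (rule up.dom_K)

lemma E_iso: "(card_of E, r) \<in> ordIso" unfolding E_r by (rule card_of_Field_ordIso[OF r])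

lemma DE: "(card_of D, card_of E) \<in> ordLeq"
  by (rule ordLeq_ordIso_trans[OF ordLess_imp_ordLeq[OF D_r] ordIso_symmetric[OF E_iso]])

lemma infinite_E: "infinite E" using infinite_D card_of_ordLeq_finite[OF DE] by blast

lemma K_bounded:
  assumes "I \<subseteq> dom up.K" and b: "\<And>f. f \<in> BB \<Longrightarrow> \<nu> f \<in> I \<Longrightarrow> \<exists>es m i. set es \<subseteq> L \<and> m \<in> D \<and> ev (\<lambda>\<xi>. f \<xi> = rf es m (Fs i) \<xi>)" and L: "L \<subseteq> E"
  shows "(card_of I, card_of ((UNIV :: nat set) \<times> {es. set es \<subseteq> L} \<times> D)) \<in> ordLeq"
proof -
  have "I \<subseteq> (\<lambda>(i, es, m). \<nu> (rf es m (Fs i))) ` ((UNIV :: nat set) \<times> {es. set es \<subseteq> L} \<times> D)"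
  proof
    fix c assume c: "c \<in> I"
    then obtain f where f: "f \<in> BB" "c = \<nu> f" using assms(1) dom_K by blast
    obtain es m i where e: "set es \<subseteq> L" "m \<in> D" "ev (\<lambda>\<xi>. f \<xi> = rf es m (Fs i) \<xi>)" using b[OF f(1)] c f(2) by blast
    have "rf es m (Fs i) \<in> BB" by (rule BB_rf) (use e L Fs_Fn in auto)
    then have "c = (\<lambda>(i, es, m). \<nu> (rf es m (Fs i))) (i, es, m)" using nu_eq[OF f(1)] e(3) f(2) by simp
    then show "c \<in> (\<lambda>(i, es, m). \<nu> (rf es m (Fs i))) ` ((UNIV :: nat set) \<times> {es. set es \<subseteq> L} \<times> D)"
      by (rule image_eqI) (use e in simp)
  qed
  then show ?thesis by (rule card_of_subset_image)
qed

text \<open>An element outside an initial segment \<open>I\<close> lies below some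
  \<open>y j\<close>, hence so does all of \<open>I\<close>, and \<open>I\<close> is built from the
  generators of level less than \<open>j\<close>. The generators themselves are pairwise distinct,
  which gives the full size.\<close>

lemma kappa_like_K: "kappa_like r up.K"
  unfolding kappa_like_def
proof (intro conjI allI impI)
  have "(card_of (dom up.K), card_of ((UNIV :: nat set) \<times> {es. set es \<subseteq> E} \<times> D)) \<in> ordLeq"
    by (rule K_bounded) (use BB_all in auto)
  moreover have "(card_of ((UNIV :: nat set) \<times> {es. set es \<subseteq> E} \<times> D), card_of E) \<in> ordLeq"
    by (rule card_of_lists_bound[OF infinite_E card_of_mono1[OF subset_refl] DE])
  ultimately have 1: "(card_of (dom up.K), card_of E) \<in> ordLeq" by (rule ordLeq_transitive)
  have "inj_on (\<lambda>e. \<nu> (\<lambda>\<xi>. uc \<xi> e)) E"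
  proof (rule inj_onI, rule ccontr)
    fix e e' assume e: "e \<in> E" "e' \<in> E" "\<nu> (\<lambda>\<xi>. uc \<xi> e) = \<nu> (\<lambda>\<xi>. uc \<xi> e')" "e \<noteq> e'"
    then have q: "ev (\<lambda>\<xi>. uc \<xi> e = uc \<xi> e')" using nu_eq[OF BB_u[OF e(1)] BB_u[OF e(2)]] by blast
    have "ev (\<lambda>\<xi>. uc \<xi> e \<prec> uc \<xi> e') \<or> ev (\<lambda>\<xi>. uc \<xi> e' \<prec> uc \<xi> e)"
      using less2_total[OF e(1,2)] e(4) uc_distinct[OF e(1,2)] uc_distinct[OF e(2,1)] by blast
    then have "ev (\<lambda>\<xi>. False)"
    proof
      assume "ev (\<lambda>\<xi>. uc \<xi> e \<prec> uc \<xi> e')" with q show ?thesis by eventually_elim (use lt_irrefl[OF uc_D] in simp)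
    next
      assume "ev (\<lambda>\<xi>. uc \<xi> e' \<prec> uc \<xi> e)" with q show ?thesis by eventually_elim (use lt_irrefl[OF uc_D] in simp)
    qed
    then show False by (simp add: ev_const)
  qed
  moreover have "(\<lambda>e. \<nu> (\<lambda>\<xi>. uc \<xi> e)) ` E \<subseteq> dom up.K" unfolding dom_K using BB_u by blast
  ultimately have "(card_of E, card_of (dom up.K)) \<in> ordLeq" unfolding card_of_ordLeq[symmetric] by blast
  with 1 have "(card_of (dom up.K), card_of E) \<in> ordIso" by (simp add: ordIso_iff_ordLeq)
  then show "(card_of (dom up.K), r) \<in> ordIso" by (rule ordIso_transitive[OF _ E_iso])
  fix I assume I: "I \<subseteq> dom up.K" "I \<noteq> dom up.K" "\<forall>a\<in>I. \<forall>b\<in>dom up.K. lt up.K b a \<longrightarrow> b \<in> I"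
  obtain g where g: "g \<in> BB" "\<nu> g \<notin> I" using I(1,2) unfolding dom_K by blast
  obtain j where j: "ev (\<lambda>\<xi>. g \<xi> \<preceq> y j (xc \<xi>))" using BB_y[OF g(1)] by blast
  let ?L = "{e\<in>E. lv e < j}"
  have a: "(card_of I, card_of ((UNIV :: nat set) \<times> {es. set es \<subseteq> ?L} \<times> D)) \<in> ordLeq"
  proof (rule K_bounded[OF I(1)])
    fix f assume f: "f \<in> BB" "\<nu> f \<in> I"
    have "\<not> lt up.K (\<nu> g) (\<nu> f)" using I(3) f(2) g dom_K by blast
    then have "ev (\<lambda>\<xi>. \<not> g \<xi> \<prec> f \<xi>)" using up.K_ops(4)[OF g(1) f(1)] up.ev_not[of "\<lambda>\<xi>. g \<xi> \<prec> f \<xi>"] by simp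
    then have "ev (\<lambda>\<xi>. f \<xi> \<preceq> y j (xc \<xi>))" using j
      by eventually_elim (use BB_D[OF f(1)] BB_D[OF g(1)] in \<open>auto intro: le_trans[OF _ _ _ _ yD[OF xc_D]]\<close>)
    from BB_low[OF f(1) this]
    show "\<exists>es m i. set es \<subseteq> ?L \<and> m \<in> D \<and> ev (\<lambda>\<xi>. f \<xi> = rf es m (Fs i) \<xi>)" .
  qed blast
  have b: "(card_of ((UNIV :: nat set) \<times> {es. set es \<subseteq> ?L} \<times> D), card_of (?L <+> D)) \<in> ordLeq"
    by (rule card_of_lists_bound[OF _ card_of_Plus1 card_of_Plus2]) (use infinite_D in simp)
  have c: "(card_of (?L <+> D), r) \<in> ordLess"
    by (rule card_of_Plus_ordLess_infinite_Field[OF _ r lv_r D_r]) (use infinite_E E_r in simp)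
  show "(card_of I, r) \<in> ordLess" by (rule ordLeq_ordLess_trans[OF ordLeq_transitive[OF a b] c])
qed

lemma end_ext: "sigma_elem_end_ext k Inl M up.K"
  unfolding sigma_elem_end_ext_def
proof (intro conjI ballI allI impI)
  show "inj_on Inl D" by simp
  show "Inl ` D \<subseteq> dom up.K" unfolding dom_K using BB_con nu_con by (metis image_subsetI imageI)
  show "Inl \<zero> = zer up.K" using nu_con[OF D0] by (simp add: up.K_def)
  fix a assume a: "a \<in> D"
  show "Inl (\<S> a) = sc up.K (Inl a)" using up.K_ops(1)[OF BB_con[OF a] BB_con[OF a]] nu_con a by simp
  fix b assume b: "b \<in> D"
  show "Inl (a \<oplus> b) = pl up.K (Inl a) (Inl b)" "Inl (a \<otimes> b) = tm up.K (Inl a) (Inl b)"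
    "a \<prec> b = lt up.K (Inl a) (Inl b)"
    using up.K_ops(2,3,4)[OF BB_con[OF a] BB_con[OF b]] nu_con a b by (simp_all add: ev_const)
next
  fix c a assume c: "c \<in> dom up.K - Inl ` D" and a: "a \<in> D"
  obtain f where f: "f \<in> BB" "c = \<nu> f" using c unfolding dom_K by blast
  show "lt up.K (Inl a) c"
  proof (rule ccontr)
    assume "\<not> lt up.K (Inl a) c"
    then have "\<not> ev (\<lambda>\<xi>. a \<prec> f \<xi>)" using up.K_ops(4)[OF BB_con[OF a] f(1)] nu_con[OF a] f(2) by simp
    then have "ev (\<lambda>\<xi>. \<not> a \<prec> f \<xi>)" using up.ev_not[of "\<lambda>\<xi>. a \<prec> f \<xi>"] by simp
    then have "ev (\<lambda>\<xi>. f \<xi> \<preceq> a)" by eventually_elim (use a BB_D[OF f(1)] in simp)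
    from BB_const[OF f(1) a this] obtain m where "m \<in> D" "ev (\<lambda>\<xi>. f \<xi> = m)" by blast
    then have "c = Inl m" using nu_eq[OF f(1) BB_con] nu_con f(2) by metis
    then show False using c \<open>m \<in> D\<close> by blast
  qed
next
  fix p and s :: "nat \<Rightarrow> 'a" assume p: "Sigma k p" and s: "\<forall>v. s v \<in> D"
  have "sat up.K (\<lambda>v. \<nu> (\<lambda>_. s v)) p = ev (\<lambda>\<xi>. sat M (\<lambda>v. s v) p)"
    by (rule up.los[of p "\<lambda>v _. s v"]) (use up.Sigma_Pi_hdl(1)[OF p] BB_con s in auto)
  moreover have "(\<lambda>v. \<nu> (\<lambda>_. s v)) = Inl \<circ> s" by (rule ext) (use nu_con s in simp)
  ultimately show "sat M s p = sat up.K (Inl \<circ> s) p" by (simp add: ev_const)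
qed

text \<open>With parameters in \<open>Q\<close> the assignment consists of constant functions of the
  class, so \<open>pi_up\<close> carries \<open>q\<close> over; for a sentence the assignment may
  then be changed at will.\<close>

lemma models_K:
  assumes p: "sentence p" and q: "Pi (Suc (Suc k)) q" "\<And>v. e v \<in> Q" "sat M e q"
    and imp: "sat up.K (Inl \<circ> e) q \<Longrightarrow> sat up.K e0 p"
  shows "sat up.K s p"
proof -
  have "sat up.K (\<lambda>v. \<nu> (\<lambda>\<xi>. e v)) q"
    by (rule up.pi_up[of q "\<lambda>v z. e v" xc, OF q(1)]) (use q R.Fn_con BB_x in auto)
  moreover have "(\<lambda>v. \<nu> (\<lambda>\<xi>. e v)) = Inl \<circ> e"
  proof
    fix v
    have "e v \<in> D" using q(2) QD by blast
    then show "\<nu> (\<lambda>\<xi>. e v) = (Inl \<circ> e) v" using nu_con by simp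
  qed
  ultimately have "sat up.K e0 p" using imp by simp
  moreover have "sat up.K s p = sat up.K e0 p" by (rule sat_cong) (use p in \<open>simp add: sentence_def\<close>)
  ultimately show ?thesis by simp
qed

text \<open>The heads \<open>h l\<close> of the values \<open>y l x\<close> contain both an element of \<open>A\<close> and a code of the next
  function \<open>y (Suc l)\<close>, so a coded sequence that starts with \<open>y 0 x\<close> and follows these codes
  reads off the elements of \<open>A\<close>. In the ultrapower such a sequence is bounded by some \<open>y j x\<close>
  and therefore has standard length.\<close>

definition TT :: "'a \<Rightarrow> 'a \<Rightarrow> 'a \<Rightarrow> 'a \<Rightarrow> bool" where
  "TT c a x g \<longleftrightarrow> U k g (pr x (pr (nth (fs c) \<zero>) \<zero>))
     \<and> (\<forall>j\<in>D. j \<prec> sn c \<longrightarrow> U k (sn (fs (nth (fs c) j))) (pr x (pr (nth (fs c) (\<S> j)) \<zero>)))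
     \<and> a = fs (fs (nth (fs c) (sn c)))"

lemma TT_SG: "SG (\<lambda>e. TT (e 0) (e 1) (e 2) (e 3))"
proof -
  note US = U_Sg[OF QD Q0, of k]
  have 1: "SG (\<lambda>e. U k (e 3) (pr (e 2) (pr (nth (fs (e 0)) \<zero>) \<zero>)))"
    by (rule sg_r2[of "U k", OF US]) (intro cintro)+
  have 2: "SG (\<lambda>e. \<forall>j\<in>D. j \<prec> sn (e 0) \<longrightarrow> U k (sn (fs (nth (fs (e 0)) j))) (pr (e 2) (pr (nth (fs (e 0)) (\<S> j)) \<zero>)))"
    by (rule sg_ball, intro cintro, rule sg_r2[of "U k", OF US]) (intro cintro)+
  have 3: "SG (\<lambda>e. e 1 = fs (fs (nth (fs (e 0)) (sn (e 0)))))" by (rule sg_C) (intro cintro)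
  show ?thesis unfolding TT_def by (intro sg_and 1 2 3)
qed

context
  fixes as gc :: "nat \<Rightarrow> 'a"
  assumes asQ: "as i \<in> Q" and gcQ: "gc i \<in> Q" and hQ: "h i \<in> Q" and h_eq: "h i = pr (as i) (gc (Suc i))"
    and gc: "x \<in> D \<Longrightarrow> v \<in> D \<Longrightarrow> U k (gc i) (pr x (pr v \<zero>)) \<longleftrightarrow> v = y i x"
begin

lemma h_D: "as i \<in> D" "gc i \<in> D" "fs (h i) = as i" "sn (h i) = gc (Suc i)"
proof -
  have D: "as i \<in> D" "gc i \<in> D" for i using asQ gcQ QD by auto
  show "as i \<in> D" "gc i \<in> D" "fs (h i) = as i" "sn (h i) = gc (Suc i)" using D by (simp_all add: h_eq)
qed

text \<open>The code found in each head forces the next entry to be the next \<open>y l x\<close>. A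
  sequence reaching position \<open>j + 1\<close> would have a code of at least
  \<open>y (Suc j) x\<close>, which exceeds \<open>y j x\<close>; so the length is standard and
  \<open>a\<close> is one of the first elements.\<close>

lemma TT_chain:
  assumes c: "c \<in> D" "c \<preceq> y j x" and x: "x \<in> D" and T: "TT c a x (gc 0)" and S: "\<S> (y j x) \<preceq> y (Suc j) x"
    and hd: "\<And>l. l \<le> j \<Longrightarrow> fs (y l x) = h l"
  shows "\<exists>l\<le>j. a = as l"
proof -
  have ch: "l \<le> Suc j \<longrightarrow> nm l \<preceq> sn c \<longrightarrow> nth (fs c) (nm l) = y l x" for l
  proof (induction l)
    case 0 show ?case using T gc[OF x, of "nth (fs c) \<zero>" 0] c unfolding TT_def by simp
  next
    case (Suc l)
    show ?case
    proof (intro impI)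
      assume l: "Suc l \<le> Suc j" "nm (Suc l) \<preceq> sn c"
      then have lt: "nm l \<prec> sn c" using c by (simp add: lt_le)
      then have n: "nth (fs c) (nm l) = y l x" using Suc.IH l(1) by (simp add: lt_imp_le)
      have "U k (sn (fs (nth (fs c) (nm l)))) (pr x (pr (nth (fs c) (\<S> (nm l))) \<zero>))" using T lt unfolding TT_def by simp
      then show "nth (fs c) (nm (Suc l)) = y (Suc l) x"
        using gc[OF x, of "nth (fs c) (\<S> (nm l))" "Suc l"] n hd[of l] l(1) h_D(4)[of l] c by simp
    qed
  qed
  have "sn c \<prec> nm (Suc j)"
  proof (rule ccontr)
    assume "\<not> sn c \<prec> nm (Suc j)"
    then have "nm (Suc j) \<preceq> sn c" using c not_lt[of "sn c" "nm (Suc j)"] by simp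
    then have "nth (fs c) (nm (Suc j)) = y (Suc j) x" using ch[of "Suc j"] by simp
    then have "y (Suc j) x \<preceq> fs c" using nth_le[of "fs c" "nm (Suc j)"] c by simp
    then have "y (Suc j) x \<preceq> c" using le_trans[OF _ fs_le[OF c(1)]] c x by simp
    then have "y (Suc j) x \<preceq> y j x" using le_trans[OF _ c(2)] c x by simp
    then have "\<S> (y j x) \<preceq> y j x" using le_trans[OF S] x by simp
    then show False using x by (simp add: lt_le[symmetric])
  qed
  from nm_lt[OF sn_D[OF c(1)] this] obtain l where l: "l < Suc j" "sn c = nm l" by (elim exE conjE)
  have "a = fs (fs (y l x))" using T ch[of l] l c unfolding TT_def by simp
  then show ?thesis using hd[of l] h_D(3)[of l] l(1) by (intro exI[of _ l]) simp
qed

lemma ev_hd: "ev (\<lambda>\<xi>. \<forall>l\<in>{..j}. fs (y l (xc \<xi>)) = h l)"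
proof (rule eventually_mono[OF ev_P[OF D0, of "Suc j"]])
  fix \<xi> assume a: "\<zero> \<preceq> xc \<xi> \<and> P (Suc j) \<zero> (xc \<xi>)"
  show "\<forall>l\<in>{..j}. fs (y l (xc \<xi>)) = h l"
  proof
    fix l assume "l \<in> {..j}"
    then have "P (Suc l) \<zero> (xc \<xi>)" using P_anti[of "Suc l" "Suc j" "\<zero>" "xc \<xi>"] a by simp
    then show "fs (y l (xc \<xi>)) = h l" using P_Suc[OF D0 xc_D] y_rel[of "xc \<xi>" l] by simp
  qed
qed

lemma seq_fin: "(\<And>i. v i \<in> D) \<Longrightarrow> \<exists>s\<in>D. \<forall>i<N. nth s (nm i) = v i"
proof (induction N)
  case (Suc N)
  then obtain s where s: "s \<in> D" "\<forall>i<N. nth s (nm i) = v i" by blast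
  have "Df.Fn (\<lambda>e. if e 0 \<prec> nm N then nth s (e 0) else v N)" using s Suc.prems by (intro cintro)
  from seq_comp[of "\<lambda>i. if i \<prec> nm N then nth s i else v N", OF this nm_D[of "Suc N"]]
  obtain s' where s': "s' \<in> D" "\<And>i. i \<in> D \<Longrightarrow> i \<prec> nm (Suc N) \<Longrightarrow> nth s' i = (if i \<prec> nm N then nth s i else v N)" by blast
  have lt: "nm i \<prec> nm N" if "i < N" for i using nm_mono[of "Suc i" N] that by (simp add: lt_le)
  have "nth s' (nm i) = v i" if "i < Suc N" for i
  proof (cases "i = N")
    case True
    have "\<not> nm N \<prec> nm N" by (rule lt_irrefl) simp
    then show ?thesis using s'(2)[of "nm N"] True by simp
  next
    case False
    then show ?thesis using s'(2)[of "nm i"] lt[of i] s(2) that by (simp add: lt_imp_le)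
  qed
  then show ?case using s'(1) by blast
qed (use D0 in blast)

lemma Dl_fin: "(\<And>i. Dl Q (Suc k) (\<lambda>e. \<Phi> i e)) \<Longrightarrow> Dl Q (Suc k) (\<lambda>e. \<forall>i<(N :: nat). \<Phi> i e)"
proof (induction N)
  case 0 then show ?case by (simp add: R.c_True)
next
  case (Suc N)
  have "Dl Q (Suc k) (\<lambda>e. (\<forall>i<N. \<Phi> i e) \<and> \<Phi> N e)" using Suc by (intro R.c_and) auto
  then show ?case by (rule R.c_cong) (auto simp: less_Suc_eq)
qed

lemma definable: "Inl ` range as \<in> Sigma_Def (Suc k) up.K"
proof -
  obtain p \<rho> where p: "Sigma (Suc k) p" "\<And>i. \<rho> i \<in> Q" "\<forall>e\<in>asg. TT (e 0) (e 1) (e 2) (e 3) = sat M (pe \<rho> e) p"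
    using Sg_literal[OF TT_SG] unfolding rep_def by blast
  have \<rho>D: "\<rho> i \<in> D" for i using p(2) QD by blast
  \<comment> \<open>In the formula, variable 0 is \<open>c\<close>, variable 2 is \<open>a\<close>,
    variable 4 is \<open>x\<close> and variable 6 is the code of \<open>y 0\<close>; the odd
    variables carry the parameters from \<open>Q\<close>.\<close>
  define en where "en c a x v = (if odd v then \<rho> (v div 2) else if v = 0 then c else if v = 2 then a else if v = 4 then x else if v = 6 then gc 0 else \<zero>)"
    for c a x and v :: nat
  have en: "sat M (en c a x) p = TT c a x (gc 0)" if "c \<in> D" "a \<in> D" "x \<in> D" for c a x
  proof -
    let ?e = "\<lambda>i. if i = 0 then c else if i = 1 then a else if i = 2 then x else if i = 3 then gc 0 else \<zero>"
    have "?e \<in> asg" using that h_D(2) by (simp add: asg_def)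
    moreover have "en c a x = pe \<rho> ?e"
    proof
      fix v :: nat
      show "en c a x v = pe \<rho> ?e v" unfolding en_def pe_def by (auto elim!: evenE)
    qed
    ultimately show ?thesis using p(3)[rule_format, of ?e] by (simp add: numeral_2_eq_2 numeral_3_eq_3)
  qed
  define s0 where "s0 v = \<nu> (\<lambda>\<xi>. en \<zero> \<zero> (xc \<xi>) v)" for v
  have en_Fn: "R.Fn (\<lambda>e. en (C (e 0)) (A (e 0)) (e 0) v)" if "R.Fn (\<lambda>e. C (e 0))" "R.Fn (\<lambda>e. A (e 0))" for C A v
  proof -
    consider "odd v" | "v = 0" | "v = 2" | "v = 4" | "v = 6" | "even v" "v \<noteq> 0" "v \<noteq> 2" "v \<noteq> 4" "v \<noteq> 6" by blast
    then show ?thesis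
      by cases (simp_all add: en_def that R.Fn_con[OF p(2)] R.Fn_con[OF gcQ] R.Fn_var R.Fn_0)
  qed
  have en_BB: "(\<lambda>\<xi>. en (c \<xi>) (f \<xi>) (xc \<xi>) v) \<in> BB" if "c \<in> BB" "f \<in> BB" for c f v
  proof -
    consider "odd v" | "v = 0" | "v = 2" | "v = 4" | "v = 6" | "even v" "v \<noteq> 0" "v \<noteq> 2" "v \<noteq> 4" "v \<noteq> 6" by blast
    then show ?thesis
      by cases (simp_all add: en_def that BB_con \<rho>D h_D(2) BB_x)
  qed
  have upd: "(s0(2 := \<nu> f))(0 := \<nu> c) = (\<lambda>v. \<nu> (\<lambda>\<xi>. en (c \<xi>) (f \<xi>) (xc \<xi>) v))" for c f
  proof
    fix v :: nat
    consider "odd v" | "v = 0" | "v = 2" | "v = 4" | "v = 6" | "even v" "v \<noteq> 0" "v \<noteq> 2" "v \<noteq> 4" "v \<noteq> 6" by blast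
    then show "((s0(2 := \<nu> f))(0 := \<nu> c)) v = \<nu> (\<lambda>\<xi>. en (c \<xi>) (f \<xi>) (xc \<xi>) v)"
    proof cases
      case 1
      then have "v \<noteq> 0" "v \<noteq> 2" using odd_pos[of v] by auto
      then show ?thesis using 1 by (simp add: s0_def en_def)
    qed (simp_all add: s0_def en_def)
  qed
  have s0: "s0 v \<in> dom up.K" for v unfolding s0_def dom_K using en_BB[OF BB_con[OF D0] BB_con[OF D0], of v] by blast
  have "b \<in> Inl ` range as \<longleftrightarrow> b \<in> dom up.K \<and> sat up.K (s0(2 := b)) (Ex 0 p)" for b
  proof
    assume "b \<in> dom up.K \<and> sat up.K (s0(2 := b)) (Ex 0 p)"
    then obtain f c where f: "f \<in> BB" "b = \<nu> f" and c: "c \<in> BB" "sat up.K ((s0(2 := \<nu> f))(0 := \<nu> c)) p" by (auto simp: dom_K)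
    have "ev (\<lambda>\<xi>. sat M (\<lambda>v. en (c \<xi>) (f \<xi>) (xc \<xi>) v) p)"
      by (rule up.sigma_down[OF p(1), of "\<lambda>v \<xi>. en (c \<xi>) (f \<xi>) (xc \<xi>) v"]) (use en_BB[OF c(1) f(1)] c(2) upd in auto)
    then have T: "ev (\<lambda>\<xi>. TT (c \<xi>) (f \<xi>) (xc \<xi>) (gc 0))" using en[OF BB_D[OF c(1)] BB_D[OF f(1)] xc_D] by simp
    obtain i where i: "ev (\<lambda>\<xi>. c \<xi> \<preceq> y i (xc \<xi>))" using BB_y[OF c(1)] by blast
    have "R.Fn (\<lambda>e. \<S> (e 0))" by (intro cintro)
    from Fs_all[of "\<lambda>a. \<S> a", OF this, of i] obtain j where j: "i \<le> j" "\<And>a. a \<in> D \<Longrightarrow> Fs j a = \<S> a" by blast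
    have Sy: "\<S> (y j (xc \<xi>)) \<preceq> y (Suc j) (xc \<xi>)" for \<xi>
      unfolding j(2)[OF yD[OF xc_D], symmetric] using y_rel[of "xc \<xi>" j] by simp
    from T ev_y_mono[OF i j(1) BB_D[OF c(1)]] ev_hd[of j]
    have 1: "ev (\<lambda>\<xi>. \<exists>l\<le>j. f \<xi> = as l)"
      by eventually_elim (rule TT_chain[OF BB_D[OF c(1)] _ xc_D _ Sy], auto)
    \<comment> \<open>An ultrafilter decides a finite disjunction in favour of one of its
      members.\<close>
    have "\<exists>l. ev (\<lambda>\<xi>. f \<xi> = as l)"
    proof (rule ccontr)
      assume n: "\<nexists>l. ev (\<lambda>\<xi>. f \<xi> = as l)"
      have "ev (\<lambda>\<xi>. \<forall>l\<in>{..j}. f \<xi> \<noteq> as l)"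
        by (rule eventually_ball_finite) (use n up.ev_not in auto)
      with 1 have "ev (\<lambda>\<xi>. False)" by eventually_elim auto
      then show False by (simp add: ev_const)
    qed
    then obtain l where l: "ev (\<lambda>\<xi>. f \<xi> = as l)" by (elim exE)
    have "b = Inl (as l)" using l nu_eq[OF f(1) BB_con[OF h_D(1)]] nu_con[OF h_D(1)] f(2) by simp
    then show "b \<in> Inl ` range as" by blast
  next
    assume "b \<in> Inl ` range as"
    then obtain l where b: "b = Inl (as l)" by blast
    let ?S = "\<lambda>s z. \<forall>i<Suc l. nth s (nm i) = y i z"
    have Sd: "Dl Q (Suc k) (\<lambda>e. ?S (e 0) (e 1))"
      by (rule Dl_fin) (intro cintro R.Fn_f1[OF y_Fn])
    have Sex: "\<exists>s\<in>D. ?S s z" if "z \<in> D" for z using seq_fin[of "\<lambda>i. y i z" "Suc l"] that by simp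
    define sq where "sq z = lst (\<lambda>s. ?S s z)" for z
    have sqF: "R.Fn (\<lambda>e. sq (e 0))" unfolding sq_def
      by (rule R.Fn_lst[of "\<lambda>s e. ?S s (e 0)"]) (use Sd in simp, rule Sex, simp add: asgD)
    have sq: "?S (sq z) z" if "z \<in> D" for z unfolding sq_def by (rule lst_Fn_Df(2)[of ?S, OF R.C_Df[OF Sd] Sex that])
    have sqD: "sq z \<in> D" if "z \<in> D" for z using FnD1[OF R.Fn_Df[OF sqF] that] .
    \<comment> \<open>\<open>TT\<close> has been arranged to hold where the heads have their
      intended values. \<open>?C\<close> describes this set inside the class, as
      \<open>sigma_up\<close> requires.\<close>
    let ?c = "\<lambda>z. pr (sq z) (nm l)" and ?C = "\<lambda>z. \<forall>i<Suc l. fs (y i z) = h i"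
    have cF: "R.Fn (\<lambda>e. ?c (e 0))" by (intro R.Fn_pr sqF R.Fn_nm)
    have C: "Dl Q (Suc k) (\<lambda>e. ?C (e 0))"
      by (rule Dl_fin) (intro R.c_eq R.Fn_fs R.Fn_f1[OF y_Fn] R.Fn_var R.Fn_con hQ)
    have TTz: "TT (?c z) (as l) z (gc 0)" if z: "z \<in> D" "?C z" for z
      unfolding TT_def
    proof (intro conjI ballI impI)
      have f: "fs (?c z) = sq z" "sn (?c z) = nm l" using sqD[OF z(1)] by simp_all
      have s: "nth (sq z) (nm i) = y i z" if "i \<le> l" for i using sq[OF z(1)] that by simp
      show "U k (gc 0) (pr z (pr (nth (fs (?c z)) \<zero>) \<zero>))" unfolding f using gc[OF z(1), of "nth (sq z) \<zero>" 0] s[of 0] z by simp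
      fix j assume j: "j \<in> D" "j \<prec> sn (?c z)"
      then obtain i where i: "i < l" "j = nm i" using nm_lt[of j l] f by auto
      have "sn (fs (y i z)) = gc (Suc i)" using z(2) i(1) h_D(4)[of i] by simp
      then show "U k (sn (fs (nth (fs (?c z)) j))) (pr z (pr (nth (fs (?c z)) (\<S> j)) \<zero>))"
        unfolding f i(2) using gc[OF z(1), of "y (Suc i) z" "Suc i"] s[of i] s[of "Suc i"] i(1) z by simp
    next
      show "as l = fs (fs (nth (fs (?c z)) (sn (?c z))))"
        using sq[OF z(1)] z(2) h_D(3)[of l] sqD[OF z(1)] by simp
    qed
    have "sat up.K (\<lambda>v. \<nu> (\<lambda>\<xi>. en (?c (xc \<xi>)) (as l) (xc \<xi>) v)) p"
    proof (rule up.sigma_up[of p "\<lambda>v z. en (?c z) (as l) z v" ?C xc, OF p(1)])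
      show "R.Fn (\<lambda>e. en (?c (e 0)) (as l) (e 0) v)" for v by (rule en_Fn[OF cF R.Fn_con[OF asQ]])
      show "Dl Q (Suc k) (\<lambda>e. ?C (e 0))" by (rule C)
      show "sat M (\<lambda>v. en (?c z) (as l) z v) p" if "z \<in> D" "?C z" for z
        using TTz[OF that] en[OF _ h_D(1) that(1), of "?c z" l] sqD[OF that(1)] by simp
      show "xc \<in> BB" by (rule BB_x)
      show "ev (\<lambda>\<xi>. ?C (xc \<xi>))" using ev_hd[of l] by (rule eventually_mono) auto
    qed
    then have "sat up.K ((s0(2 := \<nu> (\<lambda>_. as l)))(0 := \<nu> (\<lambda>\<xi>. ?c (xc \<xi>)))) p" unfolding upd .
    moreover have "\<nu> (\<lambda>\<xi>. ?c (xc \<xi>)) \<in> dom up.K" unfolding dom_K by (rule imageI) (rule BB_F[OF cF BB_x])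
    moreover have "\<nu> (\<lambda>_. as l) = b" using nu_con[OF h_D(1)] b by simp
    moreover have "b \<in> dom up.K" using dom_K BB_con[OF h_D(1), of l] calculation(3) by blast
    ultimately show "b \<in> dom up.K \<and> sat up.K (s0(2 := b)) (Ex 0 p)" by auto
  qed
  then have "Inl ` range as = {b \<in> dom up.K. sat up.K (s0(2 := b)) (Ex 0 p)}" by blast
  moreover have "Sigma (Suc k) (Ex 0 p)" using p(1) by (rule Sigma_Pi.intros)
  ultimately show ?thesis unfolding Sigma_Def_def using s0 by blast
qed

end

end

lemma (in tower) conclusion:
  fixes r :: "'k rel" and as gc :: "nat \<Rightarrow> 'a"
  assumes r: "Card_order r" and E: "E = Field r" and Dr: "(card_of D, r) \<in> ordLess" and lvr: "\<And>j. (card_of {e\<in>E. lv e < j}, r) \<in> ordLess"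
    and asQ: "\<And>i. as i \<in> Q" and gcQ: "\<And>i. gc i \<in> Q" and hQ: "\<And>i. h i \<in> Q" and h_eq: "\<And>i. h i = pr (as i) (gc (Suc i))"
    and gc: "\<And>i x v. x \<in> D \<Longrightarrow> v \<in> D \<Longrightarrow> U k (gc i) (pr x (pr v \<zero>)) \<longleftrightarrow> v = y i x"
  shows "\<exists>K :: ('a + 'k) struc. kappa_like r K \<and> sigma_elem_end_ext k Inl M K \<and> Inl ` range as \<in> Sigma_Def (Suc k) K \<and> wf_struc K
    \<and> (\<forall>p q e e0 s. sentence p \<longrightarrow> Pi (Suc (Suc k)) q \<longrightarrow> (\<forall>v. e v \<in> Q) \<longrightarrow> sat M e q \<longrightarrow> (sat K (Inl \<circ> e) q \<longrightarrow> sat K e0 p) \<longrightarrow> sat K s p)"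
proof -
  have DE: "(card_of D, card_of E) \<in> ordLeq"
    unfolding E by (rule ordLeq_ordIso_trans[OF ordLess_imp_ordLeq[OF Dr] ordIso_symmetric[OF card_of_Field_ordIso[OF r]]])
  have Einf: "infinite E" using infinite_D card_of_ordLeq_finite[OF DE] by blast
  from nu_exists[OF Einf DE]
  obtain \<nu> :: "('a \<times> ('k \<Rightarrow> 'a) \<Rightarrow> 'a) \<Rightarrow> 'a + 'k" where nu1: "\<forall>f\<in>BB. \<forall>g\<in>BB. \<nu> f = \<nu> g \<longleftrightarrow> ev (\<lambda>\<xi>. f \<xi> = g \<xi>)"
    and nu2: "\<forall>m\<in>D. \<nu> (\<lambda>_. m) = Inl m" by (elim exE conjE)
  interpret kt: kappa_tower M Q k Fs w y Z X d P gm h E lv less2 r \<nu>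
  proof (rule kappa_tower.intro[OF tower_axioms], rule kappa_tower_axioms.intro)
    show "\<nu> f = \<nu> g \<longleftrightarrow> ev (\<lambda>\<xi>. f \<xi> = g \<xi>)" if "f \<in> BB" "g \<in> BB" for f g using nu1 that by blast
    show "\<nu> (\<lambda>_. m) = Inl m" if "m \<in> D" for m using nu2 that by blast
  qed (rule r E Dr lvr)+
  have def: "Inl ` range as \<in> Sigma_Def (Suc k) kt.up.K" by (rule kt.definable[of as gc, OF asQ gcQ hQ h_eq gc])
  show ?thesis
  proof (rule exI[of _ kt.up.K], intro conjI kt.kappa_like_K kt.end_ext def kt.up.wf_K allI impI)
    fix p q and e e0 s assume a: "sentence p" "Pi (Suc (Suc k)) q" "\<forall>v. e v \<in> Q" "sat M e q" "sat kt.up.K (Inl \<circ> e) q \<longrightarrow> sat kt.up.K e0 p"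
    show "sat kt.up.K s p" using kt.models_K a by metis
  qed
qed

section \<open>Assembly of the construction\<close>

context lev begin

lemma construction:
  fixes r :: "'k rel" and as :: "nat \<Rightarrow> 'a"
  assumes c: "countable Q" and pg: "programs M Q" and asQ: "\<And>i. as i \<in> Q"
    and r: "Card_order r" and cof: "countable_cofinality r" and Dr: "(card_of D, r) \<in> ordLess"
  shows "\<exists>K :: ('a + 'k) struc. kappa_like r K \<and> sigma_elem_end_ext k Inl M K \<and> Inl ` range as \<in> Sigma_Def (Suc k) K \<and> wf_struc K
    \<and> (\<forall>p q e e0 s. sentence p \<longrightarrow> Pi (Suc (Suc k)) q \<longrightarrow> (\<forall>v. e v \<in> Q) \<longrightarrow> sat M e q \<longrightarrow> (sat K (Inl \<circ> e) q \<longrightarrow> sat K e0 p) \<longrightarrow> sat K s p)"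
proof -
  interpret pg: programs M Q by (rule pg)
  obtain Fs :: "nat \<Rightarrow> 'a \<Rightarrow> 'a" where Fs: "\<forall>i. R.Fn (\<lambda>e. Fs i (e 0))"
    and Fs_all: "\<forall>F N. R.Fn (\<lambda>e. F (e 0)) \<longrightarrow> (\<exists>i\<ge>N. \<forall>a\<in>D. Fs i a = F a)"
    using enumerate_Fn[OF c] by (elim exE conjE)
  from bounding_sequence[of Fs, OF Fs[rule_format]]
  obtain Rp w y Z X d where R0: "\<forall>p x. Rp 0 p x" and RS: "\<forall>i. Rp (Suc i) = ext (Rp i) (w i) (Fs i)"
    and fns: "\<forall>i. Dl Q (Suc k) (\<lambda>e. Rp i (e 0) (e 1)) \<and> R.Fn (\<lambda>e. w i (e 0)) \<and> R.Fn (\<lambda>e. y i (e 0)) \<and> R.Fn (\<lambda>e. Z i (e 0)) \<and> gapped (y i) Fs (Z i) (X i) (d i)"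
    and fl: "\<forall>i. \<forall>p\<in>D. unb (Rp i p) \<longrightarrow> (\<forall>a\<in>D. unb (\<lambda>x. Rp i p x \<and> w i x = a))"
    and yr: "\<forall>i. \<forall>x\<in>D. fs (y i x) = w i x \<and> pr x x \<preceq> y i x \<and> y i x \<preceq> y (Suc i) x \<and> SB (Z i x) \<preceq> y (Suc i) x
        \<and> (\<forall>z\<in>D. z \<preceq> y i x \<longrightarrow> Fs i z \<preceq> y (Suc i) x)"
    by (elim exE conjE)
  have RF: "Dl Q (Suc k) (\<lambda>e. Rp i (e 0) (e 1))" and wF: "R.Fn (\<lambda>e. w i (e 0))" and yF: "R.Fn (\<lambda>e. y i (e 0))"
    and ZF: "R.Fn (\<lambda>e. Z i (e 0))" and gp: "gapped (y i) Fs (Z i) (X i) (d i)" for i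
    using fns[THEN spec, of i] by simp_all
  have "\<exists>q\<in>Q. \<forall>x\<in>D. \<forall>v\<in>D. U k q (pr x (pr v \<zero>)) \<longleftrightarrow> v = y i x" for i
  proof -
    have "SG (\<lambda>e. e 1 = y i (e 0))" by (rule sg_C, rule R.c_eq[OF R.Fn_var R.Fn_f1[OF yF R.Fn_var]])
    from pg.U_universal[OF subset_refl this]
    obtain q where q: "q \<in> Q" "\<forall>z\<in>D. (dec z 1 = y i (dec z 0)) = U k q z" by blast
    have "U k q (pr x (pr v \<zero>)) \<longleftrightarrow> v = y i x" if "x \<in> D" "v \<in> D" for x v
      using q(2)[rule_format, of "pr x (pr v \<zero>)"] that by (simp add: dec_pr)
    then show ?thesis using q(1) by blast
  qed
  then have "\<forall>i. \<exists>q. q \<in> Q \<and> (\<forall>x\<in>D. \<forall>v\<in>D. U k q (pr x (pr v \<zero>)) \<longleftrightarrow> v = y i x)" by blast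
  then obtain gc where gc: "\<And>i. gc i \<in> Q" "\<And>i. \<forall>x\<in>D. \<forall>v\<in>D. U k (gc i) (pr x (pr v \<zero>)) \<longleftrightarrow> v = y i x" by metis
  \<comment> \<open>The heads can be fixed now that the programs \<open>gc i\<close> of all the
    functions \<open>y i\<close> are known.\<close>
  define h where "h i = pr (as i) (gc (Suc i))" for i
  have hQ: "h i \<in> Q" for i unfolding h_def by (intro pg.CQ_pr asQ gc)
  have hD: "h i \<in> D" for i using hQ QD by blast
  have "\<exists>P g. (\<forall>i. \<forall>m\<in>D. unb (P i m)) \<and> (\<forall>i. \<forall>m\<in>D. \<forall>m'\<in>D. m \<preceq> m' \<longrightarrow> (\<forall>x\<in>D. P i m' x \<longrightarrow> P i m x))
    \<and> (\<forall>i. \<forall>m\<in>D. \<forall>x\<in>D. P (Suc i) m x \<longrightarrow> P i m x \<and> w i x = h i \<and> (\<forall>e\<in>D. e \<prec> m \<longrightarrow> mn (Fs i (pr (fs e) x)) (sn e) = g i e))"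
    by (rule decisions[of Fs w h Rp]) (use Fs wF hD RF R0 RS fl in simp_all)
  then obtain P g where P: "\<forall>i. \<forall>m\<in>D. unb (P i m)" "\<forall>i. \<forall>m\<in>D. \<forall>m'\<in>D. m \<preceq> m' \<longrightarrow> (\<forall>x\<in>D. P i m' x \<longrightarrow> P i m x)"
    "\<forall>i. \<forall>m\<in>D. \<forall>x\<in>D. P (Suc i) m x \<longrightarrow> P i m x \<and> w i x = h i \<and> (\<forall>e\<in>D. e \<prec> m \<longrightarrow> mn (Fs i (pr (fs e) x)) (sn e) = g i e)"
    by (elim exE conjE)
  let ?E = "Field r"
  have DE: "(card_of D, card_of ?E) \<in> ordLeq"
    by (rule ordLeq_ordIso_trans[OF ordLess_imp_ordLeq[OF Dr] ordIso_symmetric[OF card_of_Field_ordIso[OF r]]])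
  have Einf: "infinite ?E" using infinite_D card_of_ordLeq_finite[OF DE] by blast
  obtain C where C: "C \<subseteq> ?E" "countable C" "\<forall>a\<in>?E. \<exists>c\<in>C. (a, c) \<in> r" using cof unfolding countable_cofinality_def by blast
  have Cne: "C \<noteq> {}" using C(3) Einf by (metis empty_iff finite.emptyI equals0I)
  define cc where "cc = from_nat_into C"
  have ccE: "cc j \<in> ?E" for j using from_nat_into[OF Cne, of j] C(1) unfolding cc_def by blast
  \<comment> \<open>The levels cut the cardinal along a cofinal sequence, so the generators of level
    less than \<open>j\<close> lie in finitely many proper initial segments, each of smaller
    cardinality.\<close>
  define lv where "lv e = (LEAST j. (e, cc j) \<in> r)" for e
  have lvI: "(e, cc (lv e)) \<in> r" if "e \<in> ?E" for e
  proof -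
    from C(3) that have "\<exists>c\<in>C. (e, c) \<in> r" by (rule bspec)
    then obtain c where c: "c \<in> C" "(e, c) \<in> r" by (elim bexE)
    obtain j where j: "cc j = c" using from_nat_into_surj[OF C(2) c(1)] unfolding cc_def by blast
    have "(e, cc j) \<in> r" using c(2) j by simp
    then show ?thesis unfolding lv_def by (rule LeastI[of "\<lambda>j. (e, cc j) \<in> r"])
  qed
  have wo: "Well_order r" by (rule card_order_on_well_order_on[OF r])
  have ord: "trans r" "antisym r" "total_on ?E r"
    using wo unfolding well_order_on_def linear_order_on_def partial_order_on_def preorder_on_def by simp_all
  have fin: "(card_of B, r) \<in> ordLess" if "finite B" for B :: "'k set"
    by (rule finite_ordLess_infinite[OF card_of_Well_order wo]) (use that Einf in \<open>simp_all add: Field_card_of\<close>)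
  have lvr: "(card_of {e\<in>?E. lv e < j}, r) \<in> ordLess" for j
  proof (induction j)
    case 0 show ?case by (rule fin) simp
  next
    case (Suc j)
    have sub: "{e\<in>?E. lv e < Suc j} \<subseteq> {e\<in>?E. lv e < j} \<union> ({cc j} \<union> underS r (cc j))"
    proof
      fix e assume e: "e \<in> {e\<in>?E. lv e < Suc j}"
      show "e \<in> {e\<in>?E. lv e < j} \<union> ({cc j} \<union> underS r (cc j))"
      proof (cases "lv e = j")
        case True then show ?thesis using lvI[of e] e unfolding underS_def by auto
      qed (use e in auto)
    qed
    have "(card_of ({e\<in>?E. lv e < j} \<union> ({cc j} \<union> underS r (cc j))), r) \<in> ordLess"
      by (intro card_of_Un_ordLess_infinite_Field Einf r Suc.IH fin card_of_underS ccE) simp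
    then show ?case by (rule ordLeq_ordLess_trans[OF card_of_mono1[OF sub]])
  qed
  \<comment> \<open>Levels come first, because a generator of a later gap is larger;
    \<open>r\<close> orders the generators of one gap.\<close>
  define less2 where "less2 e e' \<longleftrightarrow> lv e < lv e' \<or> lv e = lv e' \<and> (e, e') \<in> r \<and> e \<noteq> e'" for e e'
  have tower: "tower M Q k Fs w y Z X d P g h ?E lv less2"
  proof (rule tower.intro[OF lev_axioms], rule tower_axioms.intro)
    show "R.Fn (\<lambda>e. Fs i (e 0))" for i using Fs by blast
    show "\<exists>i\<ge>N. \<forall>a\<in>D. Fs i a = G a" if "R.Fn (\<lambda>e. G (e 0))" for G N using Fs_all that by blast
    show "R.Fn (\<lambda>e. y i (e 0))" for i by (rule yF)
    show "R.Fn (\<lambda>e. Z i (e 0))" for i by (rule ZF)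
    show "gapped (y i) Fs (Z i) (X i) (d i)" for i by (rule gp)
    show "fs (y i x) = w i x \<and> pr x x \<preceq> y i x \<and> y i x \<preceq> y (Suc i) x \<and> SB (Z i x) \<preceq> y (Suc i) x
        \<and> (\<forall>z\<in>D. z \<preceq> y i x \<longrightarrow> Fs i z \<preceq> y (Suc i) x)" if "x \<in> D" for i x using yr that by blast
    show "unb (P i m)" if "m \<in> D" for i m using P(1) that by blast
    show "P i m x" if "m \<in> D" "m' \<in> D" "m \<preceq> m'" "x \<in> D" "P i m' x" for i m m' x using P(2) that by blast
    show "P i m x \<and> w i x = h i \<and> (\<forall>e\<in>D. e \<prec> m \<longrightarrow> mn (Fs i (pr (fs e) x)) (sn e) = g i e)" if "m \<in> D" "x \<in> D" "P (Suc i) m x" for i m x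
      using P(3) that by blast
    show "\<not> less2 e e" for e by (simp add: less2_def)
    show "less2 e e''" if "less2 e e'" "less2 e' e''" for e e' e''
      using that transD[OF ord(1), of e e' e''] antisymD[OF ord(2), of e e'] unfolding less2_def by auto
    show "less2 e e' \<or> e = e' \<or> less2 e' e" if "e \<in> ?E" "e' \<in> ?E" for e e'
      using ord(3) that unfolding less2_def total_on_def by (metis linorder_neqE_nat)
    show "lv e \<le> lv e'" if "less2 e e'" for e e' using that unfolding less2_def by auto
  qed
  show ?thesis
    by (rule tower.conclusion[OF tower r refl Dr lvr asQ gc(1) hQ h_def gc(2)[rule_format]])
qed

end

lemma delta0_Sigma_Pi: "delta0 p \<Longrightarrow> Sigma k p \<and> Pi k p"
  by (induction k) (auto intro: Sigma_Pi.intros)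

theorem theorem5p6:
  fixes n :: nat and T0 :: "fm set" and r :: "'k rel" and M :: "'a struc" and A :: "'a set"
  assumes "recursive_theory T0" and "PA \<subseteq> T0"
    and "Card_order r" and "countable_cofinality r"
    and "models M T0" and "(card_of (dom M), r) \<in> ordLess"
    and "countable A" and "A \<subseteq> dom M"
  shows "\<exists>K :: ('a + 'k) struc.
           kappa_like r K \<and> sigma_elem_end_ext n Inl M K
           \<and> models K (Sigma_Th (n + 3) T0)
           \<and> Inl ` A \<in> Sigma_Def (Suc n) K"
proof -
  interpret pa M by standard (use assms(2,5) in \<open>auto simp: models_def\<close>)
  define e0 where "e0 = (\<lambda>_ :: nat. zer M)"
  define \<Phi> where "\<Phi> p q e' \<longleftrightarrow> Pi (Suc (Suc n)) q \<and> sat M e' q \<and> (\<forall>v. e' v \<in> dom M) \<and>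
    (\<forall>(K :: ('a + 'k) struc) h. (\<forall>a\<in>dom M. h a \<in> dom K) \<longrightarrow> sat K (h \<circ> e') q \<longrightarrow> sat K (h \<circ> e0) p)" for p q e'
  have "\<exists>q e'. \<Phi> p q e'" if p: "p \<in> Sigma_Th (n + 3) T0" for p
  proof -
    have "Sigma (Suc (Suc (Suc n))) p" "proves T0 p" using p unfolding Sigma_Th_def by (simp_all add: eval_nat_numeral)
    moreover have "e0 v \<in> dom M" for v by (simp add: e0_def)
    ultimately show ?thesis unfolding \<Phi>_def using proves_sat[OF assms(5), of p e0] Sigma_strip[of "Suc (Suc n)" p M e0] by blast
  qed
  then have "\<forall>p\<in>Sigma_Th (n + 3) T0. \<exists>qe. \<Phi> p (fst qe) (snd qe)" by simp
  from bchoice[OF this] obtain qe where qe: "\<forall>p\<in>Sigma_Th (n + 3) T0. \<Phi> p (fst (qe p)) (snd (qe p))" ..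
  let ?B = "A \<union> (\<Union>p\<in>Sigma_Th (n + 3) T0. range (snd (qe p)))"
  have "countable (Sigma_Th (n + 3) T0)" by (rule countable_subset[OF subset_UNIV countable_fm])
  then have "countable ?B" using assms(7) by auto
  moreover have "?B \<subseteq> dom M" using assms(8) qe unfolding \<Phi>_def by blast
  ultimately obtain Q where Q: "?B \<subseteq> Q" "countable Q" "programs M Q" using program_closure[of ?B] by blast
  interpret pg: programs M Q by (rule Q)
  interpret lev M Q n by standard (rule pg.CQD pg.CQ_0)+
  \<comment> \<open>The construction expects a sequence, which an empty \<open>A\<close> does not
    provide; zero fills in, and the definability of the empty set is shown directly at the
    end.\<close>
  define as where "as = (if A = {} then (\<lambda>_. zer M) else from_nat_into A)"
  have as: "as i \<in> Q" for i using from_nat_into[of A i] Q(1) by (auto simp: as_def)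
  from construction[of as r, OF Q(2,3) as assms(3,4,6)] obtain K :: "('a + 'k) struc" where K: "kappa_like r K" "sigma_elem_end_ext n Inl M K"
    "Inl ` range as \<in> Sigma_Def (Suc n) K" "wf_struc K"
    "\<forall>p q e e0 s. sentence p \<longrightarrow> Pi (Suc (Suc n)) q \<longrightarrow> (\<forall>v. e v \<in> Q) \<longrightarrow> sat M e q \<longrightarrow> (sat K (Inl \<circ> e) q \<longrightarrow> sat K e0 p) \<longrightarrow> sat K s p"
    by (elim exE conjE)
  have "models K (Sigma_Th (n + 3) T0)" unfolding models_def
  proof (intro conjI ballI allI impI K(4))
    fix p s assume p: "p \<in> Sigma_Th (n + 3) T0"
    have "\<forall>a\<in>dom M. Inl a \<in> dom K" using K(2) unfolding sigma_elem_end_ext_def by blast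
    moreover have "\<Phi> p (fst (qe p)) (snd (qe p))" using qe p by blast
    ultimately have q: "Pi (Suc (Suc n)) (fst (qe p))" "sat M (snd (qe p)) (fst (qe p))"
      "sat K (Inl \<circ> snd (qe p)) (fst (qe p)) \<longrightarrow> sat K (Inl \<circ> e0) p" unfolding \<Phi>_def by blast+
    have "\<forall>v. snd (qe p) v \<in> Q" using Q(1) p by blast
    moreover have "sentence p" using p by (simp add: Sigma_Th_def)
    ultimately show "sat K s p" using K(5)[rule_format, of p "fst (qe p)" "snd (qe p)" "Inl \<circ> e0" s] q by blast
  qed
  moreover have "Inl ` A \<in> Sigma_Def (Suc n) K"
  proof (cases "A = {}")
    case True
    let ?p = "Neg (Eq Zero Zero)" and ?s = "\<lambda>_ :: nat. zer K"
    have "Sigma (Suc n) ?p \<and> (\<forall>v. ?s v \<in> dom K) \<and> Inl ` A = {b \<in> dom K. sat K (?s(0 := b)) ?p}"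
      using delta0_Sigma_Pi[of ?p] K(4) by (simp add: True wf_struc_def delta0.intros)
    then show ?thesis unfolding Sigma_Def_def by (intro CollectI exI)
  next
    case False
    then have "range as = A" using range_from_nat_into[OF False assms(7)] by (simp add: as_def)
    then show ?thesis using K(3) by simp
  qed
  ultimately show ?thesis using K(1,2) by blast
qed

end
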